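(* Let $1\leq l,l'\leq n$ with $l'\neq n$, and $r,r'\in\mathbb{Z}_n$. Assume that $t=l+l'-(n+1)\geq 0$, and let $l_1=\min\{l,l'\}$. Then, as $H_n(1,q)$-modules, $$\begin{aligned}V(l,r)\otimes P(l',r')\cong&\Big(\bigoplus_{i=c(t)}^{t}2P(l+l'-1-2i,\,r+r'+i)\Big)\\&\oplus\Big(\bigoplus_{t+1\leq i\leq l_1-1}P(l+l'-1-2i,\,r+r'+i)\Big)\\&\oplus\Big(\bigoplus_{c(l+l'-1)\leq i\leq l-1}2P(n+l+l'-1-2i,\,r+r'+i)\Big).\end{aligned}$$
   Context: Setting: $k$ is an algebraically closed field, $n>2$ is a fixed integer, $q\in k$ is a primitive $n$-th root of unity, $\mathbb{Z}_n=\mathbb{Z}/n\mathbb{Z}$, and $(i)_q=1+q+\cdots+q^{i-1}$. $H_n(1,q)$ is the Hopf algebra over $k$ (isomorphic to the Drinfeld double of the Taft algebra $H_n(q)$) generated as an algebra by $a,b,c,d$ with relations $ba=qab$, $db=qbd$, $ca=qac$, $dc=qcd$, $bc=cb$, $a^n=0$, $b^n=1$, $c^n=1$, $d^n=0$, $da-qad=1-bc$, with comultiplication $\Delta(a)=a\otimes b+1\otimes a$, $\Delta(b)=b\otimes b$, $\Delta(c)=c\otimes c$, $\Delta(d)=d\otimes c+1\otimes d$, counit $\varepsilon(a)=\varepsilon(d)=0$, $\varepsilon(b)=\varepsilon(c)=1$, and antipode $S(a)=-ab^{-1}$, $S(b)=b^{-1}$, $S(c)=c^{-1}$, $S(d)=-dc^{-1}$.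 All modules are finite-dimensional left $H_n(1,q)$-modules, $\otimes=\otimes_k$ with action through $\Delta$, and $sM$ is the direct sum of $s$ copies of $M$ ($sM=0$ if $s=0$). Simple modules: for $1\leq l\leq n$, $r\in\mathbb{Z}_n$, $V(l,r)$ has basis $v_1,\dots,v_l$ with $av_i=v_{i+1}$ for $i<l$, $av_l=0$, $bv_i=q^{r+i-1}v_i$, $cv_i=q^{i-r-l}v_i$, $dv_1=0$, $dv_i=\alpha_{i-1}(l)v_{i-1}$ for $1<i\leq l$, where $\alpha_i(l)=(i)_q(1-q^{i-l})$. For $1\leq l<n$, $P(l,r)$ is the projective cover of $V(l,r)$, and $P(n,r)=V(n,r)$ (which is projective). Conventions: integers in the second argument of $V$ and $P$ are read modulo $n$; $c(t)=\lfloor (t+1)/2\rfloor$ for $t\in\mathbb{Z}$ (the function $c(\cdot)$ is not to be confused with the generator $c$); a direct sum over an empty range of indices is zero. *)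

theory Defs
  imports
    "HOL-Algebra.QuotRing"
    "HOL-Library.Poly_Mapping"
    "HOL-Library.Product_Plus"
    "HOL-Computational_Algebra.Polynomial"
    "Jordan_Normal_Form.Matrix"
    "Jordan_Normal_Form.VS_Connect"
begin

section \<open>The bialgebra structure of $H_n(1,q)$\<close>

datatype gen = Ga | Gb | Gc | Gd

text \<open>
  The free monoid on the four generators, written additively because the library builds the
  monoid algebra \<open>'m \<Rightarrow>\<^sub>0 'k\<close> over an additively written (here noncommutative) monoid.
\<close>

datatype word = Word (letters: "gen list")

instantiation word :: monoid_add
begin

definition zero_word :: word where
  "zero_word = Word []"

definition plus_word :: "word \<Rightarrow> word \<Rightarrow> word" where
  "plus_word u v = Word (letters u @ letters v)"

instance
  by standard (simp_all add: zero_word_def plus_word_def)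

end

text \<open>
  The free algebra \<open>F = k\<langle>a,b,c,d\<rangle>\<close>, and \<open>F \<otimes> F\<close> as the monoid algebra of the product monoid;
  the basis element \<open>(u, v)\<close> of the latter is \<open>u \<otimes> v\<close>.
\<close>

type_synonym 'k free = "word \<Rightarrow>\<^sub>0 'k"
type_synonym 'k free2 = "word \<times> word \<Rightarrow>\<^sub>0 'k"

definition const :: "'k::field \<Rightarrow> 'm::monoid_add \<Rightarrow>\<^sub>0 'k" where
  "const x = Poly_Mapping.single 0 x"

definition mon :: "gen list \<Rightarrow> 'k::field free" where
  "mon gs = Poly_Mapping.single (Word gs) 1"

definition tens :: "'k::field free \<Rightarrow> 'k free \<Rightarrow> 'k free2"  (infixl \<open>\<otimes>\<^sub>F\<close> 70) where
  "x \<otimes>\<^sub>F y = (\<Sum>u\<in>Poly_Mapping.keys x. \<Sum>v\<in>Poly_Mapping.keys y.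
      Poly_Mapping.single (u, v) (Poly_Mapping.lookup x u * Poly_Mapping.lookup y v))"

definition relators :: "nat \<Rightarrow> 'k::field \<Rightarrow> 'k free set" where
  "relators n q = (let a = mon [Ga]; b = mon [Gb]; c = mon [Gc]; d = mon [Gd] in
     {b * a - const q * a * b,
      d * b - const q * b * d,
      c * a - const q * a * c,
      d * c - const q * c * d,
      b * c - c * b,
      a ^ n, b ^ n - 1, c ^ n - 1, d ^ n,
      d * a - const q * a * d - (1 - b * c)})"

definition H_ideal :: "nat \<Rightarrow> 'k::field \<Rightarrow> 'k free set" where
  "H_ideal n q = Idl\<^bsub>class_ring\<^esub> (relators n q)"

definition H :: "nat \<Rightarrow> 'k::field \<Rightarrow> 'k free set ring" where
  "H n q = class_ring Quot (H_ideal n q)"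

definition H_class :: "nat \<Rightarrow> 'k::field \<Rightarrow> 'k free \<Rightarrow> 'k free set" where
  "H_class n q x = H_ideal n q +>\<^bsub>class_ring\<^esub> x"

text \<open>\<open>H \<otimes> H\<close> is the quotient of \<open>F \<otimes> F\<close> by \<open>I \<otimes> F + F \<otimes> I\<close>, where \<open>H = F / I\<close>.\<close>

definition HH_ideal :: "nat \<Rightarrow> 'k::field \<Rightarrow> 'k free2 set" where
  "HH_ideal n q = Idl\<^bsub>class_ring\<^esub>
     ((\<lambda>x. x \<otimes>\<^sub>F 1) ` H_ideal n q \<union> (\<lambda>x. 1 \<otimes>\<^sub>F x) ` H_ideal n q)"

definition HH_class :: "nat \<Rightarrow> 'k::field \<Rightarrow> 'k free2 \<Rightarrow> 'k free2 set" where
  "HH_class n q z = HH_ideal n q +>\<^bsub>class_ring\<^esub> z"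

fun comult_gen :: "gen \<Rightarrow> 'k::field free2" where
  "comult_gen Ga = mon [Ga] \<otimes>\<^sub>F mon [Gb] + 1 \<otimes>\<^sub>F mon [Ga]"
| "comult_gen Gb = mon [Gb] \<otimes>\<^sub>F mon [Gb]"
| "comult_gen Gc = mon [Gc] \<otimes>\<^sub>F mon [Gc]"
| "comult_gen Gd = mon [Gd] \<otimes>\<^sub>F mon [Gc] + 1 \<otimes>\<^sub>F mon [Gd]"

definition comult_free :: "'k::field free \<Rightarrow> 'k free2" where
  "comult_free x = (\<Sum>w\<in>Poly_Mapping.keys x.
      const (Poly_Mapping.lookup x w) * prod_list (map comult_gen (letters w)))"

text \<open>
  \<open>\<Delta> : H \<rightarrow> H \<otimes> H\<close>, induced by the algebra map \<^const>\<open>comult_free\<close>. As usual for maps out of a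
  factor ring, \<^const>\<open>the_elem\<close> picks the common value on all representatives of a class.
  The counit and the antipode of the Hopf algebra are determined by this bialgebra structure and
  play no role for tensor products of modules.
\<close>

definition comult :: "nat \<Rightarrow> 'k::field \<Rightarrow> 'k free set \<Rightarrow> 'k free2 set" where
  "comult n q X = the_elem ((\<lambda>x. HH_class n q (comult_free x)) ` X)"


section \<open>Finite-dimensional modules\<close>

text \<open>
  A finite-dimensional left \<open>H\<close>-module is given by the underlying space \<open>k\<^sup>N\<close> (column vectors) and
  a unital \<open>k\<close>-algebra homomorphism from \<open>H\<close> to the \<open>N \<times> N\<close> matrices.
\<close>

record (overloaded) 'k fdmod =
  mdim :: nat
  act :: "'k free set \<Rightarrow> 'k mat"

definition is_module :: "nat \<Rightarrow> 'k::field \<Rightarrow> 'k fdmod \<Rightarrow> bool" where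
  "is_module n q M \<longleftrightarrow>
     act M \<in> Ring.ring_hom (H n q) (ring_mat TYPE('k) (mdim M) ()) \<and>
     (\<forall>x. act M (H_class n q (const x)) = x \<cdot>\<^sub>m 1\<^sub>m (mdim M))"

definition is_hom :: "nat \<Rightarrow> 'k::field \<Rightarrow> 'k fdmod \<Rightarrow> 'k fdmod \<Rightarrow> 'k mat \<Rightarrow> bool" where
  "is_hom n q M N f \<longleftrightarrow> is_module n q M \<and> is_module n q N \<and>
     f \<in> carrier_mat (mdim N) (mdim M) \<and>
     (\<forall>h\<in>carrier (H n q). f * act M h = act N h * f)"

definition is_epi :: "nat \<Rightarrow> 'k::field \<Rightarrow> 'k fdmod \<Rightarrow> 'k fdmod \<Rightarrow> 'k mat \<Rightarrow> bool" where
  "is_epi n q M N f \<longleftrightarrow> is_hom n q M N f \<and>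
     (\<lambda>v. f *\<^sub>v v) ` carrier_vec (mdim M) = carrier_vec (mdim N)"

definition module_iso :: "nat \<Rightarrow> 'k::field \<Rightarrow> 'k fdmod \<Rightarrow> 'k fdmod \<Rightarrow> bool" where
  "module_iso n q M N \<longleftrightarrow> (\<exists>f g. is_hom n q M N f \<and> is_hom n q N M g \<and>
     g * f = 1\<^sub>m (mdim M) \<and> f * g = 1\<^sub>m (mdim N))"

definition is_projective :: "nat \<Rightarrow> 'k::field \<Rightarrow> 'k fdmod \<Rightarrow> bool" where
  "is_projective n q P \<longleftrightarrow> is_module n q P \<and>
     (\<forall>X Y g f. is_epi n q X Y g \<and> is_hom n q P Y f \<longrightarrow>
        (\<exists>h. is_hom n q P X h \<and> g * h = f))"

text \<open>
  Projectivity and projective covers are taken in the category of finite-dimensional modules; an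
  epimorphism \<open>p\<close> is essential if \<open>g\<close> is an epimorphism whenever \<open>p g\<close> is one.
\<close>

definition is_essential_epi ::
    "nat \<Rightarrow> 'k::field \<Rightarrow> 'k fdmod \<Rightarrow> 'k fdmod \<Rightarrow> 'k mat \<Rightarrow> bool" where
  "is_essential_epi n q P M p \<longleftrightarrow> is_epi n q P M p \<and>
     (\<forall>X g. is_hom n q X P g \<and> is_epi n q X M (p * g) \<longrightarrow> is_epi n q X P g)"

definition is_projective_cover :: "nat \<Rightarrow> 'k::field \<Rightarrow> 'k fdmod \<Rightarrow> 'k fdmod \<Rightarrow> bool" where
  "is_projective_cover n q P M \<longleftrightarrow>
     is_projective n q P \<and> (\<exists>p. is_essential_epi n q P M p)"

definition direct_sum :: "'k::field fdmod list \<Rightarrow> 'k fdmod" where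
  "direct_sum Ms = \<lparr> mdim = sum_list (map mdim Ms),
                     act = (\<lambda>h. diag_block_mat (map (\<lambda>M. act M h) Ms)) \<rparr>"

definition copies :: "nat \<Rightarrow> 'k::field fdmod \<Rightarrow> 'k fdmod" where
  "copies s M = direct_sum (replicate s M)"

text \<open>
  The Kronecker product: \<open>k\<^sup>m \<otimes> k\<^sup>n\<close> is identified with \<open>k\<^bsup>m n\<^esup>\<close> by sending
  \<open>e\<^sub>i \<otimes> e\<^sub>j\<close> to the basis vector number \<open>i n + j\<close>.
\<close>

definition kron :: "'k::field mat \<Rightarrow> 'k mat \<Rightarrow> 'k mat" where
  "kron A B = mat (dim_row A * dim_row B) (dim_col A * dim_col B)
     (\<lambda>(i, j). A $$ (i div dim_row B, j div dim_col B) * B $$ (i mod dim_row B, j mod dim_col B))"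

text \<open>
  The action of (a representative of) an element of \<open>H \<otimes> H\<close> on \<open>M \<otimes> N\<close>, followed by the pullback
  along the comultiplication.
\<close>

definition act2 ::
    "nat \<Rightarrow> 'k::field \<Rightarrow> 'k fdmod \<Rightarrow> 'k fdmod \<Rightarrow> 'k free2 \<Rightarrow> 'k mat" where
  "act2 n q M N z = mat (mdim M * mdim N) (mdim M * mdim N)
     (\<lambda>ij. \<Sum>(u, v)\<in>Poly_Mapping.keys z. Poly_Mapping.lookup z (u, v) *
        kron (act M (H_class n q (Poly_Mapping.single u 1))) (act N (H_class n q (Poly_Mapping.single v 1))) $$ ij)"

definition tensor :: "nat \<Rightarrow> 'k::field \<Rightarrow> 'k fdmod \<Rightarrow> 'k fdmod \<Rightarrow> 'k fdmod" where
  "tensor n q M N = \<lparr> mdim = mdim M * mdim N,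
                      act = (\<lambda>h. the_elem (act2 n q M N ` comult n q h)) \<rparr>"


section \<open>The simple modules\<close>

text \<open>
  The module on \<open>k\<^sup>N\<close> on which the generator \<open>g\<close> acts by the matrix \<open>A g\<close>; the matrices must
  satisfy the defining relations.
\<close>

definition word_mat :: "nat \<Rightarrow> (gen \<Rightarrow> 'k::field mat) \<Rightarrow> word \<Rightarrow> 'k mat" where
  "word_mat N A w = foldr (\<lambda>g B. A g * B) (letters w) (1\<^sub>m N)"

definition free_act :: "nat \<Rightarrow> (gen \<Rightarrow> 'k::field mat) \<Rightarrow> 'k free \<Rightarrow> 'k mat" where
  "free_act N A x = mat N N
     (\<lambda>ij. \<Sum>w\<in>Poly_Mapping.keys x. Poly_Mapping.lookup x w * word_mat N A w $$ ij)"

definition module_of_gens :: "nat \<Rightarrow> (gen \<Rightarrow> 'k::field mat) \<Rightarrow> 'k fdmod" where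
  "module_of_gens N A = \<lparr> mdim = N, act = (\<lambda>X. the_elem (free_act N A ` X)) \<rparr>"

definition alpha :: "'k::field \<Rightarrow> nat \<Rightarrow> nat \<Rightarrow> 'k" where
  "alpha q l i = (\<Sum>j<i. q ^ j) * (1 - q powi (int i - int l))"

text \<open>
  Row and column indices start at 0, so the basis vector \<open>v\<^sub>i\<close> has index \<open>i - 1\<close>; the second
  parameter is an integer representing a class modulo \<open>n\<close>, on which \<open>V\<close> depends only through
  powers of \<open>q\<close>.
\<close>

fun V_gen :: "'k::field \<Rightarrow> nat \<Rightarrow> int \<Rightarrow> gen \<Rightarrow> 'k mat" where
  "V_gen q l r Ga = mat l l (\<lambda>(i, j). if i = j + 1 then 1 else 0)"
| "V_gen q l r Gb = mat l l (\<lambda>(i, j). if i = j then q powi (r + int i) else 0)"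
| "V_gen q l r Gc = mat l l (\<lambda>(i, j). if i = j then q powi (int i + 1 - r - int l) else 0)"
| "V_gen q l r Gd = mat l l (\<lambda>(i, j). if j = i + 1 then alpha q l j else 0)"

definition V :: "'k::field \<Rightarrow> nat \<Rightarrow> int \<Rightarrow> 'k fdmod" where
  "V q l r = module_of_gens l (V_gen q l r)"

definition is_primitive_root :: "nat \<Rightarrow> 'k::field \<Rightarrow> bool" where
  "is_primitive_root n q \<longleftrightarrow> q ^ n = 1 \<and> (\<forall>m. 0 < m \<and> m < n \<longrightarrow> q ^ m \<noteq> 1)"

definition half_up :: "nat \<Rightarrow> nat" where
  "half_up t = (t + 1) div 2"

end

theory Submission
  imports Defs "HOL-Library.Function_Algebras"
begin

text \<open>
  Let \<open>T = V(l,r) \<otimes> P(l',r')\<close>, which is projective because \<open>Hom(T, Y) = Hom(P(l',r'), V(l,1-l-r) \<otimes> Y)\<close>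
  and tensoring with \<open>V(l,1-l-r)\<close> is exact.  The module \<open>P(l',r')\<close> is generated by a weight vector subject only to
  \<open>d a d x = 0\<close> (one constructs such a module of dimension \<open>2n\<close> explicitly), so the maps
  \<open>T \<rightarrow> V(m,s)\<close> are the vectors \<open>x\<close> of \<open>V(l,1-l-r) \<otimes> V(m,s)\<close> of weight
  \<open>(q\<^bsup>r'\<^esup>, q\<^bsup>1-r'-l'\<^esup>)\<close> with \<open>d a d x = 0\<close>.  For each label
  \<open>(m, r+r'+i)\<close> of the decomposition there is a highest weight vector of this kind, and for the labels of
  multiplicity two also a second one, reached from a highest weight vector of a lower level or from a lowest
  weight vector of a higher level.  As the labels have distinct \<open>i < n\<close>, these maps combine to an epimorphism of
  \<open>T\<close> onto a direct sum of simple modules.  It lifts to a map from \<open>T\<close> to the direct sum of the projective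
  covers, which is surjective since the cover is essential, and an isomorphism since both sides have dimension \<open>2nl\<close>.
\<close>

text \<open>Only lower bounds are proved for the multiplicities of the simple quotients of T: a
  jointly surjective list of maps with the required number of entries for each label. The dimension
  2nl then leaves no room for anything else. The parameter 1-l-r comes from duality: passing to the
  dual inverts weights, so the b-weight q^(r+l-1) of the last basis vector of V(l,r) becomes the
  weight q^(1-l-r) of the first one. The condition d a d x = 0 normalises a generator. In the
  2n-dimensional model it holds for the top vector, but a vector of the same weight in another
  module need not satisfy it. Projectivity therefore needs a correction that produces this property
  and leaves the image of the vector unchanged. For multiplicity two, highest weight vectors alone
  are not enough, and weights only see levels modulo n. For i <= t the second vector is taken at the
  same level as the first, as a d-preimage of the end of a string; for i >= c(l+l'-1) it is taken
  exactly n levels higher.\<close>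

hide_const (open) Multiset.mult

section \<open>Ideals and quotient rings\<close>

text \<open>Two-sided ideals in terms of the class operations; \<open>ideal_iff_two_sided\<close>
  connects them with the record-based ideals in which \<open>H_ideal\<close> and
  \<open>HH_ideal\<close> are phrased.\<close>

definition two_sided :: "'a::ring_1 set \<Rightarrow> bool" where
  "two_sided J \<longleftrightarrow> 0 \<in> J \<and> (\<forall>x\<in>J. \<forall>y\<in>J. x + y \<in> J) \<and> (\<forall>x\<in>J. \<forall>r. r * x \<in> J \<and> x * r \<in> J)"

lemma two_sidedD:
  assumes "two_sided J"
  shows "0 \<in> J" "x \<in> J \<Longrightarrow> y \<in> J \<Longrightarrow> x + y \<in> J" "x \<in> J \<Longrightarrow> r * x \<in> J" "x \<in> J \<Longrightarrow> x * r \<in> J"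
  using assms by (auto simp: two_sided_def)

lemma two_sided_uminus: "two_sided J \<Longrightarrow> x \<in> J \<Longrightarrow> - x \<in> J"
  using two_sidedD(3)[of J x "-1"] by simp

lemma two_sided_diff: "two_sided J \<Longrightarrow> x \<in> J \<Longrightarrow> y \<in> J \<Longrightarrow> x - y \<in> J"
  using two_sidedD(2)[of J x "- y"] two_sided_uminus[of J y] by simp

lemma ideal_iff_two_sided: "ideal J class_ring \<longleftrightarrow> two_sided (J :: 'a::ring_1 set)"
proof
  assume "ideal J class_ring"
  then interpret ideal J "class_ring :: 'a ring" .
  show "two_sided J"
    unfolding two_sided_def
    using I_l_closed I_r_closed a_closed zero_closed by simp
next
  assume J: "two_sided J"
  have "subgroup J (add_monoid (class_ring :: 'a ring))"
  proof (unfold_locales)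
    show "inv\<^bsub>add_monoid (class_ring :: 'a ring)\<^esub> x \<in> J" if "x \<in> J" for x
    proof -
      have "inv\<^bsub>add_monoid (class_ring :: 'a ring)\<^esub> x = - x"
        unfolding m_inv_def
        by (rule the1_equality, rule ex1I[of _ "- x"]) (auto simp: minus_unique)
      thus ?thesis using two_sided_uminus[OF J that] by simp
    qed
  qed (use two_sidedD[OF J] in auto)
  moreover have "Ring.ring (class_ring :: 'a ring)" by (rule class_ring.ring_axioms)
  ultimately show "ideal J class_ring"
    by (intro idealI) (use two_sidedD[OF J] in auto)
qed

lemma two_sided_Idl: "two_sided (Idl\<^bsub>class_ring\<^esub> (S :: 'a::ring_1 set))"
  using ring.genideal_ideal[OF class_ring.ring_axioms, of S] by (simp add: ideal_iff_two_sided)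

lemma Idl_superset: "x \<in> S \<Longrightarrow> x \<in> Idl\<^bsub>class_ring\<^esub> (S :: 'a::ring_1 set)"
  using ring.genideal_self[OF class_ring.ring_axioms, of S] by auto

lemma Idl_least: "two_sided J \<Longrightarrow> S \<subseteq> J \<Longrightarrow> Idl\<^bsub>class_ring\<^esub> (S :: 'a::ring_1 set) \<subseteq> J"
  using ring.genideal_minimal[OF class_ring.ring_axioms, of J S] by (simp add: ideal_iff_two_sided)

lemma class_coset_mem:
  assumes "two_sided (J :: 'a::ring_1 set)"
  shows "y \<in> J +>\<^bsub>class_ring\<^esub> x \<longleftrightarrow> y - x \<in> J"
proof -
  have "y \<in> J +>\<^bsub>class_ring\<^esub> x \<longleftrightarrow> (\<exists>h\<in>J. y = h + x)"
    by (auto simp: a_r_coset_def')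
  also have "\<dots> \<longleftrightarrow> y - x \<in> J" by (metis add_diff_cancel diff_add_cancel)
  finally show ?thesis .
qed

lemma class_coset_eq_iff:
  assumes J: "two_sided (J :: 'a::ring_1 set)"
  shows "J +>\<^bsub>class_ring\<^esub> x = J +>\<^bsub>class_ring\<^esub> y \<longleftrightarrow> x - y \<in> J"
proof
  assume "J +>\<^bsub>class_ring\<^esub> x = J +>\<^bsub>class_ring\<^esub> y"
  hence "x \<in> J +>\<^bsub>class_ring\<^esub> y"
    using class_coset_mem[OF J, of x x] two_sidedD(1)[OF J] by simp
  thus "x - y \<in> J" by (simp add: class_coset_mem[OF J])
next
  assume xy: "x - y \<in> J"
  have "z - x \<in> J \<longleftrightarrow> z - y \<in> J" for z
    using two_sidedD(2)[OF J, of "z - x" "x - y"] two_sided_diff[OF J, of "z - y" "x - y"] xy by auto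
  thus "J +>\<^bsub>class_ring\<^esub> x = J +>\<^bsub>class_ring\<^esub> y"
    by (intro Set.set_eqI) (simp add: class_coset_mem[OF J])
qed

context
  fixes n :: nat and q :: "'k::field"
begin

lemma two_sided_H: "two_sided (H_ideal n q)"
  unfolding H_ideal_def by (rule two_sided_Idl)

lemma two_sided_HH: "two_sided (HH_ideal n q)"
  unfolding HH_ideal_def by (rule two_sided_Idl)

lemma H_class_eq_iff: "H_class n q x = H_class n q y \<longleftrightarrow> x - y \<in> H_ideal n q"
  unfolding H_class_def by (rule class_coset_eq_iff[OF two_sided_H])

lemma HH_class_eq_iff: "HH_class n q x = HH_class n q y \<longleftrightarrow> x - y \<in> HH_ideal n q"
  unfolding HH_class_def by (rule class_coset_eq_iff[OF two_sided_HH])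

lemma mem_H_class: "y \<in> H_class n q x \<longleftrightarrow> y - x \<in> H_ideal n q"
  unfolding H_class_def by (rule class_coset_mem[OF two_sided_H])

lemma mem_HH_class: "y \<in> HH_class n q x \<longleftrightarrow> y - x \<in> HH_ideal n q"
  unfolding HH_class_def by (rule class_coset_mem[OF two_sided_HH])

lemma carrier_H: "carrier (H n q) = range (H_class n q)"
  unfolding H_def FactRing_def A_RCOSETS_def' H_class_def by auto

lemma H_class_hom: "H_class n q \<in> Ring.ring_hom class_ring (H n q)"
proof -
  interpret ideal "H_ideal n q" "class_ring :: 'k free ring"
    using two_sided_H by (simp add: ideal_iff_two_sided)
  show ?thesis using rcos_ring_hom unfolding H_class_def H_def .
qed

lemma H_class_mult: "H_class n q x \<otimes>\<^bsub>H n q\<^esub> H_class n q y = H_class n q (x * y)"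
  and H_class_add: "H_class n q x \<oplus>\<^bsub>H n q\<^esub> H_class n q y = H_class n q (x + y)"
  and H_class_one: "\<one>\<^bsub>H n q\<^esub> = H_class n q 1"
  using ring_hom_mult[OF H_class_hom, of x y] ring_hom_add[OF H_class_hom, of x y]
    ring_hom_one[OF H_class_hom] by simp_all

end

text \<open>Evaluates \<open>comult\<close>, \<open>tensor\<close> and
  \<open>module_of_gens\<close>, which are defined by \<open>the_elem\<close> of the image of a
  coset, on a representative.\<close>

lemma the_elem_image_coset:
  assumes "\<And>y. y \<in> A \<Longrightarrow> f y = f x" "x \<in> A"
  shows "the_elem (f ` A) = f x"
proof -
  have "f ` A = (\<lambda>_. f x) ` A" by (rule image_cong[OF refl assms(1)])
  thus ?thesis using assms(2) by (auto simp: image_constant_conv)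
qed

lemma poly_mapping_linear_induct [case_names zero single add]:
  fixes x :: "'m \<Rightarrow>\<^sub>0 'k::ab_group_add"
  assumes zero: "Q 0" and single: "\<And>w c. Q (Poly_Mapping.single w c)"
    and add: "\<And>x y. Q x \<Longrightarrow> Q y \<Longrightarrow> Q (x + y)"
  shows "Q x"
proof (induction x rule: update_induct)
  case const
  show ?case by (rule zero)
next
  case (update f a b)
  have "Poly_Mapping.update a b f = f + Poly_Mapping.single a b"
    using update(1)
    by (intro poly_mapping_eqI) (auto simp: lookup_update lookup_add lookup_single when_def in_keys_iff)
  thus ?case using add single update by simp
qed

section \<open>Constants and words in the free algebra\<close>

lemma const_add: "const (x + y) = const x + const y"
  by (simp add: const_def single_add)

lemma const_mult: "const (x * y) = const x * const y"
  by (simp add: const_def mult_single)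

lemma const_0 [simp]: "const 0 = 0" and const_1 [simp]: "const 1 = 1"
  by (simp_all add: const_def)

lemma const_uminus: "const (- x) = - const x"
  using const_add[of x "- x"] by (simp add: eq_neg_iff_add_eq_0 add.commute)

lemma const_mult_single: "const c * Poly_Mapping.single w d = Poly_Mapping.single w (c * d)"
  by (simp add: const_def mult_single)

lemma const_central: "const c * y = y * const c"
proof (induction y rule: poly_mapping_linear_induct)
  case (single w d)
  show ?case by (simp add: const_def mult_single mult.commute)
qed (simp_all add: algebra_simps)

lemma mon_Nil: "mon [] = 1"
  by (simp add: mon_def zero_word_def[symmetric])

lemma mon_append: "mon (xs @ ys) = mon xs * mon ys"
  by (simp add: mon_def mult_single plus_word_def)

lemma mon_Cons: "mon (x # ys) = mon [x] * mon ys"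
  using mon_append[of "[x]" ys] by simp

lemma single_Word: "Poly_Mapping.single (Word gs) c = const c * mon gs"
  by (simp add: mon_def const_mult_single)

text \<open>The free algebra is generated by the constants and the four letters. This is what
  reduces statements about the whole action to the generators.\<close>

lemma free_induct [case_names const gen add mult]:
  fixes x :: "'k::field free"
  assumes const: "\<And>c. Q (const c)" and gen: "\<And>g. Q (mon [g])"
    and add: "\<And>x y. Q x \<Longrightarrow> Q y \<Longrightarrow> Q (x + y)" and mult: "\<And>x y. Q x \<Longrightarrow> Q y \<Longrightarrow> Q (x * y)"
  shows "Q x"
proof (induction x rule: poly_mapping_linear_induct)
  case zero
  show ?case using const[of 0] by simp
next
  case (single w c)
  have "Q (mon gs)" for gs
  proof (induction gs)
    case Nil
    show ?case using const[of 1] by (simp add: mon_Nil)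
  next
    case (Cons g gs)
    show ?case by (subst mon_Cons) (intro mult gen Cons)
  qed
  thus ?case by (cases w) (simp add: single_Word mult const)
qed (rule add)

subsection \<open>Linear extensions to a monoid algebra\<close>

text \<open>The common shape of \<open>free_act\<close> and \<open>act2\<close>: linear extension of
  a matrix-valued map on the basis monoid, so that multiplicativity has to be proved only
  once.\<close>

definition lin_ext_mat :: "nat \<Rightarrow> ('m \<Rightarrow> 'k mat) \<Rightarrow> ('m \<Rightarrow>\<^sub>0 'k::field) \<Rightarrow> 'k mat" where
  "lin_ext_mat N \<phi> x = mat N N (\<lambda>ij. \<Sum>w\<in>Poly_Mapping.keys x. Poly_Mapping.lookup x w * \<phi> w $$ ij)"

lemma sum_keys_superset:
  fixes x :: "'m \<Rightarrow>\<^sub>0 'k::zero"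
  assumes "finite S" "Poly_Mapping.keys x \<subseteq> S" "\<And>w. f w 0 = 0"
  shows "(\<Sum>w\<in>Poly_Mapping.keys x. f w (Poly_Mapping.lookup x w)) = (\<Sum>w\<in>S. f w (Poly_Mapping.lookup x w))"
  by (rule sum.mono_neutral_left) (use assms in \<open>auto simp: in_keys_iff\<close>)

lemma sum_keys_add:
  fixes x y :: "'m \<Rightarrow>\<^sub>0 'k::comm_monoid_add"
  assumes "\<And>w. f w 0 = 0" "\<And>w a b. f w (a + b) = f w a + f w b"
  shows "(\<Sum>w\<in>Poly_Mapping.keys (x + y). f w (Poly_Mapping.lookup (x + y) w)) =
    (\<Sum>w\<in>Poly_Mapping.keys x. f w (Poly_Mapping.lookup x w)) +
    (\<Sum>w\<in>Poly_Mapping.keys y. f w (Poly_Mapping.lookup y w))"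
proof -
  let ?S = "Poly_Mapping.keys x \<union> Poly_Mapping.keys y"
  have *: "(\<Sum>w\<in>Poly_Mapping.keys z. f w (Poly_Mapping.lookup z w)) = (\<Sum>w\<in>?S. f w (Poly_Mapping.lookup z w))"
    if "Poly_Mapping.keys z \<subseteq> ?S" for z
    by (rule sum_keys_superset) (use that assms in auto)
  show ?thesis
    unfolding *[OF keys_add] *[OF Un_upper1] *[OF Un_upper2]
    by (simp add: lookup_add assms(2) sum.distrib)
qed

lemma lin_ext_mat_carrier [simp]: "lin_ext_mat N \<phi> x \<in> carrier_mat N N"
  by (simp add: lin_ext_mat_def)

lemma lin_ext_mat_add: "lin_ext_mat N \<phi> (x + y) = lin_ext_mat N \<phi> x + lin_ext_mat N \<phi> y"
proof (rule eq_matI)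
  fix i j assume "i < dim_row (lin_ext_mat N \<phi> x + lin_ext_mat N \<phi> y)"
    "j < dim_col (lin_ext_mat N \<phi> x + lin_ext_mat N \<phi> y)"
  thus "lin_ext_mat N \<phi> (x + y) $$ (i, j) = (lin_ext_mat N \<phi> x + lin_ext_mat N \<phi> y) $$ (i, j)"
    using sum_keys_add[of "\<lambda>w c. c * \<phi> w $$ (i, j)" x y]
    by (simp add: lin_ext_mat_def algebra_simps)
qed (simp_all add: lin_ext_mat_def)

lemma lin_ext_mat_single:
  assumes "\<phi> w \<in> carrier_mat N N"
  shows "lin_ext_mat N \<phi> (Poly_Mapping.single w c) = c \<cdot>\<^sub>m \<phi> w"
  by (rule eq_matI) (use assms in \<open>auto simp: lin_ext_mat_def\<close>)

lemma lin_ext_mat_0: "lin_ext_mat N \<phi> 0 = 0\<^sub>m N N"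
  by (rule eq_matI) (auto simp: lin_ext_mat_def)

lemma smult_smult_mat: "a \<cdot>\<^sub>m (b \<cdot>\<^sub>m A) = (a * b) \<cdot>\<^sub>m (A :: 'a::semigroup_mult mat)"
  by (rule eq_matI) (auto simp: mult.assoc)

lemma lin_ext_mat_mult:
  fixes x y :: "'m::monoid_add \<Rightarrow>\<^sub>0 'k::field"
  assumes carr: "\<And>w. \<phi> w \<in> carrier_mat N N"
    and hom: "\<And>u v. \<phi> (u + v) = \<phi> u * \<phi> v"
  shows "lin_ext_mat N \<phi> (x * y) = lin_ext_mat N \<phi> x * lin_ext_mat N \<phi> y"
proof (induction x rule: poly_mapping_linear_induct)
  case zero
  show ?case by (simp add: lin_ext_mat_0 left_mult_zero_mat[OF lin_ext_mat_carrier])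
next
  case (single u c)
  show ?case
  proof (induction y rule: poly_mapping_linear_induct)
    case zero
    show ?case by (simp add: lin_ext_mat_0 right_mult_zero_mat[OF lin_ext_mat_carrier])
  next
    case (single v d)
    show ?case using carr[of u] carr[of v] carr[of "u + v"]
      by (simp add: mult_single lin_ext_mat_single carr hom mult_smult_assoc_mat[where nr=N and n=N and nc=N]
          mult_smult_distrib[where nr=N and n=N and nc=N] smult_smult_mat mult.commute)
  next
    case (add y z)
    thus ?case
      by (simp add: distrib_left lin_ext_mat_add mult_add_distrib_mat[where nr=N and n=N and nc=N])
  qed
next
  case (add x z)
  thus ?case
    by (simp add: distrib_right lin_ext_mat_add add_mult_distrib_mat[where nr=N and n=N and nc=N])
qed

lemma lin_ext_mat_const:
  fixes \<phi> :: "'m::monoid_add \<Rightarrow> 'k::field mat"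
  assumes "\<phi> 0 = 1\<^sub>m N"
  shows "lin_ext_mat N \<phi> (const c) = c \<cdot>\<^sub>m 1\<^sub>m N"
  using lin_ext_mat_single[of \<phi> 0 N c] assms by (simp add: const_def)

section \<open>Modules as matrices satisfying the defining relations\<close>

lemma one_smult_mat: "1 \<cdot>\<^sub>m A = (A :: 'a::semiring_1 mat)"
  by (rule eq_matI) auto

text \<open>Matrix representations of a monoid algebra. The monoid is left open because both the
  free algebra F and F tensor F occur.\<close>

locale alg_map =
  fixes N :: nat and \<rho> :: "('m::monoid_add \<Rightarrow>\<^sub>0 'k::field) \<Rightarrow> 'k mat"
  assumes carr: "\<rho> x \<in> carrier_mat N N"
    and add: "\<rho> (x + y) = \<rho> x + \<rho> y"
    and mult: "\<rho> (x * y) = \<rho> x * \<rho> y"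
    and scal: "\<rho> (const c) = c \<cdot>\<^sub>m 1\<^sub>m N"
begin

lemma zero: "\<rho> 0 = 0\<^sub>m N N"
  using scal[of 0] by (simp add: smult_mat_def) (rule eq_matI, auto)

lemma one: "\<rho> 1 = 1\<^sub>m N"
  using scal[of 1] by (simp add: smult_mat_def) (rule eq_matI, auto)

lemma scale: "\<rho> (const c * x) = c \<cdot>\<^sub>m \<rho> x"
  using carr[of x] by (simp add: mult scal mult_smult_assoc_mat[where nr=N and n=N and nc=N] left_mult_one_mat)

lemma uminus: "\<rho> (- x) = - \<rho> x"
proof -
  have "\<rho> (- x) = (- 1) \<cdot>\<^sub>m \<rho> x" using scale[of "- 1" x] by (simp add: const_uminus)
  also have "\<dots> = - \<rho> x" by (rule eq_matI) auto
  finally show ?thesis .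
qed

lemma diff: "\<rho> (x - y) = \<rho> x - \<rho> y"
  using add[of x "- y"] carr[of x] carr[of y] by (simp add: uminus minus_add_uminus_mat[where nr=N and nc=N])

lemma power: "\<rho> (x ^ k) = \<rho> x ^\<^sub>m k"
proof (induction k)
  case 0
  show ?case using carr[of x] by (simp add: one)
next
  case (Suc k)
  show ?case by (simp add: power_commutes[symmetric] mult Suc power_Suc2 del: power_Suc)
qed

lemma diff_eq_0_iff: "\<rho> (x - y) = 0\<^sub>m N N \<longleftrightarrow> \<rho> x = \<rho> y"
proof
  assume *: "\<rho> (x - y) = 0\<^sub>m N N"
  have "\<rho> x = \<rho> (x - y) + \<rho> y" by (simp add: add[symmetric])
  thus "\<rho> x = \<rho> y" using carr[of y] by (simp add: *)
qed (use carr in \<open>simp add: diff minus_r_inv_mat[OF carr]\<close>)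

lemma two_sided_kernel: "two_sided {x. \<rho> x = 0\<^sub>m N N}"
  unfolding two_sided_def
  by (simp add: zero add mult left_mult_zero_mat[OF carr] right_mult_zero_mat[OF carr])

end

definition rels :: "nat \<Rightarrow> 'k::field \<Rightarrow> nat \<Rightarrow> (gen \<Rightarrow> 'k mat) \<Rightarrow> bool" where
  "rels n q N A \<longleftrightarrow> (\<forall>g. A g \<in> carrier_mat N N) \<and>
     A Gb * A Ga = q \<cdot>\<^sub>m (A Ga * A Gb) \<and> A Gd * A Gb = q \<cdot>\<^sub>m (A Gb * A Gd) \<and>
     A Gc * A Ga = q \<cdot>\<^sub>m (A Ga * A Gc) \<and> A Gd * A Gc = q \<cdot>\<^sub>m (A Gc * A Gd) \<and>
     A Gb * A Gc = A Gc * A Gb \<and>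
     A Ga ^\<^sub>m n = 0\<^sub>m N N \<and> A Gb ^\<^sub>m n = 1\<^sub>m N \<and> A Gc ^\<^sub>m n = 1\<^sub>m N \<and> A Gd ^\<^sub>m n = 0\<^sub>m N N \<and>
     A Gd * A Ga - q \<cdot>\<^sub>m (A Ga * A Gd) = 1\<^sub>m N - A Gb * A Gc"

lemma (in alg_map) kills_relators_iff:
  fixes A :: "gen \<Rightarrow> 'm \<Rightarrow>\<^sub>0 'k"
  shows "rels n q N (\<lambda>g. \<rho> (A g)) \<longleftrightarrow>
    (\<forall>x\<in>{A Gb * A Ga - const q * A Ga * A Gb, A Gd * A Gb - const q * A Gb * A Gd,
      A Gc * A Ga - const q * A Ga * A Gc, A Gd * A Gc - const q * A Gc * A Gd,
      A Gb * A Gc - A Gc * A Gb, A Ga ^ n, A Gb ^ n - 1, A Gc ^ n - 1, A Gd ^ n,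
      A Gd * A Ga - const q * A Ga * A Gd - (1 - A Gb * A Gc)}. \<rho> x = 0\<^sub>m N N)"
  by (simp add: rels_def carr diff_eq_0_iff mult[symmetric] power[symmetric] scale[symmetric] one[symmetric]
      mult.assoc diff[symmetric])

lemma (in alg_map) kills_Idl:
  assumes "\<And>x. x \<in> S \<Longrightarrow> \<rho> x = 0\<^sub>m N N" "x \<in> Idl\<^bsub>class_ring\<^esub> S"
  shows "\<rho> x = 0\<^sub>m N N"
  using Idl_least[OF two_sided_kernel, of S] assms by auto

lemma alg_map_kills_H:
  assumes "alg_map N \<rho>" "rels n q N (\<lambda>g. \<rho> (mon [g]))" "x \<in> H_ideal n q"
  shows "\<rho> x = 0\<^sub>m N N"
proof -
  interpret alg_map N \<rho> by fact
  show ?thesis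
    using assms(3) unfolding H_ideal_def
    by (rule kills_Idl[rotated])
       (use assms(2)[unfolded kills_relators_iff] in \<open>auto simp: relators_def Let_def\<close>)
qed

lemma alg_map_rels:
  assumes "alg_map N \<rho>" "\<And>x. x \<in> H_ideal n q \<Longrightarrow> \<rho> x = 0\<^sub>m N N"
  shows "rels n q N (\<lambda>g. \<rho> (mon [g]))"
proof -
  interpret alg_map N \<rho> by fact
  have "\<rho> x = 0\<^sub>m N N" if "x \<in> relators n q" for x
    using that assms(2) Idl_superset[of x "relators n q"] by (simp add: H_ideal_def)
  thus ?thesis unfolding kills_relators_iff by (simp add: relators_def Let_def)
qed

lemma alg_map_const_on_class:
  assumes "alg_map N \<rho>" "rels n q N (\<lambda>g. \<rho> (mon [g]))"
  shows "H_class n q x = H_class n q y \<Longrightarrow> \<rho> x = \<rho> y"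
  using alg_map_kills_H[OF assms, of "x - y"] alg_map.diff_eq_0_iff[OF assms(1)] 
  by (simp add: H_class_eq_iff)

section \<open>Passing between modules and quadruples of matrices\<close>

lemma is_module_iff:
  "is_module n q M \<longleftrightarrow> alg_map (mdim M) (\<lambda>x. act M (H_class n q x))"
proof
  assume "is_module n q M"
  hence hom: "act M \<in> Ring.ring_hom (H n q) (ring_mat TYPE('a) (mdim M) ())"
    and sc: "act M (H_class n q (const x)) = x \<cdot>\<^sub>m 1\<^sub>m (mdim M)" for x
    by (auto simp: is_module_def)
  have c: "H_class n q x \<in> carrier (H n q)" for x by (simp add: carrier_H)
  show "alg_map (mdim M) (\<lambda>x. act M (H_class n q x))"
    using ring_hom_closed[OF hom c] ring_hom_mult[OF hom c c] ring_hom_add[OF hom c c]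
    by unfold_locales (simp_all add: ring_mat_simps H_class_mult H_class_add sc)
next
  assume "alg_map (mdim M) (\<lambda>x. act M (H_class n q x))"
  then interpret alg_map "mdim M" "\<lambda>x. act M (H_class n q x)" .
  show "is_module n q M"
    unfolding is_module_def
    by (intro conjI allI ring_hom_memI)
       (auto simp: carrier_H ring_mat_simps H_class_mult H_class_add H_class_one carr mult add one scal)
qed

definition gmat :: "nat \<Rightarrow> 'k::field \<Rightarrow> 'k fdmod \<Rightarrow> gen \<Rightarrow> 'k mat" where
  "gmat n q M g = act M (H_class n q (mon [g]))"

lemma is_module_rels:
  assumes "is_module n q M"
  shows "rels n q (mdim M) (gmat n q M)"
proof -
  interpret alg_map "mdim M" "\<lambda>x. act M (H_class n q x)" using assms by (simp add: is_module_iff)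
  have "H_class n q x = H_class n q 0" if "x \<in> H_ideal n q" for x
    using that by (simp add: H_class_eq_iff)
  hence "rels n q (mdim M) (\<lambda>g. act M (H_class n q (mon [g])))"
    using alg_map_rels[OF alg_map_axioms, of n q] zero by metis
  thus ?thesis by (simp add: gmat_def[abs_def])
qed

lemma gmat_carrier: "is_module n q M \<Longrightarrow> gmat n q M g \<in> carrier_mat (mdim M) (mdim M)"
  using is_module_rels by (auto simp: rels_def)

text \<open>Scalars are always intertwined, and the elements intertwined by \<open>f\<close> are
  closed under sums and products, so the four generators suffice.\<close>

lemma is_hom_iff:
  "is_hom n q M N f \<longleftrightarrow> is_module n q M \<and> is_module n q N \<and> f \<in> carrier_mat (mdim N) (mdim M) \<and>
     (\<forall>g. f * gmat n q M g = gmat n q N g * f)"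
proof (cases "is_module n q M \<and> is_module n q N \<and> f \<in> carrier_mat (mdim N) (mdim M)")
  case True
  hence M: "is_module n q M" and N: "is_module n q N" and f: "f \<in> carrier_mat (mdim N) (mdim M)" by auto
  interpret M: alg_map "mdim M" "\<lambda>x. act M (H_class n q x)" using M by (simp add: is_module_iff)
  interpret N: alg_map "mdim N" "\<lambda>x. act N (H_class n q x)" using N by (simp add: is_module_iff)
  have "f * act M (H_class n q x) = act N (H_class n q x) * f"
    if g: "\<And>g. f * gmat n q M g = gmat n q N g * f" for x
  proof (induction x rule: free_induct)
    case (const c)
    show ?case using f
      by (simp add: M.scal N.scal mult_smult_distrib[OF f one_carrier_mat] mult_smult_assoc_mat[OF one_carrier_mat f])
  next
    case (gen g)
    show ?case using g by (simp add: gmat_def)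
  next
    case (add x y)
    thus ?case
      by (simp add: M.add N.add mult_add_distrib_mat[OF f M.carr M.carr] add_mult_distrib_mat[OF N.carr N.carr f])
  next
    case (mult x y)
    have "f * (act M (H_class n q x) * act M (H_class n q y)) = (f * act M (H_class n q x)) * act M (H_class n q y)"
      by (rule assoc_mult_mat[OF f M.carr M.carr, symmetric])
    also have "\<dots> = act N (H_class n q x) * (f * act M (H_class n q y))"
      unfolding mult(1) by (rule assoc_mult_mat[OF N.carr f M.carr])
    also have "\<dots> = (act N (H_class n q x) * act N (H_class n q y)) * f"
      unfolding mult(2) by (rule assoc_mult_mat[OF N.carr N.carr f, symmetric])
    finally show ?case by (simp add: M.mult N.mult)
  qed
  thus ?thesis using True
    by (auto simp: is_hom_def carrier_H gmat_def)
qed (auto simp: is_hom_def)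

lemma free_act_eq: "free_act N A = lin_ext_mat N (word_mat N A)"
  by (auto simp: free_act_def lin_ext_mat_def)

lemma word_mat_carrier:
  assumes "\<And>g. A g \<in> carrier_mat N N"
  shows "word_mat N A w \<in> carrier_mat N N"
proof -
  have "foldr (\<lambda>g B. A g * B) gs (1\<^sub>m N) \<in> carrier_mat N N" for gs
    by (induction gs) (auto intro!: mult_carrier_mat[of _ N N] assms)
  thus ?thesis by (simp add: word_mat_def)
qed

lemma word_mat_add:
  assumes "\<And>g. A g \<in> carrier_mat N N"
  shows "word_mat N A (u + v) = word_mat N A u * word_mat N A v"
proof -
  let ?F = "\<lambda>gs. foldr (\<lambda>g B. A g * B) gs (1\<^sub>m N)"
  have c: "?F gs \<in> carrier_mat N N" for gs
    using word_mat_carrier[OF assms, where w = "Word gs"] by (simp add: word_mat_def)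
  have "?F (gs @ hs) = ?F gs * ?F hs" for gs hs
  proof (induction gs)
    case Nil
    show ?case using left_mult_one_mat[OF c] by simp
  next
    case (Cons g gs)
    thus ?case using assoc_mult_mat[OF assms c c] by simp
  qed
  thus ?thesis by (simp add: word_mat_def plus_word_def)
qed

lemma alg_map_free_act:
  assumes "\<And>g. A g \<in> carrier_mat N N"
  shows "alg_map N (free_act N A)"
proof -
  have "word_mat N A 0 = 1\<^sub>m N" by (simp add: word_mat_def zero_word_def)
  thus ?thesis
    unfolding free_act_eq
    by unfold_locales (simp_all add: lin_ext_mat_add lin_ext_mat_const
        lin_ext_mat_mult[OF word_mat_carrier[OF assms] word_mat_add[OF assms]])
qed

lemma free_act_gen:
  assumes "\<And>g. A g \<in> carrier_mat N N"
  shows "free_act N A (mon [g]) = A g"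
proof -
  have "word_mat N A (Word [g]) = A g" using assms[of g] by (simp add: word_mat_def)
  thus ?thesis
    using lin_ext_mat_single[where w = "Word [g]" and c = 1, OF word_mat_carrier[OF assms]] assms[of g]
    by (simp add: free_act_eq mon_def one_smult_mat)
qed

lemma module_of_gens_act:
  assumes "rels n q N A"
  shows "act (module_of_gens N A) (H_class n q x) = free_act N A x"
proof -
  have A: "\<And>g. A g \<in> carrier_mat N N" using assms by (simp add: rels_def)
  have r: "rels n q N (\<lambda>g. free_act N A (mon [g]))" using assms by (simp add: free_act_gen[OF A])
  have "the_elem (free_act N A ` H_class n q x) = free_act N A x"
  proof (rule the_elem_image_coset)
    fix y assume "y \<in> H_class n q x"
    hence "H_class n q y = H_class n q x" by (simp add: mem_H_class H_class_eq_iff)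
    thus "free_act N A y = free_act N A x" by (rule alg_map_const_on_class[OF alg_map_free_act[OF A] r])
  qed (simp add: mem_H_class two_sidedD(1)[OF two_sided_H])
  thus ?thesis by (simp add: module_of_gens_def)
qed

lemma mdim_module_of_gens [simp]: "mdim (module_of_gens N A) = N"
  by (simp add: module_of_gens_def)

lemma module_of_gens:
  assumes "rels n q N A"
  shows "is_module n q (module_of_gens N A)" "gmat n q (module_of_gens N A) = A"
proof -
  have A: "\<And>g. A g \<in> carrier_mat N N" using assms by (simp add: rels_def)
  show "is_module n q (module_of_gens N A)"
    using alg_map_free_act[OF A] by (simp add: is_module_iff module_of_gens_act[OF assms])
  show "gmat n q (module_of_gens N A) = A"
    by (rule ext) (simp add: gmat_def module_of_gens_act[OF assms] free_act_gen[OF A])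
qed

subsection \<open>Direct sums\<close>

abbreviation (input) dsum_mat :: "'k::zero mat \<Rightarrow> 'k mat \<Rightarrow> 'k mat" where
  "dsum_mat A B \<equiv> four_block_mat A (0\<^sub>m (dim_row A) (dim_col B)) (0\<^sub>m (dim_row B) (dim_col A)) B"

lemma alg_map_dsum:
  assumes "alg_map N \<rho>" "alg_map N' \<rho>'"
  shows "alg_map (N + N') (\<lambda>x. dsum_mat (\<rho> x) (\<rho>' x))"
proof -
  interpret a: alg_map N \<rho> by fact
  interpret b: alg_map N' \<rho>' by fact
  have [simp]: "dim_row (\<rho> x) = N" "dim_col (\<rho> x) = N" "dim_row (\<rho>' x) = N'" "dim_col (\<rho>' x) = N'" for x
    using a.carr[of x] b.carr[of x] by auto
  show ?thesis
  proof
    fix x y :: "'a \<Rightarrow>\<^sub>0 'b" and c :: 'b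
    show "dsum_mat (\<rho> x) (\<rho>' x) \<in> carrier_mat (N + N') (N + N')" by auto
    show "dsum_mat (\<rho> (x + y)) (\<rho>' (x + y)) = dsum_mat (\<rho> x) (\<rho>' x) + dsum_mat (\<rho> y) (\<rho>' y)"
      by (rule eq_matI) (auto simp: a.add b.add)
    show "dsum_mat (\<rho> (x * y)) (\<rho>' (x * y)) = dsum_mat (\<rho> x) (\<rho>' x) * dsum_mat (\<rho> y) (\<rho>' y)"
      using a.carr b.carr
      by (simp add: a.mult b.mult mult_four_block_mat[OF a.carr zero_carrier_mat zero_carrier_mat b.carr
            a.carr zero_carrier_mat zero_carrier_mat b.carr]
            left_mult_zero_mat[OF a.carr] left_mult_zero_mat[OF b.carr] right_mult_zero_mat[OF a.carr] right_mult_zero_mat[OF b.carr]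
            right_add_zero_mat[OF mult_carrier_mat[OF a.carr a.carr]]
            left_add_zero_mat[OF mult_carrier_mat[OF b.carr b.carr]])
    show "dsum_mat (\<rho> (const c)) (\<rho>' (const c)) = c \<cdot>\<^sub>m 1\<^sub>m (N + N')"
      by (rule eq_matI) (auto simp: a.scal b.scal)
  qed
qed

lemma direct_sum_Nil: "direct_sum [] = \<lparr>mdim = 0, act = (\<lambda>h. 0\<^sub>m 0 0)\<rparr>"
  by (simp add: direct_sum_def)

lemma mdim_direct_sum: "mdim (direct_sum Ms) = sum_list (map mdim Ms)"
  by (simp add: direct_sum_def)

lemma act_direct_sum_Cons: "act (direct_sum (M # Ms)) h = dsum_mat (act M h) (act (direct_sum Ms) h)"
  by (simp add: direct_sum_def Let_def)

lemma gmat_direct_sum_Cons: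
  "gmat n q (direct_sum (M # Ms)) g = dsum_mat (gmat n q M g) (gmat n q (direct_sum Ms) g)"
  by (simp add: gmat_def act_direct_sum_Cons)

lemma is_module_direct_sum:
  assumes "\<And>M. M \<in> set Ms \<Longrightarrow> is_module n q M"
  shows "is_module n q (direct_sum Ms)"
  using assms
proof (induction Ms)
  case Nil
  have "alg_map 0 (\<lambda>x :: 'a free. 0\<^sub>m 0 0 :: 'a mat)" by unfold_locales auto
  thus ?case by (simp add: is_module_iff direct_sum_Nil)
next
  case (Cons M Ms)
  thus ?case
    using alg_map_dsum[of "mdim M" "\<lambda>x. act M (H_class n q x)" "mdim (direct_sum Ms)"
        "\<lambda>x. act (direct_sum Ms) (H_class n q x)"]
    by (simp add: is_module_iff act_direct_sum_Cons mdim_direct_sum)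
qed

lemma direct_sum_eqI:
  assumes "sum_list (map mdim Ms) = sum_list (map mdim Ns)"
    "\<And>h. diag_block_mat (map (\<lambda>M. act M h) Ms) = diag_block_mat (map (\<lambda>M. act M h) Ns)"
  shows "direct_sum Ms = direct_sum Ns"
  using assms by (simp add: direct_sum_def)

text \<open>An equality, not just an isomorphism: nested block diagonal matrices coincide with the
  flat one. The nested sum of the final statement can thus be replaced by a sum over one
  list.\<close>

lemma direct_sum_concat: "direct_sum (map direct_sum Mss) = direct_sum (concat Mss)"
proof (rule direct_sum_eqI)
  show "sum_list (map mdim (map direct_sum Mss)) = sum_list (map mdim (concat Mss))"
    by (induction Mss) (simp_all add: mdim_direct_sum)
  show "diag_block_mat (map (\<lambda>M. act M h) (map direct_sum Mss)) = diag_block_mat (map (\<lambda>M. act M h) (concat Mss))" for h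
    by (induction Mss) (simp_all add: direct_sum_def diag_block_mat_append Let_def)
qed

section \<open>Tensor products\<close>

lemma div_mod_lt:
  fixes i m n :: nat
  assumes "i < m * n"
  shows "i div n < m" "i mod n < n"
proof -
  have "n > 0" using assms by (cases n) auto
  thus "i mod n < n" by simp
  show "i div n < m" using assms by (simp add: less_mult_imp_div_less)
qed

lemma mult_add_lt: "i < m \<Longrightarrow> j < k \<Longrightarrow> i * k + j < m * (k::nat)"
  using mult_le_mono1[of "Suc i" m k] by simp

lemma kron_carrier: "A \<in> carrier_mat m m' \<Longrightarrow> B \<in> carrier_mat k k' \<Longrightarrow> kron A B \<in> carrier_mat (m * k) (m' * k')"
  by (auto simp: kron_def)

lemma index_kron:
  assumes "A \<in> carrier_mat m m'" "B \<in> carrier_mat k k'" "i < m * k" "j < m' * k'"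
  shows "kron A B $$ (i, j) = A $$ (i div k, j div k') * B $$ (i mod k, j mod k')"
  using assms by (auto simp: kron_def)

lemma sum_div_mod:
  fixes f :: "nat \<Rightarrow> nat \<Rightarrow> 'a::comm_monoid_add"
  shows "(\<Sum>x<m * k. f (x div k) (x mod k)) = (\<Sum>i<m. \<Sum>j<k. f i j)"
proof (cases "k = 0")
  case False
  have "(\<Sum>x<m * k. f (x div k) (x mod k)) = (\<Sum>(i, j)\<in>{..<m} \<times> {..<k}. f i j)"
    by (rule sum.reindex_bij_witness[where i = "\<lambda>(i, j). i * k + j" and j = "\<lambda>x. (x div k, x mod k)"])
       (use False in \<open>auto simp: div_mod_lt mult_add_lt\<close>)
  thus ?thesis by (simp add: sum.cartesian_product)
qed simp

lemma kron_mult: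
  fixes A B C D :: "'k::field mat"
  assumes A: "A \<in> carrier_mat m m'" and B: "B \<in> carrier_mat k k'"
    and C: "C \<in> carrier_mat m' m''" and D: "D \<in> carrier_mat k' k''"
  shows "kron A B * kron C D = kron (A * C) (B * D)"
proof (rule eq_matI)
  have AB: "kron A B \<in> carrier_mat (m * k) (m' * k')" and CD: "kron C D \<in> carrier_mat (m' * k') (m'' * k'')"
    using A B C D by (auto intro: kron_carrier)
  have AC: "A * C \<in> carrier_mat m m''" and BD: "B * D \<in> carrier_mat k k''"
    using A B C D by auto
  fix i j assume "i < dim_row (kron (A * C) (B * D))" "j < dim_col (kron (A * C) (B * D))"
  hence i: "i < m * k" and j: "j < m'' * k''" using A B C D by (auto simp: kron_def)
  note lt = div_mod_lt[OF i] div_mod_lt[OF j]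
  have "(kron A B * kron C D) $$ (i, j) = (\<Sum>x<m' * k'. kron A B $$ (i, x) * kron C D $$ (x, j))"
    using AB CD i j by (simp add: scalar_prod_def atLeast0LessThan)
  also have "\<dots> = (\<Sum>x<m' * k'. (A $$ (i div k, x div k') * C $$ (x div k', j div k'')) *
      (B $$ (i mod k, x mod k') * D $$ (x mod k', j mod k'')))"
    by (rule sum.cong) (use i j in \<open>simp_all add: index_kron[OF A B] index_kron[OF C D]\<close>)
  also have "\<dots> = (\<Sum>y<m'. A $$ (i div k, y) * C $$ (y, j div k'')) * (\<Sum>z<k'. B $$ (i mod k, z) * D $$ (z, j mod k''))"
    by (simp add: sum_div_mod[where f = "\<lambda>y z. (A $$ (i div k, y) * C $$ (y, j div k'')) * (B $$ (i mod k, z) * D $$ (z, j mod k''))"]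
        sum_product)
  also have "\<dots> = kron (A * C) (B * D) $$ (i, j)"
    using A B C D i j lt by (simp add: index_kron[OF AC BD] scalar_prod_def atLeast0LessThan)
  finally show "(kron A B * kron C D) $$ (i, j) = kron (A * C) (B * D) $$ (i, j)" .
qed (use A B C D in \<open>auto simp: kron_def\<close>)

lemma kron_one: "kron (1\<^sub>m m) (1\<^sub>m k) = (1\<^sub>m (m * k) :: 'k::field mat)"
proof (rule eq_matI)
  fix i j assume "i < dim_row (1\<^sub>m (m * k) :: 'k mat)" "j < dim_col (1\<^sub>m (m * k) :: 'k mat)"
  hence i: "i < m * k" and j: "j < m * k" by auto
  have "i div k = j div k \<and> i mod k = j mod k \<longleftrightarrow> i = j"
    by (metis div_mult_mod_eq)
  thus "kron (1\<^sub>m m) (1\<^sub>m k) $$ (i, j) = (1\<^sub>m (m * k) :: 'k mat) $$ (i, j)"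
    using div_mod_lt[OF i] div_mod_lt[OF j] i j by (auto simp: index_kron[OF one_carrier_mat one_carrier_mat])
qed (auto simp: kron_def)

lemma kron_add_left:
  assumes "A \<in> carrier_mat m m'" "A' \<in> carrier_mat m m'" "B \<in> carrier_mat k k'"
  shows "kron (A + A') B = kron A B + kron A' (B :: 'k::field mat)"
  by (rule eq_matI) (use assms in \<open>auto simp: kron_def distrib_right div_mod_lt\<close>)

lemma kron_add_right:
  assumes "A \<in> carrier_mat m m'" "B \<in> carrier_mat k k'" "B' \<in> carrier_mat k k'"
  shows "kron A (B + B') = kron A B + kron A (B' :: 'k::field mat)"
  by (rule eq_matI) (use assms in \<open>auto simp: kron_def distrib_left div_mod_lt\<close>)

lemma kron_smult_left:
  assumes "A \<in> carrier_mat m m'" "B \<in> carrier_mat k k'"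
  shows "kron (c \<cdot>\<^sub>m A) B = c \<cdot>\<^sub>m kron A (B :: 'k::field mat)"
  by (rule eq_matI) (use assms in \<open>auto simp: kron_def div_mod_lt\<close>)

lemma kron_smult_right:
  assumes "A \<in> carrier_mat m m'" "B \<in> carrier_mat k k'"
  shows "kron A (c \<cdot>\<^sub>m B) = c \<cdot>\<^sub>m kron A (B :: 'k::field mat)"
  by (rule eq_matI) (use assms in \<open>auto simp: kron_def div_mod_lt\<close>)

lemma kron_zero_left: "B \<in> carrier_mat k k' \<Longrightarrow> kron (0\<^sub>m m m') B = (0\<^sub>m (m * k) (m' * k') :: 'k::field mat)"
  by (rule eq_matI) (auto simp: kron_def div_mod_lt)

lemma kron_zero_right: "A \<in> carrier_mat m m' \<Longrightarrow> kron A (0\<^sub>m k k') = (0\<^sub>m (m * k) (m' * k') :: 'k::field mat)"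
  by (rule eq_matI) (auto simp: kron_def div_mod_lt)

subsection \<open>The algebra \<open>F \<otimes> F\<close>\<close>

lemma tens_add_left: "(x + y) \<otimes>\<^sub>F z = x \<otimes>\<^sub>F z + y \<otimes>\<^sub>F z"
  unfolding tens_def
  by (rule sum_keys_add) (simp_all add: distrib_right single_add sum.distrib)

lemma tens_add_right: "z \<otimes>\<^sub>F (x + y) = z \<otimes>\<^sub>F x + z \<otimes>\<^sub>F y"
proof -
  have "(\<Sum>v\<in>Poly_Mapping.keys (x + y). Poly_Mapping.single (u, v) (Poly_Mapping.lookup z u * Poly_Mapping.lookup (x + y) v)) =
    (\<Sum>v\<in>Poly_Mapping.keys x. Poly_Mapping.single (u, v) (Poly_Mapping.lookup z u * Poly_Mapping.lookup x v)) +
    (\<Sum>v\<in>Poly_Mapping.keys y. Poly_Mapping.single (u, v) (Poly_Mapping.lookup z u * Poly_Mapping.lookup y v))" for u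
    by (rule sum_keys_add[of "\<lambda>v c. Poly_Mapping.single (u, v) (Poly_Mapping.lookup z u * c)"])
       (simp_all add: distrib_left single_add)
  thus ?thesis unfolding tens_def by (simp add: sum.distrib)
qed

lemma tens_zero [simp]: "0 \<otimes>\<^sub>F y = 0" "x \<otimes>\<^sub>F 0 = 0"
  by (simp_all add: tens_def)

lemma tens_single:
  "Poly_Mapping.single u c \<otimes>\<^sub>F Poly_Mapping.single v d = Poly_Mapping.single (u, v) (c * d)"
  by (simp add: tens_def)

lemma tens_mult: "(x \<otimes>\<^sub>F y) * (x' \<otimes>\<^sub>F y') = (x * x') \<otimes>\<^sub>F (y * y')"
proof (induction x rule: poly_mapping_linear_induct)
  case (single u c)
  show ?case
  proof (induction y rule: poly_mapping_linear_induct)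
    case (single v d)
    show ?case
    proof (induction x' rule: poly_mapping_linear_induct)
      case (single u' c')
      show ?case
      proof (induction y' rule: poly_mapping_linear_induct)
        case (single v' d')
        show ?case by (simp add: tens_single mult_single mult.assoc mult.left_commute)
      qed (simp_all add: distrib_left tens_add_right)
    qed (simp_all add: distrib_left distrib_right tens_add_left)
  qed (simp_all add: distrib_left distrib_right tens_add_left tens_add_right)
qed (simp_all add: distrib_left distrib_right tens_add_left)

lemma const_tens: "const c \<otimes>\<^sub>F const d = const (c * d)"
  by (simp add: const_def tens_single zero_prod_def)

lemma one_tens_one: "1 \<otimes>\<^sub>F 1 = (1 :: 'k::field free2)"
  using const_tens[of "1::'k" 1] by simp

text \<open>\<open>inl\<close> and \<open>inr\<close> embed two commuting copies of F into F tensor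
  F; every pure tensor is a product of their values.\<close>

definition inl :: "'k::field free \<Rightarrow> 'k free2" where "inl x = x \<otimes>\<^sub>F 1"
definition inr :: "'k::field free \<Rightarrow> 'k free2" where "inr y = 1 \<otimes>\<^sub>F y"

lemma tens_inl_inr: "x \<otimes>\<^sub>F y = inl x * inr y"
  by (simp add: inl_def inr_def tens_mult)

lemma inr_inl: "inr y * inl x = inl x * inr y"
  by (simp add: inl_def inr_def tens_mult)

lemma inl_hom: "inl (x + y) = inl x + inl y" "inl (x * y) = inl x * inl y" "inl (const c) = const c"
    "inl 1 = 1" "inl 0 = 0"
  using const_tens[of c 1]
  by (simp_all add: inl_def tens_add_left tens_mult one_tens_one)

lemma inr_hom: "inr (x + y) = inr x + inr y" "inr (x * y) = inr x * inr y" "inr (const c) = const c"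
    "inr 1 = 1" "inr 0 = 0"
  using const_tens[of 1 c]
  by (simp_all add: inr_def tens_add_right tens_mult one_tens_one)

lemma inl_diff: "inl (x - y) = inl x - inl y"
  using inl_hom(1)[of "x - y" y] by (simp add: algebra_simps)

lemma inr_diff: "inr (x - y) = inr x - inr y"
  using inr_hom(1)[of "x - y" y] by (simp add: algebra_simps)

lemma inl_power: "inl (x ^ k) = inl x ^ k" by (induction k) (simp_all add: inl_hom)
lemma inr_power: "inr (x ^ k) = inr x ^ k" by (induction k) (simp_all add: inr_hom)

subsection \<open>The comultiplication\<close>

lemma comult_free_add: "comult_free (x + y) = comult_free x + comult_free y"
  unfolding comult_free_def
  by (rule sum_keys_add) (simp_all add: const_add distrib_right)

lemma comult_free_single:
  "comult_free (Poly_Mapping.single w c) = const c * prod_list (map comult_gen (letters w))"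
  by (simp add: comult_free_def)

lemma comult_free_0 [simp]: "comult_free 0 = 0"
  by (simp add: comult_free_def)

lemma comult_free_mult: "comult_free (x * y) = comult_free x * comult_free y"
proof (induction x rule: poly_mapping_linear_induct)
  case (single u c)
  show ?case
  proof (induction y rule: poly_mapping_linear_induct)
    case (single v d)
    show ?case
      by (simp add: mult_single comult_free_single plus_word_def const_mult mult.assoc)
         (metis const_central mult.assoc)
  qed (simp_all add: distrib_left comult_free_add)
qed (simp_all add: distrib_right comult_free_add)

lemma comult_free_const: "comult_free (const c) = const c"
  using comult_free_single[of 0 c] by (simp add: zero_word_def const_def)

lemma comult_free_gen: "comult_free (mon [g]) = comult_gen g"
  using comult_free_single[of "Word [g]" 1] by (simp add: mon_def)

lemma comult_free_1: "comult_free 1 = 1"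
  using comult_free_const[of 1] by simp

lemma comult_free_diff: "comult_free (x - y) = comult_free x - comult_free y"
  using comult_free_add[of "x - y" y] by (simp add: algebra_simps)

lemma comult_free_power: "comult_free (x ^ k) = comult_free x ^ k"
  by (induction k) (simp_all add: comult_free_1 comult_free_mult)

subsection \<open>The \<open>q\<close>-binomial theorem\<close>

text \<open>The Gaussian binomial coefficient, by a q-Pascal rule: the quotient formula would divide
  by zero at a root of unity.\<close>

fun qbinom :: "'k::field \<Rightarrow> nat \<Rightarrow> nat \<Rightarrow> 'k" where
  "qbinom q m 0 = 1"
| "qbinom q 0 (Suc k) = 0"
| "qbinom q (Suc m) (Suc k) = qbinom q m k + q ^ Suc k * qbinom q m (Suc k)"

abbreviation (input) qnum :: "'k::field \<Rightarrow> nat \<Rightarrow> 'k" where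
  "qnum q i \<equiv> \<Sum>j<i. q ^ j"

lemma qnum_Suc: "qnum q (Suc i) = 1 + q * qnum q i"
  by (simp only: sum.lessThan_Suc_shift sum_distrib_left power_Suc power_0)

lemma qbinom_eq_0: "m < k \<Longrightarrow> qbinom q m k = 0"
  by (induction q m k rule: qbinom.induct) auto

lemma qbinom_self: "qbinom q m m = 1"
  by (induction m) (simp_all add: qbinom_eq_0)

text \<open>Makes the coefficients strictly between 0 and n vanish at a primitive n-th root of
  unity: there (n)_q = 0 on the right, while (k)_q on the left is nonzero for 0 < k < n.\<close>

lemma qbinom_absorb: "qnum q (Suc k) * qbinom q (Suc m) (Suc k) = qnum q (Suc m) * qbinom q m k"
proof (induction m arbitrary: k)
  case 0
  show ?case by (cases k) auto
next
  case (Suc m)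
  show ?case
  proof (cases k)
    case 0
    have "qbinom q m' (Suc 0) = qnum q m'" for m'
      by (induction m') (simp_all del: sum.lessThan_Suc add: qnum_Suc)
    thus ?thesis using 0 by (simp del: sum.lessThan_Suc qbinom.simps(3))
  next
    case (Suc k')
    let ?b = "qbinom q (Suc m) (Suc k')"
    have "qnum q (Suc k) * qbinom q (Suc (Suc m)) (Suc k) =
       qnum q (Suc k) * ?b + q ^ Suc k * (qnum q (Suc k) * qbinom q (Suc m) (Suc k))"
      using Suc by (simp add: algebra_simps del: sum.lessThan_Suc)
    also have "qnum q (Suc k) * qbinom q (Suc m) (Suc k) = qnum q (Suc m) * qbinom q m k"
      by (rule Suc.IH)
    also have "qnum q (Suc k) * ?b = ?b + q * (qnum q (Suc k') * ?b)"
    proof -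
      have "qnum q (Suc k) = 1 + q * qnum q (Suc k')" using qnum_Suc[of q k] Suc by simp
      thus ?thesis by (simp only: distrib_right mult_1_left mult.assoc)
    qed
    also have "qnum q (Suc k') * ?b = qnum q (Suc m) * qbinom q m k'"
      by (rule Suc.IH)
    finally have "qnum q (Suc k) * qbinom q (Suc (Suc m)) (Suc k) =
      ?b + q * qnum q (Suc m) * (qbinom q m k' + q ^ k * qbinom q m k)"
      by (simp add: algebra_simps del: sum.lessThan_Suc qbinom.simps)
    also have "qbinom q m k' + q ^ k * qbinom q m k = ?b" using Suc by simp
    also have "?b + q * qnum q (Suc m) * ?b = qnum q (Suc (Suc m)) * ?b"
      unfolding qnum_Suc[of q "Suc m"] by (simp only: distrib_right mult_1_left)
    finally show ?thesis using Suc by simp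
  qed
qed

definition cong_mod :: "'a::ring_1 set \<Rightarrow> 'a \<Rightarrow> 'a \<Rightarrow> bool" where
  "cong_mod J x y \<longleftrightarrow> x - y \<in> J"

lemma cong_mod_refl: "two_sided J \<Longrightarrow> cong_mod J x x"
  by (simp add: cong_mod_def two_sidedD)

lemma cong_mod_trans: "two_sided J \<Longrightarrow> cong_mod J x y \<Longrightarrow> cong_mod J y z \<Longrightarrow> cong_mod J x z"
  unfolding cong_mod_def using two_sidedD(2)[of J "x - y" "y - z"] by simp

lemma cong_mod_add: "two_sided J \<Longrightarrow> cong_mod J x y \<Longrightarrow> cong_mod J x' y' \<Longrightarrow> cong_mod J (x + x') (y + y')"
  unfolding cong_mod_def using two_sidedD(2)[of J "x - y" "x' - y'"] by (simp add: algebra_simps)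

lemma cong_mod_mult:
  assumes "two_sided J" "cong_mod J x y" "cong_mod J x' y'"
  shows "cong_mod J (x * x') (y * y')"
proof -
  have "x * x' - y * y' = (x - y) * x' + y * (x' - y')" by (simp add: algebra_simps)
  thus ?thesis using two_sidedD(2-4)[OF assms(1)] assms(2,3) by (simp add: cong_mod_def)
qed

lemma cong_mod_sum: "two_sided J \<Longrightarrow> (\<And>i. i \<in> S \<Longrightarrow> cong_mod J (f i) (g i)) \<Longrightarrow> cong_mod J (sum f S) (sum g S)"
  by (induction S rule: infinite_finite_induct) (auto intro: cong_mod_add cong_mod_refl)

lemma q_commute_power:
  assumes J: "two_sided J" and yx: "cong_mod J (Y * X) (const q * X * Y)"
  shows "cong_mod J (Y * X ^ k) (const (q ^ k) * X ^ k * Y)"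
proof (induction k)
  case 0
  show ?case by (simp add: cong_mod_refl[OF J])
next
  case (Suc k)
  note [trans] = cong_mod_trans[OF J]
  have "cong_mod J (Y * X * X ^ k) (const q * X * Y * X ^ k)"
    by (intro cong_mod_mult[OF J] yx cong_mod_refl[OF J])
  moreover have "cong_mod J (const q * X * (Y * X ^ k)) (const q * X * (const (q ^ k) * X ^ k * Y))"
    by (intro cong_mod_mult[OF J] Suc cong_mod_refl[OF J])
  ultimately have "cong_mod J (Y * X ^ Suc k) (const q * X * (const (q ^ k) * X ^ k * Y))"
    using cong_mod_trans[OF J] by (simp add: mult.assoc)
  also have "const q * X * (const (q ^ k) * X ^ k * Y) = const (q ^ Suc k) * X ^ Suc k * Y"
    by (simp add: const_mult mult.assoc) (metis const_central mult.assoc)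
  finally show ?case .
qed

text \<open>A congruence rather than an identity, because X and Y, elements of a free monoid
  algebra, q-commute only modulo the ideal.\<close>

lemma q_binomial:
  fixes X Y :: "'m::monoid_add \<Rightarrow>\<^sub>0 'k::field"
  assumes J: "two_sided J" and yx: "cong_mod J (Y * X) (const q * X * Y)"
  shows "cong_mod J ((X + Y) ^ m) (\<Sum>k\<le>m. const (qbinom q m k) * X ^ k * Y ^ (m - k))"
proof (induction m)
  case 0
  show ?case by (simp add: cong_mod_refl[OF J])
next
  case (Suc m)
  note [trans] = cong_mod_trans[OF J]
  let ?t = "\<lambda>k. const (qbinom q m k) * X ^ k * Y ^ (m - k)"
  let ?u = "\<lambda>k. const (qbinom q m k) * X ^ Suc k * Y ^ (m - k)"
  let ?v = "\<lambda>k. const (q ^ k * qbinom q m k) * X ^ k * Y ^ (Suc m - k)"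
  have X: "X * ?t k = ?u k" for k
    by (simp add: mult.assoc) (metis const_central mult.assoc)
  have Y: "cong_mod J (Y * ?t k) (?v k)" if "k \<le> m" for k
  proof -
    have "Y * ?t k = const (qbinom q m k) * (Y * X ^ k) * Y ^ (m - k)"
      by (simp add: mult.assoc) (metis const_central mult.assoc)
    also have "cong_mod J \<dots> (const (qbinom q m k) * (const (q ^ k) * X ^ k * Y) * Y ^ (m - k))"
      by (intro cong_mod_mult[OF J] q_commute_power[OF J yx] cong_mod_refl[OF J])
    also have "const (qbinom q m k) * (const (q ^ k) * X ^ k * Y) * Y ^ (m - k) = ?v k"
      using that by (simp add: Suc_diff_le const_mult mult.assoc) (metis const_central mult.assoc)
    finally show ?thesis .
  qed
  have "cong_mod J ((X + Y) ^ Suc m) ((X + Y) * (\<Sum>k\<le>m. ?t k))"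
    using cong_mod_mult[OF J cong_mod_refl[OF J] Suc] by simp
  also have "(X + Y) * (\<Sum>k\<le>m. ?t k) = (\<Sum>k\<le>m. ?u k) + (\<Sum>k\<le>m. Y * ?t k)"
    by (simp add: distrib_right sum_distrib_left X)
  also have "cong_mod J \<dots> ((\<Sum>k\<le>m. ?u k) + (\<Sum>k\<le>m. ?v k))"
    by (intro cong_mod_add[OF J] cong_mod_sum[OF J] Y cong_mod_refl[OF J]) auto
  also have "(\<Sum>k\<le>m. ?u k) + (\<Sum>k\<le>m. ?v k) = (\<Sum>k\<le>Suc m. const (qbinom q (Suc m) k) * X ^ k * Y ^ (Suc m - k))"
  proof -
    have "(\<Sum>k\<le>Suc m. ?v k) = ?v 0 + (\<Sum>k\<le>m. ?v (Suc k))" by (rule sum.atMost_Suc_shift)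
    moreover have "(\<Sum>k\<le>Suc m. ?v k) = (\<Sum>k\<le>m. ?v k)" by (simp add: qbinom_eq_0)
    ultimately have "(\<Sum>k\<le>m. ?u k) + (\<Sum>k\<le>m. ?v k) = ?v 0 + (\<Sum>k\<le>m. ?u k + ?v (Suc k))"
      by (simp add: sum.distrib algebra_simps)
    also have "(\<Sum>k\<le>m. ?u k + ?v (Suc k)) = (\<Sum>k\<le>m. const (qbinom q (Suc m) (Suc k)) * X ^ Suc k * Y ^ (Suc m - Suc k))"
      by (intro sum.cong refl) (simp add: const_add distrib_right)
    also have "?v 0 + \<dots> = (\<Sum>k\<le>Suc m. const (qbinom q (Suc m) k) * X ^ k * Y ^ (Suc m - k))"
      unfolding sum.atMost_Suc_shift by simp
    finally show ?thesis .
  qed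
  finally show ?case .
qed

lemma primitive_rootD:
  assumes "is_primitive_root n q" 
  shows "q ^ n = 1" "0 < m \<Longrightarrow> m < n \<Longrightarrow> q ^ m \<noteq> 1"
  using assms by (auto simp: is_primitive_root_def)

lemma qnum_geometric: "(1 - q) * qnum q i = 1 - (q::'k::field) ^ i"
  using one_diff_power_eq[of q i] by simp

text \<open>Needed for the n-th powers of Delta(a) and Delta(d), each of which is a sum of two
  q-commuting terms.\<close>

lemma q_freshman:
  fixes X Y :: "'m::monoid_add \<Rightarrow>\<^sub>0 'k::field"
  assumes J: "two_sided J" and yx: "cong_mod J (Y * X) (const q * X * Y)"
    and n: "1 < n" and q: "is_primitive_root n q"
  shows "cong_mod J ((X + Y) ^ n) (X ^ n + Y ^ n)"
proof -
  have q1: "q \<noteq> 1" using primitive_rootD(2)[OF q, of 1] n by simp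
  have "qbinom q n k = 0" if k: "0 < k" "k < n" for k
  proof -
    obtain k' m' where k': "k = Suc k'" "n = Suc m'" using k by (cases k; cases n) auto
    have "qnum q n = 0" using qnum_geometric[of q n] primitive_rootD(1)[OF q] q1 by simp
    moreover have "qnum q k \<noteq> 0" using qnum_geometric[of q k] primitive_rootD(2)[OF q k] by auto
    ultimately show ?thesis using qbinom_absorb[of q k' m'] unfolding k' by (simp del: sum.lessThan_Suc qbinom.simps)
  qed
  hence "(\<Sum>k\<le>n. const (qbinom q n k) * X ^ k * Y ^ (n - k)) =
    (\<Sum>k\<in>{0, n}. const (qbinom q n k) * X ^ k * Y ^ (n - k))"
    by (intro sum.mono_neutral_right) auto
  also have "\<dots> = X ^ n + Y ^ n" using n by (simp add: qbinom_self)
  finally show ?thesis using q_binomial[OF J yx, of n] by simp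
qed

text \<open>This is the well-definedness of the comultiplication on \<open>H\<close>. The elements
  sent into \<open>HH_ideal\<close> form a two-sided ideal, so only the relators have to be
  checked.\<close>

lemma comult_free_H_ideal:
  fixes q :: "'k::field"
  assumes n: "1 < n" and q: "is_primitive_root n q" and x: "x \<in> H_ideal n q"
  shows "comult_free x \<in> HH_ideal n q"
proof -
  let ?J = "HH_ideal n q"
  have J: "two_sided ?J" by (rule two_sided_HH)
  have "two_sided {x. comult_free x \<in> ?J}"
    unfolding two_sided_def using two_sidedD[OF J]
    by (auto simp: comult_free_add comult_free_mult)
  moreover have "relators n q \<subseteq> {x. comult_free x \<in> ?J}"
  proof -
    \<comment> \<open>The two copies of the generators are kept opaque. With the rules
      \<open>com\<close> and \<open>Qc\<close> the simplifier then moves scalars and letters of the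
      first factor to the left.\<close>
    define A1 A2 B1 B2 where ab: "A1 = inl (mon [Ga] :: 'k free)" "A2 = inr (mon [Ga] :: 'k free)"
      "B1 = inl (mon [Gb] :: 'k free)" "B2 = inr (mon [Gb] :: 'k free)"
    define C1 C2 D1 D2 where cd: "C1 = inl (mon [Gc] :: 'k free)" "C2 = inr (mon [Gc] :: 'k free)"
      "D1 = inl (mon [Gd] :: 'k free)" "D2 = inr (mon [Gd] :: 'k free)"
    define Q where "Q = (const q :: 'k free2)"
    have com: "Y * X = X * Y" "Y * (X * Z) = X * (Y * Z)"
      if "X \<in> {A1, B1, C1, D1}" "Y \<in> {A2, B2, C2, D2}" for X Y Z
    proof -
      show 1: "Y * X = X * Y" using that by (auto simp: ab cd inr_inl)
      show "Y * (X * Z) = X * (Y * Z)" using 1 by (metis mult.assoc)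
    qed
    note com = com[of A1 A2] com[of A1 B2] com[of A1 C2] com[of A1 D2]
      com[of B1 A2] com[of B1 B2] com[of B1 C2] com[of B1 D2]
      com[of C1 A2] com[of C1 B2] com[of C1 C2] com[of C1 D2]
      com[of D1 A2] com[of D1 B2] com[of D1 C2] com[of D1 D2]
    have Qc: "X * Q = Q * X" "X * (Q * Z) = Q * (X * Z)" for X Z
    proof -
      show "X * Q = Q * X" unfolding Q_def by (rule const_central[symmetric])
      thus "X * (Q * Z) = Q * (X * Z)" by (simp add: mult.assoc[symmetric])
    qed
    note Qc = Qc[of A1] Qc[of A2] Qc[of B1] Qc[of B2] Qc[of C1] Qc[of C2] Qc[of D1] Qc[of D2]
    have inJ: "inl x \<in> ?J" "inr x \<in> ?J" if "x \<in> relators n q" for x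
    proof -
      have "x \<in> H_ideal n q" unfolding H_ideal_def by (rule Idl_superset[OF that])
      thus "inl x \<in> ?J" "inr x \<in> ?J"
        unfolding HH_ideal_def inl_def inr_def by (auto intro!: Idl_superset)
    qed
    have rel: "B1 * A1 - Q * A1 * B1 \<in> ?J" "D1 * B1 - Q * B1 * D1 \<in> ?J" "C1 * A1 - Q * A1 * C1 \<in> ?J"
      "D1 * C1 - Q * C1 * D1 \<in> ?J" "B1 * C1 - C1 * B1 \<in> ?J" "A1 ^ n \<in> ?J" "B1 ^ n - 1 \<in> ?J"
      "C1 ^ n - 1 \<in> ?J" "D1 ^ n \<in> ?J" "D1 * A1 - Q * A1 * D1 - (1 - B1 * C1) \<in> ?J"
      "B2 * A2 - Q * A2 * B2 \<in> ?J" "D2 * B2 - Q * B2 * D2 \<in> ?J" "C2 * A2 - Q * A2 * C2 \<in> ?J"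
      "D2 * C2 - Q * C2 * D2 \<in> ?J" "B2 * C2 - C2 * B2 \<in> ?J" "A2 ^ n \<in> ?J" "B2 ^ n - 1 \<in> ?J"
      "C2 ^ n - 1 \<in> ?J" "D2 ^ n \<in> ?J" "D2 * A2 - Q * A2 * D2 - (1 - B2 * C2) \<in> ?J"
    proof -
      have "\<forall>x\<in>relators n q. inl x \<in> ?J \<and> inr x \<in> ?J" using inJ by blast
      thus "B1 * A1 - Q * A1 * B1 \<in> ?J" "D1 * B1 - Q * B1 * D1 \<in> ?J" "C1 * A1 - Q * A1 * C1 \<in> ?J"
        "D1 * C1 - Q * C1 * D1 \<in> ?J" "B1 * C1 - C1 * B1 \<in> ?J" "A1 ^ n \<in> ?J" "B1 ^ n - 1 \<in> ?J"
        "C1 ^ n - 1 \<in> ?J" "D1 ^ n \<in> ?J" "D1 * A1 - Q * A1 * D1 - (1 - B1 * C1) \<in> ?J"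
        "B2 * A2 - Q * A2 * B2 \<in> ?J" "D2 * B2 - Q * B2 * D2 \<in> ?J" "C2 * A2 - Q * A2 * C2 \<in> ?J"
        "D2 * C2 - Q * C2 * D2 \<in> ?J" "B2 * C2 - C2 * B2 \<in> ?J" "A2 ^ n \<in> ?J" "B2 ^ n - 1 \<in> ?J"
        "C2 ^ n - 1 \<in> ?J" "D2 ^ n \<in> ?J" "D2 * A2 - Q * A2 * D2 - (1 - B2 * C2) \<in> ?J"
        by (simp_all add: relators_def Let_def ab cd Q_def inl_diff inr_diff inl_hom inr_hom inl_power inr_power)
    qed
    note lin = two_sidedD(2)[OF J] two_sided_diff[OF J] two_sidedD(3)[OF J] two_sidedD(4)[OF J]
    have D: "comult_gen Ga = A1 * B2 + A2" "comult_gen Gb = B1 * B2" "comult_gen Gc = C1 * C2"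
      "comult_gen Gd = D1 * C2 + D2"
      by (simp_all add: ab cd tens_inl_inr inl_hom)
    have pow: "(X * Y) ^ k = X ^ k * Y ^ k" if "Y * X = X * Y" for X Y :: "'k free2" and k
    proof (induction k)
      case (Suc k)
      have "Y * X ^ k = X ^ k * Y" using power_commuting_commutes[of X Y k] that by simp
      moreover have "(X * Y) ^ Suc k = X * (Y * X ^ k) * Y ^ k" using Suc by (simp add: mult.assoc)
      ultimately show ?case by (simp add: mult.assoc)
    qed simp
    let ?A = "A1 * B2 + A2" and ?B = "B1 * B2" and ?C = "C1 * C2" and ?D = "D1 * C2 + D2"
    \<comment> \<open>Each image is a combination of relators that live in a single tensor factor.
      In \<open>2\<close>, \<open>3\<close> and \<open>6\<close> the letters B2 and C2 meet in
      opposite orders, which costs a term with their commutator.\<close>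
    have 1: "?B * ?A - Q * ?A * ?B = (B1 * A1 - Q * A1 * B1) * (B2 * B2) + B1 * (B2 * A2 - Q * A2 * B2)"
      by (simp add: algebra_simps com Qc)
    have 2: "?D * ?B - Q * ?B * ?D = (D1 * B1 - Q * B1 * D1) * (C2 * B2) - Q * B1 * D1 * (B2 * C2 - C2 * B2)
        + B1 * (D2 * B2 - Q * B2 * D2)"
      by (simp add: algebra_simps com Qc)
    have 3: "?C * ?A - Q * ?A * ?C = (C1 * A1 - Q * A1 * C1) * (C2 * B2) - Q * A1 * C1 * (B2 * C2 - C2 * B2)
        + C1 * (C2 * A2 - Q * A2 * C2)"
      by (simp add: algebra_simps com Qc)
    have 4: "?D * ?C - Q * ?C * ?D = (D1 * C1 - Q * C1 * D1) * (C2 * C2) + C1 * (D2 * C2 - Q * C2 * D2)"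
      by (simp add: algebra_simps com Qc)
    have 5: "?B * ?C - ?C * ?B = (B1 * C1 - C1 * B1) * (B2 * C2) + C1 * B1 * (B2 * C2 - C2 * B2)"
      by (simp add: algebra_simps com Qc)
    have 6: "?D * ?A - Q * ?A * ?D - (1 - ?B * ?C) =
        (D1 * A1 - Q * A1 * D1 - (1 - B1 * C1)) * (B2 * C2) - D1 * A1 * (B2 * C2 - C2 * B2)
        + D1 * (C2 * A2 - Q * A2 * C2) + A1 * (D2 * B2 - Q * B2 * D2) + (D2 * A2 - Q * A2 * D2 - (1 - B2 * C2))"
      by (simp add: algebra_simps com Qc)
    have 7: "(X * Y) ^ n - 1 = (X ^ n - 1) * Y ^ n + (Y ^ n - 1)" if "Y * X = X * Y" for X Y :: "'k free2"
      by (simp add: pow[OF that] algebra_simps)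
    have 8: "?A ^ n \<in> ?J"
    proof -
      \<comment> \<open>The order of the summands matters: it is A1 B2 that q-commutes past A2. For
        d the roles are reversed, and D2 is moved past D1 C2.\<close>
      have "(A1 * B2) * A2 - Q * A2 * (A1 * B2) = A1 * (B2 * A2 - Q * A2 * B2)"
        by (simp add: algebra_simps com Qc)
      hence "cong_mod ?J (A1 * B2 * A2) (const q * A2 * (A1 * B2))"
        using rel lin by (simp add: cong_mod_def Q_def)
      from q_freshman[OF J this n q] have "?A ^ n - (A2 ^ n + A1 ^ n * B2 ^ n) \<in> ?J"
        using pow[OF com(3)] by (simp add: cong_mod_def add.commute)
      from lin(1)[OF this, of "A2 ^ n + A1 ^ n * B2 ^ n"] show ?thesis using rel lin by simp
    qed
    have 9: "?D ^ n \<in> ?J"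
    proof -
      have "D2 * (D1 * C2) - Q * (D1 * C2) * D2 = D1 * (D2 * C2 - Q * C2 * D2)"
        by (simp add: algebra_simps com Qc)
      hence "cong_mod ?J (D2 * (D1 * C2)) (const q * (D1 * C2) * D2)"
        using rel lin by (simp add: cong_mod_def Q_def)
      from q_freshman[OF J this n q] have "?D ^ n - (D1 ^ n * C2 ^ n + D2 ^ n) \<in> ?J"
        using pow[of C2 D1] com by (simp add: cong_mod_def)
      from lin(1)[OF this, of "D1 ^ n * C2 ^ n + D2 ^ n"] show ?thesis using rel lin by simp
    qed
    have "?B * ?A - Q * ?A * ?B \<in> ?J" unfolding 1 by (intro lin rel)
    moreover have "?D * ?B - Q * ?B * ?D \<in> ?J" unfolding 2 by (intro lin rel)
    moreover have "?C * ?A - Q * ?A * ?C \<in> ?J" unfolding 3 by (intro lin rel)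
    moreover have "?D * ?C - Q * ?C * ?D \<in> ?J" unfolding 4 by (intro lin rel)
    moreover have "?B * ?C - ?C * ?B \<in> ?J" unfolding 5 by (intro lin rel)
    moreover have "?D * ?A - Q * ?A * ?D - (1 - ?B * ?C) \<in> ?J" unfolding 6 by (intro lin rel)
    moreover have "?B ^ n - 1 \<in> ?J" by (subst 7) (simp add: com, intro lin rel)
    moreover have "?C ^ n - 1 \<in> ?J" by (subst 7) (simp add: com, intro lin rel)
    ultimately show ?thesis using 8 9
      by (simp add: relators_def Let_def comult_free_diff comult_free_mult comult_free_power comult_free_gen D
          comult_free_const comult_free_1 Q_def del: comult_gen.simps)
  qed
  ultimately show ?thesis
    using Idl_least[of "{x. comult_free x \<in> ?J}" "relators n q"] x by (auto simp: H_ideal_def)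
qed

section \<open>The action on a tensor product of two modules\<close>

lemma act2_eq:
  "act2 n q M N = lin_ext_mat (mdim M * mdim N)
     (\<lambda>(u, v). kron (act M (H_class n q (Poly_Mapping.single u 1))) (act N (H_class n q (Poly_Mapping.single v 1))))"
  by (rule ext) (simp add: act2_def lin_ext_mat_def case_prod_unfold)

context
  fixes n :: nat and q :: "'k::field" and M N :: "'k fdmod"
  assumes M: "is_module n q M" and N: "is_module n q N"
begin

interpretation M: alg_map "mdim M" "\<lambda>x. act M (H_class n q x)" using M by (simp add: is_module_iff)
interpretation N: alg_map "mdim N" "\<lambda>x. act N (H_class n q x)" using N by (simp add: is_module_iff)

lemma alg_map_act2: "alg_map (mdim M * mdim N) (act2 n q M N)"
proof -
  let ?\<phi> = "\<lambda>(u, v). kron (act M (H_class n q (Poly_Mapping.single u 1))) (act N (H_class n q (Poly_Mapping.single v 1)))"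
  have s: "Poly_Mapping.single (u + v) (1 :: 'k) = Poly_Mapping.single u 1 * Poly_Mapping.single v 1" for u v :: word
    by (simp add: mult_single)
  have c: "?\<phi> w \<in> carrier_mat (mdim M * mdim N) (mdim M * mdim N)" for w
    by (simp add: case_prod_unfold kron_carrier[OF M.carr N.carr])
  have m: "?\<phi> (w + w') = ?\<phi> w * ?\<phi> w'" for w w'
    by (simp add: case_prod_unfold s M.mult N.mult kron_mult[OF M.carr N.carr M.carr N.carr])
  have o: "?\<phi> 0 = 1\<^sub>m (mdim M * mdim N)"
    by (simp add: case_prod_unfold M.one N.one kron_one)
  show ?thesis unfolding act2_eq
    by unfold_locales (simp_all add: lin_ext_mat_add lin_ext_mat_const[of ?\<phi>, OF o] lin_ext_mat_mult[of ?\<phi>, OF c m])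
qed

interpretation T: alg_map "mdim M * mdim N" "act2 n q M N" by (rule alg_map_act2)

lemma act2_tens: "act2 n q M N (x \<otimes>\<^sub>F y) = kron (act M (H_class n q x)) (act N (H_class n q y))"
proof (induction x rule: poly_mapping_linear_induct)
  case zero
  show ?case by (simp add: T.zero M.zero kron_zero_left[OF N.carr])
next
  case (single u c)
  show ?case
  proof (induction y rule: poly_mapping_linear_induct)
    case zero
    show ?case by (simp add: T.zero N.zero kron_zero_right[OF M.carr])
  next
    case (single v d)
    have s: "Poly_Mapping.single w e = const e * Poly_Mapping.single w 1" for w :: word and e :: 'k
      by (simp add: const_mult_single)
    have "act2 n q M N (Poly_Mapping.single (u, v) (c * d)) =
      (c * d) \<cdot>\<^sub>m kron (act M (H_class n q (Poly_Mapping.single u 1))) (act N (H_class n q (Poly_Mapping.single v 1)))"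
      unfolding act2_eq by (subst lin_ext_mat_single) (simp_all add: kron_carrier[OF M.carr N.carr])
    also have "\<dots> = kron (act M (H_class n q (Poly_Mapping.single u c))) (act N (H_class n q (Poly_Mapping.single v d)))"
      by (subst s[of u c], subst s[of v d])
         (simp add: M.scale N.scale kron_smult_left[OF M.carr smult_carrier_mat[OF N.carr]]
           kron_smult_right[OF M.carr N.carr] smult_smult_mat)
    finally show ?case by (simp add: tens_single)
  next
    case (add x y)
    thus ?case by (simp add: tens_add_right T.add N.add kron_add_right[OF M.carr N.carr N.carr])
  qed
next
  case (add x x')
  thus ?case by (simp add: tens_add_left T.add M.add kron_add_left[OF M.carr M.carr N.carr])
qed

lemma act2_kills:
  assumes "z \<in> HH_ideal n q"
  shows "act2 n q M N z = 0\<^sub>m (mdim M * mdim N) (mdim M * mdim N)"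
proof -
  have H: "H_class n q x = H_class n q 0" if "x \<in> H_ideal n q" for x
    using that by (simp add: H_class_eq_iff)
  show ?thesis
    using assms unfolding HH_ideal_def
    by (rule T.kills_Idl[rotated])
       (auto simp: act2_tens H M.zero N.zero kron_zero_left[OF N.carr] kron_zero_right[OF M.carr])
qed

lemma act2_cong:
  assumes "HH_class n q z = HH_class n q z'"
  shows "act2 n q M N z = act2 n q M N z'"
  using act2_kills[of "z - z'"] assms by (simp add: HH_class_eq_iff T.diff_eq_0_iff)

lemma mdim_tensor [simp]: "mdim (tensor n q M N) = mdim M * mdim N"
  by (simp add: tensor_def)

context
  assumes n: "1 < n" and q: "is_primitive_root n q"
begin

lemma act_tensor: "act (tensor n q M N) (H_class n q x) = act2 n q M N (comult_free x)"
proof -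
  have "comult n q (H_class n q x) = HH_class n q (comult_free x)"
    unfolding comult_def
  proof (rule the_elem_image_coset)
    fix y assume "y \<in> H_class n q x"
    hence "comult_free (y - x) \<in> HH_ideal n q"
      by (intro comult_free_H_ideal[OF n q]) (simp add: mem_H_class)
    thus "HH_class n q (comult_free y) = HH_class n q (comult_free x)"
      by (simp add: HH_class_eq_iff comult_free_diff)
  qed (simp add: mem_H_class two_sidedD(1)[OF two_sided_H])
  moreover have "the_elem (act2 n q M N ` HH_class n q z) = act2 n q M N z" for z
  proof (rule the_elem_image_coset)
    fix y assume "y \<in> HH_class n q z"
    hence "HH_class n q y = HH_class n q z" by (simp add: mem_HH_class HH_class_eq_iff)
    thus "act2 n q M N y = act2 n q M N z" by (rule act2_cong)
  qed (simp add: mem_HH_class two_sidedD(1)[OF two_sided_HH])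
  ultimately show ?thesis by (simp add: tensor_def)
qed

lemma is_module_tensor: "is_module n q (tensor n q M N)"
  unfolding is_module_iff mdim_tensor act_tensor
  by unfold_locales (simp_all add: T.carr T.add T.mult T.scal comult_free_add comult_free_mult comult_free_const)

lemma gmat_tensor:
  "gmat n q (tensor n q M N) Ga = kron (gmat n q M Ga) (gmat n q N Gb) + kron (1\<^sub>m (mdim M)) (gmat n q N Ga)"
  "gmat n q (tensor n q M N) Gb = kron (gmat n q M Gb) (gmat n q N Gb)"
  "gmat n q (tensor n q M N) Gc = kron (gmat n q M Gc) (gmat n q N Gc)"
  "gmat n q (tensor n q M N) Gd = kron (gmat n q M Gd) (gmat n q N Gc) + kron (1\<^sub>m (mdim M)) (gmat n q N Gd)"
  by (simp_all add: gmat_def act_tensor comult_free_gen T.add act2_tens M.one)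

end

end

section \<open>Representations by operators\<close>

locale vec_op = vector_space scale
  for scale :: "'k::field \<Rightarrow> 'v::ab_group_add \<Rightarrow> 'v" (infixr \<open>*s\<close> 75) +
  fixes T :: "'v \<Rightarrow> 'v"
  assumes add: "T (x + y) = T x + T y" and scale: "T (r *s x) = r *s T x"
begin

lemma zero [simp]: "T 0 = 0"
  using scale[of 0 0] by simp

lemma uminus: "T (- x) = - T x"
  using add[of x "- x"] by (simp add: eq_neg_iff_add_eq_0 add.commute)

lemma diff: "T (x - y) = T x - T y"
  using add[of x "- y"] by (simp add: uminus)

lemma sum: "T (sum f S) = (\<Sum>i\<in>S. T (f i))"
  by (induction S rule: infinite_finite_induct) (simp_all add: add)

lemma funpow_add: "(T ^^ k) (x + y) = (T ^^ k) x + (T ^^ k) y"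
  by (induction k) (simp_all add: add)

lemma funpow_scale: "(T ^^ k) (r *s x) = r *s (T ^^ k) x"
  by (induction k) (simp_all add: scale)

lemma funpow_zero [simp]: "(T ^^ k) 0 = 0"
  by (induction k) simp_all

lemma funpow_diff: "(T ^^ k) (x - y) = (T ^^ k) x - (T ^^ k) y"
  by (induction k) (simp_all add: diff)

lemma funpow_mono_zero: "(T ^^ k) x = 0 \<Longrightarrow> k \<le> j \<Longrightarrow> (T ^^ j) x = 0"
  using funpow_add[of "j - k" 0 0] by (metis comp_apply funpow_zero le_add_diff_inverse2 Nat.funpow_add)

text \<open>The vector p(T) x, evaluated by Horner's scheme.\<close>

definition poly_app :: "'k poly \<Rightarrow> 'v \<Rightarrow> 'v" where
  "poly_app p = fold_coeffs (\<lambda>r f x. r *s x + T (f x)) p (\<lambda>x. 0)"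

lemma poly_app_0 [simp]: "poly_app 0 x = 0"
  by (simp add: poly_app_def)

lemma poly_app_pCons: "poly_app (pCons r p) x = r *s x + T (poly_app p x)"
proof (cases "p = 0 \<and> r = 0")
  case False
  hence "poly_app (pCons r p) = (\<lambda>x. r *s x + T (poly_app p x))"
    by (cases "p = 0")
       (simp_all add: poly_app_def fold_coeffs_pCons_coeff_not_0_eq fold_coeffs_pCons_not_0_0_eq)
  thus ?thesis by simp
qed simp

lemma poly_app_add: "poly_app (p + p') x = poly_app p x + poly_app p' x"
  by (induction p p' rule: poly_induct2) (simp_all add: poly_app_pCons add scale_left_distrib)

lemma poly_app_smult: "poly_app (Polynomial.smult r p) x = r *s poly_app p x"
  by (induction p) (simp_all add: poly_app_pCons scale scale_right_distrib)

lemma poly_app_mult: "poly_app (p * p') x = poly_app p (poly_app p' x)"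
  by (induction p) (simp_all add: poly_app_pCons poly_app_add poly_app_smult)

lemma poly_app_T: "poly_app p (T x) = T (poly_app p x)"
  by (induction p) (simp_all add: poly_app_pCons add scale)

lemma poly_app_zero [simp]: "poly_app p 0 = 0"
  by (induction p) (simp_all add: poly_app_pCons)

lemma poly_app_1 [simp]: "poly_app 1 x = x"
  by (simp add: one_pCons poly_app_pCons)

lemma poly_app_scale: "poly_app p (r *s x) = r *s poly_app p x"
  by (induction p) (simp_all add: poly_app_pCons scale scale_right_distrib mult.commute)

lemma poly_app_intertwine:
  assumes "\<And>x y. F (x + y) = F x + F y" "\<And>r x. F (r *s x) = r *s F x" "F 0 = 0"
    and "\<And>x. F (T x) = S (F x)" "vec_op scale S"
  shows "F (poly_app p x) = vec_op.poly_app scale S p (F x)"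
proof -
  interpret S: vec_op scale S by fact
  show ?thesis by (induction p) (simp_all add: assms poly_app_pCons S.poly_app_pCons)
qed

text \<open>The projection onto the eigenspace for \<open>\<beta>\<close> of an operator with \<open>T ^^ n = id\<close>.\<close>

definition eproj :: "nat \<Rightarrow> 'k \<Rightarrow> 'v \<Rightarrow> 'v" where
  "eproj n \<beta> x = (1 / of_nat n) *s (\<Sum>k<n. (1 / \<beta> ^ k) *s (T ^^ k) x)"

text \<open>Applying T shifts the summation index and produces the factor beta; the two end terms
  agree because T^n is the identity and beta^n = 1.\<close>

lemma eproj_eigen:
  assumes n: "\<And>x. (T ^^ n) x = x" and \<beta>: "\<beta> ^ n = 1" "n > 0"
  shows "T (eproj n \<beta> x) = \<beta> *s eproj n \<beta> x"
proof -
  have [simp]: "\<beta> \<noteq> 0" using \<beta> by (auto simp: zero_power)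
  let ?g = "\<lambda>k. (1 / \<beta> ^ k) *s (T ^^ k) x"
  have "T (\<Sum>k<n. ?g k) = (\<Sum>k<n. \<beta> *s ?g (Suc k))"
    by (simp add: sum scale)
  also have "\<dots> = \<beta> *s (\<Sum>k<n. ?g (Suc k))" by (simp add: scale_sum_right)
  also have "(\<Sum>k<n. ?g (Suc k)) = (\<Sum>k<n. ?g k)"
    using sum.lessThan_Suc_shift[of ?g n] sum.lessThan_Suc[of ?g n] n \<beta> by simp
  finally show ?thesis by (simp add: eproj_def scale mult.commute)
qed

lemma eproj_fix:
  assumes "T x = \<beta> *s x" "\<beta> \<noteq> 0" "of_nat n \<noteq> (0::'k)"
  shows "eproj n \<beta> x = x"
proof -
  have "(T ^^ k) x = \<beta> ^ k *s x" for k by (induction k) (simp_all add: assms scale)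
  hence "eproj n \<beta> x = (1 / of_nat n) *s (\<Sum>k<n. x)" using assms(2) by (simp add: eproj_def)
  thus ?thesis using assms(3) by (simp add: sum_constant_scale)
qed

lemma eproj_intertwine:
  assumes "\<And>x y. F (x + y) = F x + F y" "\<And>r x. F (r *s x) = r *s F x" "F 0 = 0"
    and "\<And>x. F (T x) = S (F x)" "vec_op scale S"
  shows "F (eproj n \<beta> x) = vec_op.eproj scale S n \<beta> (F x)"
proof -
  interpret S: vec_op scale S by fact
  have Fs: "F (sum f A) = (\<Sum>i\<in>A. F (f i))" for f and A :: "nat set"
    by (induction A rule: infinite_finite_induct) (simp_all add: assms)
  have "F ((T ^^ k) x) = (S ^^ k) (F x)" for k by (induction k) (simp_all add: assms)
  thus ?thesis by (simp add: eproj_def S.eproj_def assms Fs)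
qed

lemma eproj_commute:
  assumes "vec_op scale S" "\<And>x. S (T x) = T (S x)"
  shows "S (eproj n \<beta> x) = eproj n \<beta> (S x)"
proof -
  interpret S: vec_op scale S by fact
  show ?thesis using eproj_intertwine[of S T n \<beta> x] assms(2) by (simp add: S.add S.scale vec_op_axioms)
qed

text \<open>The coordinates with respect to a weight basis are functionals of this kind. This lemma
  and the next one say which coordinates survive the projection.\<close>

lemma eproj_functional:
  fixes \<xi> :: "'v \<Rightarrow> 'k"
  assumes \<xi>: "\<And>x y. \<xi> (x + y) = \<xi> x + \<xi> y" "\<And>r x. \<xi> (r *s x) = r * \<xi> x"
    and "\<And>x. \<xi> (T x) = \<beta> * \<xi> x" "\<beta> \<noteq> 0" "of_nat n \<noteq> (0::'k)"
  shows "\<xi> (eproj n \<beta> x) = \<xi> x"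
proof -
  have "\<xi> 0 = 0" using \<xi>(2)[of 0 0] by simp
  hence Fs: "\<xi> (sum f A) = (\<Sum>i\<in>A. \<xi> (f i))" for f and A :: "nat set"
    by (induction A rule: infinite_finite_induct) (simp_all add: \<xi>)
  have "\<xi> ((T ^^ k) x) = \<beta> ^ k * \<xi> x" for k by (induction k) (simp_all add: assms)
  thus ?thesis using assms(4,5) by (simp add: eproj_def \<xi> Fs)
qed

text \<open>The value is a multiple of the geometric sum of the powers of tau/beta, a nontrivial
  n-th root of unity, and this sum is zero.\<close>

lemma eproj_functional_0:
  fixes \<xi> :: "'v \<Rightarrow> 'k"
  assumes \<xi>: "\<And>x y. \<xi> (x + y) = \<xi> x + \<xi> y" "\<And>r x. \<xi> (r *s x) = r * \<xi> x"
    and T: "\<And>x. \<xi> (T x) = \<tau> * \<xi> x" and ne: "\<tau> \<noteq> \<beta>" "\<beta> \<noteq> 0" "\<tau> ^ n = 1" "\<beta> ^ n = 1"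
  shows "\<xi> (eproj n \<beta> x) = 0"
proof -
  have "\<xi> 0 = 0" using \<xi>(2)[of 0 0] by simp
  hence Fs: "\<xi> (sum f A) = (\<Sum>i\<in>A. \<xi> (f i))" for f and A :: "nat set"
    by (induction A rule: infinite_finite_induct) (simp_all add: \<xi>)
  have Tk: "\<xi> ((T ^^ k) x) = \<tau> ^ k * \<xi> x" for k by (induction k) (simp_all add: T)
  have "(\<Sum>k<n. \<xi> ((1 / \<beta> ^ k) *s (T ^^ k) x)) = (\<Sum>k<n. (\<tau> / \<beta>) ^ k) * \<xi> x"
    by (simp add: \<xi> Tk sum_distrib_right power_divide)
  also have "(\<Sum>k<n. (\<tau> / \<beta>) ^ k) = 0"
  proof -
    have "(\<tau> / \<beta>) ^ n = 1" using ne by (simp add: power_divide)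
    hence "(1 - \<tau> / \<beta>) * (\<Sum>k<n. (\<tau> / \<beta>) ^ k) = 0"
      using qnum_geometric[of "\<tau> / \<beta>" n] by (simp only: diff_self)
    moreover have "1 - \<tau> / \<beta> \<noteq> 0" using ne by simp
    ultimately show ?thesis by (simp only: mult_eq_0_iff simp_thms)
  qed
  finally show ?thesis by (simp add: eproj_def \<xi> Fs)
qed

end

text \<open>The projection \<open>eproj\<close> divides by n. If n were 0 in the field, then 1 would
  be a root of 1 + x + ... + x^(n-1) besides the other powers of q, giving n roots in degree
  n-1.\<close>

lemma of_nat_order_ne_0:
  fixes q :: "'k::field"
  assumes q: "is_primitive_root n q" and n: "n > 0"
  shows "of_nat n \<noteq> (0 :: 'k)"
proof
  assume 0: "of_nat n = (0 :: 'k)"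
  define p where "p = (\<Sum>k<n. monom (1::'k) k)"
  have ev: "poly p x = (\<Sum>k<n. x ^ k)" for x by (simp add: p_def poly_sum poly_monom)
  have root: "poly p (q ^ j) = 0" if "j < n" for j
  proof (cases "j = 0")
    case True
    thus ?thesis using 0 by (simp add: ev)
  next
    case False
    have "(q ^ j) ^ n = 1" using primitive_rootD(1)[OF q] by (metis mult.commute power_mult power_one)
    thus ?thesis using qnum_geometric[of "q ^ j" n] primitive_rootD(2)[OF q, of j] False that by (simp add: ev)
  qed
  have q0: "q \<noteq> 0" using primitive_rootD(1)[OF q] n by (auto simp: zero_power)
  have inj: "inj_on (\<lambda>j. q ^ j) {..<n}"
  proof (rule linorder_inj_onI)
    fix i j assume ij: "i < j" "i \<in> {..<n}" "j \<in> {..<n}"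
    have "q ^ j = q ^ i * q ^ (j - i)" using ij by (simp add: power_add[symmetric])
    thus "q ^ i \<noteq> q ^ j" using primitive_rootD(2)[OF q, of "j - i"] ij q0 by auto
  qed auto
  have "coeff p (n - 1) = (\<Sum>k<n. if k = n - 1 then 1 else 0)" by (simp add: p_def coeff_sum)
  also have "\<dots> = 1" using n by (simp add: sum.delta)
  finally have p0: "p \<noteq> 0" by auto
  have "degree p \<le> n - 1" unfolding p_def
    by (rule degree_sum_le) (auto intro: order.trans[OF degree_monom_le])
  moreover have "card ((\<lambda>j. q ^ j) ` {..<n}) \<le> card {x. poly p x = 0}"
    by (rule card_mono[OF poly_roots_finite[OF p0]]) (use root in auto)
  ultimately show False
    using card_poly_roots_bound[OF p0] card_image[OF inj] n by simp
qed

lemma not_dvd_between: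
  assumes "0 < k" "k < 2 * n" "k \<noteq> (n::nat)"
  shows "\<not> n dvd k"
proof
  assume "n dvd k"
  then obtain t where t: "k = n * t" by (auto elim: dvdE)
  have "t < 2" using assms(2) t by (metis mult.commute mult_less_cancel2)
  thus False using assms t by (cases "t = 0"; cases "t = 1") auto
qed

text \<open>With S = s0 + s1 x + ..., the inverse modulo x^2 is the truncated geometric series 1/s0
  - (s1/s0^2) x.\<close>

lemma poly_inverse_mod_square:
  fixes S :: "'k::field poly"
  assumes "coeff S 0 \<noteq> 0"
  shows "\<exists>U T. S * U = pCons 1 (pCons 0 T)"
proof -
  obtain s0 S1 where S: "S = pCons s0 S1" by (cases S)
  obtain s1 S2 where S1: "S1 = pCons s1 S2" by (cases S1)
  have "s0 \<noteq> 0" using assms S by simp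
  hence "S * [:1 / s0, - s1 / s0\<^sup>2:] =
      pCons 1 (pCons 0 (Polynomial.smult (1 / s0) S2 + Polynomial.smult (- s1 / s0\<^sup>2) S1))"
    by (simp add: S S1 mult_pCons_right power2_eq_square)
  thus ?thesis by blast
qed

text \<open>The relations are required on a whole type, so that the computations with strings carry
  no carrier conditions; \<open>rep_op\<close> turns every module into such a
  representation.\<close>

locale rep = vector_space scale
  for scale :: "'k::field \<Rightarrow> 'v::ab_group_add \<Rightarrow> 'v" (infixr \<open>*s\<close> 75) +
  fixes n :: nat and q :: 'k and a b c d :: "'v \<Rightarrow> 'v"
  assumes op_a: "vec_op scale a" and op_b: "vec_op scale b" and op_c: "vec_op scale c" and op_d: "vec_op scale d"
    and ba: "b (a x) = q *s a (b x)" and db: "d (b x) = q *s b (d x)"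
    and ca: "c (a x) = q *s a (c x)" and dc: "d (c x) = q *s c (d x)"
    and bc: "b (c x) = c (b x)"
    and an: "(a ^^ n) x = 0" and bn: "(b ^^ n) x = x" and cn: "(c ^^ n) x = x" and dn: "(d ^^ n) x = 0"
    and da: "d (a x) - q *s a (d x) = x - b (c x)"
    and n_gt_1: "1 < n" and prim: "is_primitive_root n q"
begin

sublocale a: vec_op scale a by (rule op_a)
sublocale b: vec_op scale b by (rule op_b)
sublocale c: vec_op scale c by (rule op_c)
sublocale d: vec_op scale d by (rule op_d)

lemma q_ne_0 [simp]: "q \<noteq> 0"
  using primitive_rootD(1)[OF prim] n_gt_1 by (auto simp: zero_power)

definition wt :: "'k \<Rightarrow> 'k \<Rightarrow> 'v \<Rightarrow> bool" where
  "wt \<beta> \<gamma> x \<longleftrightarrow> b x = \<beta> *s x \<and> c x = \<gamma> *s x"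

lemma wt_a: "wt \<beta> \<gamma> x \<Longrightarrow> wt (q * \<beta>) (q * \<gamma>) (a x)"
  by (simp add: wt_def ba ca a.scale)

lemma wt_d: "wt \<beta> \<gamma> x \<Longrightarrow> wt (\<beta> / q) (\<gamma> / q) (d x)"
proof -
  have *: "t (d x) = (\<tau> / q) *s d x" if "q *s t (d x) = d (t x)" "t x = \<tau> *s x" for t \<tau>
  proof -
    have "t (d x) = (1 / q) *s (q *s t (d x))" by simp
    thus ?thesis unfolding that by (simp add: d.scale)
  qed
  assume "wt \<beta> \<gamma> x"
  thus ?thesis unfolding wt_def using *[of b \<beta>] *[of c \<gamma>] db[of x] dc[of x] by simp
qed

lemma wt_a_pow: "wt \<beta> \<gamma> x \<Longrightarrow> wt (q ^ i * \<beta>) (q ^ i * \<gamma>) ((a ^^ i) x)"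
proof (induction i)
  case (Suc i)
  from wt_a[OF Suc.IH[OF Suc.prems]] show ?case by (simp add: mult.assoc)
qed simp

lemma wt_d_pow: "wt \<beta> \<gamma> x \<Longrightarrow> wt (\<beta> / q ^ i) (\<gamma> / q ^ i) ((d ^^ i) x)"
proof (induction i)
  case (Suc i)
  from wt_d[OF Suc.IH[OF Suc.prems]] show ?case by (simp add: mult.commute)
qed simp

lemma wt_0: "wt \<beta> \<gamma> 0"
  by (simp add: wt_def)

lemma wt_add: "wt \<beta> \<gamma> x \<Longrightarrow> wt \<beta> \<gamma> y \<Longrightarrow> wt \<beta> \<gamma> (x + y)"
  by (simp add: wt_def b.add c.add scale_right_distrib)

lemma wt_scale: "wt \<beta> \<gamma> x \<Longrightarrow> wt \<beta> \<gamma> (r *s x)"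
  by (simp add: wt_def b.scale c.scale mult.commute)

lemma wt_ad: "wt \<beta> \<gamma> x \<Longrightarrow> wt \<beta> \<gamma> (a (d x))"
  using wt_a[OF wt_d, of \<beta> \<gamma> x] by simp

lemma da_wt: "wt \<beta> \<gamma> x \<Longrightarrow> d (a x) = q *s a (d x) + (1 - \<beta> * \<gamma>) *s x"
  using da[of x] by (simp add: wt_def b.scale algebra_simps)

lemma ad_wt: "wt \<beta> \<gamma> x \<Longrightarrow> a (d x) = (1 / q) *s d (a x) - ((1 - \<beta> * \<gamma>) / q) *s x"
proof -
  assume "wt \<beta> \<gamma> x"
  hence "q *s a (d x) = d (a x) - (1 - \<beta> * \<gamma>) *s x" by (simp add: da_wt)
  hence "(1 / q) *s q *s a (d x) = (1 / q) *s d (a x) - ((1 - \<beta> * \<gamma>) / q) *s x"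
    by (simp only: scale_right_diff_distrib scale_scale) simp
  thus ?thesis by simp
qed

subsection \<open>Strings\<close>

text \<open>The coefficients h_i of d on a^i u satisfy h_(i+1) = q h_i + 1 - q^(2i) beta gamma by
  \<open>da_wt\<close>, and this recursion has the stated closed solution.\<close>

lemma hw_string:
  assumes "wt \<beta> \<gamma> u" "d u = 0"
  shows "d ((a ^^ Suc i) u) = (qnum q (Suc i) * (1 - q ^ i * (\<beta> * \<gamma>))) *s (a ^^ i) u"
proof (induction i)
  case 0
  show ?case using da_wt[OF assms(1)] assms(2) by simp
next
  case (Suc i)
  let ?\<kappa> = "\<beta> * \<gamma>"
  have "d (a ((a ^^ Suc i) u)) = q *s a (d ((a ^^ Suc i) u)) + (1 - (q ^ Suc i * \<beta>) * (q ^ Suc i * \<gamma>)) *s (a ^^ Suc i) u"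
    by (rule da_wt[OF wt_a_pow[OF assms(1)]])
  also have "\<dots> = (q * (qnum q (Suc i) * (1 - q ^ i * ?\<kappa>)) + (1 - (q ^ Suc i * \<beta>) * (q ^ Suc i * \<gamma>))) *s (a ^^ Suc i) u"
    unfolding Suc by (simp add: a.scale scale_left_distrib del: sum.lessThan_Suc)
  also have "q * (qnum q (Suc i) * (1 - q ^ i * ?\<kappa>)) + (1 - (q ^ Suc i * \<beta>) * (q ^ Suc i * \<gamma>)) =
      (1 + q * qnum q (Suc i)) - q ^ Suc i * ?\<kappa> * (qnum q (Suc i) + q ^ Suc i)"
    by (simp add: algebra_simps del: sum.lessThan_Suc)
  also have "1 + q * qnum q (Suc i) = qnum q (Suc (Suc i))" by (rule qnum_Suc[symmetric])
  also have "qnum q (Suc i) + q ^ Suc i = qnum q (Suc (Suc i))" by simp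
  also have "qnum q (Suc (Suc i)) - q ^ Suc i * ?\<kappa> * qnum q (Suc (Suc i)) = qnum q (Suc (Suc i)) * (1 - q ^ Suc i * ?\<kappa>)"
    by (simp add: algebra_simps del: sum.lessThan_Suc)
  finally show ?case by simp
qed

text \<open>On d^i w the operator a d acts like a linear polynomial in a d applied to w first. These
  polynomials are the \<open>cas_poly\<close> used below.\<close>

lemma ad_d_pow:
  assumes "wt \<beta> \<gamma> w"
  shows "a (d ((d ^^ i) w)) =
    (d ^^ i) ((1 / q ^ i) *s a (d w) - ((1 - \<beta> * \<gamma> / q ^ Suc i) * qnum q i / q ^ i) *s w)"
proof (induction i)
  case (Suc i)
  let ?\<kappa> = "\<beta> * \<gamma>" and ?w = "(d ^^ Suc i) w"
  let ?e = "\<lambda>i. (1 - ?\<kappa> / q ^ Suc i) * qnum q i / q ^ i"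
  have "a (d ?w) = (1 / q) *s d (a ?w) - ((1 - (\<beta> / q ^ Suc i) * (\<gamma> / q ^ Suc i)) / q) *s ?w"
    by (rule ad_wt[OF wt_d_pow[OF assms]])
  also have "a ?w = (d ^^ i) ((1 / q ^ i) *s a (d w) - ?e i *s w)" using Suc by simp
  also have "d \<dots> = (d ^^ Suc i) ((1 / q ^ i) *s a (d w) - ?e i *s w)" by simp
  also have "(1 / q) *s \<dots> - ((1 - (\<beta> / q ^ Suc i) * (\<gamma> / q ^ Suc i)) / q) *s ?w =
     (d ^^ Suc i) ((1 / q ^ Suc i) *s a (d w) - (?e i / q + (1 - (\<beta> / q ^ Suc i) * (\<gamma> / q ^ Suc i)) / q) *s w)"
    by (simp add: d.funpow_scale d.funpow_diff d.funpow_add scale_left_distrib scale_right_diff_distrib mult.commute del: funpow.simps)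
  also have "?e i / q + (1 - (\<beta> / q ^ Suc i) * (\<gamma> / q ^ Suc i)) / q = ?e (Suc i)"
  proof -
    have "?e i / q + (1 - (\<beta> / q ^ Suc i) * (\<gamma> / q ^ Suc i)) / q =
        (qnum q i + q ^ i - ?\<kappa> / q ^ Suc (Suc i) * (1 + q * qnum q i)) / q ^ Suc i"
      by (simp add: field_simps)
    also have "qnum q i + q ^ i - ?\<kappa> / q ^ Suc (Suc i) * (1 + q * qnum q i) = (1 - ?\<kappa> / q ^ Suc (Suc i)) * qnum q (Suc i)"
      unfolding qnum_Suc[symmetric] by (simp add: algebra_simps)
    finally show ?thesis .
  qed
  finally show ?case .
qed simp

text \<open>The case of \<open>ad_d_pow\<close> in which d a y = 0 makes a d act on y as the scalar
  -(1 - beta gamma)/q.\<close>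

lemma lw_string:
  assumes "wt \<beta> \<gamma> y" "d (a y) = 0"
  shows "a ((d ^^ Suc i) y) = - ((1 - \<beta> * \<gamma> / q ^ i) * qnum q (Suc i) / q ^ Suc i) *s (d ^^ i) y"
proof -
  have "a (d y) = - ((1 - \<beta> * \<gamma>) / q) *s y" using ad_wt[OF assms(1)] assms(2) by simp
  hence "a ((d ^^ Suc i) y) = (d ^^ i) ((1 / q ^ i) *s (- ((1 - \<beta> * \<gamma>) / q) *s y) - ((1 - \<beta> * \<gamma> / q ^ Suc i) * qnum q i / q ^ i) *s y)"
    using ad_d_pow[OF assms(1), of i] by simp
  also have "\<dots> = (- (1 / q ^ i) * ((1 - \<beta> * \<gamma>) / q) - ((1 - \<beta> * \<gamma> / q ^ Suc i) * qnum q i / q ^ i)) *s (d ^^ i) y"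
    by (simp add: d.funpow_scale[symmetric] algebra_simps)
  also have "- (1 / q ^ i) * ((1 - \<beta> * \<gamma>) / q) - ((1 - \<beta> * \<gamma> / q ^ Suc i) * qnum q i / q ^ i) =
     - ((1 - \<beta> * \<gamma> / q ^ i) * qnum q (Suc i) / q ^ Suc i)"
  proof -
    have r: "q * qnum q i = qnum q i + q ^ i - 1" using qnum_Suc[of q i] by simp
    have "- (1 / q ^ i) * ((1 - \<beta> * \<gamma>) / q) - ((1 - \<beta> * \<gamma> / q ^ Suc i) * qnum q i / q ^ i) =
        - (((1 - \<beta> * \<gamma>) + q * qnum q i - \<beta> * \<gamma> * qnum q i / q ^ i) / q ^ Suc i)"
      by (simp add: field_simps)
    also have "(1 - \<beta> * \<gamma>) + q * qnum q i - \<beta> * \<gamma> * qnum q i / q ^ i = (1 - \<beta> * \<gamma> / q ^ i) * qnum q (Suc i)"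
      by (simp add: r field_simps)
    finally show ?thesis .
  qed
  finally show ?thesis .
qed

text \<open>As long as none of the factors vanishes, y can be recovered from d^j y.\<close>

lemma a_d_pow:
  assumes "wt \<beta> \<gamma> y" "d (a y) = 0"
  shows "(a ^^ j) ((d ^^ j) y) = (\<Prod>i<j. - ((1 - \<beta> * \<gamma> / q ^ i) * qnum q (Suc i) / q ^ Suc i)) *s y"
proof (induction j)
  case (Suc j)
  have "(a ^^ Suc j) ((d ^^ Suc j) y) = (a ^^ j) (a ((d ^^ Suc j) y))"
    by (simp add: funpow_swap1)
  thus ?case unfolding lw_string[OF assms] a.funpow_scale Suc by (simp add: mult.commute)
qed simp

lemma d_a_pow:
  assumes "wt \<beta> \<gamma> u" "d u = 0"
  shows "(d ^^ j) ((a ^^ j) u) = (\<Prod>i<j. qnum q (Suc i) * (1 - q ^ i * (\<beta> * \<gamma>))) *s u"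
proof (induction j)
  case (Suc j)
  have "(d ^^ Suc j) ((a ^^ Suc j) u) = (d ^^ j) (d ((a ^^ Suc j) u))"
    by (simp add: funpow_swap1)
  thus ?case unfolding hw_string[OF assms] d.funpow_scale Suc by (simp add: mult.commute)
qed simp

lemma qnum_ne_0: "0 < i \<Longrightarrow> i < n \<Longrightarrow> qnum q i \<noteq> 0"
  using qnum_geometric[of q i] primitive_rootD(2)[OF prim, of i] by auto

lemma q_pow_eq_1_iff: "q ^ i = 1 \<longleftrightarrow> n dvd i"
proof
  assume "q ^ i = 1"
  moreover have "q ^ i = (q ^ n) ^ (i div n) * q ^ (i mod n)"
    by (simp add: power_mult[symmetric] power_add[symmetric])
  ultimately have "q ^ (i mod n) = 1" using primitive_rootD(1)[OF prim] by simp
  thus "n dvd i" using primitive_rootD(2)[OF prim, of "i mod n"] n_gt_1 by (auto simp: dvd_eq_mod_eq_0)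
qed (auto simp: power_mult primitive_rootD(1)[OF prim])

subsection \<open>Elements corresponding to homomorphisms from \<open>P(m, s)\<close>\<close>

text \<open>The vector d x is killed by d a, so going down from it by d and back up by a only
  produces scalars. The string must break after n-m steps, and its last vector, rescaled, is
  y.\<close>

lemma lower_hw_exists:
  assumes m: "1 \<le> m" "m < n" and x: "wt \<beta> \<gamma> x" "q ^ m * (\<beta> * \<gamma>) = q" "d (a (d x)) = 0"
  shows "\<exists>y. wt (q ^ m * \<beta>) (q ^ m * \<gamma>) y \<and> d y = 0 \<and> (a ^^ (n - m - 1)) y = d x"
proof -
  let ?l = "\<lambda>i. - ((1 - \<beta> / q * (\<gamma> / q) / q ^ i) * qnum q (Suc i) / q ^ Suc i)"
  have z: "wt (\<beta> / q) (\<gamma> / q) (d x)" using wt_d[OF x(1)] .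
  have str: "a ((d ^^ Suc i) (d x)) = ?l i *s (d ^^ i) (d x)" for i
    by (rule lw_string[OF z x(3)])
  \<comment> \<open>The product of the weights of d x is q^(-m-1), so the scalar can vanish only
    when n divides i+m+1 or i+1.\<close>
  have l: "?l i \<noteq> 0" if "Suc i < n" "Suc i \<noteq> n - m" for i
  proof -
    have "\<beta> / q * (\<gamma> / q) / q ^ i = 1 \<longleftrightarrow> q ^ m * (\<beta> * \<gamma>) = q ^ m * (q ^ i * (q * q))"
      by (simp add: field_simps)
    also have "\<dots> \<longleftrightarrow> q ^ (i + m + 1) = 1"
      unfolding x(2) by (simp add: power_add algebra_simps)
    also have "\<dots> \<longleftrightarrow> n dvd (i + m + 1)" by (rule q_pow_eq_1_iff)
    finally have "\<beta> / q * (\<gamma> / q) / q ^ i \<noteq> 1"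
      using not_dvd_between[of "i + m + 1" n] that m by auto
    thus ?thesis using qnum_ne_0[of "Suc i"] that by (simp del: sum.lessThan_Suc)
  qed
  \<comment> \<open>Since d^n x = 0, the vector n-1 steps below d x is zero. Applying a repeatedly
    transports this upwards through nonzero scalars, until the break at n-m steps.\<close>
  have v: "(d ^^ (n - m + j)) (d x) = 0" if "j \<le> m - 1" for j
    using that
  proof (induction j rule: inc_induct)
    case base
    have "(d ^^ (n - m + (m - 1))) (d x) = (d ^^ Suc (n - 1)) x"
      using m by (simp only: funpow_Suc_right o_apply) simp
    thus ?case using dn[of x] n_gt_1 by simp
  next
    case (step j)
    have "?l (n - m + j) *s (d ^^ (n - m + j)) (d x) = 0"
      using str[of "n - m + j"] step.IH by simp
    moreover have "?l (n - m + j) \<noteq> 0" by (rule l) (use step m in auto)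
    ultimately show ?case by simp
  qed
  let ?\<theta> = "\<Prod>i<n - m - 1. ?l i"
  have \<theta>: "?\<theta> \<noteq> 0" using l m by (auto simp del: sum.lessThan_Suc)
  let ?y = "(1 / ?\<theta>) *s (d ^^ (n - m - 1)) (d x)"
  have "d ((d ^^ (n - m - 1)) (d x)) = 0"
  proof -
    have "d ((d ^^ (n - m - 1)) (d x)) = (d ^^ Suc (n - m - 1)) (d x)" by simp
    also have "Suc (n - m - 1) = n - m + 0" using m by simp
    finally show ?thesis using v[of 0] by simp
  qed
  hence "d ?y = 0" by (simp add: d.scale)
  moreover have "(a ^^ (n - m - 1)) ?y = d x"
    unfolding a.funpow_scale a_d_pow[OF z x(3)] using \<theta> by simp
  moreover have "wt (q ^ m * \<beta>) (q ^ m * \<gamma>) ?y"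
  proof -
    have "(d ^^ (n - m - 1)) (d x) = (d ^^ (n - m)) x"
    proof -
      have "(d ^^ (n - m - 1)) (d x) = (d ^^ Suc (n - m - 1)) x" by (simp only: funpow_Suc_right o_apply)
      moreover have "Suc (n - m - 1) = n - m" using m by simp
      ultimately show ?thesis by (simp only:)
    qed
    moreover have "1 / q ^ (n - m) = q ^ m"
      using primitive_rootD(1)[OF prim] m by (simp add: power_diff)
    ultimately show ?thesis
      using wt_scale[OF wt_d_pow[OF x(1), of "n - m"]] by (metis (no_types, lifting) divide_inverse mult.commute mult.right_neutral)
  qed
  ultimately show ?thesis by blast
qed

text \<open>The computation of \<open>hw_string\<close> with d x = a^k y in place of d x = 0: each
  commutation of d past a multiplies the inhomogeneous term by q.\<close>

lemma d_a_pow_lift: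
  assumes x: "wt \<beta> \<gamma> x" and y: "d x = (a ^^ k) y"
  shows "d ((a ^^ Suc i) x) = (qnum q (Suc i) * (1 - q ^ i * (\<beta> * \<gamma>))) *s (a ^^ i) x + q ^ Suc i *s (a ^^ (k + Suc i)) y"
proof (induction i)
  case 0
  show ?case using da_wt[OF x] y by (simp add: add.commute)
next
  case (Suc i)
  let ?\<kappa> = "\<beta> * \<gamma>"
  have "d (a ((a ^^ Suc i) x)) = q *s a (d ((a ^^ Suc i) x)) + (1 - (q ^ Suc i * \<beta>) * (q ^ Suc i * \<gamma>)) *s (a ^^ Suc i) x"
    by (rule da_wt[OF wt_a_pow[OF x]])
  also have "\<dots> = (q * (qnum q (Suc i) * (1 - q ^ i * ?\<kappa>)) + (1 - (q ^ Suc i * \<beta>) * (q ^ Suc i * \<gamma>))) *s (a ^^ Suc i) x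
      + q ^ Suc (Suc i) *s (a ^^ (k + Suc (Suc i))) y"
    unfolding Suc by (simp add: a.scale a.add scale_left_distrib scale_right_distrib add_ac del: sum.lessThan_Suc)
  also have "q * (qnum q (Suc i) * (1 - q ^ i * ?\<kappa>)) + (1 - (q ^ Suc i * \<beta>) * (q ^ Suc i * \<gamma>)) =
      (1 + q * qnum q (Suc i)) - q ^ Suc i * ?\<kappa> * (qnum q (Suc i) + q ^ Suc i)"
    by (simp add: algebra_simps del: sum.lessThan_Suc)
  also have "1 + q * qnum q (Suc i) = qnum q (Suc (Suc i))" by (rule qnum_Suc[symmetric])
  also have "qnum q (Suc i) + q ^ Suc i = qnum q (Suc (Suc i))" by simp
  also have "qnum q (Suc (Suc i)) - q ^ Suc i * ?\<kappa> * qnum q (Suc (Suc i)) = qnum q (Suc (Suc i)) * (1 - q ^ Suc i * ?\<kappa>)"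
    by (simp add: algebra_simps del: sum.lessThan_Suc)
  finally show ?case by simp
qed

sublocale z: vec_op scale "\<lambda>x. a (d x)"
  by unfold_locales (simp_all add: a.add a.scale d.add d.scale)

lemma wt_poly_app: "wt \<beta> \<gamma> x \<Longrightarrow> wt \<beta> \<gamma> (z.poly_app p x)"
  by (induction p) (auto simp: z.poly_app_pCons wt_0 intro!: wt_add wt_scale wt_ad)

abbreviation (input) cas_poly :: "'k \<Rightarrow> nat \<Rightarrow> 'k poly" where
  "cas_poly \<kappa> i \<equiv> [:- ((1 - \<kappa> / q ^ Suc i) * qnum q i / q ^ i), 1 / q ^ i:]"

text \<open>Iterates \<open>ad_d_pow\<close>: each pair of a and d is absorbed into one linear
  polynomial in a d. For j = n-1 the left side is zero, which gives a polynomial relation for a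
  d.\<close>

lemma a_d_pow_poly_app:
  assumes "wt \<beta> \<gamma> w"
  shows "(a ^^ j) ((d ^^ j) (d w)) = d (z.poly_app (\<Prod>i\<in>{1..j}. cas_poly (\<beta> * \<gamma>) i) w)"
  using assms
proof (induction j arbitrary: w)
  case (Suc j)
  let ?L = "cas_poly (\<beta> * \<gamma>) (Suc j)" and ?R = "\<Prod>i\<in>{1..j}. cas_poly (\<beta> * \<gamma>) i"
  have "(a ^^ Suc j) ((d ^^ Suc j) (d w)) = (a ^^ j) (a (d ((d ^^ Suc j) w)))"
    by (simp add: funpow_swap1)
  also have "a (d ((d ^^ Suc j) w)) = (d ^^ Suc j) (z.poly_app ?L w)"
    unfolding ad_d_pow[OF Suc.prems]
    by (simp add: z.poly_app_pCons z.add z.scale a.scale d.scale del: funpow.simps sum.lessThan_Suc)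
  also have "(a ^^ j) \<dots> = (a ^^ j) ((d ^^ j) (d (z.poly_app ?L w)))"
    by (simp add: funpow_swap1)
  also have "\<dots> = d (z.poly_app ?R (z.poly_app ?L w))" by (rule Suc.IH[OF wt_poly_app[OF Suc.prems]])
  also have "\<dots> = d (z.poly_app (\<Prod>i\<in>{1..Suc j}. cas_poly (\<beta> * \<gamma>) i) w)"
    by (simp only: z.poly_app_mult[symmetric] prod.atLeast_Suc_atMost_Suc_shift) (simp add: mult.commute)
  finally show ?case .
qed simp

text \<open>
  On a weight space with \<open>q\<^sup>m \<beta> \<gamma> = q\<close>, the identity \<open>0 = a\<^bsup>n-1\<^esup> d\<^sup>n = d L\<^sub>1 \<dots> L\<^bsub>n-1\<^esub>\<close> writes zero as
  \<open>d\<close> times a polynomial in \<open>z = a d\<close> with a simple root at \<open>0\<close>, because only the factor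
  \<open>L\<^bsub>n-m\<^esub>\<close> has no constant term.  Dividing by \<open>z\<close> and inverting the remaining product \<open>S\<close>
  modulo \<open>z\<^sup>2\<close> produces an operator \<open>1 + z\<^sup>2 T(z)\<close> with values in the kernel of \<open>d a d\<close>.
\<close>

lemma generator_correction:
  assumes m: "1 \<le> m" "m < n" and \<kappa>: "q ^ m * (\<beta> * \<gamma>) = q"
  shows "\<exists>T. \<forall>x. wt \<beta> \<gamma> x \<longrightarrow> d (a (d (x + a (d (a (d (z.poly_app T x))))))) = 0"
proof -
  let ?L = "cas_poly (\<beta> * \<gamma>)"
  define S where "S = (\<Prod>i\<in>{1..n - 1} - {n - m}. ?L i)"
  have \<kappa>_ne: "\<beta> * \<gamma> \<noteq> q ^ Suc i" if "1 \<le> i" "i \<le> n - 1" "i \<noteq> n - m" for i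
  proof
    assume "\<beta> * \<gamma> = q ^ Suc i"
    hence "q ^ (m + i) * q = 1 * q" using \<kappa> by (simp add: power_add algebra_simps)
    hence "n dvd m + i" using q_pow_eq_1_iff by simp
    thus False using not_dvd_between[of "m + i" n] that m by auto
  qed
  have "coeff S 0 = (\<Prod>i\<in>{1..n - 1} - {n - m}. coeff (?L i) 0)"
    by (simp add: S_def poly_0_coeff_0[symmetric] poly_prod)
  also have "\<dots> \<noteq> 0"
  proof -
    have "(1 - \<beta> * \<gamma> / q ^ Suc i) \<noteq> 0" if "1 \<le> i" "i \<le> n - 1" "i \<noteq> n - m" for i
      using \<kappa>_ne[OF that] by (simp add: field_simps)
    moreover have "qnum q i \<noteq> 0" if "1 \<le> i" "i \<le> n - 1" for i
      using qnum_ne_0[of i] that n_gt_1 by auto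
    ultimately show ?thesis by (auto simp del: power_Suc)
  qed
  finally obtain U T where UT: "S * U = pCons 1 (pCons 0 T)" using poly_inverse_mod_square by blast
  have Sz: "d (z.poly_app S (a (d w))) = 0" if w: "wt \<beta> \<gamma> w" for w
  proof -
    have "\<beta> * \<gamma> = q ^ Suc (n - m)"
    proof -
      have "q ^ m * (\<beta> * \<gamma>) = q ^ m * q ^ Suc (n - m)"
        using \<kappa> m primitive_rootD(1)[OF prim] by (simp add: power_add[symmetric])
      thus ?thesis by simp
    qed
    hence L: "?L (n - m) = [:0, 1 / q ^ (n - m):]" by simp
    have "{1..n - 1} = insert (n - m) ({1..n - 1} - {n - m})" using m by auto
    hence "(\<Prod>i\<in>{1..n - 1}. ?L i) = ?L (n - m) * S"
      unfolding S_def using prod.insert_remove[of "{1..n - 1}" ?L "n - m"] by simp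
    hence "(a ^^ (n - 1)) ((d ^^ (n - 1)) (d w)) = d (z.poly_app (S * ?L (n - m)) w)"
      using a_d_pow_poly_app[OF w, of "n - 1"] by (simp only: mult.commute)
    moreover have "(d ^^ (n - 1)) (d w) = (d ^^ Suc (n - 1)) w" by (simp only: funpow_Suc_right o_apply)
    hence "(d ^^ (n - 1)) (d w) = 0" using dn[of w] n_gt_1 by simp
    ultimately have "d (z.poly_app S (z.poly_app (?L (n - m)) w)) = 0" by (simp only: z.poly_app_mult a.funpow_zero)
    also have "z.poly_app (?L (n - m)) w = (1 / q ^ (n - m)) *s a (d w)"
      unfolding L by (simp add: z.poly_app_pCons a.scale d.scale)
    finally have "(1 / q ^ (n - m)) *s d (z.poly_app S (a (d w))) = 0"
      by (simp only: z.poly_app_scale d.scale)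
    thus ?thesis by simp
  qed
  have "d (a (d (x + a (d (a (d (z.poly_app T x))))))) = 0" if x: "wt \<beta> \<gamma> x" for x
  proof -
    have "x + a (d (a (d (z.poly_app T x)))) = z.poly_app (S * U) x"
      unfolding UT by (simp add: z.poly_app_pCons)
    hence "d (a (d (x + a (d (a (d (z.poly_app T x))))))) = d (z.poly_app S (a (d (z.poly_app U x))))"
      by (simp add: z.poly_app_mult z.poly_app_T)
    thus ?thesis using Sz[OF wt_poly_app[OF x]] by simp
  qed
  thus ?thesis by blast
qed

text \<open>Any preimage is first projected to the weight space, which does not change its image
  because y has that weight. The correction of \<open>generator_correction\<close> adds a multiple
  of (a d)^2, and (a d)^2 y = 0 since d a d y = 0, so the image is again unchanged.\<close>

lemma lift_generator:
  assumes Y: "rep scale n q a' b' c' d'"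
    and F: "\<And>x y. F (x + y) = F x + F y" "\<And>r x. F (r *s x) = r *s F x"
    and int: "\<And>x. F (a x) = a' (F x)" "\<And>x. F (b x) = b' (F x)" "\<And>x. F (c x) = c' (F x)" "\<And>x. F (d x) = d' (F x)"
    and m: "1 \<le> m" "m < n" and \<kappa>: "q ^ m * (\<beta> * \<gamma>) = q" "\<beta> ^ n = 1" "\<gamma> ^ n = 1"
    and y: "F x0 = y" "b' y = \<beta> *s y" "c' y = \<gamma> *s y" "d' (a' (d' y)) = 0"
  shows "\<exists>x. F x = y \<and> wt \<beta> \<gamma> x \<and> d (a (d x)) = 0"
proof -
  interpret Y: rep scale n q a' b' c' d' by fact
  have F0: "F 0 = 0" using F(2)[of 0 0] by simp
  have nn: "of_nat n \<noteq> (0::'k)" using of_nat_order_ne_0[OF prim] n_gt_1 by simp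
  have ne: "\<beta> \<noteq> 0" "\<gamma> \<noteq> 0" using \<kappa>(2,3) n_gt_1 by (auto simp: zero_power)
  define x1 where "x1 = c.eproj n \<gamma> (b.eproj n \<beta> x0)"
  have "b x1 = \<beta> *s x1"
  proof -
    have "b x1 = c.eproj n \<gamma> (b (b.eproj n \<beta> x0))"
      unfolding x1_def by (rule c.eproj_commute[OF op_b bc])
    also have "\<dots> = c.eproj n \<gamma> (\<beta> *s b.eproj n \<beta> x0)"
      using b.eproj_eigen[OF bn \<kappa>(2)] n_gt_1 by simp
    also have "\<dots> = \<beta> *s x1"
      unfolding x1_def c.eproj_def by (simp add: c.funpow_scale scale_sum_right mult.commute mult.left_commute)
    finally show ?thesis .
  qed
  moreover have "c x1 = \<gamma> *s x1"
    unfolding x1_def by (rule c.eproj_eigen[OF cn \<kappa>(3)]) (use n_gt_1 in simp)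
  ultimately have x1: "wt \<beta> \<gamma> x1" by (simp add: wt_def)
  have Fx1: "F x1 = y"
  proof -
    have "F x1 = Y.c.eproj n \<gamma> (Y.b.eproj n \<beta> (F x0))"
      unfolding x1_def
      by (simp add: c.eproj_intertwine[OF F F0 int(3) Y.op_c] b.eproj_intertwine[OF F F0 int(2) Y.op_b])
    thus ?thesis using Y.b.eproj_fix[of y \<beta> n] Y.c.eproj_fix[of y \<gamma> n] y ne nn by simp
  qed
  obtain T where T: "\<And>x. wt \<beta> \<gamma> x \<Longrightarrow> d (a (d (x + a (d (a (d (z.poly_app T x))))))) = 0"
    using generator_correction[OF m \<kappa>(1)] by blast
  define x2 where "x2 = x1 + a (d (a (d (z.poly_app T x1))))"
  have "F (a (d (a (d (z.poly_app T x1))))) = a' (d' (a' (d' (Y.z.poly_app T y))))"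
    using z.poly_app_intertwine[OF F F0 _ Y.z.vec_op_axioms, of T x1] by (simp add: int Fx1)
  also have "\<dots> = Y.z.poly_app T (a' (d' (a' (d' y))))" by (simp only: Y.z.poly_app_T)
  also have "\<dots> = 0" by (simp add: y(4))
  finally have "F x2 = y" by (simp add: x2_def F Fx1)
  moreover have "wt \<beta> \<gamma> x2" unfolding x2_def by (intro wt_add x1 wt_ad wt_poly_app)
  moreover have "d (a (d x2)) = 0" unfolding x2_def by (rule T[OF x1])
  ultimately show ?thesis by blast
qed

end

subsection \<open>Matrices acting on functions\<close>

text \<open>
  A matrix acts on functions \<open>nat \<Rightarrow> 'k\<close>; outside the index range it acts by the scalar \<open>\<epsilon>\<close>.  Taking
  the value of the counit for \<open>\<epsilon>\<close> makes the defining relations hold on all functions.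
\<close>

definition fscale :: "'k::field \<Rightarrow> (nat \<Rightarrow> 'k) \<Rightarrow> nat \<Rightarrow> 'k" where
  "fscale r f = (\<lambda>i. r * f i)"

lemma fscale_apply [simp]: "fscale r f i = r * f i"
  by (simp add: fscale_def)

global_interpretation fs: vector_space fscale
  by unfold_locales (auto simp: fun_eq_iff algebra_simps)

definition app :: "'k::field \<Rightarrow> 'k mat \<Rightarrow> (nat \<Rightarrow> 'k) \<Rightarrow> nat \<Rightarrow> 'k" where
  "app \<epsilon> A f i = (if i < dim_row A then \<Sum>j<dim_col A. A $$ (i, j) * f j else \<epsilon> * f i)"

lemma app_lt: "A \<in> carrier_mat N N' \<Longrightarrow> i < N \<Longrightarrow> app \<epsilon> A f i = (\<Sum>j<N'. A $$ (i, j) * f j)"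
  by (auto simp: app_def)

lemma app_ge: "A \<in> carrier_mat N N' \<Longrightarrow> \<not> i < N \<Longrightarrow> app \<epsilon> A f i = \<epsilon> * f i"
  by (auto simp: app_def)

lemma vec_op_app: "vec_op fscale (app \<epsilon> A)"
  by unfold_locales (auto simp: app_def fun_eq_iff algebra_simps sum.distrib sum_distrib_left intro!: sum.cong)

lemma app_mult_lt:
  assumes A: "A \<in> carrier_mat N N'" and B: "B \<in> carrier_mat N' N''" and i: "i < N"
  shows "app \<epsilon> A (app \<epsilon>' B f) i = app \<epsilon>'' (A * B) f i"
proof -
  have "app \<epsilon> A (app \<epsilon>' B f) i = (\<Sum>j<N'. A $$ (i, j) * (\<Sum>k<N''. B $$ (j, k) * f k))"
    by (simp add: app_lt[OF A i] app_lt[OF B])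
  also have "\<dots> = (\<Sum>k<N''. (\<Sum>j<N'. A $$ (i, j) * B $$ (j, k)) * f k)"
    by (simp add: sum_distrib_left sum_distrib_right mult.assoc) (rule sum.swap)
  also have "\<dots> = app \<epsilon>'' (A * B) f i"
    using A B i by (simp add: app_lt[OF mult_carrier_mat[OF A B] i] scalar_prod_def atLeast0LessThan)
  finally show ?thesis .
qed

lemma app_mult_square:
  assumes A: "A \<in> carrier_mat N N" and B: "B \<in> carrier_mat N N"
  shows "app \<epsilon> A (app \<epsilon>' B f) = app (\<epsilon> * \<epsilon>') (A * B) f"
proof
  fix i
  show "app \<epsilon> A (app \<epsilon>' B f) i = app (\<epsilon> * \<epsilon>') (A * B) f i"
    using app_mult_lt[OF A B, of i] app_ge[OF A, of i] app_ge[OF B, of i] app_ge[OF mult_carrier_mat[OF A B], of i]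
    by (cases "i < N") simp_all
qed

lemma app_mult_0:
  assumes A: "A \<in> carrier_mat N N'" and B: "B \<in> carrier_mat N' N''"
  shows "app 0 A (app \<epsilon> B f) = app 0 (A * B) f"
proof
  fix i
  show "app 0 A (app \<epsilon> B f) i = app 0 (A * B) f i"
    using app_mult_lt[OF A B, of i] app_ge[OF A, of i] app_ge[OF mult_carrier_mat[OF A B], of i]
    by (cases "i < N") simp_all
qed

lemma app_one_lt: "i < N \<Longrightarrow> app \<epsilon> (1\<^sub>m N) f i = f i"
  by (simp add: app_def if_distrib[of "\<lambda>x. x * _"] cong: if_cong)

lemma app_one: "app 1 (1\<^sub>m N) f = f"
proof
  fix i
  show "app 1 (1\<^sub>m N) f i = f i"
    by (cases "i < N") (simp_all add: app_def if_distrib[of "\<lambda>x. x * _"] cong: if_cong)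
qed

lemma app_smult: "app \<epsilon> (r \<cdot>\<^sub>m A) f i = (if i < dim_row A then r * app \<epsilon> A f i else app \<epsilon> A f i)"
  by (auto simp: app_def sum_distrib_left mult.assoc)

lemma app_minus:
  assumes "A \<in> carrier_mat N N'" "B \<in> carrier_mat N N'" "i < N"
  shows "app \<epsilon> (A - B) f i = app \<epsilon> A f i - app \<epsilon> B f i"
  using assms by (auto simp: app_def sum_subtractf algebra_simps)

lemma app_add:
  assumes "A \<in> carrier_mat N N'" "B \<in> carrier_mat N N'" "i < N"
  shows "app \<epsilon> (A + B) f i = app \<epsilon> A f i + app \<epsilon> B f i"
  using assms by (auto simp: app_def sum.distrib algebra_simps)

lemma app_pow:
  assumes A: "A \<in> carrier_mat N N"
  shows "(app \<epsilon> A ^^ k) f = app (\<epsilon> ^ k) (A ^\<^sub>m k) f"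
proof (induction k arbitrary: f)
  case 0
  have "A ^\<^sub>m 0 = 1\<^sub>m N" using A by simp
  thus ?case by (simp only: funpow_0 power_0 app_one)
next
  case (Suc k)
  show ?case
    by (simp add: funpow_Suc_right Suc app_mult_square[OF pow_carrier_mat[OF A] A] mult.commute del: funpow.simps)
qed

lemma app_cong: "(\<And>j. j < dim_col A \<Longrightarrow> f j = g j) \<Longrightarrow> (\<not> i < dim_row A \<Longrightarrow> f i = g i) \<Longrightarrow> app \<epsilon> A f i = app \<epsilon> A g i"
  by (auto simp: app_def intro!: sum.cong)

lemma app_unit: "j < dim_col A \<Longrightarrow> i < dim_row A \<Longrightarrow> app \<epsilon> A (\<lambda>k. if k = j then 1 else 0) i = A $$ (i, j)"
  by (simp add: app_def if_distrib[of "\<lambda>x. _ * x"] cong: if_cong)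

lemma mat_eq_app:
  assumes "A \<in> carrier_mat N N'" "B \<in> carrier_mat N N'" "\<And>f i. i < N \<Longrightarrow> app 0 A f i = app 0 B f i"
  shows "A = B"
proof (rule eq_matI)
  fix i j assume ij: "i < dim_row B" "j < dim_col B"
  show "A $$ (i, j) = B $$ (i, j)"
    using app_unit[of j A i 0] app_unit[of j B i 0] assms(3)[of i "\<lambda>k. if k = j then 1 else 0"] ij assms(1,2) by auto
qed (use assms in auto)

definition counit :: "gen \<Rightarrow> 'k::field" where
  "counit g = (if g = Ga \<or> g = Gd then 0 else 1)"

definition op :: "nat \<Rightarrow> 'k::field \<Rightarrow> 'k fdmod \<Rightarrow> gen \<Rightarrow> (nat \<Rightarrow> 'k) \<Rightarrow> nat \<Rightarrow> 'k" where
  "op n q M g = app (counit g) (gmat n q M g)"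

lemma rep_app:
  fixes q :: "'k::field"
  assumes A: "rels n q N A" and n: "1 < n" and q: "is_primitive_root n q"
  shows "rep fscale n q (app 0 (A Ga)) (app 1 (A Gb)) (app 1 (A Gc)) (app 0 (A Gd))"
proof -
  have c: "A g \<in> carrier_mat N N" for g using A by (simp add: rels_def)
  have mc: "A g * A h \<in> carrier_mat N N" for g h using c by (rule mult_carrier_mat[OF c])
  note sq = app_mult_square[OF c c]
  have sm: "app \<epsilon> (r \<cdot>\<^sub>m (A g * A h)) f i = (if i < N then r * app \<epsilon> (A g * A h) f i else \<epsilon> * f i)" for \<epsilon> r g h f i
    using app_ge[OF mc[of g h], of i] carrier_matD[OF c[of g]] by (simp add: app_smult)
  have ge: "\<not> i < N \<Longrightarrow> app \<epsilon> (A g * A h) f i = \<epsilon> * f i" for \<epsilon> g h f i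
    by (rule app_ge[OF mc])
  have ge1: "\<not> i < N \<Longrightarrow> app \<epsilon> (A g) f i = \<epsilon> * f i" for \<epsilon> g f i
    by (rule app_ge[OF c])
  show ?thesis
  proof (unfold_locales; (rule vec_op.add[OF vec_op_app] vec_op.scale[OF vec_op_app] n q)?)
    fix x
    show "app 1 (A Gb) (app 0 (A Ga) x) = fscale q (app 0 (A Ga) (app 1 (A Gb) x))"
      using A by (intro ext) (simp add: rels_def sq sm ge)
    show "app 0 (A Gd) (app 1 (A Gb) x) = fscale q (app 1 (A Gb) (app 0 (A Gd) x))"
      using A by (intro ext) (simp add: rels_def sq sm ge)
    show "app 1 (A Gc) (app 0 (A Ga) x) = fscale q (app 0 (A Ga) (app 1 (A Gc) x))"
      using A by (intro ext) (simp add: rels_def sq sm ge)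
    show "app 0 (A Gd) (app 1 (A Gc) x) = fscale q (app 1 (A Gc) (app 0 (A Gd) x))"
      using A by (intro ext) (simp add: rels_def sq sm ge)
    show "app 1 (A Gb) (app 1 (A Gc) x) = app 1 (A Gc) (app 1 (A Gb) x)"
      using A by (simp add: rels_def sq)
    show "(app 0 (A Ga) ^^ n) x = 0" "(app 0 (A Gd) ^^ n) x = 0"
      using A n by (auto simp: rels_def app_pow[OF c] fun_eq_iff zero_power app_def)
    show "(app 1 (A Gb) ^^ n) x = x" "(app 1 (A Gc) ^^ n) x = x"
      using A n by (simp_all add: rels_def app_pow[OF c] app_one)
    show "app 0 (A Gd) (app 0 (A Ga) x) - fscale q (app 0 (A Ga) (app 0 (A Gd) x)) = x - app 1 (A Gb) (app 1 (A Gc) x)"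
    proof
      fix i
      show "(app 0 (A Gd) (app 0 (A Ga) x) - fscale q (app 0 (A Ga) (app 0 (A Gd) x))) i = (x - app 1 (A Gb) (app 1 (A Gc) x)) i"
      proof (cases "i < N")
        case True
        have "app 0 (A Gd * A Ga - q \<cdot>\<^sub>m (A Ga * A Gd)) x i = app 0 (1\<^sub>m N - A Gb * A Gc) x i"
          using A by (simp add: rels_def)
        also have "app 0 (1\<^sub>m N - A Gb * A Gc) x i = x i - app 0 (A Gb * A Gc) x i"
          using app_minus[OF one_carrier_mat mc True] by (simp add: app_one_lt[OF True])
        also have "app 0 (A Gb * A Gc) x i = app 1 (A Gb * A Gc) x i"
          by (simp add: app_lt[OF mc True])
        finally show ?thesis using True
          by (simp add: sq sm app_minus[OF mc smult_carrier_mat[OF mc] True])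
      qed (simp add: sq ge)
    qed
  qed
qed

lemma rep_op:
  assumes "is_module n q M" "1 < n" "is_primitive_root n q"
  shows "rep fscale n q (op n q M Ga) (op n q M Gb) (op n q M Gc) (op n q M Gd)"
  using rep_app[OF is_module_rels assms(2,3)] assms(1) by (simp add: op_def counit_def)

lemma vec_op_op: "vec_op fscale (op n q M g)"
  by (simp add: op_def vec_op_app)

lemma op_ge: "is_module n q M \<Longrightarrow> \<not> i < mdim M \<Longrightarrow> op n q M g f i = counit g * f i"
  unfolding op_def by (rule app_ge[OF gmat_carrier])

lemma op_lt: "is_module n q M \<Longrightarrow> i < mdim M \<Longrightarrow> op n q M g f i = (\<Sum>j<mdim M. gmat n q M g $$ (i, j) * f j)"
  unfolding op_def by (rule app_lt[OF gmat_carrier])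

lemma is_hom_app:
  assumes "is_hom n q M N f"
  shows "app 0 f (op n q M g x) = op n q N g (app 0 f x)"
proof
  have M: "is_module n q M" and N: "is_module n q N" and f: "f \<in> carrier_mat (mdim N) (mdim M)"
    and e: "f * gmat n q M g = gmat n q N g * f" using assms by (auto simp: is_hom_iff)
  fix i
  show "app 0 f (op n q M g x) i = op n q N g (app 0 f x) i"
  proof (cases "i < mdim N")
    case True
    thus ?thesis unfolding op_def
      using app_mult_lt[OF f gmat_carrier[OF M] True, of 0 "counit g" g x 0]
        app_mult_lt[OF gmat_carrier[OF N] f True, of "counit g" g 0 x 0] by (simp add: e)
  qed (simp add: op_ge[OF N] app_ge[OF f])
qed

lemma is_homI_app:
  assumes M: "is_module n q M" and N: "is_module n q N" and f: "f \<in> carrier_mat (mdim N) (mdim M)"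
    and e: "\<And>g x i. i < mdim N \<Longrightarrow> app 0 f (op n q M g x) i = op n q N g (app 0 f x) i"
  shows "is_hom n q M N f"
proof -
  have "f * gmat n q M g = gmat n q N g * f" for g
  proof (rule mat_eq_app)
    show "f * gmat n q M g \<in> carrier_mat (mdim N) (mdim M)" "gmat n q N g * f \<in> carrier_mat (mdim N) (mdim M)"
      using f gmat_carrier[OF M] gmat_carrier[OF N] mult_carrier_mat by blast+
    fix x i assume i: "i < mdim N"
    show "app 0 (f * gmat n q M g) x i = app 0 (gmat n q N g * f) x i"
      using e[OF i, of g x] app_mult_lt[OF f gmat_carrier[OF M] i, of 0 "counit g" g x 0]
        app_mult_lt[OF gmat_carrier[OF N] f i, of "counit g" g 0 x 0] by (simp add: op_def)
  qed
  thus ?thesis using M N f by (simp add: is_hom_iff)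
qed

lemma is_hom_columns:
  assumes M: "is_module n q M" and N: "is_module n q N"
    and e: "\<And>g j i. j < mdim M \<Longrightarrow> i < mdim N \<Longrightarrow>
      op n q N g (w j) i = (\<Sum>k<mdim M. gmat n q M g $$ (k, j) * w k i)"
  shows "is_hom n q M N (mat (mdim N) (mdim M) (\<lambda>(i, j). w j i))"
proof -
  let ?f = "mat (mdim N) (mdim M) (\<lambda>(i, j). w j i)"
  have "?f * gmat n q M g = gmat n q N g * ?f" for g
  proof (rule eq_matI)
    have c: "gmat n q M g \<in> carrier_mat (mdim M) (mdim M)" "gmat n q N g \<in> carrier_mat (mdim N) (mdim N)"
      using gmat_carrier M N by auto
    fix i j assume "i < dim_row (gmat n q N g * ?f)" "j < dim_col (gmat n q N g * ?f)"
    hence ij: "i < mdim N" "j < mdim M" using c by auto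
    show "(?f * gmat n q M g) $$ (i, j) = (gmat n q N g * ?f) $$ (i, j)"
      using e[OF ij(2,1), of g] c ij
      by (simp add: op_lt[OF N] scalar_prod_def atLeast0LessThan mult.commute)
  qed (use gmat_carrier[OF M, of g] gmat_carrier[OF N, of g] in auto)
  thus ?thesis using M N by (simp add: is_hom_iff)
qed

lemma is_epi_iff:
  "is_epi n q M N f \<longleftrightarrow> is_hom n q M N f \<and> (\<forall>y. \<exists>x. \<forall>i<mdim N. app 0 f x i = y i)"
proof (cases "is_hom n q M N f")
  case True
  hence f: "f \<in> carrier_mat (mdim N) (mdim M)" by (simp add: is_hom_iff)
  have mv: "(f *\<^sub>v vec (mdim M) x) $ i = app 0 f x i" if "i < mdim N" for x i
    using f that by (simp add: app_lt[OF f that] scalar_prod_def atLeast0LessThan)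
  show ?thesis
  proof
    assume e: "is_epi n q M N f"
    show "is_hom n q M N f \<and> (\<forall>y. \<exists>x. \<forall>i<mdim N. app 0 f x i = y i)"
    proof (intro conjI True allI)
      fix y
      have "vec (mdim N) y \<in> (\<lambda>v. f *\<^sub>v v) ` carrier_vec (mdim M)" using e by (auto simp: is_epi_def)
      then obtain v where v: "v \<in> carrier_vec (mdim M)" "vec (mdim N) y = f *\<^sub>v v" by auto
      have "v = vec (mdim M) (\<lambda>i. v $ i)" using v(1) by auto
      hence "app 0 f (\<lambda>i. v $ i) i = y i" if "i < mdim N" for i
        using mv[OF that, of "\<lambda>i. v $ i"] v(2) that by (metis index_vec)
      thus "\<exists>x. \<forall>i<mdim N. app 0 f x i = y i" by blast
    qed
  next
    assume "is_hom n q M N f \<and> (\<forall>y. \<exists>x. \<forall>i<mdim N. app 0 f x i = y i)"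
    hence s: "\<exists>x. \<forall>i<mdim N. app 0 f x i = y i" for y by blast
    have "v \<in> (\<lambda>v. f *\<^sub>v v) ` carrier_vec (mdim M)" if v: "v \<in> carrier_vec (mdim N)" for v
    proof -
      obtain x where x: "\<And>i. i < mdim N \<Longrightarrow> app 0 f x i = v $ i" using s[of "\<lambda>i. v $ i"] by auto
      have "v = f *\<^sub>v vec (mdim M) x"
        by (rule eq_vecI) (use v f x mv in auto)
      thus ?thesis by auto
    qed
    moreover have "f *\<^sub>v v \<in> carrier_vec (mdim N)" if "v \<in> carrier_vec (mdim M)" for v
      using f that by auto
    ultimately show "is_epi n q M N f" using True by (auto simp: is_epi_def)
  qed
qed (simp add: is_epi_def)

lemma is_hom_comp:
  assumes "is_hom n q M N f" "is_hom n q N K g"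
  shows "is_hom n q M K (g * f)"
proof -
  have c: "f \<in> carrier_mat (mdim N) (mdim M)" "g \<in> carrier_mat (mdim K) (mdim N)"
    and m: "is_module n q M" "is_module n q N" "is_module n q K" using assms by (auto simp: is_hom_iff)
  have "g * f * gmat n q M h = gmat n q K h * (g * f)" for h
  proof -
    have "g * f * gmat n q M h = g * (f * gmat n q M h)"
      by (rule assoc_mult_mat[OF c(2,1) gmat_carrier[OF m(1)]])
    also have "f * gmat n q M h = gmat n q N h * f" using assms by (simp add: is_hom_iff)
    also have "g * \<dots> = g * gmat n q N h * f"
      by (rule assoc_mult_mat[OF c(2) gmat_carrier[OF m(2)] c(1), symmetric])
    also have "g * gmat n q N h = gmat n q K h * g" using assms by (simp add: is_hom_iff)
    also have "\<dots> * f = gmat n q K h * (g * f)"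
      by (rule assoc_mult_mat[OF gmat_carrier[OF m(3)] c(2,1)])
    finally show ?thesis .
  qed
  thus ?thesis using m mult_carrier_mat[OF c(2,1)] by (simp add: is_hom_iff)
qed

section \<open>The simple modules and their projective covers\<close>

text \<open>On a highest weight vector \<open>u\<close> of weight \<open>(\<beta>, \<gamma>)\<close>, \<open>d a\<^sup>j u = hcoef q (\<beta> \<gamma>) j a\<^bsup>j-1\<^esup> u\<close>.\<close>

definition hcoef :: "'k::field \<Rightarrow> 'k \<Rightarrow> nat \<Rightarrow> 'k" where
  "hcoef q \<kappa> j = qnum q j * (1 - q ^ (j - 1) * \<kappa>)"

lemma hcoef_0 [simp]: "hcoef q \<kappa> 0 = 0"
  by (simp add: hcoef_def)

text \<open>The relation d a - q a d = 1 - b c, evaluated on a^i u.\<close>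

lemma hcoef_Suc: "hcoef q \<kappa> (Suc i) - q * hcoef q \<kappa> i = 1 - q ^ i * q ^ i * \<kappa>"
proof (cases i)
  case (Suc j)
  have "hcoef q \<kappa> (Suc i) = (1 + q * qnum q i) - q ^ i * \<kappa> * (qnum q i + q ^ i)"
    using qnum_Suc[of q i] by (simp add: hcoef_def algebra_simps)
  moreover have "q * hcoef q \<kappa> i = q * qnum q i - q ^ i * \<kappa> * qnum q i"
    using Suc by (simp add: hcoef_def algebra_simps del: sum.lessThan_Suc)
  ultimately have "hcoef q \<kappa> (Suc i) - q * hcoef q \<kappa> i =
      (1 + q * qnum q i) - q ^ i * \<kappa> * (qnum q i + q ^ i) - (q * qnum q i - q ^ i * \<kappa> * qnum q i)"
    by (simp only:)
  thus ?thesis by (simp add: algebra_simps)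
qed (simp add: hcoef_def)

text \<open>A nonzero entry of A^k forces the height to rise by at least k, but all heights are
  below n.\<close>

lemma nilpotent_mat:
  fixes A :: "'k::field mat"
  assumes A: "A \<in> carrier_mat N N" and h: "\<And>i j. i < N \<Longrightarrow> j < N \<Longrightarrow> A $$ (i, j) \<noteq> 0 \<Longrightarrow> h j < (h i :: nat)"
    and n: "\<And>i. i < N \<Longrightarrow> h i < n"
  shows "A ^\<^sub>m n = 0\<^sub>m N N"
proof -
  have *: "h j + k \<le> h i" if "i < N" "j < N" "(A ^\<^sub>m k) $$ (i, j) \<noteq> 0" for i j k
    using that
  proof (induction k arbitrary: j)
    case 0
    thus ?case using A by (auto split: if_splits)
  next
    case (Suc k)
    have "(A ^\<^sub>m Suc k) $$ (i, j) = (\<Sum>x<N. (A ^\<^sub>m k) $$ (i, x) * A $$ (x, j))"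
      using A Suc.prems by (simp add: scalar_prod_def atLeast0LessThan)
    then obtain x where x: "x < N" "(A ^\<^sub>m k) $$ (i, x) \<noteq> 0" "A $$ (x, j) \<noteq> 0"
      using Suc.prems(3) by (metis (no_types, lifting) lessThan_iff mult_eq_0_iff sum.neutral)
    show ?case using Suc.IH[OF Suc.prems(1) x(1,2)] h[OF x(1) Suc.prems(2) x(3)] by simp
  qed
  show ?thesis
  proof (rule eq_matI)
    fix i j assume "i < dim_row (0\<^sub>m N N :: 'k mat)" "j < dim_col (0\<^sub>m N N :: 'k mat)"
    hence "i < N" "j < N" by auto
    thus "(A ^\<^sub>m n) $$ (i, j) = 0\<^sub>m N N $$ (i, j)" using *[of i j n] n[of i] by fastforce
  qed (use A in auto)
qed

lemma diag_pow:
  "mat N N (\<lambda>(i, j). if i = j then w i else 0) ^\<^sub>m k = mat N N (\<lambda>(i, j). if i = j then w i ^ k else (0 :: 'k::field))"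
proof (induction k)
  case 0
  show ?case by (rule eq_matI) auto
next
  case (Suc k)
  show ?case
  proof (rule eq_matI)
    fix i j assume "i < dim_row (mat N N (\<lambda>(i, j). if i = j then w i ^ Suc k else 0))"
      "j < dim_col (mat N N (\<lambda>(i, j). if i = j then w i ^ Suc k else 0))"
    hence ij: "i < N" "j < N" by auto
    show "(mat N N (\<lambda>(i, j). if i = j then w i else 0) ^\<^sub>m Suc k) $$ (i, j) =
      mat N N (\<lambda>(i, j). if i = j then w i ^ Suc k else 0) $$ (i, j)"
      unfolding pow_mat.simps Suc
      using ij by (simp add: scalar_prod_def if_distrib[of "\<lambda>x. x * _"] mult.commute cong: if_cong)
  qed (auto simp: Suc)
qed

text \<open>For a matrix given by its action on coordinates the quadratic relations become pointwise
  identities; since only indices below N are tested, the scalar 0 outside the range is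
  harmless.\<close>

lemma rels_appI:
  assumes c: "\<And>g. A g \<in> carrier_mat N N"
    and ba: "\<And>f i. i < N \<Longrightarrow> app 0 (A Gb) (app 0 (A Ga) f) i = q * app 0 (A Ga) (app 0 (A Gb) f) i"
    and db: "\<And>f i. i < N \<Longrightarrow> app 0 (A Gd) (app 0 (A Gb) f) i = q * app 0 (A Gb) (app 0 (A Gd) f) i"
    and ca: "\<And>f i. i < N \<Longrightarrow> app 0 (A Gc) (app 0 (A Ga) f) i = q * app 0 (A Ga) (app 0 (A Gc) f) i"
    and dc: "\<And>f i. i < N \<Longrightarrow> app 0 (A Gd) (app 0 (A Gc) f) i = q * app 0 (A Gc) (app 0 (A Gd) f) i"
    and bc: "\<And>f i. i < N \<Longrightarrow> app 0 (A Gb) (app 0 (A Gc) f) i = app 0 (A Gc) (app 0 (A Gb) f) i"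
    and da: "\<And>f i. i < N \<Longrightarrow> app 0 (A Gd) (app 0 (A Ga) f) i - q * app 0 (A Ga) (app 0 (A Gd) f) i
        = f i - app 0 (A Gb) (app 0 (A Gc) f) i"
    and "A Ga ^\<^sub>m n = 0\<^sub>m N N" "A Gb ^\<^sub>m n = 1\<^sub>m N" "A Gc ^\<^sub>m n = 1\<^sub>m N" "A Gd ^\<^sub>m n = 0\<^sub>m N N"
  shows "rels n q N A"
proof -
  have mc: "A g * A h \<in> carrier_mat N N" for g h using c by (rule mult_carrier_mat[OF c])
  note m = app_mult_lt[OF c c, where \<epsilon> = 0 and \<epsilon>' = 0 and \<epsilon>'' = 0, symmetric]
  have sm: "i < N \<Longrightarrow> app 0 (r \<cdot>\<^sub>m (A g * A h)) f i = r * app 0 (A g * A h) f i" for r g h f i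
    using carrier_matD[OF c[of g]] by (simp add: app_smult)
  have eq: "A g * A h = r \<cdot>\<^sub>m (A g' * A h')"
    if "\<And>f i. i < N \<Longrightarrow> app 0 (A g) (app 0 (A h) f) i = r * app 0 (A g') (app 0 (A h') f) i" for g h g' h' r
    by (rule mat_eq_app[OF mc smult_carrier_mat[OF mc]]) (simp add: m sm that)
  have "A Gb * A Gc = 1 \<cdot>\<^sub>m (A Gc * A Gb)" by (rule eq) (simp add: bc)
  moreover have "A Gd * A Ga - q \<cdot>\<^sub>m (A Ga * A Gd) = 1\<^sub>m N - A Gb * A Gc"
  proof (rule mat_eq_app)
    fix f i assume i: "i < N"
    show "app 0 (A Gd * A Ga - q \<cdot>\<^sub>m (A Ga * A Gd)) f i = app 0 (1\<^sub>m N - A Gb * A Gc) f i"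
      using da[OF i, of f]
      by (simp add: app_minus[OF mc smult_carrier_mat[OF mc] i] app_minus[OF one_carrier_mat mc i] sm[OF i] m[OF i] app_one_lt[OF i])
  qed (use mc in \<open>auto intro!: minus_carrier_mat\<close>)
  ultimately show ?thesis
    using assms eq[OF ba] eq[OF db] eq[OF ca] eq[OF dc]
    by (simp add: rels_def one_smult_mat)
qed

lemma powi_pow_root: "q ^ n = 1 \<Longrightarrow> (q powi e) ^ n = (1 :: 'k::field)"
proof -
  assume "q ^ n = 1"
  have "(q powi e) ^ n = (q ^ n) powi e"
    by (metis mult.commute power_int_mult power_int_of_nat)
  thus ?thesis using \<open>q ^ n = 1\<close> by simp
qed

text \<open>The highest weight of V(l,r) is (q^r, q^(1-r-l)), with product q^(1-l).\<close>

lemma alpha_hcoef: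
  assumes "q \<noteq> 0"
  shows "alpha q l (Suc i) = hcoef q (q powi (1 - int l)) (Suc i)"
proof -
  have "q powi (int (Suc i) - int l) = q powi (int i + (1 - int l))" by (simp add: algebra_simps)
  also have "\<dots> = q ^ i * q powi (1 - int l)" using assms by (simp add: power_int_add)
  finally show ?thesis by (simp add: alpha_def hcoef_def del: sum.lessThan_Suc)
qed

lemma V_gen_carrier: "V_gen q l r g \<in> carrier_mat l l"
  by (cases g) (auto simp: V_gen.simps)

declare V_gen.simps [simp del]

lemma app_V_gen:
  assumes i: "i < l"
  shows "app \<epsilon> (V_gen q l r Ga) f i = (if i = 0 then 0 else f (i - 1))"
    "app \<epsilon> (V_gen q l r Gb) f i = q powi (r + int i) * f i"
    "app \<epsilon> (V_gen q l r Gc) f i = q powi (int i + 1 - r - int l) * f i"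
    "app \<epsilon> (V_gen q l r Gd) f i = (if Suc i < l then alpha q l (Suc i) * f (Suc i) else 0)"
proof -
  note c = app_lt[OF V_gen_carrier i]
  show "app \<epsilon> (V_gen q l r Ga) f i = (if i = 0 then 0 else f (i - 1))"
    unfolding c using i by (cases i) (simp_all add: V_gen.simps if_distrib[of "\<lambda>x. x * _"] cong: if_cong)
  show "app \<epsilon> (V_gen q l r Gb) f i = q powi (r + int i) * f i"
    unfolding c using i by (simp add: V_gen.simps if_distrib[of "\<lambda>x. x * _"] cong: if_cong)
  show "app \<epsilon> (V_gen q l r Gc) f i = q powi (int i + 1 - r - int l) * f i"
    unfolding c using i by (simp add: V_gen.simps if_distrib[of "\<lambda>x. x * _"] cong: if_cong)
  show "app \<epsilon> (V_gen q l r Gd) f i = (if Suc i < l then alpha q l (Suc i) * f (Suc i) else 0)"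
    unfolding c using i by (simp add: V_gen.simps if_distrib[of "\<lambda>x. x * _"] cong: if_cong)
qed

context
  fixes n :: nat and q :: "'k::field"
  assumes n: "1 < n" and q: "is_primitive_root n q"
begin

lemma q_ne_0: "q \<noteq> 0"
  using primitive_rootD(1)[OF q] n by (auto simp: zero_power)

lemma rels_V:
  assumes l: "l \<le> n"
  shows "rels n q l (V_gen q l r)"
proof (rule rels_appI)
  note A = app_V_gen[where \<epsilon> = 0 and l = l and r = r and q = q]
  have pw: "q powi (x + 1) = q * q powi x" "q powi (1 + x) = q * q powi x" for x
    using q_ne_0 by (simp_all add: power_int_add mult.commute)
  fix f :: "nat \<Rightarrow> 'k" and i assume i: "i < l"
  show "app 0 (V_gen q l r Gb) (app 0 (V_gen q l r Ga) f) i = q * app 0 (V_gen q l r Ga) (app 0 (V_gen q l r Gb) f) i"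
    using i pw(1)[of "r + int i - 1"] by (cases i) (simp_all add: A algebra_simps)
  show "app 0 (V_gen q l r Gd) (app 0 (V_gen q l r Gb) f) i = q * app 0 (V_gen q l r Gb) (app 0 (V_gen q l r Gd) f) i"
    using i by (simp add: A pw add.assoc[symmetric] add.commute[of 1])
  show "app 0 (V_gen q l r Gc) (app 0 (V_gen q l r Ga) f) i = q * app 0 (V_gen q l r Ga) (app 0 (V_gen q l r Gc) f) i"
    using i pw(1)[of "int i - r - int l"] by (cases i) (simp_all add: A pw(1)[symmetric] algebra_simps)
  show "app 0 (V_gen q l r Gd) (app 0 (V_gen q l r Gc) f) i = q * app 0 (V_gen q l r Gc) (app 0 (V_gen q l r Gd) f) i"
    using i pw(1)[of "int i + 1 - r - int l"] by (simp add: A algebra_simps)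
  show "app 0 (V_gen q l r Gb) (app 0 (V_gen q l r Gc) f) i = app 0 (V_gen q l r Gc) (app 0 (V_gen q l r Gb) f) i"
    using i by (simp add: A)
  show "app 0 (V_gen q l r Gd) (app 0 (V_gen q l r Ga) f) i - q * app 0 (V_gen q l r Ga) (app 0 (V_gen q l r Gd) f) i
        = f i - app 0 (V_gen q l r Gb) (app 0 (V_gen q l r Gc) f) i"
  proof -
    let ?\<kappa> = "q powi (1 - int l)"
    have e: "q powi (r + int i) * q powi (int i + 1 - r - int l) = q ^ i * q ^ i * ?\<kappa>"
      using q_ne_0 by (simp add: power_int_add[symmetric] power_int_of_nat[symmetric] algebra_simps del: power_int_of_nat)
    \<comment> \<open>The string stops after l vectors although a alone would continue it; this is
      consistent because the next coefficient of d is zero.\<close>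
    have l0: "hcoef q ?\<kappa> l = 0"
    proof (cases l)
      case (Suc k)
      have "alpha q l l = 0" by (simp add: alpha_def)
      thus ?thesis using alpha_hcoef[OF q_ne_0, of l k] Suc by simp
    qed simp
    have "app 0 (V_gen q l r Gd) (app 0 (V_gen q l r Ga) f) i = hcoef q ?\<kappa> (Suc i) * f i"
      using i l0 by (cases "Suc i = l") (auto simp: A alpha_hcoef[OF q_ne_0])
    moreover have "app 0 (V_gen q l r Ga) (app 0 (V_gen q l r Gd) f) i = hcoef q ?\<kappa> i * f i"
      using i by (cases i) (auto simp: A alpha_hcoef[OF q_ne_0])
    moreover have "app 0 (V_gen q l r Gb) (app 0 (V_gen q l r Gc) f) i = q ^ i * q ^ i * ?\<kappa> * f i"
      using i by (simp add: A e mult.assoc[symmetric])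
    ultimately have "app 0 (V_gen q l r Gd) (app 0 (V_gen q l r Ga) f) i - q * app 0 (V_gen q l r Ga) (app 0 (V_gen q l r Gd) f) i =
       (hcoef q ?\<kappa> (Suc i) - q * hcoef q ?\<kappa> i) * f i"
      "app 0 (V_gen q l r Gb) (app 0 (V_gen q l r Gc) f) i = q ^ i * q ^ i * ?\<kappa> * f i"
      by (simp_all add: algebra_simps)
    thus ?thesis unfolding hcoef_Suc by (simp add: algebra_simps)
  qed
next
  show "V_gen q l r Ga ^\<^sub>m n = 0\<^sub>m l l"
    by (rule nilpotent_mat[where h = id]) (use l in \<open>auto simp: V_gen.simps split: if_splits\<close>)
  show "V_gen q l r Gd ^\<^sub>m n = 0\<^sub>m l l"
    by (rule nilpotent_mat[where h = "\<lambda>i. l - Suc i"]) (use l in \<open>auto simp: V_gen.simps split: if_splits\<close>)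
  show "V_gen q l r Gb ^\<^sub>m n = 1\<^sub>m l" "V_gen q l r Gc ^\<^sub>m n = 1\<^sub>m l"
    by (auto simp: V_gen.simps diag_pow powi_pow_root primitive_rootD(1)[OF q] intro!: eq_matI)
qed (auto simp: V_gen_carrier)

lemma V_module:
  assumes "l \<le> n"
  shows "is_module n q (V q l r)" "gmat n q (V q l r) = V_gen q l r" "mdim (V q l r) = l"
  using module_of_gens[OF rels_V[OF assms]] by (simp_all add: V_def)

lemma op_V:
  assumes "l \<le> n" "i < l"
  shows "op n q (V q l r) Ga f i = (if i = 0 then 0 else f (i - 1))"
    "op n q (V q l r) Gb f i = q powi (r + int i) * f i"
    "op n q (V q l r) Gc f i = q powi (int i + 1 - r - int l) * f i"
    "op n q (V q l r) Gd f i = (if Suc i < l then alpha q l (Suc i) * f (Suc i) else 0)"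
  using assms by (simp_all add: op_def V_module app_V_gen)

end

text \<open>
  A \<open>2n\<close>-dimensional model of the projective cover of the simple module whose highest weight is
  \<open>(\<beta>, \<gamma>)\<close>, where \<open>q\<^sup>m \<beta> \<gamma> = q\<close>.  The basis vectors \<open>e\<^sub>i = a\<^sup>i e\<^sub>0\<close> and
  \<open>f\<^sub>i = a\<^sup>i f\<^sub>0\<close> have the indices \<open>i\<close> and \<open>n + i\<close>; \<open>f\<^sub>0\<close> is a highest weight vector
  and \<open>d e\<^sub>0 = f\<^bsub>n-m-1\<^esub>\<close>.
\<close>

fun Q_gen :: "nat \<Rightarrow> 'k::field \<Rightarrow> nat \<Rightarrow> 'k \<Rightarrow> 'k \<Rightarrow> gen \<Rightarrow> 'k mat" where
  "Q_gen n q m \<beta> \<gamma> Ga = mat (2 * n) (2 * n) (\<lambda>(i, j). if i = Suc j \<and> i \<noteq> n then 1 else 0)"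
| "Q_gen n q m \<beta> \<gamma> Gb = mat (2 * n) (2 * n) (\<lambda>(i, j). if i = j then (if i < n then \<beta> * q ^ i else \<beta> * q ^ m * q ^ (i - n)) else 0)"
| "Q_gen n q m \<beta> \<gamma> Gc = mat (2 * n) (2 * n) (\<lambda>(i, j). if i = j then (if i < n then \<gamma> * q ^ i else \<gamma> * q ^ m * q ^ (i - n)) else 0)"
| "Q_gen n q m \<beta> \<gamma> Gd = mat (2 * n) (2 * n) (\<lambda>(i, j).
     (if j = Suc i then if j < n then hcoef q (\<beta> * \<gamma>) j else if i < n then 0 else hcoef q (q ^ Suc m) (j - n) else 0) +
     (if j + (2 * n - m - 1) = i then q ^ j else 0))"

lemma Q_gen_carrier: "Q_gen n q m \<beta> \<gamma> g \<in> carrier_mat (2 * n) (2 * n)"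
  by (cases g) auto

declare Q_gen.simps [simp del]

text \<open>\<open>2 * n - m - 1\<close> is the index of f_(n-m-1). From d e_0 = f_(n-m-1) the
  relations give d e_j an additional term q^j f_(n-m-1+j), understood as zero beyond f_(n-1). The
  product of the weights of f_0 is q^(2m) beta gamma, which is q^(m+1) when q^m beta gamma =
  q.\<close>

lemma app_Q_gen:
  assumes i: "i < 2 * n" and m: "m < n"
  shows "app \<epsilon> (Q_gen n q m \<beta> \<gamma> Ga) f i = (if i = 0 \<or> i = n then 0 else f (i - 1))"
    "app \<epsilon> (Q_gen n q m \<beta> \<gamma> Gb) f i = (if i < n then \<beta> * q ^ i else \<beta> * q ^ m * q ^ (i - n)) * f i"
    "app \<epsilon> (Q_gen n q m \<beta> \<gamma> Gc) f i = (if i < n then \<gamma> * q ^ i else \<gamma> * q ^ m * q ^ (i - n)) * f i"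
    "app \<epsilon> (Q_gen n q m \<beta> \<gamma> Gd) f i =
      (if Suc i < n then hcoef q (\<beta> * \<gamma>) (Suc i) * f (Suc i) else
       if n \<le> i \<and> Suc i < 2 * n then hcoef q (q ^ Suc m) (Suc i - n) * f (Suc i) else 0) +
      (if 2 * n - m - 1 \<le> i then q ^ (i - (2 * n - m - 1)) * f (i - (2 * n - m - 1)) else 0)"
proof -
  note c = app_lt[OF Q_gen_carrier i]
  show "app \<epsilon> (Q_gen n q m \<beta> \<gamma> Ga) f i = (if i = 0 \<or> i = n then 0 else f (i - 1))"
    unfolding c using i by (cases i) (auto simp: Q_gen.simps if_distrib[of "\<lambda>x. x * _"] cong: if_cong conj_cong)
  show "app \<epsilon> (Q_gen n q m \<beta> \<gamma> Gb) f i = (if i < n then \<beta> * q ^ i else \<beta> * q ^ m * q ^ (i - n)) * f i"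
    unfolding c using i by (simp add: Q_gen.simps if_distrib[of "\<lambda>x. x * _"] cong: if_cong)
  show "app \<epsilon> (Q_gen n q m \<beta> \<gamma> Gc) f i = (if i < n then \<gamma> * q ^ i else \<gamma> * q ^ m * q ^ (i - n)) * f i"
    unfolding c using i by (simp add: Q_gen.simps if_distrib[of "\<lambda>x. x * _"] cong: if_cong)
  let ?k = "i - (2 * n - m - 1)"
  have "app \<epsilon> (Q_gen n q m \<beta> \<gamma> Gd) f i =
     (\<Sum>j<2 * n. if j = Suc i then (if j < n then hcoef q (\<beta> * \<gamma>) j else if i < n then 0 else hcoef q (q ^ Suc m) (j - n)) * f j else 0) +
     (\<Sum>j<2 * n. if j + (2 * n - m - 1) = i then q ^ j * f j else 0)"
    using i unfolding sum.distrib[symmetric] c by (intro sum.cong) (auto simp: Q_gen.simps algebra_simps)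
  also have "(\<Sum>j<2 * n. if j = Suc i then (if j < n then hcoef q (\<beta> * \<gamma>) j else if i < n then 0 else hcoef q (q ^ Suc m) (j - n)) * f j else 0) =
     (if Suc i < n then hcoef q (\<beta> * \<gamma>) (Suc i) * f (Suc i) else
       if n \<le> i \<and> Suc i < 2 * n then hcoef q (q ^ Suc m) (Suc i - n) * f (Suc i) else 0)"
    using i by auto
  also have "(\<Sum>j<2 * n. if j + (2 * n - m - 1) = i then q ^ j * f j else 0) =
     (\<Sum>j<2 * n. if j = ?k then (if 2 * n - m - 1 \<le> i then q ^ j * f j else 0) else 0)"
    using m by (intro sum.cong) auto
  also have "\<dots> = (if 2 * n - m - 1 \<le> i then q ^ ?k * f ?k else 0)" using i by auto
  finally show "app \<epsilon> (Q_gen n q m \<beta> \<gamma> Gd) f i =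
      (if Suc i < n then hcoef q (\<beta> * \<gamma>) (Suc i) * f (Suc i) else
       if n \<le> i \<and> Suc i < 2 * n then hcoef q (q ^ Suc m) (Suc i - n) * f (Suc i) else 0) +
      (if 2 * n - m - 1 \<le> i then q ^ ?k * f ?k else 0)" .
qed

definition Qmod :: "nat \<Rightarrow> 'k::field \<Rightarrow> nat \<Rightarrow> 'k \<Rightarrow> 'k \<Rightarrow> 'k fdmod" where
  "Qmod n q m \<beta> \<gamma> = module_of_gens (2 * n) (Q_gen n q m \<beta> \<gamma>)"

lemma mdim_Qmod [simp]: "mdim (Qmod n q m \<beta> \<gamma>) = 2 * n"
  by (simp add: Qmod_def)

context
  fixes n m :: nat and q \<beta> \<gamma> :: "'k::field"
  assumes n: "1 < n" and q: "is_primitive_root n q" and m: "1 \<le> m" "m < n"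
    and wts: "q ^ m * (\<beta> * \<gamma>) = q" "\<beta> ^ n = 1" "\<gamma> ^ n = 1"
begin

lemma rels_Q: "rels n q (2 * n) (Q_gen n q m \<beta> \<gamma>)"
proof (rule rels_appI)
  let ?Q = "Q_gen n q m \<beta> \<gamma>" and ?p = "2 * n - m - 1"
  note A = app_Q_gen[OF _ m(2), where \<epsilon> = 0 and q = q and \<beta> = \<beta> and \<gamma> = \<gamma>]
  note qn = primitive_rootD(1)[OF q]
  \<comment> \<open>The arrow from e_k to f_(n-m-1+k) lowers weights by q: the exponents m +
    (n-m-1+k) + 1 and k agree modulo n.\<close>
  have sh: "\<tau> * q ^ m * q ^ (i - n) * q = \<tau> * q ^ (i - ?p)" if "?p \<le> i" "i < 2 * n" for i and \<tau> :: 'k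
  proof -
    have "q ^ m * q ^ (i - n) * q = q ^ (m + (i - n) + 1)" by (simp add: power_add)
    also have "m + (i - n) + 1 = n + (i - ?p)" using that m by simp
    finally show ?thesis using qn by (simp add: power_add mult.assoc)
  qed
  have hn: "hcoef q (\<beta> * \<gamma>) n = 0"
  proof -
    have "(1 - q) * qnum q n = 0" using qn by (simp add: qnum_geometric)
    thus ?thesis using primitive_rootD(2)[OF q, of 1] n by (simp add: hcoef_def)
  qed
  have hn': "hcoef q (q ^ Suc m) n = 0"
  proof -
    have "(1 - q) * qnum q n = 0" using qn by (simp add: qnum_geometric)
    thus ?thesis using primitive_rootD(2)[OF q, of 1] n by (simp add: hcoef_def)
  qed
  fix f :: "nat \<Rightarrow> 'k" and i assume i: "i < 2 * n"
  show "app 0 (?Q Gb) (app 0 (?Q Ga) f) i = q * app 0 (?Q Ga) (app 0 (?Q Gb) f) i"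
    using i m by (cases i) (auto simp: A Suc_diff_le)
  show "app 0 (?Q Gc) (app 0 (?Q Ga) f) i = q * app 0 (?Q Ga) (app 0 (?Q Gc) f) i"
    using i m by (cases i) (auto simp: A Suc_diff_le)
  \<comment> \<open>The matrices of b and c have the same diagonal form, with tau = beta or tau =
    gamma, so one computation serves for both.\<close>
  have dt: "app 0 (?Q Gd) (\<lambda>i. if i < 2 * n then (if i < n then \<tau> * q ^ i else \<tau> * q ^ m * q ^ (i - n)) * f i else 0) i
    = q * ((if i < n then \<tau> * q ^ i else \<tau> * q ^ m * q ^ (i - n)) * app 0 (?Q Gd) f i)" for \<tau>
  proof (cases "?p \<le> i")
    case True
    thus ?thesis using i m sh[OF True i, of \<tau>] by (auto simp: A[OF i] Suc_diff_le algebra_simps)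
  next
    case False
    thus ?thesis using i m by (auto simp: A[OF i] Suc_diff_le algebra_simps)
  qed
  have eqf: "app 0 (?Q Gd) g i = app 0 (?Q Gd) h i" if "\<And>j. j < 2 * n \<Longrightarrow> g j = h j" for g h
    by (rule app_cong) (auto simp: that i carrier_matD[OF Q_gen_carrier])
  show "app 0 (?Q Gd) (app 0 (?Q Gb) f) i = q * app 0 (?Q Gb) (app 0 (?Q Gd) f) i"
    unfolding A(2)[OF i] dt[symmetric] by (rule eqf) (simp add: A(2))
  show "app 0 (?Q Gd) (app 0 (?Q Gc) f) i = q * app 0 (?Q Gc) (app 0 (?Q Gd) f) i"
    unfolding A(3)[OF i] dt[symmetric] by (rule eqf) (simp add: A(3))
  show "app 0 (?Q Gb) (app 0 (?Q Gc) f) i = app 0 (?Q Gc) (app 0 (?Q Gb) f) i"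
    using i by (simp add: A)
  show "app 0 (?Q Gd) (app 0 (?Q Ga) f) i - q * app 0 (?Q Ga) (app 0 (?Q Gd) f) i = f i - app 0 (?Q Gb) (app 0 (?Q Gc) f) i"
  proof (cases "i < n")
    case True
    have "app 0 (?Q Gd) (app 0 (?Q Ga) f) i = hcoef q (\<beta> * \<gamma>) (Suc i) * f i"
      using True i m hn by (cases "Suc i = n") (auto simp: A)
    moreover have "app 0 (?Q Ga) (app 0 (?Q Gd) f) i = hcoef q (\<beta> * \<gamma>) i * f i"
      using True i m by (cases i) (auto simp: A)
    moreover have "app 0 (?Q Gb) (app 0 (?Q Gc) f) i = q ^ i * q ^ i * (\<beta> * \<gamma>) * f i"
      using True i by (simp add: A algebra_simps)
    ultimately have "app 0 (?Q Gd) (app 0 (?Q Ga) f) i - q * app 0 (?Q Ga) (app 0 (?Q Gd) f) i =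
       (hcoef q (\<beta> * \<gamma>) (Suc i) - q * hcoef q (\<beta> * \<gamma>) i) * f i"
      "app 0 (?Q Gb) (app 0 (?Q Gc) f) i = q ^ i * q ^ i * (\<beta> * \<gamma>) * f i"
      by (simp_all add: algebra_simps)
    thus ?thesis unfolding hcoef_Suc by (simp add: algebra_simps)
  next
    case False
    let ?s = "\<lambda>i. if ?p \<le> i then q ^ (i - ?p) * f (i - ?p - 1) else 0"
    \<comment> \<open>The coordinates along the e_j contribute \<open>?u\<close> both to d a and to
      q a d. They cancel, and the relation reduces to that of the string of f_0.\<close>
    let ?u = "if ?p < i then q ^ (i - ?p) * f (i - ?p - 1) else 0"
    have k: "i = n + (i - n)" using False by simp
    have "app 0 (?Q Gd) (app 0 (?Q Ga) f) i = hcoef q (q ^ Suc m) (Suc (i - n)) * f i + ?u"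
    proof (cases "Suc i = 2 * n")
      case True
      hence "Suc (i - n) = n" using n by linarith
      thus ?thesis using True False i m hn' by (auto simp: A Suc_diff_le)
    next
      case False
      thus ?thesis using \<open>\<not> i < n\<close> i m by (auto simp: A Suc_diff_le)
    qed
    moreover have "app 0 (?Q Ga) (app 0 (?Q Gd) f) i = (if i = n then 0 else hcoef q (q ^ Suc m) (i - n) * f i +
        (if ?p \<le> i - 1 then q ^ (i - 1 - ?p) * f (i - 1 - ?p) else 0))"
      using False i m by (auto simp: A Suc_diff_le)
    hence "q * app 0 (?Q Ga) (app 0 (?Q Gd) f) i = q * hcoef q (q ^ Suc m) (i - n) * f i + ?u"
    proof (cases "?p < i")
      case True
      hence "i - ?p = Suc (i - 1 - ?p)" by simp
      hence "q ^ (i - ?p) * f (i - ?p - 1) = q * (q ^ (i - 1 - ?p) * f (i - 1 - ?p))"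
        by (simp only: power_Suc mult.assoc) simp
      thus ?thesis using True m \<open>app 0 (?Q Ga) (app 0 (?Q Gd) f) i = _\<close> by (auto simp: algebra_simps)
    qed (use m False in auto)
    moreover have "app 0 (?Q Gb) (app 0 (?Q Gc) f) i = q ^ (i - n) * q ^ (i - n) * q ^ Suc m * f i"
    proof -
      have "app 0 (?Q Gb) (app 0 (?Q Gc) f) i = (q ^ m * (\<beta> * \<gamma>)) * (q ^ m * q ^ (i - n) * q ^ (i - n) * f i)"
        using False i by (simp add: A algebra_simps)
      thus ?thesis unfolding wts(1) by (simp add: algebra_simps)
    qed
    ultimately have "app 0 (?Q Gd) (app 0 (?Q Ga) f) i - q * app 0 (?Q Ga) (app 0 (?Q Gd) f) i =
       (hcoef q (q ^ Suc m) (Suc (i - n)) - q * hcoef q (q ^ Suc m) (i - n)) * f i"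
      "app 0 (?Q Gb) (app 0 (?Q Gc) f) i = q ^ (i - n) * q ^ (i - n) * q ^ Suc m * f i"
      by (simp_all add: algebra_simps)
    thus ?thesis unfolding hcoef_Suc by (simp add: algebra_simps)
  qed
next
  let ?Q = "Q_gen n q m \<beta> \<gamma>"
  note qn = primitive_rootD(1)[OF q]
  show "?Q Ga ^\<^sub>m n = 0\<^sub>m (2 * n) (2 * n)"
    by (rule nilpotent_mat[where h = "\<lambda>i. if i < n then i else i - n"])
       (use n in \<open>auto simp: Q_gen.simps split: if_splits\<close>)
  have pw: "(\<tau> * q ^ i) ^ n = 1" "(\<tau> * q ^ m * q ^ i) ^ n = 1" if "\<tau> ^ n = 1" for \<tau> i
  proof -
    have "(q ^ j) ^ n = 1" for j using qn by (metis mult.commute power_mult power_one)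
    thus "(\<tau> * q ^ i) ^ n = 1" "(\<tau> * q ^ m * q ^ i) ^ n = 1" using that by (simp_all add: power_mult_distrib)
  qed
  show "?Q Gb ^\<^sub>m n = 1\<^sub>m (2 * n)" "?Q Gc ^\<^sub>m n = 1\<^sub>m (2 * n)"
    by (auto simp: Q_gen.simps diag_pow pw wts intro!: eq_matI)
  text \<open>The height of a basis vector: the length of the longest chain of arrows of \<open>d\<close> ending in it.\<close>
  let ?h = "\<lambda>i. if i < m then m - 1 - i else if i < n then n - 1 - i
     else if i < 2 * n - m then 2 * n - 1 - i else 3 * n - 1 - m - i"
  \<comment> \<open>The arrows of d from e_m to e_(m-1) and from f_(n-m) to f_(n-m-1) have
    coefficient zero. These breaks keep every chain of d shorter than n.\<close>
  have h0: "hcoef q (\<beta> * \<gamma>) m = 0" "hcoef q (q ^ Suc m) (n - m) = 0"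
  proof -
    have "q ^ (m - 1) * (\<beta> * \<gamma>) * q = q" using wts(1) m by (cases m) (simp_all add: algebra_simps)
    thus "hcoef q (\<beta> * \<gamma>) m = 0" using q_ne_0[OF n q] by (simp add: hcoef_def)
    have "(n - m - 1) + Suc m = n" using m by simp
    hence "q ^ (n - m - 1) * q ^ Suc m = q ^ n" by (metis power_add)
    thus "hcoef q (q ^ Suc m) (n - m) = 0" using qn by (simp add: hcoef_def del: power_Suc)
  qed
  show "?Q Gd ^\<^sub>m n = 0\<^sub>m (2 * n) (2 * n)"
  proof (rule nilpotent_mat[where h = ?h])
    fix i j assume ij: "i < 2 * n" "j < 2 * n" "?Q Gd $$ (i, j) \<noteq> 0"
    hence "j = Suc i \<and> j < n \<and> j \<noteq> m \<or> j = Suc i \<and> n \<le> i \<and> j - n \<noteq> n - m \<or> j + (2 * n - m - 1) = i"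
      using h0 by (auto simp: Q_gen.simps split: if_splits)
    thus "?h j < ?h i" using ij(1,2) m by auto
  next
    fix i assume "i < 2 * n"
    thus "?h i < n" using m by auto
  qed (rule Q_gen_carrier)
qed (rule Q_gen_carrier)

lemma Q_module: "is_module n q (Qmod n q m \<beta> \<gamma>)" "gmat n q (Qmod n q m \<beta> \<gamma>) = Q_gen n q m \<beta> \<gamma>"
  using module_of_gens[OF rels_Q] by (auto simp: Qmod_def)

lemma op_Q:
  assumes "i < 2 * n"
  shows "op n q (Qmod n q m \<beta> \<gamma>) Ga f i = (if i = 0 \<or> i = n then 0 else f (i - 1))"
    "op n q (Qmod n q m \<beta> \<gamma>) Gb f i = (if i < n then \<beta> * q ^ i else \<beta> * q ^ m * q ^ (i - n)) * f i"
    "op n q (Qmod n q m \<beta> \<gamma>) Gc f i = (if i < n then \<gamma> * q ^ i else \<gamma> * q ^ m * q ^ (i - n)) * f i"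
    "op n q (Qmod n q m \<beta> \<gamma>) Gd f i =
      (if Suc i < n then hcoef q (\<beta> * \<gamma>) (Suc i) * f (Suc i) else
       if n \<le> i \<and> Suc i < 2 * n then hcoef q (q ^ Suc m) (Suc i - n) * f (Suc i) else 0) +
      (if 2 * n - m - 1 \<le> i then q ^ (i - (2 * n - m - 1)) * f (i - (2 * n - m - 1)) else 0)"
  unfolding op_def Q_module(2) by (rule app_Q_gen[OF assms m(2)])+

end

section \<open>Submodules and essential epimorphisms\<close>

text \<open>A submodule, as a set of functions that is saturated with respect to values outside the index range.\<close>

definition submod :: "nat \<Rightarrow> 'k::field \<Rightarrow> 'k fdmod \<Rightarrow> (nat \<Rightarrow> 'k) set \<Rightarrow> bool" where
  "submod n q M I \<longleftrightarrow> (\<forall>x. (\<forall>i<mdim M. x i = 0) \<longrightarrow> x \<in> I) \<and> (\<forall>x\<in>I. \<forall>y\<in>I. x + y \<in> I) \<and>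
     (\<forall>r. \<forall>x\<in>I. fscale r x \<in> I) \<and> (\<forall>g. \<forall>x\<in>I. op n q M g x \<in> I)"

abbreviation (input) unitf :: "nat \<Rightarrow> nat \<Rightarrow> 'k::field" where
  "unitf j \<equiv> \<lambda>i. if i = j then 1 else 0"

context
  fixes n :: nat and q :: "'k::field" and M :: "'k fdmod" and I
  assumes I: "submod n q M I"
begin

lemma submod_vanish: "(\<And>i. i < mdim M \<Longrightarrow> x i = 0) \<Longrightarrow> x \<in> I"
  and submod_add: "x \<in> I \<Longrightarrow> y \<in> I \<Longrightarrow> x + y \<in> I"
  and submod_scale: "x \<in> I \<Longrightarrow> fscale r x \<in> I"
  and submod_op: "x \<in> I \<Longrightarrow> op n q M g x \<in> I"
  using I by (auto simp: submod_def)

lemma submod_cong: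
  assumes "x \<in> I" "\<And>i. i < mdim M \<Longrightarrow> y i = x i"
  shows "y \<in> I"
proof -
  have "x + (y - x) \<in> I" by (rule submod_add[OF assms(1) submod_vanish]) (simp add: assms(2))
  thus ?thesis by simp
qed

lemma submod_sum: "(\<And>j. j \<in> S \<Longrightarrow> f j \<in> I) \<Longrightarrow> sum f S \<in> I"
  by (induction S rule: infinite_finite_induct) (auto intro: submod_add submod_vanish)

lemma submod_funpow: "x \<in> I \<Longrightarrow> (op n q M g ^^ k) x \<in> I"
  by (induction k) (auto intro: submod_op)

lemma submod_eproj: "x \<in> I \<Longrightarrow> vec_op.eproj fscale (op n q M g) k \<beta> x \<in> I"
  unfolding vec_op.eproj_def[OF vec_op_op] by (intro submod_scale submod_sum submod_funpow)

lemma submod_eq_UNIV: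
  assumes "\<And>j. j < mdim M \<Longrightarrow> unitf j \<in> I"
  shows "I = UNIV"
proof -
  have "x \<in> I" for x
  proof (rule submod_cong)
    show "(\<Sum>j<mdim M. fscale (x j) (unitf j)) \<in> I" by (intro submod_sum submod_scale assms) simp
    fix i assume i: "i < mdim M"
    have "(\<Sum>j\<in>S. fscale (x j) (unitf j)) i = (\<Sum>j\<in>S. x j * unitf j i)" for S
      by (induction S rule: infinite_finite_induct) simp_all
    thus "x i = (\<Sum>j<mdim M. fscale (x j) (unitf j)) i"
      using i by (simp add: if_distrib[of "\<lambda>x. _ * x"] cong: if_cong)
  qed
  thus ?thesis by blast
qed

end

lemma submod_equalizer:
  assumes f: "is_hom n q M N f" and g: "is_hom n q M N g"
  shows "submod n q M {x. app 0 f x = app 0 g x}"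
  unfolding submod_def
proof (intro conjI allI impI ballI)
  have c: "f \<in> carrier_mat (mdim N) (mdim M)" "g \<in> carrier_mat (mdim N) (mdim M)"
    using f g by (auto simp: is_hom_iff)
  show "x \<in> {x. app 0 f x = app 0 g x}" if "\<forall>i<mdim M. x i = 0" for x
    using that c by (auto simp: app_def fun_eq_iff)
  show "op n q M h x \<in> {x. app 0 f x = app 0 g x}" if "x \<in> {x. app 0 f x = app 0 g x}" for h x
    using that by (simp add: is_hom_app[OF f] is_hom_app[OF g])
qed (auto simp: vec_op.add[OF vec_op_app] vec_op.scale[OF vec_op_app])

lemma submod_image:
  assumes f: "is_hom n q M N f" and I: "submod n q M I"
  shows "submod n q N {y. \<exists>x\<in>I. \<forall>i<mdim N. app 0 f x i = y i}"
  unfolding submod_def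
proof (intro conjI allI impI ballI)
  let ?J = "{y. \<exists>x\<in>I. \<forall>i<mdim N. app 0 f x i = y i}"
  show "x \<in> ?J" if "\<forall>i<mdim N. x i = 0" for x
    using that submod_vanish[OF I, of 0] vec_op.zero[OF vec_op_app, of 0 f] by (auto intro!: bexI[of _ 0])
  show "x + y \<in> ?J" if xy: "x \<in> ?J" "y \<in> ?J" for x y
  proof -
    obtain x' y' where "x' \<in> I" "y' \<in> I" "\<forall>i<mdim N. app 0 f x' i = x i" "\<forall>i<mdim N. app 0 f y' i = y i"
      using xy by auto
    thus ?thesis by (auto intro!: bexI[of _ "x' + y'"] submod_add[OF I] simp: vec_op.add[OF vec_op_app])
  qed
  show "fscale r x \<in> ?J" if x: "x \<in> ?J" for r x
  proof -
    obtain x' where "x' \<in> I" "\<forall>i<mdim N. app 0 f x' i = x i" using x by auto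
    thus ?thesis by (auto intro!: bexI[of _ "fscale r x'"] submod_scale[OF I] simp: vec_op.scale[OF vec_op_app])
  qed
  show "op n q N g x \<in> ?J" if x: "x \<in> ?J" for g x
  proof -
    obtain x' where x': "x' \<in> I" "\<forall>i<mdim N. app 0 f x' i = x i" using x by auto
    have N: "is_module n q N" using f by (simp add: is_hom_iff)
    have "app 0 f (op n q M g x') i = op n q N g x i" if "i < mdim N" for i
      unfolding is_hom_app[OF f] op_lt[OF N that] using x'(2) by (intro sum.cong) auto
    thus ?thesis using submod_op[OF I x'(1), of g] by blast
  qed
qed

lemma submod_UNIV: "submod n q M UNIV"
  by (simp add: submod_def)

text \<open>Essential epimorphisms in terms of submodules; the lemma \<open>ess_epi\<close> recovers the categorical condition.\<close>

definition ess :: "nat \<Rightarrow> 'k::field \<Rightarrow> 'k fdmod \<Rightarrow> 'k fdmod \<Rightarrow> 'k mat \<Rightarrow> bool" where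
  "ess n q M S p \<longleftrightarrow> is_epi n q M S p \<and>
     (\<forall>I. submod n q M I \<longrightarrow> (\<forall>s. \<exists>y\<in>I. \<forall>i<mdim S. app 0 p y i = s i) \<longrightarrow> I = UNIV)"

lemma app_app:
  "is_hom n q M N f \<Longrightarrow> is_hom n q N K g \<Longrightarrow> app 0 g (app 0 f x) = app 0 (g * f) x"
  by (rule app_mult_0) (auto simp: is_hom_iff)

lemma ess_id:
  assumes M: "is_module n q M"
  shows "ess n q M M (1\<^sub>m (mdim M))"
  unfolding ess_def is_epi_iff
proof (intro conjI allI impI)
  show "is_hom n q M M (1\<^sub>m (mdim M))"
    using M left_mult_one_mat[OF gmat_carrier[OF M]] right_mult_one_mat[OF gmat_carrier[OF M]] by (simp add: is_hom_iff)
  show "\<exists>x. \<forall>i<mdim M. app 0 (1\<^sub>m (mdim M)) x i = y i" for y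
    by (intro exI[of _ y]) (simp add: app_one_lt)
  fix I assume I: "submod n q M I" and s: "\<forall>s. \<exists>y\<in>I. \<forall>i<mdim M. app 0 (1\<^sub>m (mdim M)) y i = s i"
  have "s \<in> I" for s
  proof -
    obtain y where "y \<in> I" "\<forall>i<mdim M. app 0 (1\<^sub>m (mdim M)) y i = s i" using s by blast
    thus ?thesis using submod_cong[OF I, of y s] by (simp add: app_one_lt)
  qed
  thus "I = UNIV" by blast
qed

lemma ess_epi:
  assumes p: "ess n q M S p" and h: "is_hom n q X M h" and ph: "is_epi n q X S (p * h)"
  shows "is_epi n q X M h"
proof -
  have pm: "is_hom n q M S p" using p by (simp add: ess_def is_epi_def)
  hence pc: "p \<in> carrier_mat (mdim S) (mdim M)" by (simp add: is_hom_iff)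
  let ?I = "{y. \<exists>x\<in>UNIV. \<forall>i<mdim M. app 0 h x i = y i}"
  have "\<exists>y\<in>?I. \<forall>i<mdim S. app 0 p y i = s i" for s
  proof -
    obtain x where "\<forall>i<mdim S. app 0 (p * h) x i = s i" using ph by (auto simp: is_epi_iff)
    thus ?thesis by (intro bexI[of _ "app 0 h x"]) (auto simp: app_app[OF h pm])
  qed
  hence "?I = UNIV" using p submod_image[OF h submod_UNIV] unfolding ess_def by blast
  hence "y \<in> ?I" for y using UNIV_I[of y] by (simp only:)
  hence "\<forall>y. \<exists>x. \<forall>i<mdim M. app 0 h x i = y i" by blast
  thus ?thesis using h by (simp add: is_epi_iff)
qed

subsection \<open>Isomorphisms\<close>

text \<open>If b exceeded a, padding both matrices with zeros to size b would give square matrices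
  with F G = 1, hence G F = 1; but row a of the padded G is zero.\<close>

lemma right_inverse_dims:
  assumes f: "f \<in> carrier_mat b a" and g: "g \<in> carrier_mat a b" and fg: "f * g = (1\<^sub>m b :: 'k::field mat)"
  shows "b \<le> a"
proof (rule ccontr)
  assume "\<not> b \<le> a"
  hence ab: "a < b" by simp
  let ?F = "mat b b (\<lambda>(i, j). if j < a then f $$ (i, j) else 0)"
  let ?G = "mat b b (\<lambda>(i, j). if i < a then g $$ (i, j) else 0)"
  have "?F * ?G = 1\<^sub>m b"
  proof (rule eq_matI)
    fix i j assume "i < dim_row (1\<^sub>m b :: 'k mat)" "j < dim_col (1\<^sub>m b :: 'k mat)"
    hence ij: "i < b" "j < b" by auto
    have "(?F * ?G) $$ (i, j) = (\<Sum>k<b. if k < a then f $$ (i, k) * g $$ (k, j) else 0)"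
      using ij by (simp add: scalar_prod_def atLeast0LessThan) (intro sum.cong, auto)
    also have "\<dots> = (\<Sum>k<a. f $$ (i, k) * g $$ (k, j))"
      using ab by (intro sum.mono_neutral_cong_right) auto
    also have "\<dots> = (f * g) $$ (i, j)" using f g ij by (simp add: scalar_prod_def atLeast0LessThan)
    finally show "(?F * ?G) $$ (i, j) = 1\<^sub>m b $$ (i, j)" by (simp add: fg)
  qed auto
  hence "?G * ?F = 1\<^sub>m b" by (intro mat_mult_left_right_inverse[of ?F b ?G]) auto
  moreover have "(?G * ?F) $$ (a, a) = 0" using ab by (simp add: scalar_prod_def)
  ultimately show False using ab by simp
qed

lemma epi_right_inverse:
  assumes "is_epi n q M N f"
  shows "\<exists>g\<in>carrier_mat (mdim M) (mdim N). f * g = 1\<^sub>m (mdim N)"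
proof -
  have f: "f \<in> carrier_mat (mdim N) (mdim M)" and s: "\<And>y. \<exists>x. \<forall>i<mdim N. app 0 f x i = y i"
    using assms by (auto simp: is_epi_iff is_hom_iff)
  have "\<forall>j. \<exists>x. \<forall>i<mdim N. app 0 f x i = unitf j i" by (intro allI s)
  from choice[OF this] obtain w where "\<forall>j. \<forall>i<mdim N. app 0 f (w j) i = unitf j i" ..
  hence w: "\<And>j i. i < mdim N \<Longrightarrow> app 0 f (w j) i = unitf j i" by blast
  let ?g = "mat (mdim M) (mdim N) (\<lambda>(i, j). w j i)"
  have "f * ?g = 1\<^sub>m (mdim N)"
    by (rule eq_matI) (use f w in \<open>auto simp: app_lt[OF f] scalar_prod_def atLeast0LessThan\<close>)
  thus ?thesis by (intro bexI[of _ ?g]) auto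
qed

lemma epi_dim_le: "is_epi n q M N f \<Longrightarrow> mdim N \<le> mdim M"
  using epi_right_inverse[of n q M N f] right_inverse_dims[of f "mdim N" "mdim M"]
  by (auto simp: is_epi_iff is_hom_iff)

lemma epi_iso:
  assumes e: "is_epi n q M N f" and d: "mdim M = mdim N"
  shows "\<exists>g. is_hom n q N M g \<and> g * f = 1\<^sub>m (mdim M) \<and> f * g = 1\<^sub>m (mdim N)"
proof -
  have f: "f \<in> carrier_mat (mdim N) (mdim N)" and M: "is_module n q M" and N: "is_module n q N"
    and h: "\<And>h. f * gmat n q M h = gmat n q N h * f"
    using e d by (auto simp: is_epi_iff is_hom_iff)
  obtain g where g: "g \<in> carrier_mat (mdim N) (mdim N)" "f * g = 1\<^sub>m (mdim N)"
    using epi_right_inverse[OF e] d by auto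
  have gf: "g * f = 1\<^sub>m (mdim N)" by (rule mat_mult_left_right_inverse[OF f g])
  have "g * gmat n q N h = gmat n q M h * g" for h
  proof -
    have c: "gmat n q M h \<in> carrier_mat (mdim N) (mdim N)" "gmat n q N h \<in> carrier_mat (mdim N) (mdim N)"
      using gmat_carrier[OF M, of h] gmat_carrier[OF N, of h] d by auto
    have "g * gmat n q N h = g * (gmat n q N h * (f * g))" using c g by simp
    also have "\<dots> = g * (gmat n q N h * f) * g" using c f g
      by (simp add: assoc_mult_mat[where n\<^sub>1="mdim N" and n\<^sub>2="mdim N" and n\<^sub>3="mdim N" and n\<^sub>4="mdim N"] del: g(2))
    also have "\<dots> = (g * f) * gmat n q M h * g" using c f g
      by (simp add: h[symmetric] assoc_mult_mat[where n\<^sub>1="mdim N" and n\<^sub>2="mdim N" and n\<^sub>3="mdim N" and n\<^sub>4="mdim N"])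
    also have "\<dots> = gmat n q M h * g" using c by (simp add: gf)
    finally show ?thesis .
  qed
  hence "is_hom n q N M g" using M N g d by (simp add: is_hom_iff)
  thus ?thesis using gf g d by auto
qed

lemma ess_iso:
  assumes p: "ess n q N S p" and h: "is_hom n q M N h" and k: "is_hom n q N M k"
    and kh: "k * h = 1\<^sub>m (mdim M)" and hk: "h * k = 1\<^sub>m (mdim N)"
  shows "ess n q M S (p * h)"
proof -
  have pm: "is_hom n q N S p" using p by (simp add: ess_def is_epi_def)
  have ph: "is_hom n q M S (p * h)" by (rule is_hom_comp[OF h pm])
  have c: "p \<in> carrier_mat (mdim S) (mdim N)" "h \<in> carrier_mat (mdim N) (mdim M)" "k \<in> carrier_mat (mdim M) (mdim N)"
    using pm h k by (auto simp: is_hom_iff)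
  have hkx: "app 0 h (app 0 k x) i = x i" if "i < mdim N" for x i
    using app_app[OF k h, of x] app_one_lt[OF that, of 0 x] by (simp add: hk)
  have khx: "app 0 k (app 0 h x) i = x i" if "i < mdim M" for x i
    using app_app[OF h k, of x] app_one_lt[OF that, of 0 x] by (simp add: kh)
  have pc: "app 0 p x i = app 0 p y i" if "\<And>j. j < mdim N \<Longrightarrow> x j = y j" for x y i
    using that c(1) by (auto simp: app_def intro!: sum.cong)
  show ?thesis unfolding ess_def is_epi_iff
  proof (intro conjI ph allI impI)
    fix y
    obtain x where x: "\<forall>i<mdim S. app 0 p x i = y i" using p unfolding ess_def is_epi_iff by blast
    have *: "app 0 (p * h) (app 0 k x) i = app 0 p x i" for i
      unfolding app_app[OF h pm, symmetric] by (rule pc) (rule hkx)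
    show "\<exists>x. \<forall>i<mdim S. app 0 (p * h) x i = y i"
      using x by (intro exI[of _ "app 0 k x"]) (simp add: *)
  next
    fix I assume I: "submod n q M I" and s: "\<forall>s. \<exists>y\<in>I. \<forall>i<mdim S. app 0 (p * h) y i = s i"
    let ?J = "{y. \<exists>x\<in>I. \<forall>i<mdim N. app 0 h x i = y i}"
    have "\<exists>y\<in>?J. \<forall>i<mdim S. app 0 p y i = t i" for t
    proof -
      obtain y where "y \<in> I" "\<forall>i<mdim S. app 0 (p * h) y i = t i" using s by blast
      thus ?thesis by (intro bexI[of _ "app 0 h y"]) (auto simp: app_app[OF h pm])
    qed
    hence J: "?J = UNIV" using p submod_image[OF h I] unfolding ess_def by blast
    have "x \<in> I" for x
    proof -
      have "app 0 h x \<in> ?J" unfolding J by simp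
      then obtain y where y: "y \<in> I" "\<forall>i<mdim N. app 0 h y i = app 0 h x i" by auto
      have "x i = y i" if "i < mdim M" for i
      proof -
        have "app 0 k (app 0 h x) i = app 0 k (app 0 h y) i"
          using y(2) c(3) by (auto simp: app_def[of 0 k] intro!: sum.cong)
        thus ?thesis by (simp add: khx[OF that])
      qed
      thus ?thesis by (rule submod_cong[OF I y(1)])
    qed
    thus "I = UNIV" by blast
  qed
qed

section \<open>The universal property and projectivity of the model \<open>Qmod\<close>\<close>

context
  fixes n m :: nat and q \<beta> \<gamma> :: "'k::field"
  assumes n: "1 < n" and q: "is_primitive_root n q" and m: "1 \<le> m" "m < n"
    and wts: "q ^ m * (\<beta> * \<gamma>) = q" "\<beta> ^ n = 1" "\<gamma> ^ n = 1"
begin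

abbreviation (input) "Q \<equiv> Qmod n q m \<beta> \<gamma>"

lemmas Q_mod = Q_module[OF n q m wts]
lemmas opQ = op_Q[OF n q m wts]

lemma op_Gd_Q_0: "i < 2 * n \<Longrightarrow> op n q Q Gd (unitf 0) i = unitf (2 * n - m - 1) i"
  by (auto simp: opQ)

text \<open>From e_0 the operator a reaches all e_j, and d e_0 = f_(n-m-1). From there d descends to
  f_0 with nonzero coefficients, and a climbs up to all f_j.\<close>

lemma Q_generated:
  assumes I: "submod n q Q I" and 0: "unitf 0 \<in> I"
  shows "I = UNIV"
proof (rule submod_eq_UNIV[OF I])
  have up: "unitf (Suc j) \<in> I" if "unitf j \<in> I" "Suc j \<noteq> n" for j
    by (rule submod_cong[OF I submod_op[OF I that(1), of Ga]]) (use that in \<open>auto simp: opQ\<close>)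
  have up': "unitf (i + k) \<in> I" if "unitf i \<in> I" "i = 0 \<and> i + k < n \<or> n \<le> i" for i k
    using that by (induction k) (auto intro: up)
  have down: "unitf (n + k) \<in> I" if "unitf (n + Suc k) \<in> I" "Suc k < n - m" for k
  proof -
    let ?h = "hcoef q (q ^ Suc m) (Suc k)"
    have "q ^ (Suc k + m) \<noteq> 1" using primitive_rootD(2)[OF q, of "Suc k + m"] that by simp
    hence "1 - q ^ (Suc k - 1) * q ^ Suc m \<noteq> 0" by (simp add: power_add algebra_simps)
    moreover have "qnum q (Suc k) \<noteq> 0"
      using qnum_geometric[of q "Suc k"] primitive_rootD(2)[OF q, of "Suc k"] that by auto
    ultimately have h: "?h \<noteq> 0" by (simp add: hcoef_def del: sum.lessThan_Suc)
    show ?thesis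
      by (rule submod_cong[OF I submod_scale[OF I submod_op[OF I that(1), of Gd], of "1 / ?h"]])
         (use that h m in \<open>auto simp: opQ Suc_diff_le\<close>)
  qed
  have "unitf (2 * n - m - 1) \<in> I"
    by (rule submod_cong[OF I submod_op[OF I 0, of Gd]]) (simp add: op_Gd_Q_0)
  hence b0: "unitf (n + (n - m - 1)) \<in> I" using m by (simp add: mult_2)
  have "unitf (n + k) \<in> I" if "k \<le> n - m - 1" for k
    using that
  proof (induction k rule: inc_induct)
    case base
    show ?case by (rule b0)
  next
    case (step k)
    thus ?case using down[of k] m by auto
  qed
  from this[of 0] have n0: "unitf n \<in> I" by simp
  fix j assume "j < mdim Q"
  thus "unitf j \<in> I" using up'[OF 0, of j] up'[OF n0, of "j - n"] by (cases "j < n") auto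
qed

lemma Q_hom_eq:
  assumes f: "is_hom n q Q X f" and g: "is_hom n q Q X g" and e: "app 0 f (unitf 0) = app 0 g (unitf 0)"
  shows "f = g"
proof -
  have "{x. app 0 f x = app 0 g x} = UNIV"
    by (rule Q_generated[OF submod_equalizer[OF f g]]) (simp add: e)
  hence "app 0 f x = app 0 g x" for x by blast
  thus ?thesis using f g by (intro mat_eq_app[of f "mdim X" "mdim Q"]) (auto simp: is_hom_iff)
qed

text \<open>With y taken from \<open>lower_hw_exists\<close>, e_j is sent to a^j x and f_j to a^j y.
  Compatibility with d is \<open>d_a_pow_lift\<close> on the e_j and \<open>hw_string\<close> on the
  f_j.\<close>

lemma Q_hom_exists:
  assumes X: "is_module n q X"
    and x: "op n q X Gb x = fscale \<beta> x" "op n q X Gc x = fscale \<gamma> x" "op n q X Gd (op n q X Ga (op n q X Gd x)) = 0"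
  shows "\<exists>f. is_hom n q Q X f \<and> (\<forall>i<mdim X. app 0 f (unitf 0) i = x i)"
proof -
  interpret X: rep fscale n q "op n q X Ga" "op n q X Gb" "op n q X Gc" "op n q X Gd"
    by (rule rep_op[OF X n q])
  let ?a = "op n q X Ga"
  have wx: "X.wt \<beta> \<gamma> x" using x by (simp add: X.wt_def)
  obtain y where y: "X.wt (q ^ m * \<beta>) (q ^ m * \<gamma>) y" "op n q X Gd y = 0" "(?a ^^ (n - m - 1)) y = op n q X Gd x"
    using X.lower_hw_exists[OF m wx wts(1) x(3)] by blast
  have \<kappa>': "q ^ m * \<beta> * (q ^ m * \<gamma>) = q ^ Suc m"
  proof -
    have "q ^ m * \<beta> * (q ^ m * \<gamma>) = q ^ m * (q ^ m * (\<beta> * \<gamma>))" by (simp add: algebra_simps)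
    thus ?thesis unfolding wts(1) by (simp add: mult.commute)
  qed
  have a0: "(?a ^^ k) z = 0" if "n \<le> k" for k z
    using X.a.funpow_mono_zero[OF X.an that] .
  define w where "w j = (if j < n then (?a ^^ j) x else (?a ^^ (j - n)) y)" for j
  have "is_hom n q Q X (mat (mdim X) (mdim Q) (\<lambda>(i, j). w j i))"
  proof (rule is_hom_columns[OF Q_mod(1) X])
    fix g j i assume j: "j < mdim Q" and i: "i < mdim X"
    hence j2: "j < 2 * n" by simp
    have "op n q X g (w j) = (\<Sum>k<2 * n. fscale (gmat n q Q g $$ (k, j)) (w k))"
    proof (cases g)
      case Ga
      have "(\<Sum>k<2 * n. fscale (gmat n q Q g $$ (k, j)) (w k)) =
         (\<Sum>k<2 * n. if k = Suc j then if k \<noteq> n then w k else 0 else 0)"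
        using j2 by (intro sum.cong) (auto simp: Ga Q_mod Q_gen.simps fun_eq_iff)
      also have "\<dots> = (if Suc j < 2 * n \<and> Suc j \<noteq> n then w (Suc j) else 0)"
        by auto
      also have "\<dots> = op n q X Ga (w j)"
      proof (cases "Suc j = n \<or> Suc j = 2 * n")
        case True
        have "op n q X Ga (w j) = 0"
        proof (cases "j < n")
          case True
          hence "op n q X Ga (w j) = (?a ^^ Suc j) x" by (simp add: w_def)
          thus ?thesis using a0[of "Suc j" x] \<open>Suc j = n \<or> Suc j = 2 * n\<close> by auto
        next
          case False
          hence "op n q X Ga (w j) = (?a ^^ Suc (j - n)) y" by (simp add: w_def)
          thus ?thesis using a0[of "Suc (j - n)" y] \<open>Suc j = n \<or> Suc j = 2 * n\<close> False by auto
        qed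
        thus ?thesis using True by auto
      next
        case False
        thus ?thesis using j2 by (auto simp: w_def Suc_diff_le)
      qed
      finally show ?thesis using Ga by simp
    next
      case Gb
      have "(\<Sum>k<2 * n. fscale (gmat n q Q g $$ (k, j)) (w k)) =
         (\<Sum>k<2 * n. if k = j then fscale (if j < n then \<beta> * q ^ j else \<beta> * q ^ m * q ^ (j - n)) (w j) else 0)"
        using j2 by (intro sum.cong) (auto simp: Gb Q_mod Q_gen.simps fun_eq_iff)
      also have "\<dots> = op n q X Gb (w j)"
        using j2 X.wt_a_pow[OF wx, of j] X.wt_a_pow[OF y(1), of "j - n"]
        by (auto simp: w_def X.wt_def mult_ac)
      finally show ?thesis using Gb by simp
    next
      case Gc
      have "(\<Sum>k<2 * n. fscale (gmat n q Q g $$ (k, j)) (w k)) =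
         (\<Sum>k<2 * n. if k = j then fscale (if j < n then \<gamma> * q ^ j else \<gamma> * q ^ m * q ^ (j - n)) (w j) else 0)"
        using j2 by (intro sum.cong) (auto simp: Gc Q_mod Q_gen.simps fun_eq_iff)
      also have "\<dots> = op n q X Gc (w j)"
        using j2 X.wt_a_pow[OF wx, of j] X.wt_a_pow[OF y(1), of "j - n"]
        by (auto simp: w_def X.wt_def mult_ac)
      finally show ?thesis using Gc by simp
    next
      case Gd
      let ?p = "2 * n - m - 1"
      have "(\<Sum>k<2 * n. fscale (gmat n q Q g $$ (k, j)) (w k)) =
         (\<Sum>k<2 * n. if k = j - 1 then if j = 0 \<or> j = n then 0 else
            fscale (if j < n then hcoef q (\<beta> * \<gamma>) j else hcoef q (q ^ Suc m) (j - n)) (w k) else 0) +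
         (\<Sum>k<2 * n. if k = j + ?p then fscale (q ^ j) (w k) else 0)"
        using j2 unfolding sum.distrib[symmetric]
        by (intro sum.cong) (auto simp: Gd Q_mod Q_gen.simps fun_eq_iff distrib_right)
      also have "\<dots> = (if j = 0 \<or> j = n then 0 else
            fscale (if j < n then hcoef q (\<beta> * \<gamma>) j else hcoef q (q ^ Suc m) (j - n)) (w (j - 1))) +
            (if j + ?p < 2 * n then fscale (q ^ j) (w (j + ?p)) else 0)"
        using j2 by (simp only: sum.delta finite_lessThan) auto
      also have "\<dots> = op n q X Gd (w j)"
      proof (cases "j < n")
        case True
        \<comment> \<open>Where the index leaves the range of the f_j, the power of a is at least n,
          so the missing term is zero.\<close>
        have tail: "(if j + ?p < 2 * n then fscale (q ^ j) (w (j + ?p)) else 0) = fscale (q ^ j) ((?a ^^ (n - m - 1 + j)) y)"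
        proof (cases "j + ?p < 2 * n")
          case True
          moreover have "j + ?p - n = n - m - 1 + j" "\<not> j + ?p < n" using m by auto
          hence "w (j + ?p) = (?a ^^ (n - m - 1 + j)) y" unfolding w_def by (simp only: if_False)
          ultimately show ?thesis by (simp only: if_True)
        next
          case False
          thus ?thesis using a0[of "n - m - 1 + j" y] m by simp
        qed
        show ?thesis
        proof (cases j)
          case 0
          thus ?thesis unfolding tail using y(3) n by (simp add: w_def)
        next
          case (Suc k)
          show ?thesis unfolding tail using True Suc X.d_a_pow_lift[OF wx y(3)[symmetric], of k]
            by (simp add: w_def hcoef_def del: sum.lessThan_Suc)
        qed
      next
        case False
        have nt: "\<not> j + ?p < 2 * n" using False m by auto
        show ?thesis
        proof (cases "j = n")
          case True
          thus ?thesis using nt y(2) by (simp add: w_def)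
        next
          case False
          then obtain k where k: "j = n + Suc k" using \<open>\<not> j < n\<close> by (metis add_Suc_right less_imp_Suc_add linorder_neqE_nat)
          show ?thesis using nt X.hw_string[OF y(1,2), of k]
            by (simp add: k w_def hcoef_def \<kappa>' del: sum.lessThan_Suc power_Suc funpow.simps)
        qed
      qed
      finally show ?thesis using Gd by simp
    qed
    moreover have "(\<Sum>k\<in>S. fscale (gmat n q Q g $$ (k, j)) (w k)) i = (\<Sum>k\<in>S. gmat n q Q g $$ (k, j) * w k i)" for S
      by (induction S rule: infinite_finite_induct) simp_all
    ultimately show "op n q X g (w j) i = (\<Sum>k<mdim Q. gmat n q Q g $$ (k, j) * w k i)" by simp
  qed
  moreover have "app 0 (mat (mdim X) (mdim Q) (\<lambda>(i, j). w j i)) (unitf 0) i = x i" if "i < mdim X" for i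
    using that n by (simp add: app_unit w_def)
  ultimately show ?thesis by blast
qed

lemma Q_unit_relations:
  "op n q Q Gb (unitf 0) = fscale \<beta> (unitf 0)" "op n q Q Gc (unitf 0) = fscale \<gamma> (unitf 0)"
  "op n q Q Gd (op n q Q Ga (op n q Q Gd (unitf 0))) = 0"
proof -
  have ge: "op n q Q g f i = counit g * f i" if "\<not> i < 2 * n" for g f i
    using op_ge[OF Q_mod(1), of i g f] that by simp
  show "op n q Q Gb (unitf 0) = fscale \<beta> (unitf 0)" "op n q Q Gc (unitf 0) = fscale \<gamma> (unitf 0)"
  proof (rule_tac [!] ext)
    fix i
    show "op n q Q Gb (unitf 0) i = fscale \<beta> (unitf 0) i" "op n q Q Gc (unitf 0) i = fscale \<gamma> (unitf 0) i"
      using n by (cases "i < 2 * n"; simp add: opQ ge)+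
  qed
  show "op n q Q Gd (op n q Q Ga (op n q Q Gd (unitf 0))) = 0"
  proof
    fix i
    have 1: "op n q Q Gd (unitf 0) = unitf (2 * n - m - 1)"
      using ge[of _ Gd] by (intro ext, case_tac "i < 2 * n") (use m in \<open>auto simp: op_Gd_Q_0 counit_def\<close>)
    have 2: "op n q Q Ga (unitf (2 * n - m - 1)) = unitf (2 * n - m)"
      using ge[of _ Ga] m by (intro ext, case_tac "i < 2 * n") (auto simp: opQ counit_def)
    have "(n - m - 1) + Suc m = n" using m by simp
    hence "q ^ (n - m - 1) * q ^ Suc m = q ^ n" by (metis power_add)
    hence h: "hcoef q (q ^ Suc m) (n - m) = 0" using primitive_rootD(1)[OF q] by (simp add: hcoef_def del: power_Suc)
    show "op n q Q Gd (op n q Q Ga (op n q Q Gd (unitf 0))) i = 0 i"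
      unfolding 1 2 using ge[of i Gd] m h by (cases "i < 2 * n") (auto simp: opQ counit_def)
  qed
qed

text \<open>A map out of Q is determined by the image of e_0, and lifting it along an epimorphism
  means lifting a vector together with its three relations, as in
  \<open>lift_generator\<close>.\<close>

lemma Q_projective: "is_projective n q Q"
  unfolding is_projective_def
proof (intro conjI allI impI Q_mod(1))
  fix X Y g f assume "is_epi n q X Y g \<and> is_hom n q Q Y f"
  hence g: "is_epi n q X Y g" and f: "is_hom n q Q Y f" by auto
  hence gh: "is_hom n q X Y g" by (simp add: is_epi_iff)
  hence X: "is_module n q X" and Y: "is_module n q Y" and gc: "g \<in> carrier_mat (mdim Y) (mdim X)"
    and fc: "f \<in> carrier_mat (mdim Y) (mdim Q)" using f by (auto simp: is_hom_iff)
  interpret X: rep fscale n q "op n q X Ga" "op n q X Gb" "op n q X Gc" "op n q X Gd"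
    by (rule rep_op[OF X n q])
  define y where "y = app 0 f (unitf 0)"
  obtain x0 where x0: "\<forall>i<mdim Y. app 0 g x0 i = y i" using g unfolding is_epi_iff by blast
  have "app 0 g x0 i = y i" for i
    using x0 app_ge[OF gc, of i] app_ge[OF fc, of i] unfolding y_def by (cases "i < mdim Y") simp_all
  hence x0: "app 0 g x0 = y" by (rule ext)
  note F = vec_op.add[OF vec_op_app] vec_op.scale[OF vec_op_app]
  have y: "op n q Y Gb y = fscale \<beta> y" "op n q Y Gc y = fscale \<gamma> y" "op n q Y Gd (op n q Y Ga (op n q Y Gd y)) = 0"
    unfolding y_def is_hom_app[OF f, symmetric] Q_unit_relations
    by (simp_all add: F vec_op.zero[OF vec_op_app])
  obtain x where x: "app 0 g x = y" "X.wt \<beta> \<gamma> x" "op n q X Gd (op n q X Ga (op n q X Gd x)) = 0"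
    using X.lift_generator[OF rep_op[OF Y n q] F is_hom_app[OF gh] is_hom_app[OF gh] is_hom_app[OF gh] is_hom_app[OF gh] m wts x0 y]
    by blast
  obtain h where h: "is_hom n q Q X h" "\<forall>i<mdim X. app 0 h (unitf 0) i = x i"
    using Q_hom_exists[OF X _ _ x(3)] x(2) unfolding X.wt_def by blast
  have "app 0 (g * h) (unitf 0) = app 0 f (unitf 0)"
  proof -
    have "app 0 (g * h) (unitf 0) = app 0 g (app 0 h (unitf 0))" by (rule app_app[OF h(1) gh, symmetric])
    also have "\<dots> = app 0 g x"
      using h(2) gc by (auto simp: app_def[of 0 g] fun_eq_iff intro!: sum.cong)
    finally show ?thesis using x(1) by (simp add: y_def)
  qed
  hence "g * h = f" by (intro Q_hom_eq[OF is_hom_comp[OF h(1) gh] f])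
  thus "\<exists>h. is_hom n q Q X h \<and> g * h = f" using h(1) by blast
qed

text \<open>Uniqueness of projective covers. Lifting each of the two covering maps through the other
  gives h and k, both surjective by essentiality; hence the dimensions agree and h is invertible.
  This carries the universal property of Q over to an arbitrary cover.\<close>

lemma mdim_projective_cover:
  assumes P: "is_projective_cover n q P S" and p: "ess n q Q S p"
  shows "\<exists>h k. is_hom n q P Q h \<and> is_hom n q Q P k \<and> k * h = 1\<^sub>m (mdim P) \<and> h * k = 1\<^sub>m (mdim Q) \<and> mdim P = 2 * n"
proof -
  have pe: "is_epi n q Q S p" using p by (simp add: ess_def)
  obtain r where r: "is_essential_epi n q P S r" and Pp: "is_projective n q P"
    using P by (auto simp: is_projective_cover_def)
  hence re: "is_epi n q P S r" by (simp add: is_essential_epi_def)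
  obtain h where h: "is_hom n q P Q h" "p * h = r"
    using Pp pe re unfolding is_projective_def is_epi_def[of n q P S r] by blast
  have he: "is_epi n q P Q h" by (rule ess_epi[OF p h(1)]) (simp add: h(2) re)
  obtain k where k: "is_hom n q Q P k" "r * k = p"
    using Q_projective pe re unfolding is_projective_def is_epi_def[of n q Q S p] by blast
  have ke: "is_epi n q Q P k"
    using r k pe unfolding is_essential_epi_def by blast
  have d: "mdim P = mdim Q" using epi_dim_le[OF he] epi_dim_le[OF ke] by simp
  obtain k' where "is_hom n q Q P k'" "k' * h = 1\<^sub>m (mdim P)" "h * k' = 1\<^sub>m (mdim Q)"
    using epi_iso[OF he d] by blast
  thus ?thesis using h d by auto
qed

end

section \<open>\<open>Qmod\<close> as the projective cover of a simple module\<close>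

context
  fixes n m :: nat and q :: "'k::field" and s :: int
  assumes n: "1 < n" and q: "is_primitive_root n q" and m: "1 \<le> m" "m < n"
begin

lemma V_weights:
  "q ^ m' * (q powi s * q powi (1 - s - int m')) = q" "(q powi s) ^ n = 1" "(q powi e) ^ n = 1"
  using q_ne_0[OF n q] powi_pow_root[OF primitive_rootD(1)[OF q]]
  by (simp_all add: power_int_add[symmetric] power_int_of_nat[symmetric] del: power_int_of_nat)

abbreviation (input) "QV \<equiv> Qmod n q m (q powi s) (q powi (1 - s - int m))"

lemmas wtV = V_weights(1)[of m] V_weights(2) V_weights(3)[of "1 - s - int m"]
lemmas opQV = op_Q[OF n q m wtV]
lemmas opV = op_V[OF n q less_imp_le[OF m(2)]]

definition p_Q :: "'k mat" where
  "p_Q = mat m (2 * n) (\<lambda>(i, j). if i = j then 1 else 0)"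

lemma app_p_Q: "i < m \<Longrightarrow> app 0 p_Q x i = x i"
  using m by (simp add: p_Q_def app_def if_distrib[of "\<lambda>x. x * _"] cong: if_cong)

lemma p_Q_hom: "is_hom n q QV (V q m s) p_Q"
proof (rule is_homI_app)
  note V = V_module[OF n q less_imp_le[OF m(2)]]
  show "is_module n q QV" by (rule Q_module[OF n q m wtV])
  show "is_module n q (V q m s)" by (rule V)
  show "p_Q \<in> carrier_mat (mdim (V q m s)) (mdim QV)" by (simp add: p_Q_def V)
  fix g x i assume "i < mdim (V q m s)"
  hence i: "i < m" by (simp add: V)
  have q0: "q \<noteq> 0" by (rule q_ne_0[OF n q])
  have \<kappa>: "q powi s * q powi (1 - s - int m) = q powi (1 - int m)"
    using q0 by (simp add: power_int_add[symmetric])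
  \<comment> \<open>The arrow of d from e_m to e_(m-1) vanishes, so cutting off at m is compatible
    with d.\<close>
  have hm: "hcoef q (q powi (1 - int m)) m = 0"
    using alpha_hcoef[OF q0, of m "m - 1"] m by (simp add: alpha_def)
  show "app 0 p_Q (op n q QV g x) i = op n q (V q m s) g (app 0 p_Q x) i"
  proof (cases g)
    case Ga
    thus ?thesis using i m by (simp add: app_p_Q opQV opV)
  next
    case Gb
    thus ?thesis using i m q0 by (simp add: app_p_Q opQV opV power_int_add)
  next
    case Gc
    have "q powi (1 - s - int m) * q ^ i = q powi (int i + 1 - s - int m)"
      using q0 by (simp add: power_int_add[symmetric] power_int_of_nat[symmetric] algebra_simps del: power_int_of_nat)
    thus ?thesis using i m Gc by (simp add: app_p_Q opQV opV)
  next
    case Gd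
    show ?thesis
    proof (cases "Suc i < m")
      case True
      thus ?thesis using i m Gd by (simp add: app_p_Q opQV opV \<kappa> alpha_hcoef[OF q0])
    next
      case False
      hence "Suc i = m" using i by simp
      thus ?thesis using i m Gd hm by (simp add: app_p_Q opQV opV \<kappa>)
    qed
  qed
qed

text \<open>A submodule that maps onto V(m,s) contains a vector with coordinate 1 at e_0. Its
  projection to the b-eigenspace of e_0 has the form e_0 + t f_(n-m). Applying d gives f_(n-m-1),
  then a gives f_(n-m); hence e_0, a generator, lies in the submodule.\<close>

lemma ess_Q: "ess n q QV (V q m s) p_Q"
  unfolding ess_def is_epi_iff
proof (intro conjI p_Q_hom allI impI)
  note V = V_module[OF n q less_imp_le[OF m(2)]]
  note M = Q_module(1)[OF n q m wtV]
  have q0: "q \<noteq> 0" by (rule q_ne_0[OF n q])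
  let ?\<beta> = "q powi s"
  show "\<exists>x. \<forall>i<mdim (V q m s). app 0 p_Q x i = y i" for y
    by (rule exI[of _ y]) (simp add: V app_p_Q)
  fix I assume I: "submod n q QV I" and s: "\<forall>s'. \<exists>y\<in>I. \<forall>i<mdim (V q m s). app 0 p_Q y i = s' i"
  obtain y where y: "y \<in> I" "y 0 = 1"
    using spec[OF s, of "unitf 0"] m by (auto simp: V app_p_Q)
  interpret vec_op fscale "op n q QV Gb" by (rule vec_op_op)
  define y' where "y' = eproj n ?\<beta> y"
  have y'I: "y' \<in> I" unfolding y'_def by (rule submod_eproj[OF I y(1)])
  have nn: "of_nat n \<noteq> (0::'k)" using of_nat_order_ne_0[OF q] n by simp
  have b0: "?\<beta> \<noteq> 0" using q0 by simp
  have y'0: "y' 0 = 1"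
    unfolding y'_def using eproj_functional[of "\<lambda>x. x 0" ?\<beta> n y] y(2) b0 nn n by (simp add: opQV)
  have qi: "(q ^ i) ^ n = 1" for i using primitive_rootD(1)[OF q] by (metis mult.commute power_mult power_one)
  have y'i: "y' i = 0" if i: "i < 2 * n" "i \<noteq> 0" "i \<noteq> 2 * n - m" for i
  proof -
    let ?\<tau> = "if i < n then ?\<beta> * q ^ i else ?\<beta> * q ^ m * q ^ (i - n)"
    have "?\<tau> \<noteq> ?\<beta>"
    proof (cases "i < n")
      case True
      thus ?thesis using primitive_rootD(2)[OF q, of i] i b0 by simp
    next
      case False
      have "q ^ (m + (i - n)) \<noteq> 1"
      proof (cases "m + (i - n) < n")
        case True
        thus ?thesis using primitive_rootD(2)[OF q, of "m + (i - n)"] m by simp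
      next
        case ge: False
        have "q ^ (m + (i - n)) = q ^ n * q ^ (m + (i - n) - n)" using ge by (simp add: power_add[symmetric])
        thus ?thesis using primitive_rootD(2)[OF q, of "m + (i - n) - n"] primitive_rootD(1)[OF q] ge i False m by auto
      qed
      hence "q ^ m * q ^ (i - n) \<noteq> 1" unfolding power_add .
      thus ?thesis using False b0 by (simp add: mult.assoc)
    qed
    thus ?thesis
      unfolding y'_def using eproj_functional_0[of "\<lambda>x. x i" ?\<tau> ?\<beta> n y] i b0 V_weights(2) qi
      by (simp add: opQV power_mult_distrib)
  qed
  have "(n - m - 1) + Suc m = n" using m by simp
  hence "q ^ (n - m - 1) * q ^ Suc m = q ^ n" by (metis power_add)
  hence h: "hcoef q (q ^ Suc m) (n - m) = 0" using primitive_rootD(1)[OF q] by (simp add: hcoef_def del: power_Suc)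
  have "unitf (2 * n - m - 1) \<in> I"
  proof (rule submod_cong[OF I submod_op[OF I y'I, of Gd]])
    fix i assume "i < mdim QV"
    hence i: "i < 2 * n" by simp
    show "unitf (2 * n - m - 1) i = op n q QV Gd y' i"
    proof (cases "i = 2 * n - m - 1")
      case True
      have "\<not> Suc i < n" "Suc i - n = n - m" "i - (2 * n - m - 1) = 0" "2 * n - m - 1 \<le> i" using True m by auto
      hence "op n q QV Gd y' i = 1" by (simp only: opQV[OF i] h y'0) simp
      thus ?thesis using True by simp
    next
      case False
      have "y' (Suc i) = 0" if "Suc i < 2 * n" using y'i[of "Suc i"] that False m by auto
      moreover have "y' (i - (2 * n - m - 1)) = 0" if "2 * n - m - 1 \<le> i"
        using y'i[of "i - (2 * n - m - 1)"] that False i m by auto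
      ultimately show ?thesis using i False by (simp add: opQV)
    qed
  qed
  hence "op n q QV Ga (unitf (2 * n - m - 1)) \<in> I" by (rule submod_op[OF I])
  from submod_add[OF I y'I submod_scale[OF I this, of "- y' (2 * n - m)"]]
  have "unitf 0 \<in> I"
  proof (rule submod_cong[OF I])
    fix i assume "i < mdim QV"
    hence i: "i < 2 * n" by simp
    show "unitf 0 i = (y' + fscale (- y' (2 * n - m)) (op n q QV Ga (unitf (2 * n - m - 1)))) i"
    proof (cases "i = 2 * n - m")
      case True
      thus ?thesis using i m by (auto simp: opQV)
    next
      case False
      thus ?thesis using i y'0 y'i[OF i] m by (auto simp: opQV)
    qed
  qed
  thus "I = UNIV" by (rule Q_generated[OF n q m wtV I])
qed

lemma projective_cover_V:
  assumes "is_projective_cover n q P (V q m s)"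
  shows "mdim P = 2 * n" "\<exists>p. ess n q P (V q m s) p" "\<exists>h k. is_hom n q P QV h \<and> is_hom n q QV P k \<and> k * h = 1\<^sub>m (mdim P) \<and> h * k = 1\<^sub>m (mdim QV)"
proof -
  obtain h k where *: "is_hom n q P QV h" "is_hom n q QV P k" "k * h = 1\<^sub>m (mdim P)" "h * k = 1\<^sub>m (mdim QV)" "mdim P = 2 * n"
    using mdim_projective_cover[OF n q m wtV assms ess_Q] by blast
  show "mdim P = 2 * n" by fact
  show "\<exists>p. ess n q P (V q m s) p" using ess_iso[OF ess_Q *(1-4)] by blast
  show "\<exists>h k. is_hom n q P QV h \<and> is_hom n q QV P k \<and> k * h = 1\<^sub>m (mdim P) \<and> h * k = 1\<^sub>m (mdim QV)"
    using * by blast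
qed

end

section \<open>Tensor products with a simple module\<close>

definition slice :: "nat \<Rightarrow> (nat \<Rightarrow> 'a) \<Rightarrow> nat \<Rightarrow> nat \<Rightarrow> 'a" where
  "slice N f i k = f (i * N + k)"

lemma app_kron:
  assumes A: "A \<in> carrier_mat l l" and B: "B \<in> carrier_mat N' N" and i: "i < l" and k: "k < N'"
  shows "app \<epsilon> (kron A B) f (i * N' + k) = (\<Sum>i'<l. A $$ (i, i') * app \<epsilon>' B (slice N f i') k)"
proof -
  have lt: "i * N' + k < l * N'" by (rule mult_add_lt[OF i k])
  have "app \<epsilon> (kron A B) f (i * N' + k) = (\<Sum>x<l * N. A $$ (i, x div N) * B $$ (k, x mod N) * f (x div N * N + x mod N))"
    unfolding app_lt[OF kron_carrier[OF A B] lt]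
    by (intro sum.cong refl) (use lt k in \<open>simp add: index_kron[OF A B lt]\<close>)
  also have "\<dots> = (\<Sum>i'<l. \<Sum>k'<N. A $$ (i, i') * B $$ (k, k') * f (i' * N + k'))"
    by (rule sum_div_mod[where f = "\<lambda>i' k'. A $$ (i, i') * B $$ (k, k') * f (i' * N + k')"])
  also have "\<dots> = (\<Sum>i'<l. A $$ (i, i') * app \<epsilon>' B (slice N f i') k)"
    by (simp add: app_lt[OF B k] slice_def sum_distrib_left mult.assoc)
  finally show ?thesis .
qed

lemma sum_shift_up:
  fixes f :: "nat \<Rightarrow> 'a::comm_monoid_add"
  shows "(\<Sum>i<l. if i = 0 then 0 else f i) = (\<Sum>i<l. if Suc i < l then f (Suc i) else 0)"
proof (cases l)
  case (Suc k)
  have "(\<Sum>i<Suc k. if i = 0 then 0 else f i) = (\<Sum>i<k. f (Suc i))"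
    by (simp only: sum.lessThan_Suc_shift) simp
  also have "\<dots> = (\<Sum>i<Suc k. if Suc i < Suc k then f (Suc i) else 0)" by simp
  finally show ?thesis using Suc by simp
qed simp

lemma app_cong_lt: "A \<in> carrier_mat N' N \<Longrightarrow> (\<And>k. k < N \<Longrightarrow> x k = y k) \<Longrightarrow> app 0 A x = app 0 A y"
  by (auto simp: app_def fun_eq_iff intro!: sum.cong)

lemma sum_one_mat: "i < l \<Longrightarrow> (\<Sum>i'<l. (1\<^sub>m l :: 'k::field mat) $$ (i, i') * g i') = g i"
  by (simp add: if_distrib[of "\<lambda>x. x * _"] cong: if_cong)

text \<open>Dualising reverses the basis of V(l,r); this symmetry matches the coefficients of d on
  the reversed basis with the original ones.\<close>

lemma qpow_inverse_alpha:
  fixes q :: "'k::field"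
  assumes q: "q \<noteq> 0" "q \<noteq> 1" and j: "j \<le> l"
  shows "alpha q l j * q powi (int l - 2 * int j) = alpha q l (l - j)"
proof -
  define X Y where "X = q ^ j" and "Y = q ^ (l - j)"
  have XY: "X \<noteq> 0" "Y \<noteq> 0" using q by (simp_all add: X_def Y_def)
  have n: "(1 - q) * qnum q j = 1 - X" "(1 - q) * qnum q (l - j) = 1 - Y"
    by (simp_all add: qnum_geometric X_def Y_def)
  have p: "q powi (int j - int l) = 1 / Y" "q powi (int l - 2 * int j) = Y / X" "q powi (int (l - j) - int l) = 1 / X"
  proof -
    have e: "int j - int l = - int (l - j)" "int l - 2 * int j = int (l - j) - int j" "int (l - j) - int l = - int j"
      using j by auto
    show "q powi (int j - int l) = 1 / Y" "q powi (int l - 2 * int j) = Y / X" "q powi (int (l - j) - int l) = 1 / X"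
      unfolding e using q by (simp_all add: power_int_minus power_int_diff X_def Y_def inverse_eq_divide)
  qed
  have "(1 - q) * (alpha q l j * q powi (int l - 2 * int j)) = (1 - X) * (1 - 1 / Y) * (Y / X)"
    unfolding alpha_def p n(1)[symmetric] by (simp add: mult.assoc)
  also have "\<dots> = (1 - Y) * (1 - 1 / X)" using XY by (simp add: field_simps)
  also have "\<dots> = (1 - q) * alpha q l (l - j)" unfolding alpha_def p n(2)[symmetric] by (simp add: mult.assoc)
  finally show ?thesis using q by simp
qed

context
  fixes n l :: nat and q :: "'k::field"
  assumes n: "1 < n" and q: "is_primitive_root n q" and l: "l \<le> n"
begin

lemma q_ne_1: "q \<noteq> 1"
  using primitive_rootD(2)[OF q, of 1] n by simp

lemma op_tensor_V:
  assumes N: "is_module n q N" and i: "i < l" and k: "k < mdim N"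
  shows "op n q (tensor n q (V q l r) N) Ga f (i * mdim N + k) =
      (if i = 0 then 0 else op n q N Gb (slice (mdim N) f (i - 1)) k) + op n q N Ga (slice (mdim N) f i) k"
    "op n q (tensor n q (V q l r) N) Gb f (i * mdim N + k) = q powi (r + int i) * op n q N Gb (slice (mdim N) f i) k"
    "op n q (tensor n q (V q l r) N) Gc f (i * mdim N + k) = q powi (int i + 1 - r - int l) * op n q N Gc (slice (mdim N) f i) k"
    "op n q (tensor n q (V q l r) N) Gd f (i * mdim N + k) =
      (if Suc i < l then alpha q l (Suc i) * op n q N Gc (slice (mdim N) f (Suc i)) k else 0) + op n q N Gd (slice (mdim N) f i) k"
proof -
  note V = V_module[OF n q l]
  note g = gmat_tensor[OF V(1)[of r] N n q]
  note c = gmat_carrier[OF N] 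
  have vc: "V_gen q l r g \<in> carrier_mat l l" for g by (rule V_gen_carrier)
  note ak = app_kron[OF vc c i k] app_kron[OF one_carrier_mat c i k]
  have vsum: "(\<Sum>i'<l. V_gen q l r g $$ (i, i') * h i') = app 0 (V_gen q l r g) h i" for g h
    by (rule app_lt[OF vc i, symmetric])
  have kc: "kron A B \<in> carrier_mat (l * mdim N) (l * mdim N)"
    if "A \<in> carrier_mat l l" "B \<in> carrier_mat (mdim N) (mdim N)" for A B :: "'k mat"
    using kron_carrier[OF that] .
  have lt: "i * mdim N + k < l * mdim N" by (rule mult_add_lt[OF i k])
  show "op n q (tensor n q (V q l r) N) Ga f (i * mdim N + k) =
      (if i = 0 then 0 else op n q N Gb (slice (mdim N) f (i - 1)) k) + op n q N Ga (slice (mdim N) f i) k"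
    unfolding op_def g V(2,3) app_add[OF kc[OF vc c] kc[OF one_carrier_mat c] lt] ak(1)[where \<epsilon>' = "counit Gb"] 
      ak(2)[where \<epsilon>' = "counit Ga"] vsum sum_one_mat[OF i]
    by (simp add: app_V_gen[OF i])
  show "op n q (tensor n q (V q l r) N) Gb f (i * mdim N + k) = q powi (r + int i) * op n q N Gb (slice (mdim N) f i) k"
    unfolding op_def g V(2,3) ak(1)[where \<epsilon>' = "counit Gb"] vsum by (simp add: app_V_gen[OF i])
  show "op n q (tensor n q (V q l r) N) Gc f (i * mdim N + k) = q powi (int i + 1 - r - int l) * op n q N Gc (slice (mdim N) f i) k"
    unfolding op_def g V(2,3) ak(1)[where \<epsilon>' = "counit Gc"] vsum by (simp add: app_V_gen[OF i])
  show "op n q (tensor n q (V q l r) N) Gd f (i * mdim N + k) =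
      (if Suc i < l then alpha q l (Suc i) * op n q N Gc (slice (mdim N) f (Suc i)) k else 0) + op n q N Gd (slice (mdim N) f i) k"
    unfolding op_def g V(2,3) app_add[OF kc[OF vc c] kc[OF one_carrier_mat c] lt] ak(1)[where \<epsilon>' = "counit Gc"] 
      ak(2)[where \<epsilon>' = "counit Gd"] vsum sum_one_mat[OF i]
    by (simp add: app_V_gen[OF i])
qed

lemma tensor_V_module: "is_module n q N \<Longrightarrow> is_module n q (tensor n q (V q l r) N)"
  by (rule is_module_tensor[OF V_module(1)[OF n q l] _ n q])

lemma mdim_tensor_V: "mdim (tensor n q (V q l r) N) = l * mdim N"
  by (simp add: tensor_def V_module[OF n q l])

text \<open>
  The adjunction \<open>Hom(V(l,r) \<otimes> P, Y) = Hom(P, V(l,1-l-r) \<otimes> Y)\<close>.  Both sides are families of maps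
  \<open>F\<^sub>i : P \<rightarrow> Y\<close>, \<open>i < l\<close>, with the following compatibility; up to the scalars
  \<open>dual_scal\<close> the basis \<open>v\<^sub>0, \<dots>, v\<^bsub>l-1\<^esub>\<close> of \<open>V(l,1-l-r)\<close> is dual to the reversed basis of \<open>V(l,r)\<close>.
\<close>

definition fam_shift :: "int \<Rightarrow> 'k fdmod \<Rightarrow> (nat \<Rightarrow> (nat \<Rightarrow> 'k) \<Rightarrow> nat \<Rightarrow> 'k) \<Rightarrow> gen \<Rightarrow> nat \<Rightarrow> (nat \<Rightarrow> 'k) \<Rightarrow> nat \<Rightarrow> 'k" where
  "fam_shift r P F g i x = (case g of
     Ga \<Rightarrow> (if Suc i < l then F (Suc i) (op n q P Gb x) else 0) + F i (op n q P Ga x)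
   | Gb \<Rightarrow> fscale (q powi (r + int i)) (F i (op n q P Gb x))
   | Gc \<Rightarrow> fscale (q powi (int i + 1 - r - int l)) (F i (op n q P Gc x))
   | Gd \<Rightarrow> (if i = 0 then 0 else fscale (alpha q l i) (F (i - 1) (op n q P Gc x))) + F i (op n q P Gd x))"

definition fam_hom :: "int \<Rightarrow> 'k fdmod \<Rightarrow> 'k fdmod \<Rightarrow> (nat \<Rightarrow> 'k mat) \<Rightarrow> bool" where
  "fam_hom r P Y F \<longleftrightarrow> (\<forall>g. \<forall>i<l. \<forall>x. \<forall>j<mdim Y.
     fam_shift r P (\<lambda>i. app 0 (F i)) g i x j = op n q Y g (app 0 (F i) x) j)"

definition hcat :: "nat \<Rightarrow> nat \<Rightarrow> (nat \<Rightarrow> 'k mat) \<Rightarrow> 'k mat" where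
  "hcat NY NP F = mat NY (l * NP) (\<lambda>(j, x). F (x div NP) $$ (j, x mod NP))"

definition vcat :: "nat \<Rightarrow> nat \<Rightarrow> (nat \<Rightarrow> 'k mat) \<Rightarrow> 'k mat" where
  "vcat NY NP F = mat (l * NY) NP (\<lambda>(x, p). F (x div NY) $$ (x mod NY, p))"

lemma app_hcat:
  assumes F: "\<And>i. F i \<in> carrier_mat NY NP" and j: "j < NY"
  shows "app 0 (hcat NY NP F) z j = (\<Sum>i<l. app 0 (F i) (slice NP z i) j)"
proof -
  have "app 0 (hcat NY NP F) z j = (\<Sum>x<l * NP. F (x div NP) $$ (j, x mod NP) * z (x div NP * NP + x mod NP))"
    using j by (simp add: app_def hcat_def)
  also have "\<dots> = (\<Sum>i<l. \<Sum>p<NP. F i $$ (j, p) * z (i * NP + p))"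
    by (rule sum_div_mod[where f = "\<lambda>i p. F i $$ (j, p) * z (i * NP + p)"])
  also have "\<dots> = (\<Sum>i<l. app 0 (F i) (slice NP z i) j)" by (simp add: app_lt[OF F j] slice_def)
  finally show ?thesis .
qed

lemma app_vcat:
  assumes F: "\<And>i. F i \<in> carrier_mat NY NP" and k: "k < l" and j: "j < NY"
  shows "app 0 (vcat NY NP F) x (k * NY + j) = app 0 (F k) x j"
  using mult_add_lt[OF k j] j by (simp add: app_def vcat_def carrier_matD[OF F])

text \<open>Written out in the slices of a vector of the tensor product, the intertwining condition
  is the sum over i of the conditions on the family.\<close>

lemma hcat_hom_iff:
  assumes P: "is_module n q P" and Y: "is_module n q Y" and F: "\<And>i. F i \<in> carrier_mat (mdim Y) (mdim P)"
  shows "is_hom n q (tensor n q (V q l r) P) Y (hcat (mdim Y) (mdim P) F) \<longleftrightarrow> fam_hom r P Y F"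
proof -
  let ?T = "tensor n q (V q l r) P" and ?f = "hcat (mdim Y) (mdim P) F" and ?F = "\<lambda>i. app 0 (F i)"
  note T = tensor_V_module[OF P, of r]
  have fc: "?f \<in> carrier_mat (mdim Y) (mdim ?T)" by (simp add: hcat_def mdim_tensor_V)
  note lin = vec_op.add[OF vec_op_app] vec_op.scale[OF vec_op_app] vec_op.zero[OF vec_op_app]
  have L: "app 0 ?f (op n q ?T g z) j = (\<Sum>i<l. fam_shift r P ?F g i (slice (mdim P) z i) j)" if j: "j < mdim Y" for g z j
  proof -
    let ?z = "slice (mdim P) z"
    have *: "app 0 ?f (op n q ?T g z) j = (\<Sum>i<l. ?F i (w i) j)"
      if w: "\<And>i k. i < l \<Longrightarrow> k < mdim P \<Longrightarrow> op n q ?T g z (i * mdim P + k) = w i k" for w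
      unfolding app_hcat[OF F j]
      by (intro sum.cong refl, rule fun_cong[OF app_cong_lt[OF F]]) (simp add: slice_def w)
    show ?thesis
    proof (cases g)
      case Ga
      have "app 0 ?f (op n q ?T g z) j = (\<Sum>i<l. ?F i ((if i = 0 then 0 else op n q P Gb (?z (i - 1))) + op n q P Ga (?z i)) j)"
        by (rule *) (auto simp: Ga op_tensor_V[OF P])
      also have "\<dots> = (\<Sum>i<l. if i = 0 then 0 else ?F i (op n q P Gb (?z (i - 1))) j) + (\<Sum>i<l. ?F i (op n q P Ga (?z i)) j)"
        unfolding sum.distrib[symmetric] by (intro sum.cong) (auto simp: lin)
      also have "(\<Sum>i<l. if i = 0 then 0 else ?F i (op n q P Gb (?z (i - 1))) j) =
          (\<Sum>i<l. if Suc i < l then ?F (Suc i) (op n q P Gb (?z i)) j else 0)"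
        by (subst sum_shift_up) (auto intro!: sum.cong)
      finally show ?thesis
        unfolding sum.distrib[symmetric] by (simp add: Ga fam_shift_def if_distrib[of "\<lambda>f. f j"] cong: if_cong)
    next
      case Gb
      have "app 0 ?f (op n q ?T g z) j = (\<Sum>i<l. ?F i (fscale (q powi (r + int i)) (op n q P Gb (?z i))) j)"
        by (rule *) (auto simp: Gb op_tensor_V[OF P])
      thus ?thesis by (simp add: Gb fam_shift_def lin)
    next
      case Gc
      have "app 0 ?f (op n q ?T g z) j = (\<Sum>i<l. ?F i (fscale (q powi (int i + 1 - r - int l)) (op n q P Gc (?z i))) j)"
        by (rule *) (auto simp: Gc op_tensor_V[OF P])
      thus ?thesis by (simp add: Gc fam_shift_def lin)
    next
      case Gd
      have "app 0 ?f (op n q ?T g z) j = (\<Sum>i<l. ?F i ((if Suc i < l then fscale (alpha q l (Suc i)) (op n q P Gc (?z (Suc i))) else 0) + op n q P Gd (?z i)) j)"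
        by (rule *) (auto simp: Gd op_tensor_V[OF P])
      also have "\<dots> = (\<Sum>i<l. if Suc i < l then alpha q l (Suc i) * ?F i (op n q P Gc (?z (Suc i))) j else 0) + (\<Sum>i<l. ?F i (op n q P Gd (?z i)) j)"
        unfolding sum.distrib[symmetric] by (intro sum.cong) (auto simp: lin)
      also have "(\<Sum>i<l. if Suc i < l then alpha q l (Suc i) * ?F i (op n q P Gc (?z (Suc i))) j else 0) =
          (\<Sum>i<l. if i = 0 then 0 else alpha q l i * ?F (i - 1) (op n q P Gc (?z i)) j)"
        by (subst sum_shift_up) (auto intro!: sum.cong)
      finally show ?thesis
        unfolding sum.distrib[symmetric] by (simp add: Gd fam_shift_def if_distrib[of "\<lambda>f. f j"] cong: if_cong)
    qed
  qed
  have R: "op n q Y g (app 0 ?f z) j = (\<Sum>i<l. op n q Y g (?F i (slice (mdim P) z i)) j)" if j: "j < mdim Y" for g z j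
  proof -
    have "op n q Y g (app 0 ?f z) j = op n q Y g (\<Sum>i<l. ?F i (slice (mdim P) z i)) j"
    proof -
      have "(\<Sum>i\<in>S. ?F i (slice (mdim P) z i)) k = (\<Sum>i\<in>S. ?F i (slice (mdim P) z i) k)" for S k
        by (induction S rule: infinite_finite_induct) simp_all
      thus ?thesis unfolding op_lt[OF Y j] by (intro sum.cong) (auto simp: app_hcat[OF F])
    qed
    also have "\<dots> = (\<Sum>i<l. op n q Y g (?F i (slice (mdim P) z i))) j"
      by (simp only: vec_op.sum[OF vec_op_op])
    also have "(\<Sum>i\<in>S. op n q Y g (?F i (slice (mdim P) z i))) j = (\<Sum>i\<in>S. op n q Y g (?F i (slice (mdim P) z i)) j)" for S
      by (induction S rule: infinite_finite_induct) simp_all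
    finally show ?thesis .
  qed
  show ?thesis
  proof
    assume "fam_hom r P Y F"
    thus "is_hom n q ?T Y ?f"
      by (intro is_homI_app[OF T Y fc]) (auto simp: L R fam_hom_def intro!: sum.cong)
  next
    assume hom: "is_hom n q ?T Y ?f"
    show "fam_hom r P Y F" unfolding fam_hom_def
    proof (intro allI impI)
      fix g i x j assume i: "i < l" and j: "j < mdim Y"
      let ?NP = "mdim P"
      \<comment> \<open>The vector v_i tensor x, which isolates the summand with index i in
        \<open>L\<close> and \<open>R\<close>.\<close>
      define z :: "nat \<Rightarrow> 'k" where "z y = (if y div ?NP = i then x (y mod ?NP) else 0)" for y
      have sl: "slice ?NP z i' k = (if i' = i then x k else 0)" if "k < ?NP" for i' k
        using that by (simp add: slice_def z_def)
      have Fs: "?F i'' (slice ?NP z i') = (if i' = i then ?F i'' x else 0)" for i' i''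
      proof -
        have "?F i'' (slice ?NP z i') = ?F i'' (if i' = i then x else 0)"
          by (rule app_cong_lt[OF F]) (simp add: sl)
        thus ?thesis by (simp add: lin)
      qed
      have opP: "?F i'' (op n q P h (slice ?NP z i')) = (if i' = i then ?F i'' (op n q P h x) else 0)" for h i' i''
      proof -
        have "?F i'' (op n q P h (slice ?NP z i')) = ?F i'' (op n q P h (if i' = i then x else 0))"
          by (rule app_cong_lt[OF F]) (auto simp: op_lt[OF P] sl intro!: sum.cong)
        thus ?thesis by (simp add: lin vec_op.zero[OF vec_op_op])
      qed
      have "fam_shift r P ?F g i' (slice ?NP z i') j = (if i' = i then fam_shift r P ?F g i x j else 0)" for i'
        by (cases g) (simp_all add: fam_shift_def opP fun_eq_iff)
      moreover have "op n q Y g (?F i' (slice ?NP z i')) j = (if i' = i then op n q Y g (?F i x) j else 0)" for i'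
        by (simp add: Fs vec_op.zero[OF vec_op_op])
      ultimately show "fam_shift r P ?F g i x j = op n q Y g (?F i x) j"
        using L[OF j, of g z] R[OF j, of g z] is_hom_app[OF hom, of g z] i by simp
    qed
  qed
qed

text \<open>The ratio of consecutive scalars is forced by the condition for a: the power of q is the
  eigenvalue of b on the next basis vector, and the sign is that of the antipode, S(a) = -a
  b^(-1).\<close>

definition dual_scal :: "int \<Rightarrow> nat \<Rightarrow> 'k" where
  "dual_scal r i = (\<Prod>j<i. - (q powi (r + int j + 1)))"

lemma dual_scal_Suc: "dual_scal r (Suc i) = - (q powi (r + int i + 1)) * dual_scal r i"
  by (simp add: dual_scal_def)

lemma dual_scal_ne_0: "dual_scal r i \<noteq> 0"
  using q_ne_0[OF n q] by (simp add: dual_scal_def)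

text \<open>\<open>EG\<close> is the intertwining condition in one coordinate, \<open>EF\<close> the
  matching condition on the family. On a tensor product a also involves b, and d also involves c, so
  the equivalences for a and d presuppose the conditions for b and c.\<close>

lemma vcat_hom_iff:
  assumes P: "is_module n q P" and Y: "is_module n q Y" and G: "\<And>i. G i \<in> carrier_mat (mdim Y) (mdim P)"
  shows "is_hom n q P (tensor n q (V q l (1 - int l - r)) Y) (vcat (mdim Y) (mdim P) G) \<longleftrightarrow>
    fam_hom r P Y (\<lambda>i. dual_scal r i \<cdot>\<^sub>m G (l - 1 - i))"
proof -
  let ?s = "1 - int l - r"
  let ?T = "tensor n q (V q l ?s) Y" and ?f = "vcat (mdim Y) (mdim P) G"
  let ?F = "\<lambda>i. app 0 (dual_scal r i \<cdot>\<^sub>m G (l - 1 - i))" and ?G = "\<lambda>i. app 0 (G i)"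
  note T = tensor_V_module[OF Y, of ?s]
  have q0: "q \<noteq> 0" by (rule q_ne_0[OF n q])
  have fc: "?f \<in> carrier_mat (mdim ?T) (mdim P)" by (simp add: vcat_def mdim_tensor_V)
  have F: "?F i x = fscale (dual_scal r i) (?G (l - 1 - i) x)" for i x
    using app_ge[OF G] by (auto simp: fun_eq_iff app_smult carrier_matD[OF G])
  have ds0: "dual_scal r i \<noteq> 0" for i by (rule dual_scal_ne_0)
  have opY: "op n q Y g (slice (mdim Y) (app 0 ?f x) k) j = op n q Y g (?G k x) j" if "k < l" "j < mdim Y" for g x k j
    unfolding op_lt[OF Y that(2)] using that(1) by (intro sum.cong) (auto simp: slice_def app_vcat[OF G])
  have opl: "op n q Y g (fscale c x) j = c * op n q Y g x j" for g c x j
    by (simp add: vec_op.scale[OF vec_op_op])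
  define EG where "EG g k x j \<longleftrightarrow> ?G k (op n q P g x) j = op n q ?T g (app 0 ?f x) (k * mdim Y + j)" for g k x j
  define EF where "EF g i x j \<longleftrightarrow> fam_shift r P ?F g i x j = op n q Y g (?F i x) j" for g i x j
  have pw: "q powi (x + y) = q powi x * q powi y" for x y using q0 by (simp add: power_int_add)
  have pinv: "q powi x * (q powi (- x) * y) = y" for x y
    using q0 by (simp add: power_int_minus)
  have sw: "u = q powi (- e) * v \<longleftrightarrow> q powi e * u = v" for u v e
    using q0 by (auto simp: power_int_minus field_simps)
  have Gb: "EG Gb k x j \<longleftrightarrow> EF Gb (l - 1 - k) x j" if k: "k < l" and j: "j < mdim Y" for k x j
  proof -
    let ?i = "l - 1 - k"
    have e: "?s + int k = - (r + int ?i)" and kk: "l - 1 - ?i = k" using k by auto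
    have "EG Gb k x j \<longleftrightarrow> ?G k (op n q P Gb x) j = q powi (- (r + int ?i)) * op n q Y Gb (?G k x) j"
      unfolding EG_def by (simp add: op_tensor_V[OF Y k j] opY[OF k j] e)
    also have "\<dots> \<longleftrightarrow> q powi (r + int ?i) * ?G k (op n q P Gb x) j = op n q Y Gb (?G k x) j"
      by (rule sw)
    also have "\<dots> \<longleftrightarrow> EF Gb ?i x j"
      unfolding EF_def fam_shift_def gen.case F unfolding kk by (simp add: opl ds0 mult.left_commute)
    finally show ?thesis .
  qed
  have Gc: "EG Gc k x j \<longleftrightarrow> EF Gc (l - 1 - k) x j" if k: "k < l" and j: "j < mdim Y" for k x j
  proof -
    let ?i = "l - 1 - k"
    have e: "int k + 1 - ?s - int l = - (int ?i + 1 - r - int l)" and kk: "l - 1 - ?i = k" using k by auto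
    have "EG Gc k x j \<longleftrightarrow> ?G k (op n q P Gc x) j = q powi (- (int ?i + 1 - r - int l)) * op n q Y Gc (?G k x) j"
      unfolding EG_def by (simp only: op_tensor_V[OF Y k j] opY[OF k j] e)
    also have "\<dots> \<longleftrightarrow> q powi (int ?i + 1 - r - int l) * ?G k (op n q P Gc x) j = op n q Y Gc (?G k x) j"
      by (rule sw)
    also have "\<dots> \<longleftrightarrow> EF Gc ?i x j"
      unfolding EF_def fam_shift_def gen.case F unfolding kk by (simp add: opl ds0 mult.left_commute)
    finally show ?thesis .
  qed
  have Ga: "EG Ga k x j \<longleftrightarrow> EF Ga (l - 1 - k) x j"
    if k: "k < l" and j: "j < mdim Y" and b: "\<And>k. k < l \<Longrightarrow> EG Gb k x j" for k x j
  proof -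
    let ?i = "l - 1 - k"
    have kk: "l - 1 - ?i = k" using k by auto
    have sh: "(if Suc ?i < l then ?F (Suc ?i) (op n q P Gb x) else 0) j =
        - dual_scal r ?i * (if k = 0 then 0 else op n q Y Gb (?G (k - 1) x) j)"
    proof (cases "k = 0")
      case False
      hence lt: "Suc ?i < l" "k - 1 < l" and e: "l - 1 - Suc ?i = k - 1" "?s + int (k - 1) = - (r + int ?i + 1)"
        using k by auto
      have "?G (k - 1) (op n q P Gb x) j = q powi (- (r + int ?i + 1)) * op n q Y Gb (?G (k - 1) x) j"
        using b[OF lt(2)] unfolding EG_def op_tensor_V[OF Y lt(2) j] opY[OF lt(2) j] e .
      hence H: "?G (k - 1) (op n q P Gb x) j = q powi (- (r + int ?i + 1)) * op n q Y Gb (?G (k - 1) x) j" .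
      have "?F (Suc ?i) (op n q P Gb x) j = - (q powi (r + int ?i + 1)) * dual_scal r ?i * ?G (k - 1) (op n q P Gb x) j"
        unfolding F unfolding e dual_scal_Suc by simp
      also have "\<dots> = - dual_scal r ?i * (q powi (r + int ?i + 1) * (q powi (- (r + int ?i + 1)) * op n q Y Gb (?G (k - 1) x) j))"
        unfolding H by (simp only: mult_minus_left mult_minus_right mult_ac)
      also have "\<dots> = - dual_scal r ?i * op n q Y Gb (?G (k - 1) x) j" by (simp only: pinv)
      finally have "?F (Suc ?i) (op n q P Gb x) j = - dual_scal r ?i * op n q Y Gb (?G (k - 1) x) j" .
      thus ?thesis using False lt by simp
    qed (use k in simp)
    have "EF Ga ?i x j \<longleftrightarrow> dual_scal r ?i * (?G k (op n q P Ga x) j - (if k = 0 then 0 else op n q Y Gb (?G (k - 1) x) j)) =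
        dual_scal r ?i * op n q Y Ga (?G k x) j"
      unfolding EF_def fam_shift_def gen.case plus_fun_apply sh unfolding F unfolding kk by (simp add: opl algebra_simps)
    also have "\<dots> \<longleftrightarrow> ?G k (op n q P Ga x) j - (if k = 0 then 0 else op n q Y Gb (?G (k - 1) x) j) = op n q Y Ga (?G k x) j"
      using ds0[of ?i] by (simp only: mult_cancel_left simp_thms)
    also have "\<dots> \<longleftrightarrow> EG Ga k x j"
      using k opY[of "k - 1" j Gb x]
      unfolding EG_def op_tensor_V[OF Y k j] opY[OF k j] by (auto simp: j algebra_simps)
    finally show ?thesis by simp
  qed
  have Gd: "EG Gd k x j \<longleftrightarrow> EF Gd (l - 1 - k) x j"
    if k: "k < l" and j: "j < mdim Y" and c: "\<And>k. k < l \<Longrightarrow> EG Gc k x j" for k x j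
  proof -
    let ?i = "l - 1 - k"
    have kk: "l - 1 - ?i = k" using k by auto
    have sh: "(if ?i = 0 then 0 else fscale (alpha q l ?i) (?F (?i - 1) (op n q P Gc x))) j =
        - dual_scal r ?i * (if Suc k < l then alpha q l (Suc k) * op n q Y Gc (?G (Suc k) x) j else 0)"
    proof (cases "Suc k < l")
      case True
      hence i0: "?i \<noteq> 0" and e: "l - 1 - (?i - 1) = Suc k" "int (Suc k) + 1 - ?s - int l = (int l - 2 * int ?i) + (r + int (?i - 1) + 1)"
        "l - ?i = Suc k" "?i \<le> l"
        by auto
      have "?G (Suc k) (op n q P Gc x) j = q powi (int l - 2 * int ?i) * q powi (r + int (?i - 1) + 1) * op n q Y Gc (?G (Suc k) x) j"
        using c[OF True] unfolding EG_def op_tensor_V[OF Y True j] opY[OF True j] e pw .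
      hence H: "?G (Suc k) (op n q P Gc x) j = q powi (int l - 2 * int ?i) * q powi (r + int (?i - 1) + 1) * op n q Y Gc (?G (Suc k) x) j" .
      have "alpha q l ?i * ?F (?i - 1) (op n q P Gc x) j = alpha q l ?i * (dual_scal r (?i - 1) * ?G (Suc k) (op n q P Gc x) j)"
        unfolding F unfolding e by simp
      also have "\<dots> = (alpha q l ?i * q powi (int l - 2 * int ?i)) * (q powi (r + int (?i - 1) + 1) * dual_scal r (?i - 1)) * op n q Y Gc (?G (Suc k) x) j"
        unfolding H by (simp only: mult_ac)
      also have "alpha q l ?i * q powi (int l - 2 * int ?i) = alpha q l (Suc k)"
        using qpow_inverse_alpha[OF q0 q_ne_1 e(4)] e(3) by simp
      also have "q powi (r + int (?i - 1) + 1) * dual_scal r (?i - 1) = - dual_scal r ?i"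
      proof -
        have e5: "Suc (?i - 1) = ?i" using i0 by simp
        show ?thesis unfolding dual_scal_Suc[of r "?i - 1", unfolded e5] by simp
      qed
      finally show ?thesis using True i0 by (simp add: mult_ac)
    next
      case False
      hence "?i = 0" using k by simp
      thus ?thesis using False by (simp only:) simp
    qed
    have "EF Gd ?i x j \<longleftrightarrow> dual_scal r ?i * (?G k (op n q P Gd x) j - (if Suc k < l then alpha q l (Suc k) * op n q Y Gc (?G (Suc k) x) j else 0)) =
        dual_scal r ?i * op n q Y Gd (?G k x) j"
      unfolding EF_def fam_shift_def gen.case plus_fun_apply sh unfolding F unfolding kk by (simp add: opl algebra_simps)
    also have "\<dots> \<longleftrightarrow> ?G k (op n q P Gd x) j - (if Suc k < l then alpha q l (Suc k) * op n q Y Gc (?G (Suc k) x) j else 0) = op n q Y Gd (?G k x) j"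
      using ds0[of ?i] by (simp only: mult_cancel_left simp_thms)
    also have "\<dots> \<longleftrightarrow> EG Gd k x j"
      using k opY[of "Suc k" j Gc x]
      unfolding EG_def op_tensor_V[OF Y k j] opY[OF k j] by (auto simp: j algebra_simps)
    finally show ?thesis by simp
  qed
  have "is_hom n q P ?T ?f \<longleftrightarrow> (\<forall>g. \<forall>k<l. \<forall>x. \<forall>j<mdim Y. EG g k x j)"
  proof
    assume h: "is_hom n q P ?T ?f"
    show "\<forall>g. \<forall>k<l. \<forall>x. \<forall>j<mdim Y. EG g k x j"
      unfolding EG_def is_hom_app[OF h, symmetric] by (simp add: app_vcat[OF G])
  next
    assume e: "\<forall>g. \<forall>k<l. \<forall>x. \<forall>j<mdim Y. EG g k x j"
    show "is_hom n q P ?T ?f"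
    proof (rule is_homI_app[OF P T fc])
      fix g x y assume "y < mdim ?T"
      hence y: "y < l * mdim Y" by (simp add: mdim_tensor_V)
      have "app 0 ?f (op n q P g x) (y div mdim Y * mdim Y + y mod mdim Y) = op n q ?T g (app 0 ?f x) (y div mdim Y * mdim Y + y mod mdim Y)"
        using e div_mod_lt[OF y] unfolding EG_def by (simp only: app_vcat[OF G])
      thus "app 0 ?f (op n q P g x) y = op n q ?T g (app 0 ?f x) y" by simp
    qed
  qed
  also have "\<dots> \<longleftrightarrow> (\<forall>g. \<forall>k<l. \<forall>x. \<forall>j<mdim Y. EF g (l - 1 - k) x j)"
  proof
    assume e: "\<forall>g. \<forall>k<l. \<forall>x. \<forall>j<mdim Y. EG g k x j"
    show "\<forall>g. \<forall>k<l. \<forall>x. \<forall>j<mdim Y. EF g (l - 1 - k) x j"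
    proof (intro allI impI)
      fix g k x j assume "k < l" "j < mdim Y"
      thus "EF g (l - 1 - k) x j" using e Ga[of k j x] Gb[of k j x] Gc[of k j x] Gd[of k j x] by (cases g) auto
    qed
  next
    assume e: "\<forall>g. \<forall>k<l. \<forall>x. \<forall>j<mdim Y. EF g (l - 1 - k) x j"
    show "\<forall>g. \<forall>k<l. \<forall>x. \<forall>j<mdim Y. EG g k x j"
    proof (intro allI impI)
      fix g k x j assume kj: "k < l" "j < mdim Y"
      have "EG Gb k x j" "EG Gc k x j" if "k < l" for k using e Gb[OF that kj(2)] Gc[OF that kj(2)] that kj by auto
      thus "EG g k x j" using kj e Ga[of k j x] Gd[of k j x] by (cases g) auto
    qed
  qed
  also have "\<dots> \<longleftrightarrow> (\<forall>g. \<forall>i<l. \<forall>x. \<forall>j<mdim Y. EF g i x j)"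
  proof -
    have "(\<forall>k<l. R (l - 1 - k)) \<longleftrightarrow> (\<forall>i<l. R i)" for R :: "nat \<Rightarrow> bool"
    proof (intro iffI allI impI)
      fix i assume R: "\<forall>k<l. R (l - 1 - k)" and i: "i < l"
      have e: "l - 1 - (l - 1 - i) = i" using i by simp
      have "R (l - 1 - (l - 1 - i))" by (rule R[rule_format]) (use i in simp)
      thus "R i" unfolding e .
    qed auto
    from this[of "\<lambda>i. \<forall>x. \<forall>j<mdim Y. EF _ i x j"] show ?thesis by blast
  qed
  finally show ?thesis unfolding EF_def fam_hom_def .
qed

lemma fam_hom_cong: "(\<And>i. i < l \<Longrightarrow> F i = F' i) \<Longrightarrow> fam_hom r P Y F = fam_hom r P Y F'"
  unfolding fam_hom_def fam_shift_def by (auto split: gen.split)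

lemma hcat_blocks:
  assumes "f \<in> carrier_mat NY (l * NP)"
  shows "hcat NY NP (\<lambda>i. mat NY NP (\<lambda>(j, p). f $$ (j, i * NP + p))) = f"
  by (rule eq_matI) (use assms in \<open>auto simp: hcat_def div_mod_lt\<close>)

lemma vcat_blocks:
  assumes "f \<in> carrier_mat (l * NY) NP"
  shows "vcat NY NP (\<lambda>i. mat NY NP (\<lambda>(j, p). f $$ (i * NY + j, p))) = f"
  by (rule eq_matI) (use assms in \<open>auto simp: vcat_def div_mod_lt\<close>)

lemma hcat_cong: "(\<And>i. i < l \<Longrightarrow> F i = F' i) \<Longrightarrow> hcat NY NP F = hcat NY NP F'"
  by (rule eq_matI) (auto simp: hcat_def div_mod_lt)

lemma mult_hcat:
  assumes g: "g \<in> carrier_mat NY NX" and F: "\<And>i. F i \<in> carrier_mat NX NP"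
  shows "g * hcat NX NP F = hcat NY NP (\<lambda>i. g * F i)"
proof (rule eq_matI)
  fix j x assume "j < dim_row (hcat NY NP (\<lambda>i. g * F i))" "x < dim_col (hcat NY NP (\<lambda>i. g * F i))"
  hence jx: "j < NY" "x < l * NP" by (auto simp: hcat_def)
  show "(g * hcat NX NP F) $$ (j, x) = hcat NY NP (\<lambda>i. g * F i) $$ (j, x)"
    using g carrier_matD[OF F] jx div_mod_lt[OF jx(2)] by (simp add: hcat_def scalar_prod_def)
qed (use g in \<open>auto simp: hcat_def\<close>)

section \<open>Tensoring with a simple module preserves epimorphisms and projectivity\<close>

lemma is_hom_kron_one:
  assumes "is_hom n q X Y g"
  shows "is_hom n q (tensor n q (V q l r) X) (tensor n q (V q l r) Y) (kron (1\<^sub>m l) g)"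
proof -
  have X: "is_module n q X" and Y: "is_module n q Y" and g: "g \<in> carrier_mat (mdim Y) (mdim X)"
    and e: "\<And>h. g * gmat n q X h = gmat n q Y h * g" using assms by (auto simp: is_hom_iff)
  note V = V_module[OF n q l]
  note c = gmat_carrier[OF X] gmat_carrier[OF Y]
  note vc = V_gen_carrier one_carrier_mat
  have gc: "g * gmat n q X h \<in> carrier_mat (mdim Y) (mdim X)" for h using g c by auto
  have k: "kron (1\<^sub>m l) g * kron A (gmat n q X h) = kron A (gmat n q Y h) * kron (1\<^sub>m l) g"
    if A: "A \<in> carrier_mat l l" for A h
    by (simp add: kron_mult[OF one_carrier_mat g A c(1)] kron_mult[OF A c(2) one_carrier_mat g] e
        left_mult_one_mat[OF A] right_mult_one_mat[OF A])
  note kc = kron_carrier[OF V_gen_carrier c(1)] kron_carrier[OF one_carrier_mat c(1)]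
    kron_carrier[OF V_gen_carrier c(2)] kron_carrier[OF one_carrier_mat c(2)] kron_carrier[OF one_carrier_mat g]
  have "kron (1\<^sub>m l) g * gmat n q (tensor n q (V q l r) X) h = gmat n q (tensor n q (V q l r) Y) h * kron (1\<^sub>m l) g" for h
    by (cases h)
       (simp_all add: gmat_tensor[OF V(1) X n q] gmat_tensor[OF V(1) Y n q] V k[OF V_gen_carrier] k[OF one_carrier_mat]
         mult_add_distrib_mat[OF kc(5) kc(1) kc(2)] add_mult_distrib_mat[OF kc(3) kc(4) kc(5)])
  thus ?thesis using tensor_V_module X Y kron_carrier[OF one_carrier_mat g, of l]
    by (simp add: is_hom_iff mdim_tensor_V)
qed

lemma app_kron_one:
  assumes g: "g \<in> carrier_mat NY NX" and k: "k < l" "j < NY"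
  shows "app 0 (kron (1\<^sub>m l) g) z (k * NY + j) = app 0 g (slice NX z k) j"
  by (subst app_kron[OF one_carrier_mat g k, where \<epsilon>' = 0]) (rule sum_one_mat[OF k(1)])

lemma is_epi_kron_one:
  assumes "is_epi n q X Y g"
  shows "is_epi n q (tensor n q (V q l r) X) (tensor n q (V q l r) Y) (kron (1\<^sub>m l) g)"
  unfolding is_epi_iff
proof (intro conjI allI)
  have h: "is_hom n q X Y g" and s: "\<And>y. \<exists>x. \<forall>i<mdim Y. app 0 g x i = y i" using assms by (auto simp: is_epi_iff)
  show "is_hom n q (tensor n q (V q l r) X) (tensor n q (V q l r) Y) (kron (1\<^sub>m l) g)" by (rule is_hom_kron_one[OF h])
  have g: "g \<in> carrier_mat (mdim Y) (mdim X)" using h by (simp add: is_hom_iff)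
  fix y
  have "\<forall>k. \<exists>x. \<forall>i<mdim Y. app 0 g x i = slice (mdim Y) y k i" by (intro allI s)
  from choice[OF this] obtain w where w: "\<forall>k. \<forall>i<mdim Y. app 0 g (w k) i = slice (mdim Y) y k i" ..
  let ?x = "\<lambda>z. w (z div mdim X) (z mod mdim X)"
  have "app 0 (kron (1\<^sub>m l) g) ?x i = y i" if i: "i < l * mdim Y" for i
  proof -
    note d = div_mod_lt[OF i]
    have "app 0 (kron (1\<^sub>m l) g) ?x (i div mdim Y * mdim Y + i mod mdim Y) = app 0 g (slice (mdim X) ?x (i div mdim Y)) (i mod mdim Y)"
      by (rule app_kron_one[OF g d])
    also have "app 0 g (slice (mdim X) ?x (i div mdim Y)) = app 0 g (w (i div mdim Y))"
      by (rule app_cong_lt[OF g]) (simp add: slice_def)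
    also have "\<dots> (i mod mdim Y) = y i" using w d by (simp add: slice_def)
    finally show ?thesis by simp
  qed
  thus "\<exists>x. \<forall>i<mdim (tensor n q (V q l r) Y). app 0 (kron (1\<^sub>m l) g) x i = y i"
    by (intro exI[of _ ?x]) (simp add: mdim_tensor_V)
qed

lemma tensor_V_projective:
  assumes "is_projective n q P"
  shows "is_projective n q (tensor n q (V q l r) P)"
  unfolding is_projective_def
proof (intro conjI allI impI)
  have P: "is_module n q P" using assms by (simp add: is_projective_def)
  let ?T = "tensor n q (V q l r) P" and ?s = "1 - int l - r"
  show "is_module n q ?T" by (rule tensor_V_module[OF P])
  fix X Y g f assume "is_epi n q X Y g \<and> is_hom n q ?T Y f"
  hence ge: "is_epi n q X Y g" and f: "is_hom n q ?T Y f" by auto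
  have gh: "is_hom n q X Y g" using ge by (simp add: is_epi_iff)
  hence X: "is_module n q X" and Y: "is_module n q Y" and g: "g \<in> carrier_mat (mdim Y) (mdim X)"
    by (auto simp: is_hom_iff)
  have fc: "f \<in> carrier_mat (mdim Y) (l * mdim P)" using f by (simp add: is_hom_iff mdim_tensor_V)
  define F where "F i = mat (mdim Y) (mdim P) (\<lambda>(j, p). f $$ (j, i * mdim P + p))" for i
  \<comment> \<open>Reversing the index and dividing by the scalars brings the blocks of f into the
    form required by \<open>vcat_hom_iff\<close>.\<close>
  define G where "G k = (1 / dual_scal r (l - 1 - k)) \<cdot>\<^sub>m F (l - 1 - k)" for k
  have Fc: "F i \<in> carrier_mat (mdim Y) (mdim P)" and Gc: "G i \<in> carrier_mat (mdim Y) (mdim P)" for i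
    by (simp_all add: F_def G_def)
  have fF: "f = hcat (mdim Y) (mdim P) F" unfolding F_def by (rule hcat_blocks[OF fc, symmetric])
  have FG: "dual_scal r i \<cdot>\<^sub>m G (l - 1 - i) = F i" if "i < l" for i
    using that dual_scal_ne_0[of r i] by (simp add: G_def smult_smult_mat one_smult_mat)
  have "fam_hom r P Y F" using f hcat_hom_iff[OF P Y Fc] by (simp add: fF)
  hence "fam_hom r P Y (\<lambda>i. dual_scal r i \<cdot>\<^sub>m G (l - 1 - i))" by (subst fam_hom_cong[OF FG])
  hence \<phi>: "is_hom n q P (tensor n q (V q l ?s) Y) (vcat (mdim Y) (mdim P) G)" using vcat_hom_iff[OF P Y Gc] by simp
  obtain \<psi> where \<psi>: "is_hom n q P (tensor n q (V q l ?s) X) \<psi>" "kron (1\<^sub>m l) g * \<psi> = vcat (mdim Y) (mdim P) G"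
    using assms \<phi> is_epi_kron_one[OF ge] unfolding is_projective_def by blast
  define G' where "G' k = mat (mdim X) (mdim P) (\<lambda>(j, p). \<psi> $$ (k * mdim X + j, p))" for k
  have G'c: "G' i \<in> carrier_mat (mdim X) (mdim P)" for i by (simp add: G'_def)
  have \<psi>c: "\<psi> \<in> carrier_mat (l * mdim X) (mdim P)" using \<psi>(1) by (simp add: is_hom_iff mdim_tensor_V)
  have \<psi>G: "\<psi> = vcat (mdim X) (mdim P) G'" unfolding G'_def by (rule vcat_blocks[OF \<psi>c, symmetric])
  have gG: "g * G' k = G k" if k: "k < l" for k
  proof (rule mat_eq_app[OF mult_carrier_mat[OF g G'c] Gc])
    fix x j assume j: "j < mdim Y"
    have "app 0 (G k) x j = app 0 (kron (1\<^sub>m l) g * \<psi>) x (k * mdim Y + j)"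
      unfolding \<psi>(2) by (rule app_vcat[OF Gc k j, symmetric])
    also have "\<dots> = app 0 (kron (1\<^sub>m l) g) (app 0 \<psi> x) (k * mdim Y + j)"
      by (rule fun_cong[OF app_mult_0[OF kron_carrier[OF one_carrier_mat g] \<psi>c, symmetric]])
    also have "\<dots> = app 0 g (slice (mdim X) (app 0 \<psi> x) k) j" by (rule app_kron_one[OF g k j])
    also have "app 0 g (slice (mdim X) (app 0 \<psi> x) k) = app 0 g (app 0 (G' k) x)"
      by (rule app_cong_lt[OF g]) (simp add: slice_def \<psi>G app_vcat[OF G'c k])
    also have "\<dots> = app 0 (g * G' k) x" by (rule app_mult_0[OF g G'c])
    finally show "app 0 (g * G' k) x j = app 0 (G k) x j" by simp
  qed
  define F' where "F' i = dual_scal r i \<cdot>\<^sub>m G' (l - 1 - i)" for i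
  have F'c: "F' i \<in> carrier_mat (mdim X) (mdim P)" for i by (simp add: F'_def G'c)
  have "fam_hom r P X F'" using \<psi>(1) vcat_hom_iff[OF P X G'c, of r] unfolding \<psi>G F'_def by simp
  hence h: "is_hom n q ?T X (hcat (mdim X) (mdim P) F')" using hcat_hom_iff[OF P X F'c] by simp
  have "g * F' i = F i" if i: "i < l" for i
    using gG[of "l - 1 - i"] FG[OF i] i by (simp add: F'_def mult_smult_distrib[OF g G'c])
  hence "g * hcat (mdim X) (mdim P) F' = f"
    unfolding mult_hcat[OF g F'c] fF by (rule hcat_cong)
  thus "\<exists>h. is_hom n q ?T X h \<and> g * h = f" using h by blast
qed

end

section \<open>Direct sums of projective covers\<close>

lemma sum_add_split:
  fixes f :: "nat \<Rightarrow> 'a::comm_monoid_add"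
  shows "(\<Sum>j<a + b. f j) = (\<Sum>j<a. f j) + (\<Sum>j<b. f (a + j))"
  by (induction b) (simp_all add: add.assoc)

lemma app_dsum_mat:
  assumes A: "A \<in> carrier_mat a a'" and B: "B \<in> carrier_mat b b'" and i: "i < a + b"
  shows "app \<epsilon> (dsum_mat A B) f i = (if i < a then app \<epsilon>' A f i else app \<epsilon>' B (\<lambda>k. f (a' + k)) (i - a))"
proof -
  have "app \<epsilon> (dsum_mat A B) f i = (\<Sum>j<a' + b'. dsum_mat A B $$ (i, j) * f j)"
    by (rule app_lt[OF _ i]) (use A B in auto)
  also have "\<dots> = (\<Sum>j<a'. dsum_mat A B $$ (i, j) * f j) + (\<Sum>j<b'. dsum_mat A B $$ (i, a' + j) * f (a' + j))"
    by (rule sum_add_split)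
  also have "\<dots> = (if i < a then app \<epsilon>' A f i else app \<epsilon>' B (\<lambda>k. f (a' + k)) (i - a))"
    using A B i by (auto simp: app_def)
  finally show ?thesis .
qed

context
  fixes n :: nat and q :: "'k::field" and M :: "'k fdmod" and Ms
  assumes M: "is_module n q M" and Ms: "is_module n q (direct_sum Ms)"
begin

lemma mdim_direct_sum_Cons: "mdim (direct_sum (M # Ms)) = mdim M + mdim (direct_sum Ms)"
  by (simp add: mdim_direct_sum)

lemma is_module_direct_sum_Cons: "is_module n q (direct_sum (M # Ms))"
  using alg_map_dsum[of "mdim M" "\<lambda>x. act M (H_class n q x)" "mdim (direct_sum Ms)"
        "\<lambda>x. act (direct_sum Ms) (H_class n q x)"] M Ms
  by (simp add: is_module_iff act_direct_sum_Cons mdim_direct_sum_Cons)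

lemma op_direct_sum:
  assumes "i < mdim (direct_sum (M # Ms))"
  shows "op n q (direct_sum (M # Ms)) g x i =
    (if i < mdim M then op n q M g x i else op n q (direct_sum Ms) g (\<lambda>k. x (mdim M + k)) (i - mdim M))"
  unfolding op_def gmat_direct_sum_Cons
  by (rule app_dsum_mat[OF gmat_carrier[OF M] gmat_carrier[OF Ms]]) (use assms in \<open>simp add: mdim_direct_sum_Cons\<close>)

end

lemma op_cong:
  "is_module n q M \<Longrightarrow> (\<And>k. k < mdim M \<Longrightarrow> x k = y k) \<Longrightarrow> i < mdim M \<Longrightarrow> op n q M g x i = op n q M g y i"
  by (simp add: op_lt)

text \<open>Let I map onto both summands together. \<open>?K\<close> collects the first components
  of those vectors of I whose second component is killed by p'; it maps onto S, so it is everything.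
  \<open>?L\<close> collects the second components of those vectors of I whose first component is
  zero; by the first half it maps onto the other summand, so it is everything too. Together they
  exhaust I.\<close>

lemma ess_dsum:
  assumes p: "ess n q M S p" and p': "ess n q (direct_sum Ms) (direct_sum Ss) p'"
  shows "ess n q (direct_sum (M # Ms)) (direct_sum (S # Ss)) (dsum_mat p p')"
proof -
  have hp: "is_hom n q M S p" and hp': "is_hom n q (direct_sum Ms) (direct_sum Ss) p'"
    using p p' by (auto simp: ess_def is_epi_iff)
  hence M: "is_module n q M" and S: "is_module n q S" and Ms: "is_module n q (direct_sum Ms)" and Ss: "is_module n q (direct_sum Ss)"
    and c: "p \<in> carrier_mat (mdim S) (mdim M)" and c': "p' \<in> carrier_mat (mdim (direct_sum Ss)) (mdim (direct_sum Ms))"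
    by (auto simp: is_hom_iff)
  let ?M = "direct_sum (M # Ms)" and ?S = "direct_sum (S # Ss)" and ?p = "dsum_mat p p'"
  let ?m = "mdim M" and ?s = "mdim S"
  note MM = is_module_direct_sum_Cons[OF M Ms] and SS = is_module_direct_sum_Cons[OF S Ss]
  note dM = mdim_direct_sum_Cons[OF M Ms] and dS = mdim_direct_sum_Cons[OF S Ss]
  note opM = op_direct_sum[OF M Ms] and opS = op_direct_sum[OF S Ss]
  have ap: "app 0 ?p x i = (if i < ?s then app 0 p x i else app 0 p' (\<lambda>k. x (?m + k)) (i - ?s))" if "i < mdim ?S" for x i
    by (rule app_dsum_mat[OF c c']) (use that dS in simp)
  have ap1: "app 0 ?p x i = app 0 p x i" if "i < ?s" for x i using ap[of i x] that dS by simp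
  have ap2: "app 0 ?p x (?s + i) = app 0 p' (\<lambda>k. x (?m + k)) i" if "i < mdim (direct_sum Ss)" for x i
    using ap[of "?s + i" x] that dS by simp
  have opM1: "op n q ?M g x i = op n q M g x i" if "i < ?m" for g x i using opM[of i g x] that dM by simp
  have opM2: "op n q ?M g x (?m + i) = op n q (direct_sum Ms) g (\<lambda>k. x (?m + k)) i" if "i < mdim (direct_sum Ms)" for g x i
    using opM[of "?m + i" g x] that dM by simp
  have hom: "is_hom n q ?M ?S ?p"
  proof (rule is_homI_app[OF MM SS])
    show "?p \<in> carrier_mat (mdim ?S) (mdim ?M)" unfolding dM dS using c c' by auto
    fix g x i assume i: "i < mdim ?S"
    show "app 0 ?p (op n q ?M g x) i = op n q ?S g (app 0 ?p x) i"
    proof (cases "i < ?s")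
      case True
      have "app 0 p (op n q ?M g x) i = app 0 p (op n q M g x) i"
        by (rule fun_cong[OF app_cong_lt[OF c opM1]])
      also have "\<dots> = op n q S g (app 0 p x) i" by (simp only: is_hom_app[OF hp])
      also have "\<dots> = op n q S g (app 0 ?p x) i" by (rule op_cong[OF S _ True]) (simp add: ap1)
      finally show ?thesis using True by (simp add: ap[OF i] opS[OF i])
    next
      case False
      let ?i = "i - ?s" and ?x = "\<lambda>k. x (?m + k)"
      have i': "?i < mdim (direct_sum Ss)" using False i dS by simp
      have "app 0 p' (\<lambda>k. op n q ?M g x (?m + k)) ?i = app 0 p' (op n q (direct_sum Ms) g ?x) ?i"
        by (rule fun_cong[OF app_cong_lt[OF c' opM2]])
      also have "\<dots> = op n q (direct_sum Ss) g (app 0 p' ?x) ?i" by (simp only: is_hom_app[OF hp'])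
      also have "\<dots> = op n q (direct_sum Ss) g (\<lambda>k. app 0 ?p x (?s + k)) ?i" by (rule op_cong[OF Ss _ i']) (simp add: ap2)
      finally show ?thesis using False by (simp add: ap[OF i] opS[OF i])
    qed
  qed
  define pair :: "nat \<Rightarrow> (nat \<Rightarrow> 'a) \<Rightarrow> (nat \<Rightarrow> 'a) \<Rightarrow> nat \<Rightarrow> 'a" where
    "pair k x y i = (if i < k then x i else y (i - k))" for k x y i
  have pair: "pair k x y i = (if i < k then x i else y (i - k))" "pair k x y (k + j) = y j" for k i j x y
    by (simp_all add: pair_def)
  show ?thesis unfolding ess_def is_epi_iff
  proof (intro conjI hom allI impI)
    fix y
    obtain x where x: "\<forall>i<?s. app 0 p x i = y i" using p unfolding ess_def is_epi_iff by blast
    obtain x' where x': "\<forall>i<mdim (direct_sum Ss). app 0 p' x' i = y (?s + i)"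
      using p' unfolding ess_def is_epi_iff by (elim conjE) (drule spec[of _ "\<lambda>i. y (?s + i)"], blast)
    have "app 0 ?p (pair ?m x x') i = y i" if i: "i < mdim ?S" for i
    proof -
      have "app 0 p (pair ?m x x') = app 0 p x" by (rule app_cong_lt[OF c]) (simp add: pair)
      thus ?thesis using x spec[OF x', of "i - ?s"] i dS by (simp add: ap pair)
    qed
    thus "\<exists>x. \<forall>i<mdim ?S. app 0 ?p x i = y i" by blast
  next
    fix I assume I: "submod n q ?M I" and sur: "\<forall>s. \<exists>y\<in>I. \<forall>i<mdim ?S. app 0 ?p y i = s i"
    note lin = vec_op.add[OF vec_op_app] vec_op.scale[OF vec_op_app] vec_op.zero[OF vec_op_app]
    have lin': "app 0 p' (\<lambda>k. (x + y) (?m + k)) = app 0 p' (\<lambda>k. x (?m + k)) + app 0 p' (\<lambda>k. y (?m + k))"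
      "app 0 p' (\<lambda>k. fscale r x (?m + k)) = fscale r (app 0 p' (\<lambda>k. x (?m + k)))" for x y r
      unfolding lin[symmetric] by (simp_all add: plus_fun_def fscale_def)
    let ?K = "{x. \<exists>z\<in>I. (\<forall>i<?m. z i = x i) \<and> (\<forall>i<mdim (direct_sum Ss). app 0 p' (\<lambda>k. z (?m + k)) i = 0)}"
    have K: "submod n q M ?K"
      unfolding submod_def
    proof (intro conjI allI impI ballI)
      show "x \<in> ?K" if "\<forall>i<mdim M. x i = 0" for x
        using that submod_vanish[OF I, of 0] by (auto intro!: bexI[of _ 0] simp: app_def)
      show "x + y \<in> ?K" if xy: "x \<in> ?K" "y \<in> ?K" for x y
      proof -
        obtain z w where "z \<in> I" "w \<in> I" "\<forall>i<?m. z i = x i" "\<forall>i<?m. w i = y i"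
          "\<forall>i<mdim (direct_sum Ss). app 0 p' (\<lambda>k. z (?m + k)) i = 0" "\<forall>i<mdim (direct_sum Ss). app 0 p' (\<lambda>k. w (?m + k)) i = 0"
          using xy by auto
        thus ?thesis using lin'(1)[of z w] by (auto intro!: bexI[of _ "z + w"] submod_add[OF I])
      qed
      show "fscale r x \<in> ?K" if x: "x \<in> ?K" for r x
      proof -
        obtain z where "z \<in> I" "\<forall>i<?m. z i = x i" "\<forall>i<mdim (direct_sum Ss). app 0 p' (\<lambda>k. z (?m + k)) i = 0"
          using x by auto
        thus ?thesis using lin'(2)[of r z] by (auto intro!: bexI[of _ "fscale r z"] submod_scale[OF I])
      qed
      show "op n q M g x \<in> ?K" if x: "x \<in> ?K" for g x
      proof -
        obtain z where z: "z \<in> I" "\<forall>i<?m. z i = x i" "\<forall>i<mdim (direct_sum Ss). app 0 p' (\<lambda>k. z (?m + k)) i = 0"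
          using x by auto
        have "app 0 p' (\<lambda>k. op n q ?M g z (?m + k)) i = 0" if i: "i < mdim (direct_sum Ss)" for i
        proof -
          have "app 0 p' (\<lambda>k. op n q ?M g z (?m + k)) i = app 0 p' (op n q (direct_sum Ms) g (\<lambda>k. z (?m + k))) i"
            by (rule fun_cong[OF app_cong_lt[OF c' opM2]])
          also have "\<dots> = op n q (direct_sum Ss) g (app 0 p' (\<lambda>k. z (?m + k))) i" by (simp only: is_hom_app[OF hp'])
          also have "\<dots> = op n q (direct_sum Ss) g 0 i" by (rule op_cong[OF Ss _ i]) (use z in simp)
          finally show ?thesis by (simp add: vec_op.zero[OF vec_op_op])
        qed
        moreover have "op n q ?M g z i = op n q M g x i" if "i < ?m" for i
          unfolding opM1[OF that] by (rule op_cong[OF M _ that]) (use z in simp)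
        ultimately show ?thesis using submod_op[OF I z(1), of g] by blast
      qed
    qed
    have "\<exists>y\<in>?K. \<forall>i<mdim S. app 0 p y i = t i" for t
    proof -
      obtain z where z: "z \<in> I" "\<forall>i<mdim ?S. app 0 ?p z i = pair ?s t 0 i" using sur by blast
      have "app 0 p z i = t i" if "i < ?s" for i using z(2) ap1[OF that, of z] that dS by (auto simp: pair)
      moreover have "app 0 p' (\<lambda>k. z (?m + k)) i = 0" if "i < mdim (direct_sum Ss)" for i
        using spec[OF z(2), of "?s + i"] ap2[OF that, of z] that dS by (simp add: pair)
      ultimately show ?thesis using z(1) by (intro bexI[of _ z]) auto
    qed
    hence "?K = UNIV" using p K unfolding ess_def by blast
    hence Ku: "x \<in> ?K" for x using UNIV_I[of x] by (simp only:)
    let ?L = "{y. \<exists>z\<in>I. (\<forall>i<?m. z i = 0) \<and> (\<forall>i<mdim (direct_sum Ms). z (?m + i) = y i)}"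
    have L: "submod n q (direct_sum Ms) ?L"
      unfolding submod_def
    proof (intro conjI allI impI ballI)
      show "x \<in> ?L" if "\<forall>i<mdim (direct_sum Ms). x i = 0" for x
        using that submod_vanish[OF I, of 0] by (auto intro!: bexI[of _ 0])
      show "x + y \<in> ?L" if xy: "x \<in> ?L" "y \<in> ?L" for x y
      proof -
        obtain z w where "z \<in> I" "w \<in> I" "\<forall>i<?m. z i = 0" "\<forall>i<?m. w i = 0"
          "\<forall>i<mdim (direct_sum Ms). z (?m + i) = x i" "\<forall>i<mdim (direct_sum Ms). w (?m + i) = y i"
          using xy by auto
        thus ?thesis by (auto intro!: bexI[of _ "z + w"] submod_add[OF I])
      qed
      show "fscale r x \<in> ?L" if x: "x \<in> ?L" for r x
      proof -
        obtain z where "z \<in> I" "\<forall>i<?m. z i = 0" "\<forall>i<mdim (direct_sum Ms). z (?m + i) = x i"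
          using x by auto
        thus ?thesis by (auto intro!: bexI[of _ "fscale r z"] submod_scale[OF I])
      qed
      show "op n q (direct_sum Ms) g x \<in> ?L" if x: "x \<in> ?L" for g x
      proof -
        obtain z where z: "z \<in> I" "\<forall>i<?m. z i = 0" "\<forall>i<mdim (direct_sum Ms). z (?m + i) = x i"
          using x by auto
        have "op n q ?M g z i = 0" if "i < ?m" for i
        proof -
          have "op n q M g z i = op n q M g 0 i" by (rule op_cong[OF M _ that]) (use z in simp)
          thus ?thesis unfolding opM1[OF that] by (simp add: vec_op.zero[OF vec_op_op])
        qed
        moreover have "op n q ?M g z (?m + i) = op n q (direct_sum Ms) g x i" if "i < mdim (direct_sum Ms)" for i
          unfolding opM2[OF that] by (rule op_cong[OF Ms _ that]) (use z in simp)
        ultimately show ?thesis using submod_op[OF I z(1), of g] by blast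
      qed
    qed
    have "\<exists>y\<in>?L. \<forall>i<mdim (direct_sum Ss). app 0 p' y i = t i" for t
    proof -
      obtain z where z: "z \<in> I" "\<forall>i<mdim ?S. app 0 ?p z i = pair ?s 0 t i" using sur by blast
      obtain w where w: "w \<in> I" "\<forall>i<?m. w i = z i" "\<forall>i<mdim (direct_sum Ss). app 0 p' (\<lambda>k. w (?m + k)) i = 0"
        using Ku[of z] by blast
      \<comment> \<open>Subtracting w clears the first component and leaves the image of the second
        one under p' as it was.\<close>
      let ?d = "z + fscale (- 1) w"
      have "?d \<in> I" by (intro submod_add[OF I] submod_scale[OF I] z w)
      moreover have "app 0 p' (\<lambda>k. ?d (?m + k)) i = t i" if "i < mdim (direct_sum Ss)" for i
        using spec[OF z(2), of "?s + i"] ap2[OF that, of z] w(3) that dS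
        unfolding lin' by (simp add: pair)
      ultimately show ?thesis using w(2) by (intro bexI[of _ "\<lambda>k. ?d (?m + k)"]) (auto intro!: bexI[of _ ?d])
    qed
    hence "?L = UNIV" using p' L unfolding ess_def by blast
    hence Lu: "x \<in> ?L" for x using UNIV_I[of x] by (simp only:)
    have "x \<in> I" for x
    proof -
      obtain z where z: "z \<in> I" "\<forall>i<?m. z i = x i" using Ku[of x] by blast
      obtain w where w: "w \<in> I" "\<forall>i<?m. w i = 0" "\<forall>i<mdim (direct_sum Ms). w (?m + i) = x (?m + i) - z (?m + i)"
        using Lu[of "\<lambda>k. x (?m + k) - z (?m + k)"] by blast
      show ?thesis
      proof (rule submod_cong[OF I submod_add[OF I z(1) w(1)]])
        fix i assume i: "i < mdim ?M"
        show "x i = (z + w) i"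
        proof (cases "i < ?m")
          case False
          hence "?m + (i - ?m) = i" "i - ?m < mdim (direct_sum Ms)" using i dM by auto
          thus ?thesis using spec[OF w(3), of "i - ?m"] by simp
        qed (use z w in simp)
      qed
    qed
    thus "I = UNIV" by blast
  qed
qed

lemma ess_dsum_list:
  assumes "\<And>x. x \<in> set L \<Longrightarrow> ess n q (R x) (S x) (p x)"
  shows "\<exists>p. ess n q (direct_sum (map R L)) (direct_sum (map S L)) p"
  using assms
proof (induction L)
  case Nil
  have m: "is_module n q (direct_sum [])" by (rule is_module_direct_sum) simp
  have "is_hom n q (direct_sum []) (direct_sum []) (0\<^sub>m 0 0)"
    by (rule is_homI_app[OF m m]) (simp_all add: mdim_direct_sum)
  hence "ess n q (direct_sum []) (direct_sum []) (0\<^sub>m 0 0)"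
    by (auto simp: ess_def is_epi_iff mdim_direct_sum submod_def)
  thus ?case by auto
next
  case (Cons x L)
  then obtain p' where "ess n q (direct_sum (map R L)) (direct_sum (map S L)) p'" by auto
  thus ?case using ess_dsum[of n q "R x" "S x" "p x" "map R L" "map S L" p'] Cons.prems by auto
qed

subsection \<open>Homomorphisms into direct sums of simple modules\<close>

fun vstack :: "nat \<Rightarrow> 'k::zero mat list \<Rightarrow> 'k mat" where
  "vstack N [] = 0\<^sub>m 0 N"
| "vstack N (f # fs) = (let B = vstack N fs in mat (dim_row f + dim_row B) N
     (\<lambda>(i, j). if i < dim_row f then f $$ (i, j) else B $$ (i - dim_row f, j)))"

lemma app_vstack_Cons:
  assumes "f \<in> carrier_mat a N" "vstack N fs \<in> carrier_mat b N" "i < a + b"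
  shows "app 0 (vstack N (f # fs)) x i = (if i < a then app 0 f x i else app 0 (vstack N fs) x (i - a))"
  using assms by (auto simp: app_def Let_def vstack.simps(2))

declare vstack.simps(2) [simp del]

lemma vstack_hom:
  assumes T: "is_module n q T" and h: "\<And>x. x \<in> set L \<Longrightarrow> is_hom n q T (S x) (f x)"
  shows "is_hom n q T (direct_sum (map S L)) (vstack (mdim T) (map f L))"
  using h
proof (induction L)
  case Nil
  have "is_module n q (direct_sum [])" by (rule is_module_direct_sum) simp
  thus ?case using T by (auto intro!: is_homI_app simp: mdim_direct_sum)
next
  case (Cons y L)
  have hf: "is_hom n q T (S y) (f y)" and hs: "is_hom n q T (direct_sum (map S L)) (vstack (mdim T) (map f L))"
    using Cons by auto
  have S: "is_module n q (S y)" and Ss: "is_module n q (direct_sum (map S L))"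
    and c: "f y \<in> carrier_mat (mdim (S y)) (mdim T)" "vstack (mdim T) (map f L) \<in> carrier_mat (mdim (direct_sum (map S L))) (mdim T)"
    using hf hs by (auto simp: is_hom_iff)
  let ?D = "direct_sum (map S (y # L))" and ?v = "vstack (mdim T) (map f (y # L))"
  have d: "mdim ?D = mdim (S y) + mdim (direct_sum (map S L))" by (simp add: mdim_direct_sum)
  note ap = app_vstack_Cons[OF c]
  show ?case
  proof (rule is_homI_app[OF T])
    show "is_module n q ?D" using is_module_direct_sum_Cons[OF S Ss] by simp
    show "?v \<in> carrier_mat (mdim ?D) (mdim T)" unfolding d using c by (auto simp: Let_def vstack.simps(2))
    fix g x i assume i: "i < mdim ?D"
    have i': "i < mdim (S y) + mdim (direct_sum (map S L))" using i d by simp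
    show "app 0 ?v (op n q T g x) i = op n q ?D g (app 0 ?v x) i"
    proof (cases "i < mdim (S y)")
      case True
      have "op n q ?D g (app 0 ?v x) i = op n q (S y) g (app 0 ?v x) i"
        using op_direct_sum[OF S Ss, of i g "app 0 ?v x"] i True by simp
      also have "\<dots> = op n q (S y) g (app 0 (f y) x) i"
        by (rule op_cong[OF S _ True]) (simp add: ap)
      finally show ?thesis using ap[OF i'] True by (simp add: is_hom_app[OF hf])
    next
      case False
      hence lt: "i - mdim (S y) < mdim (direct_sum (map S L))" using i' by simp
      have "op n q ?D g (app 0 ?v x) i = op n q (direct_sum (map S L)) g (\<lambda>k. app 0 ?v x (mdim (S y) + k)) (i - mdim (S y))"
        using op_direct_sum[OF S Ss, of i g "app 0 ?v x"] i False by simp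
      also have "\<dots> = op n q (direct_sum (map S L)) g (app 0 (vstack (mdim T) (map f L)) x) (i - mdim (S y))"
        by (rule op_cong[OF Ss _ lt]) (simp add: ap)
      finally show ?thesis using ap[OF i'] False by (simp add: is_hom_app[OF hs])
    qed
  qed
qed

section \<open>Joint surjectivity of independent maps to simple modules\<close>

context
  fixes n :: nat and q :: "'k::field" and T :: "'k fdmod"
  assumes n: "1 < n" and q: "is_primitive_root n q" and T: "is_module n q T"
begin

text \<open>
  A list of triples \<open>(m, s, f)\<close> with \<open>f : T \<rightarrow> V(m,s)\<close> for which each \<open>f\<close> is independent of the later
  entries with the same \<open>s\<close>; entries with different \<open>s\<close> are independent for free.
\<close>

fun indep :: "(nat \<times> int \<times> 'k mat) list \<Rightarrow> bool" where
  "indep [] = True"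
| "indep ((m, s, f) # L) = ((\<exists>y. op n q T Gb y = fscale (q powi s) y \<and> (\<forall>j<m. app 0 f y j = unitf 0 j) \<and>
     (\<forall>(m', s', f')\<in>set L. q powi s' = q powi s \<longrightarrow> (\<forall>j<m'. app 0 f' y j = 0))) \<and> indep L)"

lemma powi_eq_iff: "q powi i = q powi j \<longleftrightarrow> int n dvd i - j"
proof -
  interpret r: rep fscale n q "op n q T Ga" "op n q T Gb" "op n q T Gc" "op n q T Gd"
    by (rule rep_op[OF T n q])
  have q0: "q \<noteq> 0" by simp
  have "q powi i = q powi j \<longleftrightarrow> q powi (i - j) = 1" using q0 by (simp add: power_int_diff)
  also have "q powi (i - j) = q ^ nat ((i - j) mod int n)"
  proof -
    have "i - j = int n * ((i - j) div int n) + int (nat ((i - j) mod int n))" using n by simp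
    hence "q powi (i - j) = q powi (int n * ((i - j) div int n)) * q powi int (nat ((i - j) mod int n))"
      using q0 by (metis power_int_add)
    also have "q powi (int n * ((i - j) div int n)) = 1"
      by (simp add: power_int_mult primitive_rootD(1)[OF q])
    finally show ?thesis by (simp only: mult_1_left power_int_of_nat)
  qed
  also have "\<dots> = 1 \<longleftrightarrow> n dvd nat ((i - j) mod int n)" by (rule r.q_pow_eq_1_iff)
  also have "\<dots> \<longleftrightarrow> int n dvd i - j"
  proof -
    have "nat ((i - j) mod int n) < n" using n by (simp add: nat_less_iff)
    hence "n dvd nat ((i - j) mod int n) \<longleftrightarrow> nat ((i - j) mod int n) = 0"
      using dvd_imp_le[of n "nat ((i - j) mod int n)"] by auto
    also have "\<dots> \<longleftrightarrow> (i - j) mod int n = 0" using n by (simp add: nat_eq_iff)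
    finally show ?thesis by (simp add: dvd_eq_mod_eq_0)
  qed
  finally show ?thesis .
qed

lemma indep_append:
  assumes "indep A" "indep B"
    and "\<And>m s f m' s' f'. (m, s, f) \<in> set A \<Longrightarrow> (m', s', f') \<in> set B \<Longrightarrow> q powi s' \<noteq> q powi s"
  shows "indep (A @ B)"
  using assms
proof (induction A)
  case (Cons e A)
  obtain m s f where e: "e = (m, s, f)" by (cases e)
  have "q powi s' \<noteq> q powi s" if "(m', s', f') \<in> set B" for m' s' f'
    using Cons.prems(3)[of m s f] that e by auto
  moreover have "indep (A @ B)"
  proof (rule Cons.IH)
    show "indep A" using Cons.prems(1) by (simp add: e)
    show "q powi s' \<noteq> q powi s" if "(m, s, f) \<in> set A" "(m', s', f') \<in> set B" for m s f m' s' f'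
      using Cons.prems(3)[of m s f m' s' f'] that by simp
  qed (rule Cons.prems(2))
  moreover obtain y where "op n q T Gb y = fscale (q powi s) y" "\<forall>j<m. app 0 f y j = unitf 0 j"
     "\<forall>(m', s', f')\<in>set A. q powi s' = q powi s \<longrightarrow> (\<forall>j<m'. app 0 f' y j = 0)"
    using Cons.prems(1) by (auto simp: e)
  ultimately show ?case by (auto simp: e intro!: exI[of _ y])
qed simp

text \<open>Second parameters sigma + i with distinct i < n give distinct powers of q, so lists
  belonging to different i are independent of each other.\<close>

lemma indep_concat:
  assumes "distinct (map \<iota> D)" and "\<And>d. d \<in> set D \<Longrightarrow> \<iota> d < n \<and> indep (F d) \<and> (\<forall>(m, s, f)\<in>set (F d). s = \<sigma> + int (\<iota> d))"
  shows "indep (concat (map F D))"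
  using assms
proof (induction D)
  case Nil
  show ?case by simp
next
  case (Cons d D)
  have "indep (F d @ concat (map F D))"
  proof (rule indep_append)
    fix m s f m' s' f'
    assume 1: "(m, s, f) \<in> set (F d)" and "(m', s', f') \<in> set (concat (map F D))"
    then obtain d' where d': "d' \<in> set D" "(m', s', f') \<in> set (F d')" by auto
    have s: "s = \<sigma> + int (\<iota> d)" "s' = \<sigma> + int (\<iota> d')"
      using Cons.prems(2)[of d] Cons.prems(2)[of d'] 1 d' by auto
    have i: "\<iota> d < n" "\<iota> d' < n" using Cons.prems(2)[of d] Cons.prems(2)[of d'] d'(1) by auto
    have "\<iota> d \<noteq> \<iota> d'" using Cons.prems(1) d'(1) by auto
    hence "\<not> int n dvd s' - s"
      using i s zdvd_not_zless[of "int (\<iota> d') - int (\<iota> d)" "int n"] zdvd_not_zless[of "int (\<iota> d) - int (\<iota> d')" "int n"]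
      by (cases "\<iota> d < \<iota> d'") (auto simp: dvd_diff_commute)
    thus "q powi s' \<noteq> q powi s" using powi_eq_iff by blast
  qed (use Cons in auto)
  thus ?case by simp
qed

text \<open>The image of y is an eigenvector of b, hence concentrated in one coordinate t as m <= n,
  and t > 0 because coordinate 0 has another weight. There a d acts by the nonzero scalar
  alpha_t(m), so c = -1/alpha_t(m) works.\<close>

lemma kill_other_weight:
  assumes f: "is_hom n q T (V q m s) f" and m: "m \<le> n" and y: "op n q T Gb y = fscale \<beta> y" and ne: "q powi s \<noteq> \<beta>"
  shows "\<exists>c. \<forall>j<m. app 0 f (y + fscale c (op n q T Ga (op n q T Gd y))) j = 0"
proof (cases "\<forall>j<m. app 0 f y j = 0")
  case True
  show ?thesis using True by (intro exI[of _ 0]) simp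
next
  case False
  then obtain t where t: "t < m" "app 0 f y t \<noteq> 0" by auto
  note V = op_V[OF n q m]
  interpret r: rep fscale n q "op n q T Ga" "op n q T Gb" "op n q T Gc" "op n q T Gd"
    by (rule rep_op[OF T n q])
  have fb: "q powi (s + int j) * app 0 f y j = \<beta> * app 0 f y j" if "j < m" for j
    using is_hom_app[OF f, of Gb y] V(2)[OF that, of s "app 0 f y"] unfolding y
    by (simp add: vec_op.scale[OF vec_op_app] fun_eq_iff)
  have b: "\<beta> = q powi (s + int t)" using fb[OF t(1)] t(2) by simp
  have z: "app 0 f y j = 0" if j: "j < m" "j \<noteq> t" for j
  proof -
    have "\<not> int n dvd (s + int j) - (s + int t)"
      using j t(1) m zdvd_imp_le[of "int n" "int j - int t"] zdvd_imp_le[of "int n" "int t - int j"] dvd_diff_commute[of "int n" "int j" "int t"]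
      by (cases "j < t") auto
    thus ?thesis using fb[OF j(1)] b powi_eq_iff by auto
  qed
  have t0: "t \<noteq> 0" using ne b by (cases t) auto
  let ?\<nu> = "alpha q m t"
  have "?\<nu> \<noteq> 0"
  proof -
    have "\<not> int n dvd (int t - int m) - 0" using t t0 m zdvd_imp_le[of "int n" "int m - int t"] dvd_diff_commute[of "int n" "int m" "int t"] by auto
    hence "q powi (int t - int m) \<noteq> 1" using powi_eq_iff[of "int t - int m" 0] by simp
    thus ?thesis using r.qnum_ne_0[of t] t0 t(1) m by (simp add: alpha_def)
  qed
  moreover have "app 0 f (op n q T Ga (op n q T Gd y)) j = (if j = t then ?\<nu> * app 0 f y t else 0)" if j: "j < m" for j
  proof -
    have "app 0 f (op n q T Ga (op n q T Gd y)) j = op n q (V q m s) Ga (op n q (V q m s) Gd (app 0 f y)) j"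
      by (simp only: is_hom_app[OF f])
    also have "\<dots> = (if j = 0 then 0 else alpha q m j * app 0 f y j)"
      using j by (cases j) (simp_all add: V)
    finally show ?thesis using z[OF j] t0 by auto
  qed
  ultimately show ?thesis using z
    by (intro exI[of _ "- 1 / ?\<nu>"]) (auto simp: vec_op.add[OF vec_op_app] vec_op.diff[OF vec_op_app] vec_op.scale[OF vec_op_app])
qed

text \<open>Applies \<open>kill_other_weight\<close> to the entries one after the other. The two
  middle clauses are the invariants: adding a multiple of a d y changes neither an image that is a
  multiple of the highest weight vector, because d kills that vector, nor an image that is
  zero.\<close>

lemma kill_list:
  assumes "\<And>m' s' f'. (m', s', f') \<in> set L \<Longrightarrow> is_hom n q T (V q m' s') f' \<and> m' \<le> n"
    and y: "op n q T Gb y = fscale \<beta> y"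
  shows "\<exists>y'. op n q T Gb y' = fscale \<beta> y' \<and>
     (\<forall>m s f. is_hom n q T (V q m s) f \<longrightarrow> m \<le> n \<longrightarrow> q powi s = \<beta> \<longrightarrow> (\<exists>c. \<forall>j<m. app 0 f y j = c * unitf 0 j) \<longrightarrow> (\<forall>j<m. app 0 f y' j = app 0 f y j)) \<and>
     (\<forall>m s f. is_hom n q T (V q m s) f \<longrightarrow> m \<le> n \<longrightarrow> (\<forall>j<m. app 0 f y j = 0) \<longrightarrow> (\<forall>j<m. app 0 f y' j = 0)) \<and>
     (\<forall>(m', s', f')\<in>set L. q powi s' \<noteq> \<beta> \<longrightarrow> (\<forall>j<m'. app 0 f' y' j = 0))"
  using assms(1)
proof (induction L)
  case Nil
  show ?case by (intro exI[of _ y]) (use y in auto)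
next
  case (Cons e L)
  obtain m1 s1 f1 where e: "e = (m1, s1, f1)" by (cases e)
  have "\<exists>y'. op n q T Gb y' = fscale \<beta> y' \<and>
     (\<forall>m s f. is_hom n q T (V q m s) f \<longrightarrow> m \<le> n \<longrightarrow> q powi s = \<beta> \<longrightarrow> (\<exists>c. \<forall>j<m. app 0 f y j = c * unitf 0 j) \<longrightarrow> (\<forall>j<m. app 0 f y' j = app 0 f y j)) \<and>
     (\<forall>m s f. is_hom n q T (V q m s) f \<longrightarrow> m \<le> n \<longrightarrow> (\<forall>j<m. app 0 f y j = 0) \<longrightarrow> (\<forall>j<m. app 0 f y' j = 0)) \<and>
     (\<forall>(m', s', f')\<in>set L. q powi s' \<noteq> \<beta> \<longrightarrow> (\<forall>j<m'. app 0 f' y' j = 0))"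
    by (rule Cons.IH) (use Cons.prems in auto)
  then obtain y' where y'0: "op n q T Gb y' = fscale \<beta> y' \<and>
     (\<forall>m s f. is_hom n q T (V q m s) f \<longrightarrow> m \<le> n \<longrightarrow> q powi s = \<beta> \<longrightarrow> (\<exists>c. \<forall>j<m. app 0 f y j = c * unitf 0 j) \<longrightarrow> (\<forall>j<m. app 0 f y' j = app 0 f y j)) \<and>
     (\<forall>m s f. is_hom n q T (V q m s) f \<longrightarrow> m \<le> n \<longrightarrow> (\<forall>j<m. app 0 f y j = 0) \<longrightarrow> (\<forall>j<m. app 0 f y' j = 0)) \<and>
     (\<forall>(m', s', f')\<in>set L. q powi s' \<noteq> \<beta> \<longrightarrow> (\<forall>j<m'. app 0 f' y' j = 0))" ..
  have y': "op n q T Gb y' = fscale \<beta> y'"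
     "\<And>m s f. is_hom n q T (V q m s) f \<Longrightarrow> m \<le> n \<Longrightarrow> q powi s = \<beta> \<Longrightarrow> \<exists>c. \<forall>j<m. app 0 f y j = c * unitf 0 j \<Longrightarrow> \<forall>j<m. app 0 f y' j = app 0 f y j"
     "\<And>m s f. is_hom n q T (V q m s) f \<Longrightarrow> m \<le> n \<Longrightarrow> \<forall>j<m. app 0 f y j = 0 \<Longrightarrow> \<forall>j<m. app 0 f y' j = 0"
     "\<forall>(m', s', f')\<in>set L. q powi s' \<noteq> \<beta> \<longrightarrow> (\<forall>j<m'. app 0 f' y' j = 0)"
    using y'0 by simp_all
  show ?case
  proof (cases "q powi s1 = \<beta>")
    case True
    show ?thesis by (rule exI[of _ y']) (use y' True in \<open>auto simp: e\<close>)
  next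
    case False
    have h1: "is_hom n q T (V q m1 s1) f1" "m1 \<le> n" using Cons.prems[of m1 s1 f1] by (auto simp: e)
    obtain c where c: "\<forall>j<m1. app 0 f1 (y' + fscale c (op n q T Ga (op n q T Gd y'))) j = 0"
      using kill_other_weight[OF h1 y'(1) False] by blast
    define z where "z = y' + fscale c (op n q T Ga (op n q T Gd y'))"
    note c = c[folded z_def]
    interpret r: rep fscale n q "op n q T Ga" "op n q T Gb" "op n q T Gc" "op n q T Gd"
      by (rule rep_op[OF T n q])
    have ad: "app 0 f (op n q T Ga (op n q T Gd x)) j = (if j = 0 then 0 else alpha q m j * app 0 f x j)"
      if f: "is_hom n q T (V q m s) f" "m \<le> n" and j: "j < m" for m s f x j
    proof -
      have "app 0 f (op n q T Ga (op n q T Gd x)) j = op n q (V q m s) Ga (op n q (V q m s) Gd (app 0 f x)) j"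
        by (simp only: is_hom_app[OF f(1)])
      also have "\<dots> = (if j = 0 then 0 else alpha q m j * app 0 f x j)"
        using j by (cases j) (simp_all add: op_V[OF n q f(2)])
      finally show ?thesis .
    qed
    have "op n q T Gb (op n q T Ga (op n q T Gd y')) = fscale \<beta> (op n q T Ga (op n q T Gd y'))"
    proof -
      have "fscale q (op n q T Gb (op n q T Gd y')) = op n q T Gd (op n q T Gb y')" using r.db[of y'] by simp
      also have "\<dots> = fscale \<beta> (op n q T Gd y')" by (simp add: y'(1) r.d.scale)
      finally have "op n q T Ga (fscale q (op n q T Gb (op n q T Gd y'))) = op n q T Ga (fscale \<beta> (op n q T Gd y'))" by simp
      thus ?thesis by (simp add: r.ba r.a.scale)
    qed
    hence 1: "op n q T Gb z = fscale \<beta> z"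
      by (simp add: z_def r.b.add r.b.scale y'(1) fs.scale_right_distrib fs.scale_left_commute)
    have 2: "\<forall>j<m. app 0 f z j = app 0 f y j"
      if f: "is_hom n q T (V q m s) f" "m \<le> n" "q powi s = \<beta>" "\<exists>c. \<forall>j<m. app 0 f y j = c * unitf 0 j" for m s f
      using y'(2)[OF f] f(4) by (auto simp: z_def vec_op.add[OF vec_op_app] vec_op.scale[OF vec_op_app] ad[OF f(1,2)])
    have 3: "\<forall>j<m. app 0 f z j = 0"
      if f: "is_hom n q T (V q m s) f" "m \<le> n" "\<forall>j<m. app 0 f y' j = 0" for m s f
      using f(3) by (auto simp: z_def vec_op.add[OF vec_op_app] vec_op.scale[OF vec_op_app] ad[OF f(1,2)])
    have 4: "\<forall>j<m'. app 0 f' z j = 0" if x: "(m', s', f') \<in> set (e # L)" "q powi s' \<noteq> \<beta>" for m' s' f'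
    proof (cases "(m', s', f') \<in> set L")
      case True
      have "\<forall>j<m'. app 0 f' y' j = 0" using bspec[OF y'(4) True] x(2) by simp
      thus ?thesis using 3 Cons.prems[OF x(1)] by blast
    next
      case False
      thus ?thesis using x(1) c by (simp add: e)
    qed
    have 5: "\<forall>j<m. app 0 f z j = 0"
      if "is_hom n q T (V q m s) f" "m \<le> n" "\<forall>j<m. app 0 f y j = 0" for m s f
      using 3[OF that(1,2) y'(3)[OF that]] .
    have 6: "\<forall>(m', s', f')\<in>set (e # L). q powi s' \<noteq> \<beta> \<longrightarrow> (\<forall>j<m'. app 0 f' z j = 0)"
      using 4 by blast
    show ?thesis
      by (rule exI[of _ z], intro conjI, rule 1, use 2 in blast, use 5 in blast, rule 6)
  qed
qed

text \<open>After \<open>kill_list\<close> there is a vector y with first image v_0 on which all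
  later maps vanish. Its translates a^j y are mapped to v_j by the first map and to zero by the
  others, so the first component can be adjusted freely.\<close>

lemma indep_epi:
  assumes "\<And>m s f. (m, s, f) \<in> set L \<Longrightarrow> is_hom n q T (V q m s) f \<and> 1 \<le> m \<and> m \<le> n" and "indep L"
  shows "is_epi n q T (direct_sum (map (\<lambda>(m, s, f). V q m s) L)) (vstack (mdim T) (map (\<lambda>(m, s, f). f) L))"
  using assms
proof (induction L)
  case Nil
  have "is_hom n q T (direct_sum (map (\<lambda>(m, s, f). V q m s) [])) (vstack (mdim T) (map (\<lambda>(m, s, f). f) []))"
    using vstack_hom[OF T, of "[]"] by simp
  thus ?case by (simp add: is_epi_iff mdim_direct_sum)
next
  case (Cons e L)
  obtain m s f where e: "e = (m, s, f)" by (cases e)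
  let ?S = "\<lambda>(m, s, f). V q m s" and ?f = "\<lambda>(m :: nat, s :: int, f :: 'k mat). f"
  let ?D = "direct_sum (map ?S L)" and ?v = "vstack (mdim T) (map ?f L)"
  have f: "is_hom n q T (V q m s) f" "1 \<le> m" "m \<le> n" using Cons.prems(1)[of m s f] e by auto
  note V = V_module[OF n q f(3)]
  have epi: "is_epi n q T ?D ?v" using Cons by (auto simp: e)
  have D: "is_module n q ?D" and vc: "?v \<in> carrier_mat (mdim ?D) (mdim T)" and vh: "is_hom n q T ?D ?v"
    using epi by (auto simp: is_epi_iff is_hom_iff)
  have fc: "f \<in> carrier_mat m (mdim T)" using f(1) by (simp add: is_hom_iff V)
  interpret r: rep fscale n q "op n q T Ga" "op n q T Gb" "op n q T Gc" "op n q T Gd"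
    by (rule rep_op[OF T n q])
  obtain y0 where y0: "op n q T Gb y0 = fscale (q powi s) y0" "\<forall>j<m. app 0 f y0 j = unitf 0 j"
     "\<forall>(m', s', f')\<in>set L. q powi s' = q powi s \<longrightarrow> (\<forall>j<m'. app 0 f' y0 j = 0)"
    using Cons.prems(2) by (auto simp: e)
  have Lh: "is_hom n q T (V q m' s') f' \<and> m' \<le> n" if "(m', s', f') \<in> set L" for m' s' f'
    using Cons.prems(1)[of m' s' f'] that by auto
  obtain y where y: "op n q T Gb y = fscale (q powi s) y" "\<forall>j<m. app 0 f y j = unitf 0 j"
      "\<forall>(m', s', f')\<in>set L. \<forall>j<m'. app 0 f' y j = 0"
  proof -
    obtain y where y: 
     "\<And>m' s' f. is_hom n q T (V q m' s') f \<Longrightarrow> m' \<le> n \<Longrightarrow> q powi s' = q powi s \<Longrightarrow> (\<exists>c. \<forall>j<m'. app 0 f y0 j = c * unitf 0 j) \<Longrightarrow> (\<forall>j<m'. app 0 f y j = app 0 f y0 j)"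
     "\<And>m s f. is_hom n q T (V q m s) f \<Longrightarrow> m \<le> n \<Longrightarrow> (\<forall>j<m. app 0 f y0 j = 0) \<Longrightarrow> (\<forall>j<m. app 0 f y j = 0)"
     "\<forall>(m', s', f')\<in>set L. q powi s' \<noteq> q powi s \<longrightarrow> (\<forall>j<m'. app 0 f' y j = 0)"
     "op n q T Gb y = fscale (q powi s) y"
      using kill_list[of L y0 "q powi s", OF Lh y0(1)] by blast
    have "\<forall>j<m. app 0 f y j = unitf 0 j"
    proof -
      have "\<exists>c. \<forall>j<m. app 0 f y0 j = c * unitf 0 j" using y0(2) by (intro exI[of _ 1]) simp
      thus ?thesis using y(1)[OF f(1,3) refl] y0(2) by simp
    qed
    moreover have "\<forall>j<m'. app 0 f' y j = 0" if x: "(m', s', f') \<in> set L" for m' s' f'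
    proof (cases "q powi s' = q powi s")
      case True
      hence "\<forall>j<m'. app 0 f' y0 j = 0" using bspec[OF y0(3) x] by simp
      thus ?thesis using y(2) Lh[OF x] by blast
    next
      case False
      thus ?thesis using bspec[OF y(3) x] by simp
    qed
    hence "\<forall>(m', s', f')\<in>set L. \<forall>j<m'. app 0 f' y j = 0" by blast
    ultimately show ?thesis using that[OF y(4)] by blast
  qed
  have vz: "app 0 ?v x = 0" if "\<forall>(m', s', f')\<in>set L. \<forall>j<m'. app 0 f' x j = 0" for x
  proof -
    have sub: "app 0 (vstack (mdim T) (map ?f K)) x i = 0"
      if "set K \<subseteq> set L" "i < mdim (direct_sum (map ?S K))" for K i
      using that
    proof (induction K arbitrary: i)
      case Nil
      thus ?case by (simp add: mdim_direct_sum)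
    next
      case (Cons e' K)
      obtain m' s' f' where e': "e' = (m', s', f')" by (cases e')
      have x': "(m', s', f') \<in> set L" using Cons.prems(1) e' by auto
      have hK: "is_hom n q T (direct_sum (map ?S K)) (vstack (mdim T) (map ?f K))"
        by (rule vstack_hom[OF T]) (use Lh Cons.prems(1) in auto)
      have c: "f' \<in> carrier_mat m' (mdim T)" "vstack (mdim T) (map ?f K) \<in> carrier_mat (mdim (direct_sum (map ?S K))) (mdim T)"
        using Lh[OF x'] hK by (auto simp: is_hom_iff V_module[OF n q])
      have d: "mdim (direct_sum (map ?S (e' # K))) = m' + mdim (direct_sum (map ?S K))"
        using Lh[OF x'] by (simp add: mdim_direct_sum e' V_module[OF n q])
      show ?case
        using app_vstack_Cons[OF c, of i x] Cons.IH[of "i - m'"] Cons.prems d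
          \<open>\<forall>(m', s', f')\<in>set L. \<forall>j<m'. app 0 f' x j = 0\<close> x'
        by (auto simp: e')
    qed
    show ?thesis
    proof
      fix i
      show "app 0 ?v x i = 0 i"
        using sub[OF subset_refl, of i] app_ge[OF vc, of i 0 x] by (cases "i < mdim ?D") simp_all
    qed
  qed
  have vy: "app 0 ?v y = 0" by (rule vz[OF y(3)])
  have d: "mdim (direct_sum (map ?S (e # L))) = m + mdim ?D" by (simp add: mdim_direct_sum e V)
  show ?case unfolding is_epi_iff
  proof (intro conjI allI)
    show "is_hom n q T (direct_sum (map ?S (e # L))) (vstack (mdim T) (map ?f (e # L)))"
      by (rule vstack_hom[OF T]) (use Cons.prems(1) in auto)
    fix t
    obtain x0 where x0: "\<forall>i<mdim ?D. app 0 ?v x0 i = t (m + i)"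
      using epi unfolding is_epi_iff by (elim conjE) (drule spec[of _ "\<lambda>i. t (m + i)"], blast)
    \<comment> \<open>\<open>x0\<close> is correct for the later components; the sum repairs the
      first component and is invisible to the others.\<close>
    let ?x = "x0 + (\<Sum>j<m. fscale (t j - app 0 f x0 j) ((op n q T Ga ^^ j) y))"
    note lin = vec_op.add[OF vec_op_app] vec_op.scale[OF vec_op_app] vec_op.sum[OF vec_op_app]
    have fa: "app 0 f ((op n q T Ga ^^ j) y) i = unitf j i" if "i < m" for i j
      using that
    proof (induction j arbitrary: i)
      case 0
      thus ?case using y(2) by simp
    next
      case (Suc j)
      have "app 0 f ((op n q T Ga ^^ Suc j) y) i = op n q (V q m s) Ga (app 0 f ((op n q T Ga ^^ j) y)) i"
        by (simp add: is_hom_app[OF f(1)])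
      thus ?case using Suc by (auto simp: op_V[OF n q f(3)])
    qed
    have va: "app 0 ?v ((op n q T Ga ^^ j) y) = 0" for j
    proof (induction j)
      case 0
      show ?case by (simp only: funpow_0 vy)
    next
      case (Suc j)
      have "app 0 ?v ((op n q T Ga ^^ Suc j) y) = op n q ?D Ga (app 0 ?v ((op n q T Ga ^^ j) y))"
        by (simp only: funpow.simps o_apply is_hom_app[OF vh])
      also have "\<dots> = 0" unfolding Suc by (rule vec_op.zero[OF vec_op_op])
      finally show ?case .
    qed
    have fx: "app 0 f ?x i = t i" if i: "i < m" for i
    proof -
      have "(\<Sum>j\<in>A. fscale (c j) (app 0 f ((op n q T Ga ^^ j) y))) i = (\<Sum>j\<in>A. c j * unitf j i)" for A c
        by (induction A rule: infinite_finite_induct) (simp_all add: fa[OF i])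
      thus ?thesis using i by (simp add: lin if_distrib[of "\<lambda>x. _ * x"] cong: if_cong)
    qed
    have vx: "app 0 ?v ?x = app 0 ?v x0" by (simp add: lin va)
    have "app 0 (vstack (mdim T) (map ?f (e # L))) ?x i = t i" if i: "i < m + mdim ?D" for i
      using app_vstack_Cons[OF fc vc i, of ?x] fx spec[OF x0, of "i - m"] i by (auto simp: e vx)
    thus "\<exists>x. \<forall>i<mdim (direct_sum (map ?S (e # L))). app 0 (vstack (mdim T) (map ?f (e # L))) x i = t i"
      unfolding d by blast
  qed
qed

end

section \<open>Vectors in a tensor product of two simple modules\<close>

context
  fixes n l m :: nat and q :: "'k::field" and s0 s :: int
  assumes n: "1 < n" and q: "is_primitive_root n q" and l: "1 \<le> l" "l \<le> n" and m: "1 \<le> m" "m \<le> n"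
begin

abbreviation (input) "X \<equiv> tensor n q (V q l s0) (V q m s)"
abbreviation (input) "Xa \<equiv> op n q X Ga"
abbreviation (input) "Xb \<equiv> op n q X Gb"
abbreviation (input) "Xc \<equiv> op n q X Gc"
abbreviation (input) "Xd \<equiv> op n q X Gd"

lemma X_module: "is_module n q X"
  by (rule tensor_V_module[OF n q l(2) V_module(1)[OF n q m(2)]])

lemma mdim_X: "mdim X = l * m"
  by (simp add: mdim_tensor_V[OF n q l(2)] V_module[OF n q m(2)])

interpretation X: rep fscale n q Xa Xb Xc Xd
  by (rule rep_op[OF X_module n q])

definition ent :: "(nat \<Rightarrow> 'k) \<Rightarrow> nat \<Rightarrow> nat \<Rightarrow> 'k" where
  "ent f i j = f (i * m + j)"

lemma ent_simps [simp]:
  "ent 0 i j = 0" "ent (f + g) i j = ent f i j + ent g i j" "ent (f - g) i j = ent f i j - ent g i j"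
  "ent (fscale r f) i j = r * ent f i j"
  by (simp_all add: ent_def)

text \<open>The basis vector v_i tensor v_j, set to zero outside the range so that
  \<open>Xa_eu\<close> needs no case distinction at the last column.\<close>

definition eu :: "nat \<Rightarrow> nat \<Rightarrow> nat \<Rightarrow> 'k" where
  "eu i j = (if i < l \<and> j < m then unitf (i * m + j) else 0)"

lemma eu_apply:
  assumes "i' < l" "j' < m"
  shows "ent (eu i j) i' j' = (if i' = i \<and> j' = j then 1 else 0)"
proof -
  have "i' * m + j' = i * m + j \<longleftrightarrow> i' = i \<and> j' = j" if "j < m"
    using assms that by (metis div_mult_self3 mod_mult_self3 mod_less add_cancel_right_left div_less add.commute nat_neq_iff not_less0)
  thus ?thesis using assms by (auto simp: eu_def ent_def)
qed

lemma eu_ge: "\<not> k < l * m \<Longrightarrow> eu i j k = 0"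
  using mult_add_lt[of i l j m] by (auto simp: eu_def)

lemma X_eqI:
  assumes "\<And>i j. i < l \<Longrightarrow> j < m \<Longrightarrow> ent f i j = ent g i j" "\<And>k. \<not> k < l * m \<Longrightarrow> f k = (g k :: 'k)"
  shows "f = g"
proof
  fix k
  show "f k = g k"
  proof (cases "k < l * m")
    case True
    thus ?thesis using assms(1)[OF div_mod_lt[OF True]] by (simp add: ent_def)
  qed (rule assms(2))
qed

lemma op_X_ge: "\<not> k < l * m \<Longrightarrow> op n q X g f k = counit g * f k"
  using op_ge[OF X_module, of k g f] by (simp add: mdim_X)

lemma op_X:
  assumes i: "i < l" and j: "j < m"
  shows "ent (Xa f) i j = (if i = 0 then 0 else q powi (s + int j) * ent f (i - 1) j) + (if j = 0 then 0 else ent f i (j - 1))"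
    "ent (Xb f) i j = q powi (s0 + int i) * (q powi (s + int j) * ent f i j)"
    "ent (Xc f) i j = q powi (int i + 1 - s0 - int l) * (q powi (int j + 1 - s - int m) * ent f i j)"
    "ent (Xd f) i j = (if Suc i < l then alpha q l (Suc i) * (q powi (int j + 1 - s - int m) * ent f (Suc i) j) else 0)
       + (if Suc j < m then alpha q m (Suc j) * ent f i (Suc j) else 0)"
proof -
  note V = V_module[OF n q m(2)]
  have j': "j < mdim (V q m s)" using j by (simp add: V)
  note T = op_tensor_V[OF n q l(2) V(1) i j', unfolded V(3)]
  show "ent (Xa f) i j = (if i = 0 then 0 else q powi (s + int j) * ent f (i - 1) j) + (if j = 0 then 0 else ent f i (j - 1))"
    unfolding ent_def T op_V[OF n q m(2) j] slice_def ..
  show "ent (Xb f) i j = q powi (s0 + int i) * (q powi (s + int j) * ent f i j)"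
    unfolding ent_def T op_V[OF n q m(2) j] slice_def ..
  show "ent (Xc f) i j = q powi (int i + 1 - s0 - int l) * (q powi (int j + 1 - s - int m) * ent f i j)"
    unfolding ent_def T op_V[OF n q m(2) j] slice_def ..
  show "ent (Xd f) i j = (if Suc i < l then alpha q l (Suc i) * (q powi (int j + 1 - s - int m) * ent f (Suc i) j) else 0)
       + (if Suc j < m then alpha q m (Suc j) * ent f i (Suc j) else 0)"
    unfolding ent_def T op_V[OF n q m(2) j] slice_def ..
qed

lemma Xd_eu:
  assumes i: "i < l" and j: "j < m"
  shows "Xd (eu i j) = (if j = 0 then 0 else fscale (alpha q m j) (eu i (j - 1))) +
    (if i = 0 then 0 else fscale (alpha q l i * q powi (int j + 1 - s - int m)) (eu (i - 1) j))"
proof (rule X_eqI)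
  fix i' j' assume ij: "i' < l" "j' < m"
  show "ent (Xd (eu i j)) i' j' = ent ((if j = 0 then 0 else fscale (alpha q m j) (eu i (j - 1))) +
    (if i = 0 then 0 else fscale (alpha q l i * q powi (int j + 1 - s - int m)) (eu (i - 1) j))) i' j'"
    using ij i j by (auto simp: op_X eu_apply)
next
  fix k assume "\<not> k < l * m"
  thus "Xd (eu i j) k = ((if j = 0 then 0 else fscale (alpha q m j) (eu i (j - 1))) +
    (if i = 0 then 0 else fscale (alpha q l i * q powi (int j + 1 - s - int m)) (eu (i - 1) j))) k"
    by (simp add: op_X_ge eu_ge)
qed

lemma Xa_eu:
  assumes i: "i < l" and j: "j < m"
  shows "Xa (eu i j) = eu i (Suc j) + (if Suc i < l then fscale (q powi (s + int j)) (eu (Suc i) j) else 0)"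
proof (rule X_eqI)
  fix i' j' assume ij: "i' < l" "j' < m"
  show "ent (Xa (eu i j)) i' j' = ent (eu i (Suc j) + (if Suc i < l then fscale (q powi (s + int j)) (eu (Suc i) j) else 0)) i' j'"
    using ij i j by (auto simp: op_X eu_apply)
next
  fix k assume "\<not> k < l * m"
  thus "Xa (eu i j) k = (eu i (Suc j) + (if Suc i < l then fscale (q powi (s + int j)) (eu (Suc i) j) else 0)) k"
    by (simp add: op_X_ge eu_ge counit_def)
qed

text \<open>An integral refinement of the weight: a raises the level by one and d lowers it, whereas
  the weight determines the level only modulo n. Vanishing outside the index range makes equations
  between such vectors hold as equations between functions.\<close>

definition lev :: "nat \<Rightarrow> (nat \<Rightarrow> 'k) \<Rightarrow> bool" where
  "lev p f \<longleftrightarrow> (\<forall>i<l. \<forall>j<m. i + j \<noteq> p \<longrightarrow> ent f i j = 0) \<and> (\<forall>k. \<not> k < l * m \<longrightarrow> f k = 0)"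

lemma lev_0: "lev p 0"
  by (simp add: lev_def)

lemma lev_add: "lev p f \<Longrightarrow> lev p g \<Longrightarrow> lev p (f + g)"
  by (simp add: lev_def)

lemma lev_diff: "lev p f \<Longrightarrow> lev p g \<Longrightarrow> lev p (f - g)"
  by (simp add: lev_def)

lemma lev_scale: "lev p f \<Longrightarrow> lev p (fscale r f)"
  by (simp add: lev_def)

lemma lev_eu: "i + j = p \<Longrightarrow> lev p (eu i j)"
  by (auto simp: lev_def eu_apply eu_ge)

lemma lev_d: "lev (Suc p) f \<Longrightarrow> lev p (Xd f)"
  unfolding lev_def by (auto simp: op_X op_X_ge counit_def)

lemma lev_a: "lev p f \<Longrightarrow> lev (Suc p) (Xa f)"
  unfolding lev_def by (auto simp: op_X op_X_ge counit_def)

lemma lev_a_pow: "lev p f \<Longrightarrow> lev (p + k) ((Xa ^^ k) f)"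
  by (induction k) (auto intro: lev_a)

lemma lev_d_pow: "lev (p + k) f \<Longrightarrow> lev p ((Xd ^^ k) f)"
proof (induction k arbitrary: f)
  case (Suc k)
  from Suc.IH[OF lev_d, of f] Suc.prems show ?case by (simp add: funpow_Suc_right del: funpow.simps)
qed simp

definition lev_b :: "nat \<Rightarrow> 'k" where "lev_b p = q powi (s0 + s + int p)"
definition lev_c :: "nat \<Rightarrow> 'k" where "lev_c p = q powi (int p + 2 - s0 - s - int l - int m)"

lemma lev_wt:
  assumes "lev p f"
  shows "X.wt (lev_b p) (lev_c p) f"
proof -
  have q0: "q \<noteq> 0" by (rule q_ne_0[OF n q])
  have "Xb f = fscale (lev_b p) f"
  proof (rule X_eqI)
    fix i j assume ij: "i < l" "j < m"
    show "ent (Xb f) i j = ent (fscale (lev_b p) f) i j"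
    proof (cases "i + j = p")
      case True
      have "q powi (s0 + int i) * q powi (s + int j) = lev_b p"
        using True q0 by (simp add: lev_b_def power_int_add[symmetric] algebra_simps flip: of_nat_add)
      thus ?thesis by (simp add: op_X[OF ij] mult.assoc[symmetric])
    qed (use assms ij in \<open>simp add: op_X lev_def\<close>)
  next
    fix k assume "\<not> k < l * m"
    thus "Xb f k = fscale (lev_b p) f k" using assms by (simp add: op_X_ge lev_def)
  qed
  moreover have "Xc f = fscale (lev_c p) f"
  proof (rule X_eqI)
    fix i j assume ij: "i < l" "j < m"
    show "ent (Xc f) i j = ent (fscale (lev_c p) f) i j"
    proof (cases "i + j = p")
      case True
      have "q powi (int i + 1 - s0 - int l) * q powi (int j + 1 - s - int m) = lev_c p"
        using True q0 by (simp add: lev_c_def power_int_add[symmetric] algebra_simps flip: of_nat_add)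
      thus ?thesis by (simp add: op_X[OF ij] mult.assoc[symmetric])
    qed (use assms ij in \<open>simp add: op_X lev_def\<close>)
  next
    fix k assume "\<not> k < l * m"
    thus "Xc f k = fscale (lev_c p) f k" using assms by (simp add: op_X_ge lev_def)
  qed
  ultimately show ?thesis by (simp add: X.wt_def)
qed

lemma lev_bc: "lev_b p * lev_c p = q powi (2 * int p + 2 - int l - int m)"
  using q_ne_0[OF n q] by (simp add: lev_b_def lev_c_def power_int_add[symmetric] algebra_simps)

section \<open>Images and kernels of a and d, level by level\<close>

lemma lev_span:
  assumes S: "0 \<in> S" "\<And>x y. x \<in> S \<Longrightarrow> y \<in> S \<Longrightarrow> x + y \<in> S" "\<And>r x. x \<in> S \<Longrightarrow> fscale r x \<in> S"
    and e: "\<And>i j. i < l \<Longrightarrow> j < m \<Longrightarrow> i + j = p \<Longrightarrow> eu i j \<in> S" and g: "lev p g"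
  shows "g \<in> S"
proof -
  have sum: "sum f A \<in> S" if "\<And>x. x \<in> A \<Longrightarrow> f x \<in> S" for f and A :: "nat set"
    using that by (induction A rule: infinite_finite_induct) (auto intro: S)
  let ?t = "\<lambda>k. fscale (g k) (eu (k div m) (k mod m))"
  have "g = (\<Sum>k<l * m. ?t k)"
  proof
    fix k
    have "(\<Sum>k\<in>A. ?t k) k' = (\<Sum>k\<in>A. g k * eu (k div m) (k mod m) k')" for A k'
      by (induction A rule: infinite_finite_induct) simp_all
    moreover have "(\<Sum>x<l * m. g x * eu (x div m) (x mod m) k) = (\<Sum>x<l * m. if k = x then g x else 0)"
      by (rule sum.cong) (auto simp: eu_def div_mod_lt)
    moreover have "\<dots> = g k" using g by (auto simp: lev_def)
    ultimately show "g k = (\<Sum>k<l * m. ?t k) k" by simp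
  qed
  also have "\<dots> \<in> S"
  proof (rule sum)
    fix k assume "k \<in> {..<l * m}"
    hence k: "k < l * m" by simp
    show "?t k \<in> S"
    proof (cases "k div m + k mod m = p")
      case True
      thus ?thesis using div_mod_lt[OF k] e S(3) by blast
    next
      case False
      have "ent g (k div m) (k mod m) = 0" using g div_mod_lt[OF k] False unfolding lev_def by blast
      hence t0: "?t k = 0" by (simp add: fun_eq_iff ent_def)
      show ?thesis unfolding t0 by (rule S(1))
    qed
  qed
  finally show ?thesis .
qed

lemma alpha_ne_0:
  assumes "0 < j" "j < k" "k \<le> n"
  shows "alpha q k j \<noteq> 0"
proof -
  have "q powi (int j - int k) = inverse (q ^ (k - j))"
  proof -
    have e: "int j - int k = - int (k - j)" using assms by simp
    show ?thesis unfolding e power_int_minus power_int_of_nat ..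
  qed
  hence "q powi (int j - int k) \<noteq> 1" using primitive_rootD(2)[OF q, of "k - j"] assms by simp
  thus ?thesis using X.qnum_ne_0[of j] assms by (simp add: alpha_def)
qed

text \<open>On the basis vectors other than the corner with indices (p+1, 0), d is triangular: it
  sends the one with first index i to a nonzero multiple of the basis vector with indices (i, p-i),
  plus a term with smaller first index. Leaving out the corner keeps room for a kernel
  vector.\<close>

lemma Xd_surj:
  assumes p: "Suc p < l" "Suc p < m" and g: "lev p g"
  shows "\<exists>f. lev (Suc p) f \<and> ent f (Suc p) 0 = 0 \<and> Xd f = g"
proof -
  let ?S = "{g. \<exists>f. lev (Suc p) f \<and> ent f (Suc p) 0 = 0 \<and> Xd f = g}"
  have scale: "fscale r x \<in> ?S" if "x \<in> ?S" for r x
  proof -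
    obtain f where "lev (Suc p) f" "ent f (Suc p) 0 = 0" "Xd f = x" using \<open>x \<in> ?S\<close> by blast
    thus ?thesis by (auto intro!: exI[of _ "fscale r f"] lev_scale simp: X.d.scale)
  qed
  have add: "x + y \<in> ?S" if "x \<in> ?S" "y \<in> ?S" for x y
  proof -
    obtain f h where "lev (Suc p) f" "ent f (Suc p) 0 = 0" "Xd f = x" "lev (Suc p) h" "ent h (Suc p) 0 = 0" "Xd h = y"
      using \<open>x \<in> ?S\<close> \<open>y \<in> ?S\<close> by blast
    thus ?thesis by (auto intro!: exI[of _ "f + h"] lev_add simp: X.d.add)
  qed
  have eu: "eu i (p - i) \<in> ?S" if "i \<le> p" for i
    using that
  proof (induction i)
    case 0
    have a: "alpha q m (Suc p) \<noteq> 0" by (rule alpha_ne_0) (use p m in auto)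
    have "Xd (eu 0 (Suc p)) = fscale (alpha q m (Suc p)) (eu 0 p)"
      using Xd_eu[of 0 "Suc p"] p by simp
    moreover have "ent (eu 0 (Suc p)) (Suc p) 0 = 0" using p by (simp add: eu_apply)
    ultimately have "fscale (alpha q m (Suc p)) (eu 0 p) \<in> ?S"
      using lev_eu[of 0 "Suc p" "Suc p"] by auto
    from scale[OF this, of "1 / alpha q m (Suc p)"] show ?case using a by (simp add: fs.scale_scale)
  next
    case (Suc i)
    let ?j = "Suc p - Suc i"
    have j: "?j = Suc (p - Suc i)" "?j < m" "0 < ?j" using Suc.prems p by auto
    have a: "alpha q m ?j \<noteq> 0" by (rule alpha_ne_0) (use j m in auto)
    let ?c = "alpha q l (Suc i) * q powi (int ?j + 1 - s - int m)"
    have "Xd (eu (Suc i) ?j) = fscale (alpha q m ?j) (eu (Suc i) (?j - 1)) + fscale ?c (eu i ?j)"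
      using Xd_eu[of "Suc i" ?j] Suc.prems p j by simp
    moreover have "ent (eu (Suc i) ?j) (Suc p) 0 = 0" using p j by (simp add: eu_apply)
    moreover have "lev (Suc p) (eu (Suc i) ?j)" by (rule lev_eu) (use Suc.prems in simp)
    ultimately have a1: "fscale (alpha q m ?j) (eu (Suc i) (?j - 1)) + fscale ?c (eu i ?j) \<in> ?S" by auto
    have a2: "eu i ?j \<in> ?S" using Suc by simp
    have "fscale (alpha q m ?j) (eu (Suc i) (?j - 1)) + fscale ?c (eu i ?j) + fscale (- ?c) (eu i ?j) =
        fscale (alpha q m ?j) (eu (Suc i) (?j - 1))"
      by (simp add: fun_eq_iff)
    with add[OF a1 scale[OF a2, of "- ?c"]] have "fscale (alpha q m ?j) (eu (Suc i) (?j - 1)) \<in> ?S" by (simp only:)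
    from scale[OF this, of "1 / alpha q m ?j"] show ?case using a by (simp add: fs.scale_scale)
  qed
  have "g \<in> ?S"
  proof (rule lev_span[OF _ add scale _ g])
    show "0 \<in> ?S" by (auto intro!: exI[of _ 0] simp: lev_0)
    show "eu i j \<in> ?S" if "i < l" "j < m" "i + j = p" for i j
      using eu[of i] that by auto
  qed
  thus ?thesis by blast
qed

text \<open>The corner vector minus a vector with the same image under d and without a corner
  coordinate.\<close>

lemma hw_exists:
  assumes p: "p < l" "p < m"
  shows "\<exists>u. lev p u \<and> Xd u = 0 \<and> ent u p 0 = 1"
proof (cases p)
  case 0
  have "Xd (eu 0 0) = 0" using Xd_eu[of 0 0] p 0 by simp
  thus ?thesis using 0 p lev_eu[of 0 0 0] by (auto simp: eu_apply)
next
  case (Suc p')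
  have "Xd (eu p 0) = fscale (alpha q l p * q powi (int 0 + 1 - s - int m)) (eu p' 0)"
    using Xd_eu[of p 0] p Suc by simp
  moreover have "lev p' \<dots>" by (intro lev_scale lev_eu) simp
  ultimately obtain f where f: "lev p f" "ent f p 0 = 0" "Xd f = Xd (eu p 0)"
    using Xd_surj[of p' "Xd (eu p 0)"] p Suc by auto
  have "lev p (eu p 0 - f)" by (intro lev_diff lev_eu f) simp
  moreover have "Xd (eu p 0 - f) = 0" using f by (simp add: X.d.diff)
  moreover have "ent (eu p 0 - f) p 0 = 1" using f p by (simp add: eu_apply)
  ultimately show ?thesis by blast
qed

text \<open>The mirror image of \<open>hw_exists\<close>. In this range level P has l+m-1-P basis
  vectors and level P+1 has one fewer; again the basis vectors other than one corner already span
  the image of a.\<close>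

lemma lw_exists:
  assumes P: "l \<le> Suc P" "m \<le> Suc P" "P + 2 \<le> l + m"
  shows "\<exists>y. lev P y \<and> Xa y = 0 \<and> y \<noteq> 0"
proof -
  \<comment> \<open>The smallest first index at level P; it is paired with the last second index
    m-1.\<close>
  define i0 where "i0 = Suc P - m"
  have i0: "i0 < l" "i0 + (m - 1) = P" using P m l by (auto simp: i0_def)
  let ?S = "{g. \<exists>f. lev P f \<and> ent f i0 (m - 1) = 0 \<and> Xa f = g}"
  have scale: "fscale r x \<in> ?S" if "x \<in> ?S" for r x
  proof -
    obtain f where "lev P f" "ent f i0 (m - 1) = 0" "Xa f = x" using \<open>x \<in> ?S\<close> by blast
    thus ?thesis by (auto intro!: exI[of _ "fscale r f"] lev_scale simp: X.a.scale)
  qed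
  have add: "x + y \<in> ?S" if "x \<in> ?S" "y \<in> ?S" for x y
  proof -
    obtain f h where "lev P f" "ent f i0 (m - 1) = 0" "Xa f = x" "lev P h" "ent h i0 (m - 1) = 0" "Xa h = y"
      using \<open>x \<in> ?S\<close> \<open>y \<in> ?S\<close> by blast
    thus ?thesis by (auto intro!: exI[of _ "f + h"] lev_add simp: X.a.add)
  qed
  have Pi: "Suc (P - i) = Suc P - i" if "i < l" for i using that P by auto
  have eu: "eu i (Suc P - i) \<in> ?S" if "i0 < i" "i \<le> l - 1" for i
    using that(2,1)
  proof (induction i rule: inc_induct)
    case base
    have "Xa (eu (l - 1) (P - (l - 1))) = eu (l - 1) (Suc P - (l - 1))"
      using Xa_eu[of "l - 1" "P - (l - 1)"] Pi[of "l - 1"] l base P m by (simp add: i0_def)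
    moreover have "ent (eu (l - 1) (P - (l - 1))) i0 (m - 1) = 0" using i0 base m by (auto simp: eu_apply)
    moreover have "lev P (eu (l - 1) (P - (l - 1)))" by (rule lev_eu) (use P in simp)
    ultimately show ?case by blast
  next
    case (step i)
    have i: "Suc i < l" "i < l" using step by auto
    have j: "P - i < m" using step P by (simp add: i0_def)
    let ?c = "q powi (s + int (P - i))"
    have "Xa (eu i (P - i)) = eu i (Suc P - i) + fscale ?c (eu (Suc i) (P - i))"
      using Xa_eu[OF i(2) j] Pi[OF i(2)] i by simp
    moreover have "ent (eu i (P - i)) i0 (m - 1) = 0" using i0 step m by (auto simp: eu_apply)
    moreover have "lev P (eu i (P - i))" by (rule lev_eu) (use P i in simp)
    ultimately have a1: "eu i (Suc P - i) + fscale ?c (eu (Suc i) (P - i)) \<in> ?S" by blast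
    have a2: "eu (Suc i) (P - i) \<in> ?S" using step by simp
    have "eu i (Suc P - i) + fscale ?c (eu (Suc i) (P - i)) + fscale (- ?c) (eu (Suc i) (P - i)) = eu i (Suc P - i)"
      by (simp add: fun_eq_iff)
    with add[OF a1 scale[OF a2, of "- ?c"]] show ?case by (simp only:)
  qed
  have S0: "0 \<in> ?S" by (auto intro!: exI[of _ 0] simp: lev_0)
  have "Xa (eu i0 (m - 1)) = (if Suc i0 < l then fscale (q powi (s + int (m - 1))) (eu (Suc i0) (m - 1)) else 0)"
    using Xa_eu[of i0 "m - 1"] i0 m by (simp add: eu_def)
  also have "\<dots> \<in> ?S"
  proof (cases "Suc i0 < l")
    case True
    have "eu (Suc i0) (m - 1) \<in> ?S" using eu[of "Suc i0"] True i0 by (simp flip: i0(2))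
    thus ?thesis using True scale by simp
  qed (use S0 in simp)
  finally obtain f where f: "lev P f" "ent f i0 (m - 1) = 0" "Xa f = Xa (eu i0 (m - 1))" by blast
  have "lev P (eu i0 (m - 1) - f)" by (intro lev_diff lev_eu f i0)
  moreover have "Xa (eu i0 (m - 1) - f) = 0" using f by (simp add: X.a.diff)
  moreover have "ent (eu i0 (m - 1) - f) i0 (m - 1) = 1" using f i0 m by (simp add: eu_apply)
  hence "eu i0 (m - 1) - f \<noteq> 0" by (metis ent_simps(1) zero_neq_one)
  ultimately show ?thesis by blast
qed

lemma q_powi_eq_1_iff: "q powi e = 1 \<longleftrightarrow> int n dvd e"
  using powi_eq_iff[OF n q X_module, of e 0] by simp

text \<open>
  The vectors \<open>x\<close> of weight \<open>\<lambda>\<close> with \<open>d a d x = 0\<close> correspond to homomorphisms from a projective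
  cover.  Besides a highest weight vector \<open>u\<close> there is a second one above a highest weight
  vector of lower level, or below a lowest weight vector.
\<close>

lemma hom_vector_above:
  assumes p: "p < l" "p < m" and p': "p = p' + j" "0 < j" "j < n" and e: "int l + int m - 1 - 2 * int p' = int n + int j"
  shows "\<exists>u x. lev p u \<and> lev p x \<and> Xd u = 0 \<and> Xd (Xa (Xd x)) = 0 \<and>
     (\<forall>c1 c2. fscale c1 u + fscale c2 x = 0 \<longrightarrow> c1 = 0 \<and> c2 = 0)"
proof -
  obtain u where u: "lev p u" "Xd u = 0" "ent u p 0 = 1" using hw_exists[OF p] by blast
  obtain u' where u': "lev p' u'" "Xd u' = 0" "ent u' p' 0 = 1" using hw_exists[of p'] p p' by auto
  note wu = lev_wt[OF u'(1)]
  have q0: "q \<noteq> 0" by (rule q_ne_0[OF n q])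
  have qp: "q ^ i * (lev_b p' * lev_c p') = q powi (int i + 1 - int n - int j)" for i
  proof -
    have "2 * int p' + 2 - int l - int m = 1 - int n - int j" using e by simp
    hence "lev_b p' * lev_c p' = q powi (1 - int n - int j)" by (simp only: lev_bc)
    thus ?thesis using q0 by (simp add: power_int_add[symmetric] power_int_of_nat[symmetric] algebra_simps del: power_int_of_nat)
  qed
  let ?h = "\<lambda>i. qnum q (Suc i) * (1 - q ^ i * (lev_b p' * lev_c p'))"
  have h: "?h i \<noteq> 0" if "Suc i < j" for i
  proof -
    have "\<not> int n dvd (int i + 1 - int n - int j)"
    proof
      assume "int n dvd (int i + 1 - int n - int j)"
      hence "int n dvd int j - 1 - int i"
        using dvd_add[of "int n" "int i + 1 - int n - int j" "int n"] dvd_minus_iff[of "int n" "int i + 1 - int j"]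
        by (simp add: algebra_simps)
      hence "int n \<le> int j - 1 - int i" using that by (intro zdvd_imp_le) auto
      thus False using p'(3) by simp
    qed
    thus ?thesis using X.qnum_ne_0[of "Suc i"] that p'(3) q_powi_eq_1_iff unfolding qp by (simp del: sum.lessThan_Suc)
  qed
  \<comment> \<open>The string of u' breaks after j vectors, so its last vector y = a^(j-1) u'
    satisfies d a y = 0, and any d-preimage x of y has d a d x = 0.\<close>
  have h0: "?h (j - 1) = 0"
  proof -
    have "int (j - 1) + 1 - int n - int j = - int n" using p'(2) by simp
    thus ?thesis unfolding qp using q_powi_eq_1_iff by simp
  qed
  define y where "y = (Xa ^^ (j - 1)) u'"
  have "Xd (Xa y) = Xd ((Xa ^^ Suc (j - 1)) u')" by (simp add: y_def)
  also have "\<dots> = 0" unfolding X.hw_string[OF wu u'(2)] h0 by simp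
  finally have day: "Xd (Xa y) = 0" .
  \<comment> \<open>Going back down, d^(j-1) y is a nonzero multiple of u'.\<close>
  have y0: "y \<noteq> 0"
  proof
    assume "y = 0"
    hence z: "(Xa ^^ (j - 1)) u' = 0" by (simp only: y_def)
    have "fscale (\<Prod>i<j - 1. ?h i) u' = (Xd ^^ (j - 1)) 0"
      using X.d_a_pow[OF wu u'(2), of "j - 1"] unfolding z by (rule sym)
    hence "(\<Prod>i<j - 1. ?h i) = 0 \<or> u' = 0" by (simp only: X.d.funpow_zero fs.scale_eq_0_iff)
    moreover have "(\<Prod>i<j - 1. ?h i) \<noteq> 0" using h by (auto simp del: sum.lessThan_Suc)
    ultimately show False using u'(3) by (auto simp: ent_def)
  qed
  have ly: "lev (p - 1) y" using lev_a_pow[OF u'(1), of "j - 1"] p' by (simp add: y_def)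
  obtain x where x: "lev p x" "Xd x = y" using Xd_surj[of "p - 1" y] ly p p' by auto
  have "c1 = 0 \<and> c2 = 0" if 0: "fscale c1 u + fscale c2 x = 0" for c1 c2
  proof -
    have "fscale c2 y = Xd (fscale c1 u + fscale c2 x)" by (simp add: X.d.add X.d.scale u x)
    hence c2: "c2 = 0" using y0 unfolding 0 by simp
    hence "ent (fscale c1 u) p 0 = 0" using arg_cong[OF 0, of "\<lambda>f. ent f p 0"] by simp
    thus ?thesis using c2 u(3) by simp
  qed
  thus ?thesis using u x day by blast
qed

text \<open>The lowest weight vector y at level p+n+k-1 has weights with product q^(k-1), so its
  string downwards breaks after k vectors: x = d^(k-1) y is nonzero and a d x = 0. It lies n levels
  above u, which gives the same weight and, since the levels differ, independence.\<close>

lemma hom_vector_below: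
  assumes p: "p < l" "p < m" and k: "1 \<le> k" "k \<le> n" and e: "int n dvd 2 * int p + 1 - int l - int m + int k"
    and P: "l \<le> p + n + k" "m \<le> p + n + k" "p + n + k + 1 \<le> l + m"
  shows "\<exists>u x. lev p u \<and> lev (p + n) x \<and> Xd u = 0 \<and> Xd (Xa (Xd x)) = 0 \<and>
     (\<forall>c1 c2. fscale c1 u + fscale c2 x = 0 \<longrightarrow> c1 = 0 \<and> c2 = 0)"
proof -
  define P' where "P' = p + n + (k - 1)"
  obtain u where u: "lev p u" "Xd u = 0" "ent u p 0 = 1" using hw_exists[OF p] by blast
  obtain y where y: "lev P' y" "Xa y = 0" "y \<noteq> 0" using lw_exists[of P'] P k by (auto simp: P'_def)
  note wy = lev_wt[OF y(1)]
  have q0: "q \<noteq> 0" by (rule q_ne_0[OF n q])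
  have bc: "lev_b P' * lev_c P' = q ^ (k - 1)"
  proof -
    have "int n dvd (2 * int P' + 2 - int l - int m) - int (k - 1)"
    proof -
      have "(2 * int P' + 2 - int l - int m) - int (k - 1) = (2 * int p + 1 - int l - int m + int k) + 2 * int n"
        using k by (simp add: P'_def)
      thus ?thesis using e by (simp only: dvd_add dvd_triv_right)
    qed
    hence "q powi (2 * int P' + 2 - int l - int m) = q powi int (k - 1)" using powi_eq_iff[OF n q X_module] by blast
    thus ?thesis by (simp add: lev_bc)
  qed
  let ?c = "\<lambda>i. - ((1 - lev_b P' * lev_c P' / q ^ i) * qnum q (Suc i) / q ^ Suc i)"
  have c: "?c i \<noteq> 0" if "i < k - 1" for i
  proof -
    have "q ^ (k - 1) = q ^ i * q ^ (k - 1 - i)" using that by (simp add: power_add[symmetric])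
    hence "q ^ (k - 1) / q ^ i \<noteq> 1" using primitive_rootD(2)[OF q, of "k - 1 - i"] that k q0 by simp
    thus ?thesis using X.qnum_ne_0[of "Suc i"] that k q0 unfolding bc by (simp del: sum.lessThan_Suc)
  qed
  define x where "x = (Xd ^^ (k - 1)) y"
  have day: "Xd (Xa y) = 0" using y(2) by simp
  have "Xa (Xd x) = Xa ((Xd ^^ Suc (k - 1)) y)" by (simp add: x_def)
  also have "\<dots> = 0" unfolding X.lw_string[OF wy day] bc using q0 by simp
  finally have dax: "Xd (Xa (Xd x)) = 0" by simp
  have x0: "x \<noteq> 0"
  proof
    assume "x = 0"
    hence z: "(Xd ^^ (k - 1)) y = 0" by (simp only: x_def)
    have "fscale (\<Prod>i<k - 1. ?c i) y = (Xa ^^ (k - 1)) 0"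
      using X.a_d_pow[OF wy day, of "k - 1"] unfolding z by (rule sym)
    hence "(\<Prod>i<k - 1. ?c i) = 0 \<or> y = 0" by (simp only: X.a.funpow_zero fs.scale_eq_0_iff)
    moreover have "(\<Prod>i<k - 1. ?c i) \<noteq> 0" using c by (auto simp del: sum.lessThan_Suc)
    ultimately show False using y(3) by auto
  qed
  have lx: "lev (p + n) x" using lev_d_pow[of "p + n" "k - 1" y] y(1) by (simp add: P'_def x_def)
  have "\<forall>i<l. \<forall>j<m. i + j \<noteq> p + n \<longrightarrow> ent x i j = 0" using lx by (simp add: lev_def)
  from this[rule_format, of p 0] have xp: "ent x p 0 = 0" using p n m by simp
  have "c1 = 0 \<and> c2 = 0" if 0: "fscale c1 u + fscale c2 x = 0" for c1 c2
  proof -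
    have c1: "c1 = 0" using arg_cong[OF 0, of "\<lambda>f. ent f p 0"] u(3) xp by simp
    hence "fscale c2 x = 0" using 0 by simp
    thus ?thesis using c1 x0 by simp
  qed
  thus ?thesis using u lx dax by blast
qed

end

section \<open>The decomposition\<close>

text \<open>The vector v_i tensor w.\<close>

definition ins :: "nat \<Rightarrow> nat \<Rightarrow> (nat \<Rightarrow> 'k::zero) \<Rightarrow> nat \<Rightarrow> 'k" where
  "ins N i w y = (if y div N = i then w (y mod N) else 0)"

context
  fixes n l l' :: nat and q :: "'k::field" and r r' :: int and P :: "'k fdmod"
  assumes n: "1 < n" and q: "is_primitive_root n q" and l: "1 \<le> l" "l \<le> n" and l': "1 \<le> l'" "l' < n"
    and P: "is_projective_cover n q P (V q l' r')"
begin

abbreviation (input) "T \<equiv> tensor n q (V q l r) P"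
abbreviation (input) "Xop m s \<equiv> op n q (tensor n q (V q l (1 - int l - r)) (V q m s))"

lemma P_module: "is_module n q P"
  using P by (simp add: is_projective_cover_def is_projective_def)

lemma T_module: "is_module n q T"
  by (rule tensor_V_module[OF n q l(2) P_module])

text \<open>The vector x defines a map from the model, hence from P, to V(l,1-l-r) tensor V(m,s),
  and the adjunction turns it into f. Here w is the generator of P corresponding to e_0 and is the
  same for all x. The values of f on v_i tensor w return all coordinates of x, so relations between
  maps yield relations between vectors.\<close>

lemma hom_of_vector:
  assumes m: "1 \<le> m" "m \<le> n"
  shows "\<exists>w. \<forall>x. Xop m s Gb x = fscale (q powi r') x \<and>
     Xop m s Gc x = fscale (q powi (1 - r' - int l')) x \<and>
     Xop m s Gd (Xop m s Ga
       (Xop m s Gd x)) = 0 \<longrightarrow>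
     (\<exists>f. is_hom n q T (V q m s) f \<and>
       (\<forall>i<l. \<forall>j<m. app 0 f (ins (mdim P) i w) j = dual_scal q r i * x ((l - 1 - i) * m + j)))"
proof -
  let ?Q = "Qmod n q l' (q powi r') (q powi (1 - r' - int l'))"
  obtain h k where hk: "is_hom n q P ?Q h" "is_hom n q ?Q P k" "h * k = 1\<^sub>m (mdim ?Q)"
    using projective_cover_V(3)[OF n q l' P] by blast
  define w where "w = app 0 k (unitf 0)"
  show ?thesis
  proof (intro exI[of _ w] allI impI)
    fix x
    let ?Y = "V q m s"
    let ?X = "tensor n q (V q l (1 - int l - r)) ?Y"
    assume "op n q ?X Gb x = fscale (q powi r') x \<and> op n q ?X Gc x = fscale (q powi (1 - r' - int l')) x \<and>
      op n q ?X Gd (op n q ?X Ga (op n q ?X Gd x)) = 0"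
    hence x: "op n q ?X Gb x = fscale (q powi r') x" "op n q ?X Gc x = fscale (q powi (1 - r' - int l')) x"
      "op n q ?X Gd (op n q ?X Ga (op n q ?X Gd x)) = 0" by auto
    note Y = V_module[OF n q m(2), of s]
    note X = tensor_V_module[OF n q l(2) Y(1), of "1 - int l - r"]
    have dX: "mdim ?X = l * m" by (simp add: mdim_tensor_V[OF n q l(2)] Y)
    obtain \<psi> where \<psi>: "is_hom n q ?Q ?X \<psi>" "\<forall>i<l * m. app 0 \<psi> (unitf 0) i = x i"
      using Q_hom_exists[OF n q l' wtV[OF n q l'] X x] dX by auto
    define \<phi> where "\<phi> = \<psi> * h"
    have \<phi>: "is_hom n q P ?X \<phi>" unfolding \<phi>_def by (rule is_hom_comp[OF hk(1) \<psi>(1)])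
    have \<phi>c: "\<phi> \<in> carrier_mat (l * m) (mdim P)" using \<phi> by (simp add: is_hom_iff dX)
    have "app 0 \<phi> w = app 0 \<psi> (app 0 h (app 0 k (unitf 0)))"
      unfolding \<phi>_def w_def by (rule app_app[OF hk(1) \<psi>(1), symmetric])
    also have "\<dots> = app 0 \<psi> (app 0 (1\<^sub>m (mdim ?Q)) (unitf 0))"
      by (simp add: app_app[OF hk(2,1)] hk(3))
    also have "\<dots> = app 0 \<psi> (unitf 0)"
      by (rule app_cong_lt[of \<psi> "mdim ?X" "mdim ?Q"]) (use \<psi>(1) in \<open>simp_all add: is_hom_iff app_one_lt\<close>)
    finally have \<phi>w: "\<forall>i<l * m. app 0 \<phi> w i = x i" using \<psi>(2) by simp
    define G where "G i = mat m (mdim P) (\<lambda>(j, p). \<phi> $$ (i * m + j, p))" for i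
    have Gc: "G i \<in> carrier_mat (mdim ?Y) (mdim P)" for i by (simp add: G_def Y)
    have \<phi>G: "\<phi> = vcat l m (mdim P) G" unfolding G_def by (rule vcat_blocks[OF n q l(2) \<phi>c, symmetric])
    define F where "F i = dual_scal q r i \<cdot>\<^sub>m G (l - 1 - i)" for i
    have Fc: "F i \<in> carrier_mat (mdim ?Y) (mdim P)" for i by (simp add: F_def Gc)
    have "fam_hom n l q r P ?Y F"
      using \<phi> vcat_hom_iff[OF n q l(2) P_module Y(1) Gc, of r] unfolding \<phi>G F_def by (simp add: Y)
    hence "is_hom n q T ?Y (hcat l m (mdim P) F)"
      using hcat_hom_iff[OF n q l(2) P_module Y(1) Fc, of r] by (simp add: Y)
    moreover have "app 0 (hcat l m (mdim P) F) (ins (mdim P) i w) j = dual_scal q r i * x ((l - 1 - i) * m + j)"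
      if ij: "i < l" "j < m" for i j
    proof -
      have Fc': "F i \<in> carrier_mat m (mdim P)" for i using Fc by (simp add: Y)
      have Gc': "G i \<in> carrier_mat m (mdim P)" for i by (simp add: G_def)
      have "app 0 (F i') (slice (mdim P) (ins (mdim P) i w) i') j = (if i' = i then app 0 (F i) w j else 0)" for i'
      proof -
        have "app 0 (F i') (slice (mdim P) (ins (mdim P) i w) i') = app 0 (F i') (if i' = i then w else 0)"
          by (rule app_cong_lt[OF Fc']) (simp add: slice_def ins_def)
        thus ?thesis by (simp add: vec_op.zero[OF vec_op_app])
      qed
      hence "app 0 (hcat l m (mdim P) F) (ins (mdim P) i w) j = app 0 (F i) w j"
        using ij by (simp add: app_hcat[OF n q l(2) Fc' ij(2)])
      also have "\<dots> = dual_scal q r i * app 0 (G (l - 1 - i)) w j"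
        using ij carrier_matD[OF Gc'] by (simp add: F_def app_smult)
      also have "app 0 (G (l - 1 - i)) w j = app 0 \<phi> w ((l - 1 - i) * m + j)"
        unfolding \<phi>G by (rule app_vcat[OF n q l(2) Gc' _ ij(2), symmetric]) (use ij in simp)
      also have "\<dots> = x ((l - 1 - i) * m + j)"
        using \<phi>w mult_add_lt[of "l - 1 - i" l j m] ij by simp
      finally show ?thesis .
    qed
    ultimately show "\<exists>f. is_hom n q T ?Y f \<and>
       (\<forall>i<l. \<forall>j<m. app 0 f (ins (mdim P) i w) j = dual_scal q r i * x ((l - 1 - i) * m + j))" by blast
  qed
qed

text \<open>By d, coordinate j+1 of an image becomes coordinate j with a nonzero factor, so
  coordinate 0 already controls the whole map.\<close>

lemma row_zero:
  assumes f: "is_hom n q T (V q m s) f1" "is_hom n q T (V q m s) f2" and m: "m \<le> n"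
    and 0: "\<And>y. c1 * app 0 f1 y 0 + c2 * app 0 f2 y 0 = 0" and j: "j < m"
  shows "c1 * app 0 f1 y j + c2 * app 0 f2 y j = 0"
  using j
proof (induction j arbitrary: y)
  case 0
  show ?case by (rule assms(4))
next
  case (Suc j)
  have "alpha q m (Suc j) \<noteq> 0" by (rule alpha_ne_0[OF n q l l]) (use Suc.prems m in auto)
  moreover have "alpha q m (Suc j) * (c1 * app 0 f1 y (Suc j) + c2 * app 0 f2 y (Suc j)) =
      c1 * app 0 f1 (op n q T Gd y) j + c2 * app 0 f2 (op n q T Gd y) j"
    using Suc.prems by (simp add: is_hom_app[OF f(1)] is_hom_app[OF f(2)] op_V[OF n q m] algebra_simps)
  ultimately show ?case using Suc by simp
qed

text \<open>Otherwise the kernel of the second functional is contained in that of the first, and the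
  two are proportional.\<close>

lemma functional_pair:
  fixes \<xi>1 \<xi>2 :: "(nat \<Rightarrow> 'k) \<Rightarrow> 'k"
  assumes lin: "\<And>x y. \<xi>1 (x + y) = \<xi>1 x + \<xi>1 y" "\<And>r x. \<xi>1 (fscale r x) = r * \<xi>1 x"
      "\<And>x y. \<xi>2 (x + y) = \<xi>2 x + \<xi>2 y" "\<And>r x. \<xi>2 (fscale r x) = r * \<xi>2 x"
    and ind: "\<And>c1 c2. (\<And>y. c1 * \<xi>1 y + c2 * \<xi>2 y = 0) \<Longrightarrow> c1 = 0 \<and> c2 = 0"
  shows "\<exists>y. \<xi>1 y = 1 \<and> \<xi>2 y = 0"
proof (rule ccontr)
  assume no: "\<not> ?thesis"
  have z: "\<xi>1 y = 0" if "\<xi>2 y = 0" for y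
  proof (rule ccontr)
    assume "\<xi>1 y \<noteq> 0"
    hence "\<xi>1 (fscale (1 / \<xi>1 y) y) = 1" "\<xi>2 (fscale (1 / \<xi>1 y) y) = 0" using that by (simp_all add: lin)
    thus False using no by blast
  qed
  obtain x where x: "\<xi>2 x \<noteq> 0" using ind[of 0 1] by auto
  have "\<xi>2 x * \<xi>1 y + (- \<xi>1 x) * \<xi>2 y = 0" for y
  proof -
    have "\<xi>2 (y + fscale (- \<xi>2 y / \<xi>2 x) x) = 0" unfolding lin using x by simp
    from z[OF this] show ?thesis unfolding lin using x by (simp add: field_simps)
  qed
  from ind[OF this] x show False by simp
qed

text \<open>Coordinate j of an image is an eigenfunctional of b for q^(s+j). For 0 < j < m <= n this
  differs from q^s, so the projection clears that coordinate and keeps coordinate 0.\<close>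

lemma weight_projection:
  assumes f: "is_hom n q T (V q m s) f" "is_hom n q T (V q m s) f2" and m: "1 \<le> m" "m \<le> n"
  shows "\<exists>y'. op n q T Gb y' = fscale (q powi s) y' \<and> (\<forall>j<m. app 0 f y' j = app 0 f y 0 * unitf 0 j) \<and>
     (\<forall>j<m. app 0 f2 y' j = app 0 f2 y 0 * unitf 0 j)"
proof -
  interpret r: rep fscale n q "op n q T Ga" "op n q T Gb" "op n q T Gc" "op n q T Gd"
    by (rule rep_op[OF T_module n q])
  let ?y = "r.b.eproj n (q powi s) y"
  have q0: "q powi s \<noteq> 0" by simp
  have nn: "of_nat n \<noteq> (0::'k)" using of_nat_order_ne_0[OF q] n by simp
  have qn: "(q powi e) ^ n = 1" for e by (rule V_weights(3)[OF n q l'])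
  note lin = vec_op.add[OF vec_op_app] vec_op.scale[OF vec_op_app]
  have *: "app 0 f ?y j = app 0 f y 0 * unitf 0 j" if f: "is_hom n q T (V q m s) f" and j: "j < m" for f j
  proof -
    have b: "app 0 f (op n q T Gb x) j = q powi (s + int j) * app 0 f x j" for x
      using j by (simp add: is_hom_app[OF f] op_V[OF n q m(2)])
    show ?thesis
    proof (cases "j = 0")
      case True
      thus ?thesis using r.b.eproj_functional[of "\<lambda>x. app 0 f x j" "q powi s" n y] b q0 nn by (simp add: lin)
    next
      case False
      have "\<not> int n dvd s + int j - s" using False j m zdvd_imp_le[of "int n" "int j"] by auto
      hence "q powi (s + int j) \<noteq> q powi s" using powi_eq_iff[OF n q T_module] by blast
      thus ?thesis
        using r.b.eproj_functional_0[of "\<lambda>x. app 0 f x j" "q powi (s + int j)" "q powi s" n y] b q0 qn False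
        by (simp add: lin)
    qed
  qed
  have "op n q T Gb ?y = fscale (q powi s) ?y"
    by (rule r.b.eproj_eigen[OF r.bn qn]) (use n in simp)
  thus ?thesis using * f by blast
qed

text \<open>A linear relation between the coordinate-0 functionals of f1 and f2 extends to f1 and f2
  by \<open>row_zero\<close> and then to x1 and x2. Independent functionals admit the vectors that
  \<open>indep\<close> asks for.\<close>

lemma indep_pair:
  assumes m: "1 \<le> m" "m \<le> n"
    and x: "\<And>x. x \<in> {x1, x2} \<Longrightarrow> Xop m s Gb x = fscale (q powi r') x \<and>
     Xop m s Gc x = fscale (q powi (1 - r' - int l')) x \<and>
     Xop m s Gd (Xop m s Ga
       (Xop m s Gd x)) = 0 \<and> (\<forall>k. \<not> k < l * m \<longrightarrow> x k = 0)"
    and ind: "\<forall>c1 c2. fscale c1 x1 + fscale c2 x2 = 0 \<longrightarrow> c1 = 0 \<and> c2 = 0"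
  shows "\<exists>f1 f2. is_hom n q T (V q m s) f1 \<and> is_hom n q T (V q m s) f2 \<and> indep n q T [(m, s, f1), (m, s, f2)]"
proof -
  obtain w where W: "\<And>x. Xop m s Gb x = fscale (q powi r') x \<Longrightarrow>
     Xop m s Gc x = fscale (q powi (1 - r' - int l')) x \<Longrightarrow>
     Xop m s Gd (Xop m s Ga
       (Xop m s Gd x)) = 0 \<Longrightarrow>
     \<exists>f. is_hom n q T (V q m s) f \<and>
       (\<forall>i<l. \<forall>j<m. app 0 f (ins (mdim P) i w) j = dual_scal q r i * x ((l - 1 - i) * m + j))"
    using hom_of_vector[OF m] by metis
  have w: "\<exists>f. is_hom n q T (V q m s) f \<and>
       (\<forall>i<l. \<forall>j<m. app 0 f (ins (mdim P) i w) j = dual_scal q r i * x ((l - 1 - i) * m + j))"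
    if "x \<in> {x1, x2}" for x
    by (rule W) (use x[OF that] in simp_all)
  obtain f1 where f1: "is_hom n q T (V q m s) f1"
      "\<forall>i<l. \<forall>j<m. app 0 f1 (ins (mdim P) i w) j = dual_scal q r i * x1 ((l - 1 - i) * m + j)"
    using w[of x1] by auto
  obtain f2 where f2: "is_hom n q T (V q m s) f2"
      "\<forall>i<l. \<forall>j<m. app 0 f2 (ins (mdim P) i w) j = dual_scal q r i * x2 ((l - 1 - i) * m + j)"
    using w[of x2] by auto
  note lin = vec_op.add[OF vec_op_app] vec_op.scale[OF vec_op_app]
  have ind': "c1 = 0 \<and> c2 = 0" if 0: "\<And>y. c1 * app 0 f1 y 0 + c2 * app 0 f2 y 0 = 0" for c1 c2
  proof -
    have "(fscale c1 x1 + fscale c2 x2) k = 0" for k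
    proof (cases "k < l * m")
      case True
      note d = div_mod_lt[OF True]
      let ?i = "l - 1 - k div m"
      have e: "l - 1 - ?i = k div m" "?i < l" using d by auto
      have "dual_scal q r ?i * (c1 * x1 k + c2 * x2 k) =
        c1 * app 0 f1 (ins (mdim P) ?i w) (k mod m) + c2 * app 0 f2 (ins (mdim P) ?i w) (k mod m)"
        using f1(2)[rule_format, OF e(2) d(2)] f2(2)[rule_format, OF e(2) d(2)] unfolding e by (simp add: algebra_simps)
      also have "\<dots> = 0" by (rule row_zero[OF f1(1) f2(1) m(2) 0 d(2)])
      finally show ?thesis using dual_scal_ne_0[OF n q l(2), of r ?i] by simp
    next
      case False
      thus ?thesis using x[of x1] x[of x2] by simp
    qed
    hence "fscale c1 x1 + fscale c2 x2 = 0" by (simp add: fun_eq_iff)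
    thus ?thesis using ind by blast
  qed
  have "\<exists>y. app 0 f1 y 0 = 1 \<and> app 0 f2 y 0 = 0"
  proof (rule functional_pair)
    fix c1 c2 assume "\<And>y. c1 * app 0 f1 y 0 + c2 * app 0 f2 y 0 = 0"
    thus "c1 = 0 \<and> c2 = 0" by (rule ind')
  qed (simp_all add: lin)
  then obtain y1 where y1: "app 0 f1 y1 0 = 1" "app 0 f2 y1 0 = 0" by blast
  have "\<exists>y. app 0 f2 y 0 \<noteq> 0" using ind'[of 0 1] by auto
  then obtain y' where "app 0 f2 y' 0 \<noteq> 0" ..
  hence "app 0 f2 (fscale (1 / app 0 f2 y' 0) y') 0 = 1" by (simp add: lin)
  then obtain y2 where y2: "app 0 f2 y2 0 = 1" ..
  obtain z1 where z1: "op n q T Gb z1 = fscale (q powi s) z1" "\<forall>j<m. app 0 f1 z1 j = unitf 0 j" "\<forall>j<m. app 0 f2 z1 j = 0"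
    using weight_projection[OF f1(1) f2(1) m, of y1] y1 by auto
  obtain z2 where z2: "op n q T Gb z2 = fscale (q powi s) z2" "\<forall>j<m. app 0 f2 z2 j = unitf 0 j"
    using weight_projection[OF f2(1) f2(1) m, of y2] y2 by auto
  have "indep n q T [(m, s, f1), (m, s, f2)]"
    using z1 z2 by (auto simp: indep.simps[OF n q T_module])
  thus ?thesis using f1(1) f2(1) by blast
qed

lemma indep_single:
  assumes m: "1 \<le> m" "m \<le> n"
    and x: "Xop m s Gb x = fscale (q powi r') x"
     "Xop m s Gc x = fscale (q powi (1 - r' - int l')) x"
     "Xop m s Gd (Xop m s Ga
       (Xop m s Gd x)) = 0" 
    and k: "k < l * m" "x k \<noteq> 0"
  shows "\<exists>f. is_hom n q T (V q m s) f \<and> indep n q T [(m, s, f)]"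
proof -
  obtain f w where f: "is_hom n q T (V q m s) f"
      "\<forall>i<l. \<forall>j<m. app 0 f (ins (mdim P) i w) j = dual_scal q r i * x ((l - 1 - i) * m + j)"
    using hom_of_vector[OF m] x by metis
  note d = div_mod_lt[OF k(1)]
  let ?i = "l - 1 - k div m"
  have e: "l - 1 - ?i = k div m" "?i < l" using d by auto
  have "app 0 f (ins (mdim P) ?i w) (k mod m) \<noteq> 0"
    using f(2)[rule_format, OF e(2) d(2)] k dual_scal_ne_0[OF n q l(2), of r ?i] unfolding e by simp
  hence "\<not> (\<forall>y. app 0 f y 0 = 0)" using row_zero[OF f(1) f(1) m(2) _ d(2), of 1 0] by auto
  then obtain y where y: "app 0 f y 0 \<noteq> 0" by blast
  note lin = vec_op.add[OF vec_op_app] vec_op.scale[OF vec_op_app]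
  obtain z where "op n q T Gb z = fscale (q powi s) z" "\<forall>j<m. app 0 f z j = app 0 f (fscale (1 / app 0 f y 0) y) 0 * unitf 0 j"
    using weight_projection[OF f(1) f(1) m] by blast
  hence "op n q T Gb z = fscale (q powi s) z" "\<forall>j<m. app 0 f z j = unitf 0 j" using y by (auto simp: lin)
  hence "indep n q T [(m, s, f)]" by (auto simp: indep.simps[OF n q T_module])
  thus ?thesis using f(1) by blast
qed

text \<open>For s = r+r'+i, the required b-weight occurs at exactly the levels congruent to l-1-i
  modulo n; the second congruence then settles the c-weight.\<close>

lemma lev_weights:
  assumes y: "lev l m p y" and m: "1 \<le> m" "m \<le> n" and p: "int n dvd int p + int i + 1 - int l"
    and i: "int n dvd int l + int l' - 1 - 2 * int i - int m"
  shows "Xop m (r + r' + int i) Gb y = fscale (q powi r') y"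
    "Xop m (r + r' + int i) Gc y = fscale (q powi (1 - r' - int l')) y"
proof -
  let ?z = "1 - int l - r" and ?s = "r + r' + int i"
  interpret X: rep fscale n q "Xop m ?s Ga" "Xop m ?s Gb"
      "Xop m ?s Gc" "Xop m ?s Gd"
    by (rule rep_op[OF X_module[OF n q l m] n q])
  have "?z + ?s + int p - r' = int p + int i + 1 - int l" by simp
  hence b: "lev_b q ?z ?s p = q powi r'"
    using p powi_eq_iff[OF n q T_module, of "?z + ?s + int p" r'] by (simp only: lev_b_def[OF n q l m])
  have "int p + 2 - ?z - ?s - int l - int m - (1 - r' - int l') =
      (int p + int i + 1 - int l) + (int l + int l' - 1 - 2 * int i - int m)" by simp
  hence "int n dvd int p + 2 - ?z - ?s - int l - int m - (1 - r' - int l')"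
    using dvd_add[OF p i] by (simp only:)
  hence c: "lev_c l m q ?z ?s p = q powi (1 - r' - int l')"
    using powi_eq_iff[OF n q T_module] by (simp only: lev_c_def[OF n q l m])
  have "X.wt (q powi r') (q powi (1 - r' - int l')) y"
    using lev_wt[OF n q l m y, of ?z ?s] unfolding b c .
  thus "Xop m ?s Gb y = fscale (q powi r') y"
    "Xop m ?s Gc y = fscale (q powi (1 - r' - int l')) y"
    by (simp_all only: X.wt_def)
qed

lemma homs_twice_above:
  assumes i: "i + n + 1 \<le> l + l'" and m: "m + 2 * i + 1 = l + l'" "1 \<le> m" "m \<le> n"
  shows "\<exists>f1 f2. is_hom n q T (V q m (r + r' + int i)) f1 \<and> is_hom n q T (V q m (r + r' + int i)) f2 \<and>
    indep n q T [(m, r + r' + int i, f1), (m, r + r' + int i, f2)]"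
proof -
  let ?s = "r + r' + int i" and ?z = "1 - int l - r"
  let ?p = "l - 1 - i"
  have p: "?p < l" "?p < m" using i m l l' by auto
  \<comment> \<open>The string that ends just below level p has n-l' vectors, as many as the part
    f_0, ..., f_(n-l'-1) of the model of P(l',r') through which d acts on the generator. This fixes
    the level p - (n-l') of its highest weight vector.\<close>
  have pp: "?p = (l + l' - n - 1 - i) + (n - l')" "0 < n - l'" "n - l' < n" using i l l' by auto
  have e: "int l + int m - 1 - 2 * int (l + l' - n - 1 - i) = int n + int (n - l')" using i m l l' by auto
  have d1: "int ?p + int i + 1 - int l = 0" using i l' by auto
  have d2: "int l + int l' - 1 - 2 * int i - int m = 0" using m by auto
  obtain u x where ux: "lev l m ?p u" "lev l m ?p x" "Xop m ?s Gd u = 0"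
      "Xop m ?s Gd (Xop m ?s Ga
       (Xop m ?s Gd x)) = 0"
      "\<forall>c1 c2. fscale c1 u + fscale c2 x = 0 \<longrightarrow> c1 = 0 \<and> c2 = 0"
    using hom_vector_above[OF n q l m(2,3) p pp e, of ?z ?s] by blast
  have w: "Xop m ?s Gb y = fscale (q powi r') y"
    "Xop m ?s Gc y = fscale (q powi (1 - r' - int l')) y" if "lev l m ?p y" for y
    by (rule lev_weights[OF that m(2,3)], simp only: d1 dvd_0_right, simp only: d2 dvd_0_right)+
  show ?thesis
    by (rule indep_pair[OF m(2,3) _ ux(5)])
       (use w[OF ux(1)] w[OF ux(2)] ux in \<open>auto simp: lev_def[OF n q l m(2,3)] vec_op.zero[OF vec_op_op]\<close>)
qed

lemma homs_twice_below:
  assumes i: "i < l" and m: "m + 2 * i + 1 = n + l + l'" "1 \<le> m" "m \<le> n"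
  shows "\<exists>f1 f2. is_hom n q T (V q m (r + r' + int i)) f1 \<and> is_hom n q T (V q m (r + r' + int i)) f2 \<and>
    indep n q T [(m, r + r' + int i, f1), (m, r + r' + int i, f2)]"
proof -
  let ?s = "r + r' + int i" and ?z = "1 - int l - r"
  let ?p = "l - 1 - i"
  have p: "?p < l" "?p < m" using i m l l' by auto
  have d1: "int ?p + int i + 1 - int l = 0" "int (?p + n) + int i + 1 - int l = int n" using i by auto
  have d2: "int l + int l' - 1 - 2 * int i - int m = - int n" using m by auto
  \<comment> \<open>The number of steps in \<open>hom_vector_below\<close> is k = l': the lowest
    weight vector sits at level p+n+l'-1, and x is reached from it by d^(l'-1).\<close>
  have k: "1 \<le> l'" "l' \<le> n" using l' by auto
  have "2 * int ?p + 1 - int l - int m + int l' = - int n" using i m by auto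
  hence e: "int n dvd 2 * int ?p + 1 - int l - int m + int l'" by (simp only: dvd_minus_iff dvd_refl)
  have P: "l \<le> ?p + n + l'" "m \<le> ?p + n + l'" "?p + n + l' + 1 \<le> l + m" using i m l by auto
  obtain u x where ux: "lev l m ?p u" "lev l m (?p + n) x" "Xop m ?s Gd u = 0"
      "Xop m ?s Gd (Xop m ?s Ga
       (Xop m ?s Gd x)) = 0"
      "\<forall>c1 c2. fscale c1 u + fscale c2 x = 0 \<longrightarrow> c1 = 0 \<and> c2 = 0"
    using hom_vector_below[OF n q l m(2,3) p k e P, of ?z ?s] by blast
  have w: "Xop m ?s Gb y = fscale (q powi r') y"
    "Xop m ?s Gc y = fscale (q powi (1 - r' - int l')) y"
    if "lev l m ?p y \<or> lev l m (?p + n) y" for y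
    using that lev_weights[of m ?p y i] lev_weights[of m "?p + n" y i] m(2,3)
    unfolding d1 d2 by auto
  show ?thesis
    by (rule indep_pair[OF m(2,3) _ ux(5)])
       (use w[OF disjI1[OF ux(1)]] w[OF disjI2[OF ux(2)]] ux in \<open>auto simp: lev_def[OF n q l m(2,3)] vec_op.zero[OF vec_op_op]\<close>)
qed

lemma homs_once:
  assumes i: "i < l" "i < l'" and m: "m + 2 * i + 1 = l + l'" "1 \<le> m" "m \<le> n"
  shows "\<exists>f. is_hom n q T (V q m (r + r' + int i)) f \<and> indep n q T [(m, r + r' + int i, f)]"
proof -
  let ?s = "r + r' + int i" and ?z = "1 - int l - r"
  let ?p = "l - 1 - i"
  have p: "?p < l" "?p < m" using i m by auto
  have d1: "int ?p + int i + 1 - int l = 0" using i by auto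
  have d2: "int l + int l' - 1 - 2 * int i - int m = 0" using m by auto
  obtain u where u: "lev l m ?p u" "Xop m ?s Gd u = 0" "ent m u ?p 0 = 1"
    using hw_exists[OF n q l m(2,3) p, of ?z ?s] by blast
  have w: "Xop m ?s Gb u = fscale (q powi r') u"
    "Xop m ?s Gc u = fscale (q powi (1 - r' - int l')) u"
    by (rule lev_weights[OF u(1) m(2,3)], simp only: d1 dvd_0_right, simp only: d2 dvd_0_right)+
  show ?thesis
  proof (rule indep_single[OF m(2,3) w])
    show "Xop m ?s Gd (Xop m ?s Ga
       (Xop m ?s Gd u)) = 0"
      unfolding u(2) by (simp only: vec_op.zero[OF vec_op_op])
    show "?p * m + 0 < l * m" using mult_add_lt[of ?p l 0 m] p m by simp
    show "u (?p * m + 0) \<noteq> 0" using u(3) by (simp add: ent_def[OF n q l m(2,3)])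
  qed
qed

end

text \<open>For the dimension count of the two doubled blocks. The term with 2i = K is the label
  with m = n, whose projective module has dimension n instead of 2n. This halved term makes the
  total independent of the parity of K.\<close>

lemma sum_list_half_range:
  fixes N K e :: nat
  shows "sum_list (map (\<lambda>i. 2 * (if 2 * i = K then N else 2 * N)) [half_up K ..< e]) = 2 * N * (2 * e - 1 - K)"
proof (induction e)
  case (Suc e)
  show ?case
  proof (cases "half_up K \<le> e")
    case True
    hence "K \<le> 2 * e" by (auto simp: half_up_def)
    then consider "K = 2 * e" | "K = 2 * e - 1" "e \<noteq> 0" | "K + 1 < 2 * e" by linarith
    thus ?thesis
    proof cases
      case 3
      hence "2 * Suc e - 1 - K = (2 * e - 1 - K) + 2" by simp
      hence "2 * N * (2 * Suc e - 1 - K) = 2 * N * (2 * e - 1 - K) + 2 * N * 2" by (simp only: distrib_left)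
      thus ?thesis using Suc True 3 by simp
    qed (use Suc True in auto)
  next
    case False
    hence "2 * Suc e - 1 - K = 0" by (auto simp: half_up_def)
    thus ?thesis using False by simp
  qed
qed simp

theorem theorem3p5:
  fixes q :: "'k::alg_closed_field"
    and n l l' t l1 :: nat
    and r r' :: int
    and P :: "nat \<Rightarrow> int \<Rightarrow> 'k fdmod"
  assumes "n > 2"
    and "is_primitive_root n q"
    and "\<And>m s. 1 \<le> m \<Longrightarrow> m < n \<Longrightarrow> is_projective_cover n q (P m s) (V q m s)"
    and "\<And>s. P n s = V q n s"
    and "1 \<le> l" "l \<le> n"
    and "1 \<le> l'" "l' \<le> n" "l' \<noteq> n"
    and "n + 1 \<le> l + l'"
    and "t = l + l' - (n + 1)"
    and "l1 = min l l'"
  shows "module_iso n q (tensor n q (V q l r) (P l' r'))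
    (direct_sum
      [direct_sum (map (\<lambda>i. copies 2 (P (l + l' - 1 - 2 * i) (r + r' + int i)))
         [half_up t ..< t + 1]),
       direct_sum (map (\<lambda>i. P (l + l' - 1 - 2 * i) (r + r' + int i))
         [t + 1 ..< l1]),
       direct_sum (map (\<lambda>i. copies 2 (P (n + l + l' - 1 - 2 * i) (r + r' + int i)))
         [half_up (l + l' - 1) ..< l])])"
proof -
  have n: "1 < n" using assms(1) by simp
  note q = assms(2)
  have l: "1 \<le> l" "l \<le> n" and l': "1 \<le> l'" "l' < n" using assms(5-9) by auto
  have P: "is_projective_cover n q (P l' r') (V q l' r')" by (rule assms(3)[OF l'])
  let ?T = "tensor n q (V q l r) (P l' r')"
  let ?\<sigma> = "r + r'"
  note T = T_module[OF n q l l' P, of r]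
  have proj: "is_projective n q ?T"
    by (rule tensor_V_projective[OF n q l(2)]) (use P in \<open>simp add: is_projective_cover_def\<close>)
  have dP: "mdim (P m s) = (if m < n then 2 * n else n)" if "1 \<le> m" "m \<le> n" for m s
    using projective_cover_V(1)[OF n q that(1) _ assms(3)] that assms(4) V_module(3)[OF n q, of n] by (cases "m = n") auto
  have essP: "\<exists>p. ess n q (P m s) (V q m s) p" if "1 \<le> m" "m \<le> n" for m s
  proof (cases "m = n")
    case True
    thus ?thesis using ess_id[OF V_module(1)[OF n q, of n s]] assms(4) by auto
  next
    case False
    thus ?thesis using projective_cover_V(2)[OF n q that(1) _ assms(3)[OF that(1)]] that by auto
  qed
  \<comment> \<open>Triples (multiplicity, m, i) for the labels (m, r+r'+i), in the order of the
    three blocks of the decomposition.\<close>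
  define D :: "(nat \<times> nat \<times> nat) list" where
    "D = map (\<lambda>i. (2, l + l' - 1 - 2 * i, i)) [half_up t ..< t + 1] @
      map (\<lambda>i. (1, l + l' - 1 - 2 * i, i)) [t + 1 ..< l1] @
      map (\<lambda>i. (2, n + l + l' - 1 - 2 * i, i)) [half_up (l + l' - 1) ..< l]"
  have D: "1 \<le> m \<and> m \<le> n \<and> i < n \<and> (\<exists>fs. length fs = k \<and> (\<forall>f\<in>set fs. is_hom n q ?T (V q m (?\<sigma> + int i)) f) \<and>
      indep n q ?T (map (\<lambda>f. (m, ?\<sigma> + int i, f)) fs))" if d: "(k, m, i) \<in> set D" for k m i
  proof -
    have two: "\<exists>fs. length fs = 2 \<and> (\<forall>f\<in>set fs. is_hom n q ?T (V q m s) f) \<and> indep n q ?T (map (\<lambda>f. (m, s, f)) fs)"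
      if "\<exists>f1 f2. is_hom n q ?T (V q m s) f1 \<and> is_hom n q ?T (V q m s) f2 \<and> indep n q ?T [(m, s, f1), (m, s, f2)]" for m s
    proof -
      obtain f1 f2 where "is_hom n q ?T (V q m s) f1" "is_hom n q ?T (V q m s) f2" "indep n q ?T [(m, s, f1), (m, s, f2)]"
        using \<open>\<exists>f1 f2. _\<close> by blast
      thus ?thesis by (intro exI[of _ "[f1, f2]"]) simp
    qed
    have one: "\<exists>fs. length fs = 1 \<and> (\<forall>f\<in>set fs. is_hom n q ?T (V q m s) f) \<and> indep n q ?T (map (\<lambda>f. (m, s, f)) fs)"
      if "\<exists>f. is_hom n q ?T (V q m s) f \<and> indep n q ?T [(m, s, f)]" for m s
    proof -
      obtain f where "is_hom n q ?T (V q m s) f" "indep n q ?T [(m, s, f)]"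
        using \<open>\<exists>f. _\<close> by blast
      thus ?thesis by (intro exI[of _ "[f]"]) simp
    qed
    consider (1) "k = 2" "m = l + l' - 1 - 2 * i" "half_up t \<le> i" "i \<le> t"
      | (2) "k = 1" "m = l + l' - 1 - 2 * i" "t + 1 \<le> i" "i < l1"
      | (3) "k = 2" "m = n + l + l' - 1 - 2 * i" "half_up (l + l' - 1) \<le> i" "i < l"
      using d by (auto simp: D_def)
    thus ?thesis
    proof cases
      case 1
      have h: "i + n + 1 \<le> l + l'" "m + 2 * i + 1 = l + l'" "1 \<le> m" "m \<le> n"
        using 1 assms(10,11) l l' by (auto simp: half_up_def)
      show ?thesis using two[OF homs_twice_above[OF n q l l' P h]] h l l' 1(1) by auto
    next
      case 2
      have h: "i < l" "i < l'" "m + 2 * i + 1 = l + l'" "1 \<le> m" "m \<le> n"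
        using 2 assms(10-12) l l' by auto
      show ?thesis using one[OF homs_once[OF n q l l' P h]] h l l' 2(1) by auto
    next
      case 3
      have h: "i < l" "m + 2 * i + 1 = n + l + l'" "1 \<le> m" "m \<le> n"
        using 3 assms(10) l l' by (auto simp: half_up_def)
      show ?thesis using two[OF homs_twice_below[OF n q l l' P h]] h l l' 3(1) by auto
    qed
  qed
  have "\<forall>d\<in>set D. \<exists>fs. \<forall>k m i. d = (k, m, i) \<longrightarrow> length fs = k \<and> (\<forall>f\<in>set fs. is_hom n q ?T (V q m (?\<sigma> + int i)) f) \<and>
      indep n q ?T (map (\<lambda>f. (m, ?\<sigma> + int i, f)) fs)"
  proof
    fix d assume "d \<in> set D"
    thus "\<exists>fs. \<forall>k m i. d = (k, m, i) \<longrightarrow> length fs = k \<and> (\<forall>f\<in>set fs. is_hom n q ?T (V q m (?\<sigma> + int i)) f) \<and>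
      indep n q ?T (map (\<lambda>f. (m, ?\<sigma> + int i, f)) fs)"
      using D[of "fst d" "fst (snd d)" "snd (snd d)"] by (cases d) auto
  qed
  from bchoice[OF this] obtain H where H: "\<And>k m i. (k, m, i) \<in> set D \<Longrightarrow> length (H (k, m, i)) = k \<and>
      (\<forall>f\<in>set (H (k, m, i)). is_hom n q ?T (V q m (?\<sigma> + int i)) f) \<and>
      indep n q ?T (map (\<lambda>f. (m, ?\<sigma> + int i, f)) (H (k, m, i)))" by blast
  define B where "B = (\<lambda>d. case d of (k, m, i) \<Rightarrow> map (\<lambda>f. (m, ?\<sigma> + int i, f)) (H d))"
  define L where "L = concat (map B D)"
  have L: "is_hom n q ?T (V q m s) f \<and> 1 \<le> m \<and> m \<le> n" if x: "(m, s, f) \<in> set L" for m s f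
  proof -
    obtain k i where "(k, m, i) \<in> set D" "s = ?\<sigma> + int i" "f \<in> set (H (k, m, i))"
      using x by (auto simp: L_def B_def)
    thus ?thesis using H D by blast
  qed
  have "indep n q ?T L"
    unfolding L_def
  proof (rule indep_concat[OF n q T, of "\<lambda>(k, m, i). i" _ _ ?\<sigma>])
    have "map (\<lambda>(k, m, i). i) D = [half_up t ..< t + 1] @ [t + 1 ..< l1] @ [half_up (l + l' - 1) ..< l]"
      by (simp add: D_def comp_def del: upt_Suc)
    \<comment> \<open>The three ranges are disjoint because t < l1 and l1 <=
      \<open>half_up (l + l' - 1)\<close>.\<close>
    moreover have "distinct \<dots>"
      using assms(10-12) l l' by (auto simp: half_up_def)
    ultimately show "distinct (map (\<lambda>(k, m, i). i) D)" by simp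
    show "(case d of (k, m, i) \<Rightarrow> i) < n \<and> indep n q ?T (B d) \<and>
         (\<forall>(m, s, f)\<in>set (B d). s = ?\<sigma> + int (case d of (k, m, i) \<Rightarrow> i))" if "d \<in> set D" for d
    proof -
      obtain k m i where d: "d = (k, m, i)" by (cases d)
      show ?thesis using H[of k m i] D[of k m i] that by (auto simp: B_def d)
    qed
  qed
  note epi = indep_epi[OF n q T L this]
  let ?S = "direct_sum (map (\<lambda>(m, s, f). V q m s) L)" and ?R = "direct_sum (map (\<lambda>(m, s, f). P m s) L)"
  let ?\<pi> = "vstack (mdim ?T) (map (\<lambda>(m, s, f). f) L)"
  have "\<forall>d\<in>set L. \<exists>p. ess n q ((\<lambda>(m, s, f). P m s) d) ((\<lambda>(m, s, f). V q m s) d) p"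
    using essP L by fastforce
  from bchoice[OF this] obtain p0 where "\<forall>d\<in>set L. ess n q ((\<lambda>(m, s, f). P m s) d) ((\<lambda>(m, s, f). V q m s) d) (p0 d)" ..
  then obtain p where p: "ess n q ?R ?S p"
    using ess_dsum_list[of L n q "\<lambda>(m, s, f). P m s" "\<lambda>(m, s, f). V q m s" p0] by blast
  hence pe: "is_epi n q ?R ?S p" by (simp add: ess_def)
  obtain h where h: "is_hom n q ?T ?R h" "p * h = ?\<pi>"
    using proj pe epi unfolding is_projective_def is_epi_def by blast
  have he: "is_epi n q ?T ?R h" by (rule ess_epi[OF p h(1)]) (use epi h(2) in simp)
  have LP: "map (\<lambda>(m, s, f). P m s) L = concat (map (\<lambda>(k, m, i). replicate k (P m (?\<sigma> + int i))) D)"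
  proof -
    have "map (\<lambda>(m, s, f). P m s) (concat (map B E)) = concat (map (\<lambda>(k, m, i). replicate k (P m (?\<sigma> + int i))) E)"
      if "set E \<subseteq> set D" for E
      using that
    proof (induction E)
      case (Cons d E)
      obtain k m i where d: "d = (k, m, i)" by (cases d)
      hence "length (H d) = k" using H[of k m i] Cons.prems by auto
      hence "map (\<lambda>(m, s, f). P m s) (B d) = replicate k (P m (?\<sigma> + int i))"
        by (simp add: B_def d comp_def map_replicate_const)
      thus ?case using Cons by (simp add: d)
    qed simp
    thus ?thesis by (simp add: L_def)
  qed
  have R: "?R = direct_sum
      [direct_sum (map (\<lambda>i. copies 2 (P (l + l' - 1 - 2 * i) (r + r' + int i))) [half_up t ..< t + 1]),
       direct_sum (map (\<lambda>i. P (l + l' - 1 - 2 * i) (r + r' + int i)) [t + 1 ..< l1]),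
       direct_sum (map (\<lambda>i. copies 2 (P (n + l + l' - 1 - 2 * i) (r + r' + int i))) [half_up (l + l' - 1) ..< l])]"
  proof -
    have c: "direct_sum (map (\<lambda>i. copies 2 (M i)) is) = direct_sum (concat (map (\<lambda>i. replicate 2 (M i)) is))" for M :: "nat \<Rightarrow> 'k fdmod" and "is"
      using direct_sum_concat[of "map (\<lambda>i. replicate 2 (M i)) is"] by (simp add: copies_def comp_def)
    have d: "direct_sum [direct_sum As, direct_sum Bs, direct_sum Cs] = direct_sum (As @ Bs @ Cs)" for As Bs Cs :: "'k fdmod list"
      using direct_sum_concat[of "[As, Bs, Cs]"] by simp
    have s: "map M is = concat (map (\<lambda>i. replicate 1 (M i)) is)" for M :: "nat \<Rightarrow> 'k fdmod" and "is"
      by (induction "is") simp_all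
    show ?thesis
      unfolding c d LP D_def map_append concat_append map_map s[of _ "[t + 1 ..< l1]"] by (simp add: comp_def del: upt_Suc)
  qed
  have "mdim ?R = sum_list (map (\<lambda>(k, m, i). k * (if m = n then n else 2 * n)) D)"
  proof -
    have "sum_list (map mdim (concat (map (\<lambda>(k, m, i). replicate k (P m (?\<sigma> + int i))) E))) =
        sum_list (map (\<lambda>(k, m, i). k * (if m = n then n else 2 * n)) E)" if "set E \<subseteq> set D" for E
      using that
    proof (induction E)
      case (Cons d E)
      obtain k m i where d: "d = (k, m, i)" by (cases d)
      have "mdim (P m (?\<sigma> + int i)) = (if m = n then n else 2 * n)" using D[of k m i] dP[of m] Cons.prems d by auto
      thus ?case using Cons by (simp add: d sum_list_replicate)
    qed simp
    thus ?thesis by (simp add: mdim_direct_sum LP)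
  qed
  also have "\<dots> = 2 * n * (t + 1) + (l1 - (t + 1)) * (2 * n) + 2 * n * (l - l')"
  proof -
    have "map (\<lambda>i. 2 * (if l + l' - 1 - 2 * i = n then n else 2 * n)) [half_up t ..< t + 1] =
        map (\<lambda>i. 2 * (if 2 * i = t then n else 2 * n)) [half_up t ..< t + 1]"
      using assms(10,11) l l' by (intro map_cong refl) auto
    hence 1: "sum_list (map (\<lambda>i. 2 * (if l + l' - 1 - 2 * i = n then n else 2 * n)) [half_up t ..< t + 1]) = 2 * n * (t + 1)"
      using sum_list_half_range[of t n "t + 1"] by (simp only:) simp
    \<comment> \<open>Here m = n would mean 2i = t, which is impossible for i > t, so every summand
      has dimension 2n.\<close>
    have "map (\<lambda>i. if l + l' - 1 - 2 * i = n then n else 2 * n) [t + 1 ..< l1] = map (\<lambda>i. 2 * n) [t + 1 ..< l1]"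
      using assms(10-12) l l' by (intro map_cong refl) auto
    hence 2: "sum_list (map (\<lambda>i. if l + l' - 1 - 2 * i = n then n else 2 * n) [t + 1 ..< l1]) = (l1 - (t + 1)) * (2 * n)"
      by (simp only: sum_list_triv) simp
    have "map (\<lambda>i. 2 * (if n + l + l' - 1 - 2 * i = n then n else 2 * n)) [half_up (l + l' - 1) ..< l] =
        map (\<lambda>i. 2 * (if 2 * i = l + l' - 1 then n else 2 * n)) [half_up (l + l' - 1) ..< l]"
      using assms(10) l l' by (intro map_cong refl) auto
    hence 3: "sum_list (map (\<lambda>i. 2 * (if n + l + l' - 1 - 2 * i = n then n else 2 * n)) [half_up (l + l' - 1) ..< l]) = 2 * n * (l - l')"
      using sum_list_half_range[of "l + l' - 1" n l] l l' by (simp only:) (simp add: mult_2)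
    show ?thesis
      using 1 2 3 by (simp add: D_def comp_def del: upt_Suc)
  qed
  also have "\<dots> = l * (2 * n)"
  proof -
    \<comment> \<open>The subtraction l - l' is truncated: it is zero for l <= l', where l1 = l, and
      supplies the difference l - l1 otherwise.\<close>
    have e: "t + 1 + (l1 - (t + 1)) + (l - l') = l" using assms(10-12) l l' by auto
    have "2 * n * (t + 1) + (l1 - (t + 1)) * (2 * n) + 2 * n * (l - l') = (t + 1 + (l1 - (t + 1)) + (l - l')) * (2 * n)"
      by (simp only: distrib_right mult.commute[of "2 * n"])
    thus ?thesis unfolding e .
  qed
  also have "\<dots> = mdim ?T" using l' by (simp add: mdim_tensor_V[OF n q l(2)] dP)
  finally have "mdim ?T = mdim ?R" ..
  from epi_iso[OF he this] obtain g where "is_hom n q ?R ?T g" "g * h = 1\<^sub>m (mdim ?T)" "h * g = 1\<^sub>m (mdim ?R)" by blast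
  with h(1) have "module_iso n q ?T ?R" unfolding module_iso_def by blast
  thus ?thesis unfolding R .
qed

end
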